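(* In the setting described in the context (in particular, the star product $\star$ is strongly invariant, $\boldsymbol{J}=J$, and $h$ and $\operatorname{prol}$ are equivariant with $h_0\operatorname{prol}=0$), the formula $$[a]*[b]:=[\boldsymbol{\operatorname{res}}(\boldsymbol{\Phi}(a)*\boldsymbol{\Phi}(b))]$$ makes $\mathrm{H}^\bullet(\mathfrak{g},\mathcal{C}^\infty(Z))[[\nu]]$ into a $\mathbb{Z}$-graded associative algebra. For the subalgebra of invariants $\mathrm{H}^0(\mathfrak{g},\mathcal{C}^\infty(Z))[[\nu]]=\mathcal{C}^\infty(Z)^{\mathfrak{g}}[[\nu]]$ this formula simplifies to $$f*g=\boldsymbol{\operatorname{res}}(\operatorname{prol}(f)*\operatorname{prol}(g))\qquad\text{for } f,g\in\mathcal{C}^\infty(Z)^{\mathfrak{g}}.$$ Consequently, since $\mathcal{C}^\infty(Z)^{\mathfrak g}$ is isomorphic to the algebra $\mathcal{C}^\infty(M_{\mathsf{red}})$ of smooth functions on the symplectic stratified space $M_{\mathsf{red}}=Z/G$, one obtains an associative product on $\mathcal{C}^\infty(M_{\mathsf{red}})[[\nu]]$ which is given by a formal power series in $\nu$ of continuous bilinear operations (i.e. of continuous Hochschild cochains).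
   Context: Let $\mathbb{K}=\mathbb{R}$ or $\mathbb{C}$. $(M,\omega)$ is a symplectic manifold with a Hamiltonian action of a compact connected Lie group $G$ with Lie algebra $\mathfrak g$ and equivariant moment map $J:M\to\mathfrak g^*$. Fix a basis $e_1,\dots,e_\ell$ of $\mathfrak g$ with structure constants $f_{ab}^c$ and put $J_a=\langle J,e_a\rangle$, so $\{J_a,J_b\}=\sum_cf_{ab}^cJ_c$; $X\in\mathfrak g$ acts on $\mathcal C^\infty(M)$ by $\{J(X),\cdot\}$. Let $Z=J^{-1}(0)$, let $I_Z$ be the ideal of smooth functions vanishing on $Z$, and $\mathcal{C}^\infty(Z)=\mathcal{C}^\infty(M)/I_Z$ (a Fréchet $\mathfrak g$-module). Standing assumptions: $J_1,\dots,J_\ell$ generate $I_Z$, and the Koszul complex $K_\bullet=\mathcal{C}^\infty(M)\otimes\wedge^\bullet\mathfrak g$, with $\mathcal C^\infty(M)$-linear superderivation $\partial e_a=J_a$, has vanishing homology in positive degrees. Let $\operatorname{res}:\mathcal C^\infty(M)\to\mathcal C^\infty(Z)$ be restriction, and let $\operatorname{prol}:\mathcal C^\infty(Z)\to\mathcal C^\infty(M)$, $h_i:K_i\to K_{i+1}$ be $\mathfrak g$-equivariant continuous linear maps with $\operatorname{res}\operatorname{prol}=\operatorname{id}$, $\operatorname{id}-\operatorname{prol}\operatorname{res}=\partial h+h\partial$, $h_0\operatorname{prol}=0$, $h_{i+1}h_i=0$. A star product $f\star g=fg+\sum_{i\ge1}\nu^i\mu_i(f,g)$ on $M$ is an associative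 $\mathbb K[[\nu]]$-bilinear product on $\mathcal C^\infty(M)[[\nu]]$ with unit $1$, $\mu_i$ bidifferential operators and $\mu_1(f,g)-\mu_1(g,f)=\{f,g\}$. Here $\star$ is assumed strongly invariant: $J(X)\star f-f\star J(X)=\nu\{J(X),f\}$ for all $X\in\mathfrak g$, $f\in\mathcal C^\infty(M)$; the quantum moment map is $\boldsymbol J=J$. BRST algebra: $\mathscr A=\mathcal C^\infty(M)\otimes\wedge(\mathfrak g^*\oplus\mathfrak g)$, generated over $\mathcal C^\infty(M)$ by odd ghosts $\xi^a$ (degree $1$, dual basis of $\mathfrak g^*$) and antighosts $\xi_a$ (degree $-1$, basis of $\mathfrak g$). The product on $\mathscr A[[\nu]]$ is $(fv)*(gw)=(f\star g)(v\cdot w)$, where $v\cdot w=\mu\big(\exp(-2\nu\sum_a\frac{\partial}{\partial\xi_a}\otimes\frac{\partial}{\partial\xi^a})(v\otimes w)\big)$, $\mu$ is the supercommutative product, $\otimes$ is graded and the derivatives are left derivations. With $\boldsymbol\theta=-\frac14\sum f_{ab}^c\xi^a\xi^b\xi_c+\sum_a\boldsymbol J_a\xi^a+\frac\nu2\sum_{a,b}f_{ab}^b\xi^a$ put $\boldsymbol D=\frac1\nu[\boldsymbol\theta,\cdot]_*$ (graded commutator). The deformed Koszul differential on $K_\bullet[[\nu]]$ is $\boldsymbol\partial(fv)=\sum_a f\star\boldsymbol J_a\,\frac{\partial v}{\partial\xi_a}+\frac\nu2\sum_{a,b}f_{ab}^b f\frac{\partial v}{\partial\xi_a}+\frac\nu2\sum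 f_{ab}^c f\,\xi_c\frac{\partial^2v}{\partial\xi_a\partial\xi_b}$. Put $\boldsymbol{\operatorname{res}}=\operatorname{res}\,(\operatorname{id}+(\boldsymbol\partial_1-\partial_1)h_0)^{-1}:\mathcal C^\infty(M)[[\nu]]\to\mathcal C^\infty(Z)[[\nu]]$ ($\partial_1,\boldsymbol\partial_1$ the components $K_1[[\nu]]\to K_0[[\nu]]$), extended to $\mathscr A[[\nu]]\to C^\bullet(\mathfrak g,\mathcal C^\infty(Z)[[\nu]])=\wedge^\bullet\mathfrak g^*\otimes\mathcal C^\infty(Z)[[\nu]]$ coefficientwise and by zero on terms containing antighosts. In the present situation the $\mathfrak g$-action $X\mapsto\boldsymbol{\operatorname{res}}\circ\frac1\nu[\boldsymbol J(X),\cdot]_\star\circ\operatorname{prol}$ on $\mathcal C^\infty(Z)[[\nu]]$ is the classical one; let $d$ be the corresponding Lie algebra cohomology differential on $C^\bullet(\mathfrak g,\mathcal C^\infty(Z)[[\nu]])$. Let $\boldsymbol\Phi:C^\bullet(\mathfrak g,\mathcal C^\infty(Z)[[\nu]])\to\mathscr A^\bullet[[\nu]]$ and $\boldsymbol H:\mathscr A^\bullet[[\nu]]\to\mathscr A^{\bullet-1}[[\nu]]$ be series in $\nu$ of continuous maps such that $\boldsymbol{\operatorname{res}},\boldsymbol\Phi$ are chain maps (for $d$, $\boldsymbol D$), $\boldsymbol{\operatorname{res}}\,\boldsymbol\Phi=\operatorname{id}$ and $\operatorname{id}-\boldsymbol\Phi\,\boldsymbol{\operatorname{res}}=\boldsymbol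 D\boldsymbol H+\boldsymbol H\boldsymbol D$. Here $[a]$ denotes the cohomology class of a cocycle $a$. The algebra $\mathcal C^\infty(M_{\mathsf{red}})$ is $\mathcal C^\infty(M)^G/I_Z^G$. *)

theory Defs
  imports
    "HOL-Analysis.Analysis"
    "HOL-Computational_Algebra.Formal_Power_Series"
    "HOL-Library.Function_Algebras"
    "HOL-Library.Set_Algebras"
    "HOL-Algebra.Group"
begin

section \<open>Smooth manifolds\<close>

text \<open>
  A manifold is a whole type \<^emph>\<open>'m\<close> (Hausdorff, second countable) with an atlas of charts
  \<^emph>\<open>(U, phi)\<close> into a finite-dimensional normed space. The model space is only required to be of
  class \<^class>\<open>real_normed_vector\<close> with a finite spanning set, because \<^class>\<open>euclidean_space\<close>
  would rule out dimension 0 (e.g. the trivial group as a Lie group).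
\<close>

definition dir_deriv :: "'e::real_normed_vector \<Rightarrow> ('e \<Rightarrow> 'b::real_normed_vector) \<Rightarrow> 'e \<Rightarrow> 'b" where
  "dir_deriv v F x = frechet_derivative F (at x) v"

text \<open>On open sets: all iterated directional derivatives exist and are again differentiable.\<close>

definition smooth_on :: "'e::real_normed_vector set \<Rightarrow> ('e \<Rightarrow> 'b::real_normed_vector) \<Rightarrow> bool" where
  "smooth_on T F \<longleftrightarrow> (\<forall>vs. foldr dir_deriv vs F differentiable_on T)"

type_synonym ('m, 'e) atlas = "('m set \<times> ('m \<Rightarrow> 'e)) set"

definition smooth_atlas ::
    "('m::{t2_space, second_countable_topology}, 'e::real_normed_vector) atlas \<Rightarrow> bool" where
  "smooth_atlas A \<longleftrightarrow>
     (\<exists>B::'e set. finite B \<and> span B = UNIV) \<and>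
     (\<forall>(U, \<phi>)\<in>A. open U \<and> open (\<phi> ` U) \<and> homeomorphism U (\<phi> ` U) \<phi> (inv_into U \<phi>)) \<and>
     (\<Union>(U, \<phi>)\<in>A. U) = UNIV \<and>
     (\<forall>(U, \<phi>)\<in>A. \<forall>(V, \<psi>)\<in>A. smooth_on (\<phi> ` (U \<inter> V)) (\<psi> \<circ> inv_into U \<phi>))"

definition smooth_fun ::
    "('m, 'e::real_normed_vector) atlas \<Rightarrow> ('m \<Rightarrow> 'b::real_normed_vector) \<Rightarrow> bool" where
  "smooth_fun A f \<longleftrightarrow> (\<forall>(U, \<phi>)\<in>A. smooth_on (\<phi> ` U) (f \<circ> inv_into U \<phi>))"

definition smooth_map :: "('m::topological_space, 'e::real_normed_vector) atlas \<Rightarrow>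
    ('n::topological_space, 'd::real_normed_vector) atlas \<Rightarrow> ('m \<Rightarrow> 'n) \<Rightarrow> bool" where
  "smooth_map A B F \<longleftrightarrow> continuous_on UNIV F \<and>
     (\<forall>(U, \<phi>)\<in>A. \<forall>(V, \<psi>)\<in>B. smooth_on (\<phi> ` (U \<inter> F -` V)) (\<psi> \<circ> F \<circ> inv_into U \<phi>))"

definition prod_atlas :: "('m, 'e) atlas \<Rightarrow> ('n, 'd) atlas \<Rightarrow> ('m \<times> 'n, 'e \<times> 'd) atlas" where
  "prod_atlas A B = {(U \<times> V, map_prod \<phi> \<psi>) | U \<phi> V \<psi>. (U, \<phi>) \<in> A \<and> (V, \<psi>) \<in> B}"

text \<open>Iterated coordinate derivative, in the chart, along constant directions.\<close>

definition chart_deriv ::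
    "'m set \<times> ('m \<Rightarrow> 'e::real_normed_vector) \<Rightarrow> 'e list \<Rightarrow> ('m \<Rightarrow> 'b::real_normed_vector) \<Rightarrow> 'm \<Rightarrow> 'b" where
  "chart_deriv c vs f p = foldr dir_deriv vs (f \<circ> inv_into (fst c) (snd c)) (snd c p)"

text \<open>
  Tangent vectors are point derivations of the algebra of real smooth functions; the value on
  non-smooth functions is fixed to be 0, so that equality of tangent vectors is equality of functions.
\<close>

type_synonym 'm tvec = "('m \<Rightarrow> real) \<Rightarrow> real"

definition tangent :: "('m, 'e::real_normed_vector) atlas \<Rightarrow> 'm \<Rightarrow> 'm tvec set" where
  "tangent A p = {v.
     (\<forall>f g. smooth_fun A f \<longrightarrow> smooth_fun A g \<longrightarrow>
        v (f + g) = v f + v g \<and> v (f * g) = v f * g p + f p * v g) \<and>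
     (\<forall>c f. smooth_fun A f \<longrightarrow> v (\<lambda>q. c * f q) = c * v f) \<and>
     (\<forall>f. \<not> smooth_fun A f \<longrightarrow> v f = 0)}"

definition vector_field :: "('m, 'e::real_normed_vector) atlas \<Rightarrow> ('m \<Rightarrow> 'm tvec) \<Rightarrow> bool" where
  "vector_field A X \<longleftrightarrow> (\<forall>p. X p \<in> tangent A p) \<and>
     (\<forall>f. smooth_fun A f \<longrightarrow> smooth_fun A (\<lambda>p. X p f))"

definition lie_bracket :: "('m \<Rightarrow> 'm tvec) \<Rightarrow> ('m \<Rightarrow> 'm tvec) \<Rightarrow> 'm \<Rightarrow> 'm tvec" where
  "lie_bracket X Y p f = X p (\<lambda>q. Y q f) - Y p (\<lambda>q. X q f)"

text \<open>Closedness is Cartan's formula for the exterior derivative of a 2-form.\<close>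

definition symplectic_form ::
    "('m, 'e::real_normed_vector) atlas \<Rightarrow> ('m \<Rightarrow> 'm tvec \<Rightarrow> 'm tvec \<Rightarrow> real) \<Rightarrow> bool" where
  "symplectic_form A \<omega> \<longleftrightarrow>
     (\<forall>p. \<forall>u\<in>tangent A p. \<forall>v\<in>tangent A p. \<forall>w\<in>tangent A p. \<forall>c.
        \<omega> p (u + v) w = \<omega> p u w + \<omega> p v w \<and> \<omega> p (\<lambda>f. c * u f) w = c * \<omega> p u w \<and>
        \<omega> p u v = - \<omega> p v u) \<and>
     (\<forall>X Y. vector_field A X \<longrightarrow> vector_field A Y \<longrightarrow> smooth_fun A (\<lambda>p. \<omega> p (X p) (Y p))) \<and>
     (\<forall>p. \<forall>v\<in>tangent A p. (\<forall>w\<in>tangent A p. \<omega> p v w = 0) \<longrightarrow> v = 0) \<and>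
     (\<forall>X Y W. vector_field A X \<longrightarrow> vector_field A Y \<longrightarrow> vector_field A W \<longrightarrow> (\<forall>p.
        X p (\<lambda>q. \<omega> q (Y q) (W q)) + Y p (\<lambda>q. \<omega> q (W q) (X q)) + W p (\<lambda>q. \<omega> q (X q) (Y q))
        - \<omega> p (lie_bracket X Y p) (W p) - \<omega> p (lie_bracket Y W p) (X p)
        - \<omega> p (lie_bracket W X p) (Y p) = 0))"

section \<open>Lie groups\<close>

definition lie_group ::
    "('g::{t2_space, second_countable_topology}, 'd::real_normed_vector) atlas \<Rightarrow> 'g monoid \<Rightarrow> bool" where
  "lie_group A G \<longleftrightarrow> smooth_atlas A \<and> Group.group G \<and> carrier G = UNIV \<and>
     smooth_map (prod_atlas A A) A (\<lambda>(a, b). a \<otimes>\<^bsub>G\<^esub> b) \<and> smooth_map A A (\<lambda>a. inv\<^bsub>G\<^esub> a)"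

text \<open>The Lie algebra is the tangent space at the unit, with the bracket of left-invariant fields.\<close>

definition left_invariant :: "'g monoid \<Rightarrow> 'g tvec \<Rightarrow> 'g \<Rightarrow> 'g tvec" where
  "left_invariant G X a \<phi> = X (\<lambda>b. \<phi> (a \<otimes>\<^bsub>G\<^esub> b))"

definition alg_bracket :: "'g monoid \<Rightarrow> 'g tvec \<Rightarrow> 'g tvec \<Rightarrow> 'g tvec" where
  "alg_bracket G X Y = lie_bracket (left_invariant G X) (left_invariant G Y) \<one>\<^bsub>G\<^esub>"

definition Adj :: "'g monoid \<Rightarrow> 'g \<Rightarrow> 'g tvec \<Rightarrow> 'g tvec" where
  "Adj G a X = (\<lambda>\<phi>. X (\<lambda>b. \<phi> (a \<otimes>\<^bsub>G\<^esub> b \<otimes>\<^bsub>G\<^esub> inv\<^bsub>G\<^esub> a)))"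

section \<open>Grassmann algebra\<close>

text \<open>
  Grassmann elements over the odd generators indexed by the naturals are given by their coefficients:
  \<^emph>\<open>a S\<close> is the coefficient of the monomial that multiplies the generators in \<^emph>\<open>S\<close> in increasing
  order. The ghost \<^emph>\<open>xi^a\<close> has index \<^emph>\<open>2a\<close>, the antighost \<^emph>\<open>xi_a\<close> has index \<^emph>\<open>2a+1\<close>.
\<close>

type_synonym 'c grass = "nat set \<Rightarrow> 'c"

definition gh :: "nat \<Rightarrow> nat" where "gh a = 2 * a"
definition ag :: "nat \<Rightarrow> nat" where "ag a = 2 * a + 1"

definition signed :: "nat \<Rightarrow> 'c::ab_group_add \<Rightarrow> 'c" where
  "signed n x = (if even n then x else - x)"

definition inversions :: "nat set \<Rightarrow> nat set \<Rightarrow> nat" where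
  "inversions S T = card {(s, t). s \<in> S \<and> t \<in> T \<and> t < s}"

definition gen :: "nat \<Rightarrow> 'c::zero_neq_one grass" where
  "gen i = (\<lambda>T. if T = {i} then 1 else 0)"

definition emb :: "'c::zero \<Rightarrow> 'c grass" where
  "emb f = (\<lambda>T. if T = {} then f else 0)"

definition gscale :: "'c::times \<Rightarrow> 'c grass \<Rightarrow> 'c grass" where
  "gscale c a = (\<lambda>T. c * a T)"

definition gmul :: "'c::comm_ring_1 grass \<Rightarrow> 'c grass \<Rightarrow> 'c grass" where
  "gmul a b = (\<lambda>R. \<Sum>S\<in>Pow R. signed (inversions S (R - S)) (a S * b (R - S)))"

text \<open>The left derivation with respect to the \<^emph>\<open>i\<close>-th generator.\<close>

definition gder :: "nat \<Rightarrow> 'c::ab_group_add grass \<Rightarrow> 'c grass" where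
  "gder i a = (\<lambda>T. if i \<in> T then 0 else signed (card {s\<in>T. s < i}) (a (insert i T)))"

definition gdeg :: "nat set \<Rightarrow> int" where
  "gdeg S = (\<Sum>i\<in>S. if even i then 1 else - 1)"

definition homog :: "int \<Rightarrow> 'c::zero grass \<Rightarrow> bool" where
  "homog n a \<longleftrightarrow> (\<forall>T. a T \<noteq> 0 \<longrightarrow> gdeg T = n)"

definition grass_over :: "'c::zero set \<Rightarrow> nat set \<Rightarrow> 'c grass set" where
  "grass_over V E = {a. \<forall>S. if S \<subseteq> E then a S \<in> V else a S = 0}"

text \<open>
  On tensors \<^emph>\<open>t\<close> (with \<^emph>\<open>t S T\<close> the coefficient of the tensor product of the monomials of \<^emph>\<open>S\<close> and
  \<^emph>\<open>T\<close>): the graded operator \<^emph>\<open>sum_a d/dxi_a (x) d/dxi^a\<close>. Moving the second derivation past the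
  first factor, a monomial of \<^emph>\<open>card S + 1\<close> generators, gives the Koszul sign.
\<close>

definition contraction :: "nat \<Rightarrow> (nat set \<Rightarrow> 'c::ab_group_add grass) \<Rightarrow> nat set \<Rightarrow> 'c grass" where
  "contraction l t = (\<lambda>S T. \<Sum>a<l. signed (Suc (card S)) (gder (ag a) (\<lambda>S'. gder (gh a) (t S') T) S))"

section \<open>Formal power series of operators\<close>

definition ser :: "'c set \<Rightarrow> 'c fps set" where
  "ser V = {F. \<forall>n. fps_nth F n \<in> V}"

definition ser_map :: "('c \<Rightarrow> 'd) \<Rightarrow> 'c fps \<Rightarrow> 'd fps" where
  "ser_map T F = Abs_fps (\<lambda>n. T (fps_nth F n))"

text \<open>
  The \<^emph>\<open>nu\<close>-bilinear extension of the series of bilinear maps \<^emph>\<open>m i\<close>. It is also used with cosets as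
  coefficients: there \<^emph>\<open>+\<close> is elementwise addition of sets, which is addition in the quotient, and
  the index ranges are nonempty.
\<close>

definition ser_bilin :: "(nat \<Rightarrow> 'c \<Rightarrow> 'c \<Rightarrow> 'c::comm_monoid_add) \<Rightarrow> 'c fps \<Rightarrow> 'c fps \<Rightarrow> 'c fps" where
  "ser_bilin m F G =
     Abs_fps (\<lambda>n. \<Sum>i\<le>n. \<Sum>j\<le>n - i. m i (fps_nth F j) (fps_nth G (n - i - j)))"

text \<open>Series of operators on Grassmann elements, acting on elements with power series coefficients.\<close>

definition gcoeff :: "'c fps grass \<Rightarrow> nat \<Rightarrow> 'c grass" where
  "gcoeff a n = (\<lambda>S. fps_nth (a S) n)"

definition gser_map :: "('c grass \<Rightarrow> 'd grass) \<Rightarrow> 'c fps grass \<Rightarrow> 'd fps grass" where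
  "gser_map T a = (\<lambda>S. Abs_fps (\<lambda>n. T (gcoeff a n) S))"

definition gser_app ::
    "(nat \<Rightarrow> 'c grass \<Rightarrow> 'd::comm_monoid_add grass) \<Rightarrow> 'c fps grass \<Rightarrow> 'd fps grass" where
  "gser_app P a = (\<lambda>S. Abs_fps (\<lambda>n. \<Sum>i\<le>n. P i (gcoeff a (n - i)) S))"

section \<open>Linear maps, quotients, algebras\<close>

definition fscale :: "'k::times \<Rightarrow> ('m \<Rightarrow> 'k) \<Rightarrow> 'm \<Rightarrow> 'k" where
  "fscale c f = (\<lambda>p. c * f p)"

definition fgscale :: "'k::times \<Rightarrow> ('m \<Rightarrow> 'k) grass \<Rightarrow> ('m \<Rightarrow> 'k) grass" where
  "fgscale c a = (\<lambda>S. fscale c (a S))"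

definition linear_map :: "('k \<Rightarrow> 'v \<Rightarrow> 'v) \<Rightarrow> ('k \<Rightarrow> 'w \<Rightarrow> 'w) \<Rightarrow>
    'v::plus set \<Rightarrow> 'w::plus set \<Rightarrow> ('v \<Rightarrow> 'w) \<Rightarrow> bool" where
  "linear_map s s' V W T \<longleftrightarrow> T ` V \<subseteq> W \<and>
     (\<forall>x\<in>V. \<forall>y\<in>V. T (x + y) = T x + T y) \<and> (\<forall>c. \<forall>x\<in>V. T (s c x) = s' c (T x))"

definition bilinear_op :: "('k \<Rightarrow> 'v \<Rightarrow> 'v) \<Rightarrow> 'v::plus set \<Rightarrow> ('v \<Rightarrow> 'v \<Rightarrow> 'v) \<Rightarrow> bool" where
  "bilinear_op s V m \<longleftrightarrow>
     (\<forall>x\<in>V. linear_map s s V V (m x)) \<and> (\<forall>y\<in>V. linear_map s s V V (\<lambda>x. m x y))"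

definition coset :: "'v::plus set \<Rightarrow> 'v \<Rightarrow> 'v set" where
  "coset W x = (\<lambda>w. x + w) ` W"

definition coset_scale :: "('k \<Rightarrow> 'v \<Rightarrow> 'v) \<Rightarrow> 'v::plus set \<Rightarrow> 'k \<Rightarrow> 'v set \<Rightarrow> 'v set" where
  "coset_scale s W c X = s c ` X + W"

definition coset_mult :: "'v::{plus, times} set \<Rightarrow> 'v set \<Rightarrow> 'v set \<Rightarrow> 'v set" where
  "coset_mult W X Y = {x * y + w | x y w. x \<in> X \<and> y \<in> Y \<and> w \<in> W}"

definition quotient_topology :: "'v topology \<Rightarrow> ('v \<Rightarrow> 'w) \<Rightarrow> 'w topology" where
  "quotient_topology T q =
     topology (\<lambda>U. U \<subseteq> q ` topspace T \<and> openin T {x \<in> topspace T. q x \<in> U})"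

definition grass_topology :: "'c::zero topology \<Rightarrow> nat set \<Rightarrow> 'c grass topology" where
  "grass_topology T E = pullback_topology (grass_over (topspace T) E) (\<lambda>a. restrict a (Pow E))
     (product_topology (\<lambda>_. T) (Pow E))"

definition ser_scale ::
    "('k \<Rightarrow> 'v \<Rightarrow> 'v::comm_monoid_add) \<Rightarrow> 'k fps \<Rightarrow> 'v fps \<Rightarrow> 'v fps" where
  "ser_scale s c F = Abs_fps (\<lambda>n. \<Sum>i\<le>n. s (fps_nth c i) (fps_nth F (n - i)))"

text \<open>Bilinear over the ring of formal power series in the deformation parameter, and associative.\<close>

definition series_algebra :: "('k \<Rightarrow> 'v \<Rightarrow> 'v::comm_monoid_add) \<Rightarrow> 'v set \<Rightarrow>
    ('v fps \<Rightarrow> 'v fps \<Rightarrow> 'v fps) \<Rightarrow> bool" where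
  "series_algebra s V m \<longleftrightarrow> bilinear_op (ser_scale s) (ser V) m \<and>
     (\<forall>x\<in>ser V. \<forall>y\<in>ser V. \<forall>z\<in>ser V. m (m x y) z = m x (m y z))"

text \<open>Direct sum decomposition of \<^emph>\<open>V\<close> (with zero element \<^emph>\<open>z\<close>) respected by the product.\<close>

definition graded_by :: "'v \<Rightarrow> 'v::comm_monoid_add set \<Rightarrow> (int \<Rightarrow> 'v set) \<Rightarrow> ('v \<Rightarrow> 'v \<Rightarrow> 'v) \<Rightarrow> bool" where
  "graded_by z V P m \<longleftrightarrow> (\<forall>n. P n \<subseteq> V) \<and>
     (\<forall>x\<in>V. \<exists>!y. (\<forall>n. y n \<in> P n) \<and> finite {n. y n \<noteq> z} \<and> x = z + (\<Sum>n | y n \<noteq> z. y n)) \<and>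
     (\<forall>i j. \<forall>x\<in>P i. \<forall>y\<in>P j. m x y \<in> P (i + j))"

section \<open>The Hamiltonian system\<close>

text \<open>
  The scalar type \<^emph>\<open>'k\<close> will be of class \<^class>\<open>real_normed_field\<close> and \<^class>\<open>euclidean_space\<close>;
  up to isomorphism these are exactly the real and the complex numbers. \<^emph>\<open>moment p X\<close> is the pairing
  of the moment map at \<^emph>\<open>p\<close> with the Lie algebra element \<^emph>\<open>X\<close>; \<^emph>\<open>sconst a b c\<close> is \<^emph>\<open>f_ab^c\<close>.
\<close>

record ('m, 'e, 'g, 'd, 'k) brst_data =
  M_atlas :: "('m, 'e) atlas"
  omega :: "'m \<Rightarrow> 'm tvec \<Rightarrow> 'm tvec \<Rightarrow> real"
  G_atlas :: "('g, 'd) atlas"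
  G_grp :: "'g monoid"
  act :: "'g \<Rightarrow> 'm \<Rightarrow> 'm"
  moment :: "'m \<Rightarrow> 'g tvec \<Rightarrow> real"
  gdim :: nat
  gbasis :: "nat \<Rightarrow> 'g tvec"
  sconst :: "nat \<Rightarrow> nat \<Rightarrow> nat \<Rightarrow> real"
  prol :: "('m \<Rightarrow> 'k) \<Rightarrow> 'm \<Rightarrow> 'k"
  hmap :: "('m \<Rightarrow> 'k) grass \<Rightarrow> ('m \<Rightarrow> 'k) grass"
  mu :: "nat \<Rightarrow> ('m \<Rightarrow> 'k) \<Rightarrow> ('m \<Rightarrow> 'k) \<Rightarrow> 'm \<Rightarrow> 'k"
  Phi :: "nat \<Rightarrow> ('m \<Rightarrow> 'k) grass \<Rightarrow> ('m \<Rightarrow> 'k) grass"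
  Htpy :: "nat \<Rightarrow> ('m \<Rightarrow> 'k) grass \<Rightarrow> ('m \<Rightarrow> 'k) grass"

definition lie_alg :: "('m, 'e, 'g, 'd::real_normed_vector, 'k, 'z) brst_data_scheme \<Rightarrow> 'g tvec set" where
  "lie_alg D = tangent (G_atlas D) \<one>\<^bsub>G_grp D\<^esub>"

text \<open>
  The Poisson bracket is \<^emph>\<open>omega(X_f, X_g)\<close> with \<^emph>\<open>i(X_f) omega = df\<close>. The opposite convention
  amounts to replacing the arbitrary symplectic form by its negative.
\<close>

definition ham_vec :: "('m, 'e::real_normed_vector, 'g, 'd, 'k, 'z) brst_data_scheme \<Rightarrow>
    ('m \<Rightarrow> real) \<Rightarrow> 'm \<Rightarrow> 'm tvec" where
  "ham_vec D f p = (THE v. v \<in> tangent (M_atlas D) p \<and>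
     (\<forall>w\<in>tangent (M_atlas D) p. omega D p v w = w f))"

definition poisson_real :: "('m, 'e::real_normed_vector, 'g, 'd, 'k, 'z) brst_data_scheme \<Rightarrow>
    ('m \<Rightarrow> real) \<Rightarrow> ('m \<Rightarrow> real) \<Rightarrow> 'm \<Rightarrow> real" where
  "poisson_real D f g p = omega D p (ham_vec D f p) (ham_vec D g p)"

text \<open>The scalar-bilinear extension to \<^emph>\<open>'k\<close>-valued functions.\<close>

definition poisson :: "('m, 'e::real_normed_vector, 'g, 'd, 'k::{real_normed_field, euclidean_space}, 'z)
    brst_data_scheme \<Rightarrow> ('m \<Rightarrow> 'k) \<Rightarrow> ('m \<Rightarrow> 'k) \<Rightarrow> 'm \<Rightarrow> 'k" where
  "poisson D f g p = (\<Sum>b\<in>Basis. \<Sum>c\<in>Basis.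
     poisson_real D (\<lambda>q. f q \<bullet> b) (\<lambda>q. g q \<bullet> c) p *\<^sub>R (b * c))"

text \<open>
  A Lie algebra element acts on functions by differentiating \<^emph>\<open>f o act (inv a)\<close> at the unit, the
  convention compatible with the bracket of left-invariant fields. The last condition is the
  infinitesimal form of equivariance.
\<close>

definition hamiltonian_system ::
    "('m::{t2_space, second_countable_topology}, 'e::real_normed_vector,
      'g::{t2_space, second_countable_topology}, 'd::real_normed_vector, 'k, 'z) brst_data_scheme \<Rightarrow> bool" where
  "hamiltonian_system D \<longleftrightarrow>
     smooth_atlas (M_atlas D) \<and> symplectic_form (M_atlas D) (omega D) \<and>
     lie_group (G_atlas D) (G_grp D) \<and> compact (UNIV :: 'g set) \<and> connected (UNIV :: 'g set) \<and>
     smooth_map (prod_atlas (G_atlas D) (M_atlas D)) (M_atlas D) (\<lambda>(a, p). act D a p) \<and>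
     (\<forall>p. act D \<one>\<^bsub>G_grp D\<^esub> p = p) \<and>
     (\<forall>a b p. act D (a \<otimes>\<^bsub>G_grp D\<^esub> b) p = act D a (act D b p)) \<and>
     (\<forall>a p. \<forall>v\<in>tangent (M_atlas D) p. \<forall>w\<in>tangent (M_atlas D) p.
        omega D (act D a p) (\<lambda>f. v (f \<circ> act D a)) (\<lambda>f. w (f \<circ> act D a)) = omega D p v w) \<and>
     (\<forall>p. \<forall>X\<in>lie_alg D. \<forall>Y\<in>lie_alg D. \<forall>c. moment D p (X + Y) = moment D p X + moment D p Y \<and>
        moment D p (\<lambda>\<phi>. c * X \<phi>) = c * moment D p X) \<and>
     (\<forall>X\<in>lie_alg D. smooth_fun (M_atlas D) (\<lambda>p. moment D p X)) \<and>
     (\<forall>X\<in>lie_alg D. \<forall>f p. smooth_fun (M_atlas D) f \<longrightarrow>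
        poisson_real D (\<lambda>q. moment D q X) f p = X (\<lambda>a. f (act D (inv\<^bsub>G_grp D\<^esub> a) p))) \<and>
     (\<forall>a p. \<forall>X\<in>lie_alg D.
        moment D (act D a p) X = moment D p (Adj (G_grp D) (inv\<^bsub>G_grp D\<^esub> a) X)) \<and>
     (\<forall>X\<in>lie_alg D. \<forall>Y\<in>lie_alg D. \<forall>p.
        poisson_real D (\<lambda>q. moment D q X) (\<lambda>q. moment D q Y) p = moment D p (alg_bracket (G_grp D) X Y))"

definition lie_basis :: "('m, 'e, 'g, 'd::real_normed_vector, 'k, 'z) brst_data_scheme \<Rightarrow> bool" where
  "lie_basis D \<longleftrightarrow> (\<forall>a<gdim D. gbasis D a \<in> lie_alg D) \<and>
     (\<forall>X\<in>lie_alg D. \<exists>!c. (\<forall>a\<ge>gdim D. c a = 0) \<and> X = (\<lambda>\<phi>. \<Sum>a<gdim D. c a * gbasis D a \<phi>)) \<and>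
     (\<forall>a<gdim D. \<forall>b<gdim D. alg_bracket (G_grp D) (gbasis D a) (gbasis D b) =
        (\<lambda>\<phi>. \<Sum>c<gdim D. sconst D a b c * gbasis D c \<phi>))"

definition J_of :: "('m, 'e, 'g, 'd, 'k::real_normed_field, 'z) brst_data_scheme \<Rightarrow> 'g tvec \<Rightarrow> 'm \<Rightarrow> 'k" where
  "J_of D X = (\<lambda>p. of_real (moment D p X))"

definition Jc :: "('m, 'e, 'g, 'd, 'k::real_normed_field, 'z) brst_data_scheme \<Rightarrow> nat \<Rightarrow> 'm \<Rightarrow> 'k" where
  "Jc D a = J_of D (gbasis D a)"

definition fc :: "('m, 'e, 'g, 'd, 'k::real_normed_field, 'z) brst_data_scheme \<Rightarrow> nat \<Rightarrow> nat \<Rightarrow> nat \<Rightarrow> 'k" where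
  "fc D a b c = of_real (sconst D a b c)"

section \<open>Function spaces\<close>

definition CM :: "('m, 'e::real_normed_vector, 'g, 'd, 'k::real_normed_field, 'z) brst_data_scheme \<Rightarrow>
    ('m \<Rightarrow> 'k) set" where
  "CM D = {f. smooth_fun (M_atlas D) f}"

definition Zset :: "('m, 'e, 'g, 'd::real_normed_vector, 'k, 'z) brst_data_scheme \<Rightarrow> 'm set" where
  "Zset D = {p. \<forall>X\<in>lie_alg D. moment D p X = 0}"

definition IZ :: "('m, 'e::real_normed_vector, 'g, 'd::real_normed_vector, 'k::real_normed_field, 'z)
    brst_data_scheme \<Rightarrow> ('m \<Rightarrow> 'k) set" where
  "IZ D = {f \<in> CM D. \<forall>p\<in>Zset D. f p = 0}"

text \<open>
  Elements of the quotient by the vanishing ideal are represented by their restrictions to the zero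
  set, extended by 0 to the whole type.
\<close>

definition res :: "('m, 'e, 'g, 'd::real_normed_vector, 'k::real_normed_field, 'z) brst_data_scheme \<Rightarrow>
    ('m \<Rightarrow> 'k) \<Rightarrow> 'm \<Rightarrow> 'k" where
  "res D f = (\<lambda>p. if p \<in> Zset D then f p else 0)"

definition CZ :: "('m, 'e::real_normed_vector, 'g, 'd::real_normed_vector, 'k::real_normed_field, 'z)
    brst_data_scheme \<Rightarrow> ('m \<Rightarrow> 'k) set" where
  "CZ D = res D ` CM D"

text \<open>
  The Frechet topology of uniform convergence of all derivatives on compact sets, generated by the
  balls of the corresponding seminorms.
\<close>

definition CM_topology :: "('m::topological_space, 'e::real_normed_vector, 'g, 'd, 'k::real_normed_field, 'z)
    brst_data_scheme \<Rightarrow> ('m \<Rightarrow> 'k) topology" where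
  "CM_topology D = topology_generated_by
     {{f \<in> CM D. \<forall>p\<in>K. norm (chart_deriv c vs (f - g) p) < \<epsilon>} | K c vs g \<epsilon>.
        c \<in> M_atlas D \<and> compact K \<and> K \<subseteq> fst c \<and> g \<in> CM D \<and> \<epsilon> > 0}"

definition CZ_topology :: "('m::topological_space, 'e::real_normed_vector, 'g, 'd::real_normed_vector,
    'k::real_normed_field, 'z) brst_data_scheme \<Rightarrow> ('m \<Rightarrow> 'k) topology" where
  "CZ_topology D = quotient_topology (CM_topology D) (res D)"

definition act_Z :: "('m, 'e::real_normed_vector, 'g, 'd::real_normed_vector,
    'k::{real_normed_field, euclidean_space}, 'z) brst_data_scheme \<Rightarrow> nat \<Rightarrow> ('m \<Rightarrow> 'k) \<Rightarrow> 'm \<Rightarrow> 'k" where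
  "act_Z D a u = res D (poisson D (Jc D a) (SOME f. f \<in> CM D \<and> res D f = u))"

definition CZ_inv :: "('m, 'e::real_normed_vector, 'g, 'd::real_normed_vector,
    'k::{real_normed_field, euclidean_space}, 'z) brst_data_scheme \<Rightarrow> ('m \<Rightarrow> 'k) set" where
  "CZ_inv D = {u \<in> CZ D. \<forall>a<gdim D. act_Z D a u = 0}"

definition CM_inv :: "('m, 'e::real_normed_vector, 'g, 'd, 'k::real_normed_field, 'z) brst_data_scheme \<Rightarrow>
    ('m \<Rightarrow> 'k) set" where
  "CM_inv D = {f \<in> CM D. \<forall>a p. f (act D a p) = f p}"

definition IZ_inv :: "('m, 'e::real_normed_vector, 'g, 'd::real_normed_vector, 'k::real_normed_field, 'z)
    brst_data_scheme \<Rightarrow> ('m \<Rightarrow> 'k) set" where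
  "IZ_inv D = IZ D \<inter> CM_inv D"

definition CM_red :: "('m, 'e::real_normed_vector, 'g, 'd::real_normed_vector, 'k::real_normed_field, 'z)
    brst_data_scheme \<Rightarrow> ('m \<Rightarrow> 'k) set set" where
  "CM_red D = coset (IZ_inv D) ` CM_inv D"

definition CM_red_topology :: "('m::topological_space, 'e::real_normed_vector, 'g, 'd::real_normed_vector,
    'k::real_normed_field, 'z) brst_data_scheme \<Rightarrow> ('m \<Rightarrow> 'k) set topology" where
  "CM_red_topology D = quotient_topology (subtopology (CM_topology D) (CM_inv D)) (coset (IZ_inv D))"

section \<open>Koszul complex and equivariant contraction\<close>

definition all_gens :: "('m, 'e, 'g, 'd, 'k, 'z) brst_data_scheme \<Rightarrow> nat set" where
  "all_gens D = {..<2 * gdim D}"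

definition ghosts :: "('m, 'e, 'g, 'd, 'k, 'z) brst_data_scheme \<Rightarrow> nat set" where
  "ghosts D = gh ` {..<gdim D}"

definition antighosts :: "('m, 'e, 'g, 'd, 'k, 'z) brst_data_scheme \<Rightarrow> nat set" where
  "antighosts D = ag ` {..<gdim D}"

definition koszul_space :: "('m, 'e::real_normed_vector, 'g, 'd, 'k::real_normed_field, 'z)
    brst_data_scheme \<Rightarrow> ('m \<Rightarrow> 'k) grass set" where
  "koszul_space D = grass_over (CM D) (antighosts D)"

definition koszul_piece :: "('m, 'e::real_normed_vector, 'g, 'd, 'k::real_normed_field, 'z)
    brst_data_scheme \<Rightarrow> nat \<Rightarrow> ('m \<Rightarrow> 'k) grass set" where
  "koszul_piece D i = {x \<in> koszul_space D. \<forall>S. x S \<noteq> 0 \<longrightarrow> card S = i}"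

definition koszul :: "('m, 'e, 'g, 'd, 'k::real_normed_field, 'z) brst_data_scheme \<Rightarrow>
    ('m \<Rightarrow> 'k) grass \<Rightarrow> ('m \<Rightarrow> 'k) grass" where
  "koszul D x = (\<Sum>a<gdim D. gscale (Jc D a) (gder (ag a) x))"

definition generating_acyclic ::
    "('m, 'e::real_normed_vector, 'g, 'd::real_normed_vector, 'k::real_normed_field, 'z)
     brst_data_scheme \<Rightarrow> bool" where
  "generating_acyclic D \<longleftrightarrow>
     IZ D = {\<Sum>a<gdim D. g a * Jc D a | g. \<forall>a<gdim D. g a \<in> CM D} \<and>
     (\<forall>i>0. \<forall>x\<in>koszul_piece D i. koszul D x = 0 \<longrightarrow> (\<exists>y\<in>koszul_piece D (Suc i). koszul D y = x))"

text \<open>The action of the \<^emph>\<open>a\<close>-th basis element: Poisson bracket on coefficients, adjoint on antighosts.\<close>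

definition koszul_act :: "('m, 'e::real_normed_vector, 'g, 'd, 'k::{real_normed_field, euclidean_space}, 'z)
    brst_data_scheme \<Rightarrow> nat \<Rightarrow> ('m \<Rightarrow> 'k) grass \<Rightarrow> ('m \<Rightarrow> 'k) grass" where
  "koszul_act D a x = (\<lambda>S. poisson D (Jc D a) (x S)) +
     (\<Sum>b<gdim D. \<Sum>c<gdim D. gscale (\<lambda>_. fc D a b c) (gmul (gen (ag c)) (gder (ag b) x)))"

definition equivariant_contraction ::
    "('m::topological_space, 'e::real_normed_vector, 'g, 'd::real_normed_vector,
      'k::{real_normed_field, euclidean_space}, 'z) brst_data_scheme \<Rightarrow> bool" where
  "equivariant_contraction D \<longleftrightarrow>
     linear_map fscale fscale (CZ D) (CM D) (prol D) \<and>
     continuous_map (CZ_topology D) (CM_topology D) (prol D) \<and>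
     (\<forall>a<gdim D. \<forall>u\<in>CZ D. prol D (act_Z D a u) = poisson D (Jc D a) (prol D u)) \<and>
     linear_map fgscale fgscale (koszul_space D) (koszul_space D) (hmap D) \<and>
     (\<forall>i. hmap D ` koszul_piece D i \<subseteq> koszul_piece D (Suc i)) \<and>
     continuous_map (grass_topology (CM_topology D) (antighosts D))
       (grass_topology (CM_topology D) (antighosts D)) (hmap D) \<and>
     (\<forall>a<gdim D. \<forall>x\<in>koszul_space D. hmap D (koszul_act D a x) = koszul_act D a (hmap D x)) \<and>
     (\<forall>u\<in>CZ D. res D (prol D u) = u) \<and>
     (\<forall>x\<in>koszul_space D. x - emb (prol D (res D (x {}))) = koszul D (hmap D x) + hmap D (koszul D x)) \<and>
     (\<forall>u\<in>CZ D. hmap D (emb (prol D u)) = 0) \<and>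
     (\<forall>x\<in>koszul_space D. hmap D (hmap D x) = 0)"

section \<open>Star product\<close>

text \<open>A bidifferential operator of finite order, through its local expression in charts.\<close>

definition bidifferential :: "('m, 'e::real_normed_vector, 'g, 'd, 'k::real_normed_field, 'z)
    brst_data_scheme \<Rightarrow> (('m \<Rightarrow> 'k) \<Rightarrow> ('m \<Rightarrow> 'k) \<Rightarrow> 'm \<Rightarrow> 'k) \<Rightarrow> bool" where
  "bidifferential D B \<longleftrightarrow> bilinear_op fscale (CM D) B \<and>
     (\<exists>N. \<forall>c\<in>M_atlas D. \<exists>I \<gamma>. finite I \<and>
        (\<forall>(vs, ws)\<in>I. length vs \<le> N \<and> length ws \<le> N \<and>
           smooth_on (snd c ` fst c) (\<gamma> vs ws \<circ> inv_into (fst c) (snd c))) \<and>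
        (\<forall>f\<in>CM D. \<forall>g\<in>CM D. \<forall>p\<in>fst c.
           B f g p = (\<Sum>(vs, ws)\<in>I. \<gamma> vs ws p * chart_deriv c vs f p * chart_deriv c ws g p)))"

definition star :: "('m, 'e, 'g, 'd, 'k::real_normed_field, 'z) brst_data_scheme \<Rightarrow>
    ('m \<Rightarrow> 'k) fps \<Rightarrow> ('m \<Rightarrow> 'k) fps \<Rightarrow> ('m \<Rightarrow> 'k) fps" where
  "star D = ser_bilin (mu D)"

definition star_product :: "('m, 'e::real_normed_vector, 'g, 'd, 'k::{real_normed_field, euclidean_space}, 'z)
    brst_data_scheme \<Rightarrow> bool" where
  "star_product D \<longleftrightarrow>
     (\<forall>f\<in>CM D. \<forall>g\<in>CM D. mu D 0 f g = f * g) \<and>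
     (\<forall>i. bidifferential D (mu D i)) \<and>
     (\<forall>F\<in>ser (CM D). \<forall>G\<in>ser (CM D). \<forall>H\<in>ser (CM D). star D (star D F G) H = star D F (star D G H)) \<and>
     (\<forall>F\<in>ser (CM D). star D 1 F = F \<and> star D F 1 = F) \<and>
     (\<forall>f\<in>CM D. \<forall>g\<in>CM D. mu D 1 f g - mu D 1 g f = poisson D f g)"

definition strongly_invariant :: "('m, 'e::real_normed_vector, 'g, 'd::real_normed_vector,
    'k::{real_normed_field, euclidean_space}, 'z) brst_data_scheme \<Rightarrow> bool" where
  "strongly_invariant D \<longleftrightarrow> (\<forall>X\<in>lie_alg D. \<forall>f\<in>CM D.
     star D (fps_const (J_of D X)) (fps_const f) - star D (fps_const f) (fps_const (J_of D X))
     = fps_X * fps_const (poisson D (J_of D X) f))"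

section \<open>Quantum BRST algebra\<close>

text \<open>
  Elements of the deformed BRST algebra are Grassmann elements with coefficients in the power series
  ring. The product \<^emph>\<open>*\<close> of \<^typ>\<open>('m \<Rightarrow> 'k) fps\<close> is the undeformed pointwise one, so multiplication
  by \<^const>\<open>fps_X\<close> is multiplication by the deformation parameter.
\<close>

definition scal :: "'k \<Rightarrow> ('m \<Rightarrow> 'k::real_normed_field) fps" where
  "scal c = fps_const (\<lambda>_. c)"

definition brst_space :: "('m, 'e::real_normed_vector, 'g, 'd, 'k::real_normed_field, 'z)
    brst_data_scheme \<Rightarrow> ('m \<Rightarrow> 'k) grass set" where
  "brst_space D = grass_over (CM D) (all_gens D)"

definition brst_ser :: "('m, 'e::real_normed_vector, 'g, 'd, 'k::real_normed_field, 'z)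
    brst_data_scheme \<Rightarrow> ('m \<Rightarrow> 'k) fps grass set" where
  "brst_ser D = grass_over (ser (CM D)) (all_gens D)"

text \<open>
  \<^emph>\<open>exp (-2 nu contraction)\<close> on tensors, followed by the supercommutative product, with the star
  product on coefficients.
\<close>

definition exp_contraction :: "nat \<Rightarrow> (nat set \<Rightarrow> ('m \<Rightarrow> 'k::real_normed_field) fps grass) \<Rightarrow>
    nat set \<Rightarrow> ('m \<Rightarrow> 'k) fps grass" where
  "exp_contraction l t = (\<lambda>S T. Abs_fps (\<lambda>n. \<Sum>k\<le>n.
     fscale ((- 2) ^ k / fact k) (fps_nth (((contraction l) ^^ k) t S T) (n - k))))"

definition brst_mult :: "('m, 'e, 'g, 'd, 'k::real_normed_field, 'z) brst_data_scheme \<Rightarrow>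
    ('m \<Rightarrow> 'k) fps grass \<Rightarrow> ('m \<Rightarrow> 'k) fps grass \<Rightarrow> ('m \<Rightarrow> 'k) fps grass" where
  "brst_mult D x y = (\<lambda>R. \<Sum>S\<in>Pow R. signed (inversions S (R - S))
     (exp_contraction (gdim D) (\<lambda>S T. star D (x S) (y T)) S (R - S)))"

definition even_part :: "'c::zero grass \<Rightarrow> 'c grass" where
  "even_part x = (\<lambda>S. if even (card S) then x S else 0)"

definition odd_part :: "'c::zero grass \<Rightarrow> 'c grass" where
  "odd_part x = (\<lambda>S. if odd (card S) then x S else 0)"

definition brst_comm :: "('m, 'e, 'g, 'd, 'k::real_normed_field, 'z) brst_data_scheme \<Rightarrow>
    ('m \<Rightarrow> 'k) fps grass \<Rightarrow> ('m \<Rightarrow> 'k) fps grass \<Rightarrow> ('m \<Rightarrow> 'k) fps grass" where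
  "brst_comm D x y = brst_mult D x y - brst_mult D (even_part y) x
     - brst_mult D (odd_part y) (even_part x) + brst_mult D (odd_part y) (odd_part x)"

definition theta :: "('m, 'e, 'g, 'd, 'k::real_normed_field, 'z) brst_data_scheme \<Rightarrow>
    ('m \<Rightarrow> 'k) fps grass" where
  "theta D =
     (\<Sum>a<gdim D. \<Sum>b<gdim D. \<Sum>c<gdim D. gscale (scal (- (1 / 4) * fc D a b c))
        (gmul (gmul (gen (gh a)) (gen (gh b))) (gen (ag c))))
     + (\<Sum>a<gdim D. gscale (fps_const (Jc D a)) (gen (gh a)))
     + (\<Sum>a<gdim D. \<Sum>b<gdim D. gscale (fps_X * scal (1 / 2 * fc D a b b)) (gen (gh a)))"

text \<open>The graded commutator is divisible by the deformation parameter; \<^const>\<open>fps_shift\<close> divides by it.\<close>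

definition brst_diff :: "('m, 'e, 'g, 'd, 'k::real_normed_field, 'z) brst_data_scheme \<Rightarrow>
    ('m \<Rightarrow> 'k) fps grass \<Rightarrow> ('m \<Rightarrow> 'k) fps grass" where
  "brst_diff D x = (\<lambda>S. fps_shift 1 (brst_comm D (theta D) x S))"

definition qkoszul :: "('m, 'e, 'g, 'd, 'k::real_normed_field, 'z) brst_data_scheme \<Rightarrow>
    ('m \<Rightarrow> 'k) fps grass \<Rightarrow> ('m \<Rightarrow> 'k) fps grass" where
  "qkoszul D x =
     (\<Sum>a<gdim D. (\<lambda>S. star D (gder (ag a) x S) (fps_const (Jc D a))))
     + (\<Sum>a<gdim D. \<Sum>b<gdim D. gscale (fps_X * scal (1 / 2 * fc D a b b)) (gder (ag a) x))
     + (\<Sum>a<gdim D. \<Sum>b<gdim D. \<Sum>c<gdim D. gscale (fps_X * scal (1 / 2 * fc D a b c))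
          (gmul (gen (ag c)) (gder (ag a) (gder (ag b) x))))"

text \<open>\<^emph>\<open>res\<close> after the inverse, on power series of smooth functions, of \<^emph>\<open>id + (qkoszul - koszul) h_0\<close>.\<close>

definition qres_fun :: "('m, 'e::real_normed_vector, 'g, 'd::real_normed_vector, 'k::real_normed_field, 'z)
    brst_data_scheme \<Rightarrow> ('m \<Rightarrow> 'k) fps \<Rightarrow> ('m \<Rightarrow> 'k) fps" where
  "qres_fun D F = ser_map (res D) (inv_into (ser (CM D))
     (\<lambda>F. F + (let y = gser_map (hmap D) (emb F) in qkoszul D y - gser_map (koszul D) y) {}) F)"

definition qres :: "('m, 'e::real_normed_vector, 'g, 'd::real_normed_vector, 'k::real_normed_field, 'z)
    brst_data_scheme \<Rightarrow> ('m \<Rightarrow> 'k) fps grass \<Rightarrow> ('m \<Rightarrow> 'k) fps grass" where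
  "qres D x = (\<lambda>S. if \<forall>i\<in>S. even i then qres_fun D (x S) else 0)"

section \<open>Lie algebra cohomology\<close>

definition cochains :: "('m, 'e::real_normed_vector, 'g, 'd::real_normed_vector, 'k::real_normed_field, 'z)
    brst_data_scheme \<Rightarrow> ('m \<Rightarrow> 'k) grass set" where
  "cochains D = grass_over (CZ D) (ghosts D)"

definition cochain_ser :: "('m, 'e::real_normed_vector, 'g, 'd::real_normed_vector, 'k::real_normed_field, 'z)
    brst_data_scheme \<Rightarrow> ('m \<Rightarrow> 'k) fps grass set" where
  "cochain_ser D = grass_over (ser (CZ D)) (ghosts D)"

text \<open>
  The Chevalley-Eilenberg differential
  \<^emph>\<open>sum_a xi^a X_a - 1/2 sum f_ab^c xi^a xi^b d/dxi^c\<close>; on power series it acts coefficientwise.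
\<close>

definition ce_diff :: "('m, 'e::real_normed_vector, 'g, 'd::real_normed_vector,
    'k::{real_normed_field, euclidean_space}, 'z) brst_data_scheme \<Rightarrow>
    ('m \<Rightarrow> 'k) grass \<Rightarrow> ('m \<Rightarrow> 'k) grass" where
  "ce_diff D u = (\<Sum>a<gdim D. gmul (gen (gh a)) (\<lambda>S. act_Z D a (u S)))
     - (\<Sum>a<gdim D. \<Sum>b<gdim D. \<Sum>c<gdim D. gscale (\<lambda>_. 1 / 2 * fc D a b c)
          (gmul (gmul (gen (gh a)) (gen (gh b))) (gder (gh c) u)))"

definition coboundaries :: "('m, 'e::real_normed_vector, 'g, 'd::real_normed_vector,
    'k::{real_normed_field, euclidean_space}, 'z) brst_data_scheme \<Rightarrow> ('m \<Rightarrow> 'k) grass set" where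
  "coboundaries D = ce_diff D ` cochains D"

definition cohom :: "('m, 'e::real_normed_vector, 'g, 'd::real_normed_vector,
    'k::{real_normed_field, euclidean_space}, 'z) brst_data_scheme \<Rightarrow> ('m \<Rightarrow> 'k) grass set set" where
  "cohom D = coset (coboundaries D) ` {u \<in> cochains D. ce_diff D u = 0}"

definition cohom_deg :: "('m, 'e::real_normed_vector, 'g, 'd::real_normed_vector,
    'k::{real_normed_field, euclidean_space}, 'z) brst_data_scheme \<Rightarrow> int \<Rightarrow> ('m \<Rightarrow> 'k) grass set set" where
  "cohom_deg D n = coset (coboundaries D) ` {u \<in> cochains D. ce_diff D u = 0 \<and> homog n u}"

definition cohom_scale :: "('m, 'e::real_normed_vector, 'g, 'd::real_normed_vector,
    'k::{real_normed_field, euclidean_space}, 'z) brst_data_scheme \<Rightarrow> 'k \<Rightarrow>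
    ('m \<Rightarrow> 'k) grass set \<Rightarrow> ('m \<Rightarrow> 'k) grass set" where
  "cohom_scale D = coset_scale fgscale (coboundaries D)"

definition cocycle_ser :: "('m, 'e::real_normed_vector, 'g, 'd::real_normed_vector,
    'k::{real_normed_field, euclidean_space}, 'z) brst_data_scheme \<Rightarrow> ('m \<Rightarrow> 'k) fps grass set" where
  "cocycle_ser D = {u \<in> cochain_ser D. gser_map (ce_diff D) u = 0}"

definition cls :: "('m, 'e::real_normed_vector, 'g, 'd::real_normed_vector,
    'k::{real_normed_field, euclidean_space}, 'z) brst_data_scheme \<Rightarrow>
    ('m \<Rightarrow> 'k) fps grass \<Rightarrow> ('m \<Rightarrow> 'k) grass set fps" where
  "cls D u = Abs_fps (\<lambda>n. coset (coboundaries D) (gcoeff u n))"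

definition quantum_contraction ::
    "('m::topological_space, 'e::real_normed_vector, 'g, 'd::real_normed_vector,
      'k::{real_normed_field, euclidean_space}, 'z) brst_data_scheme \<Rightarrow> bool" where
  "quantum_contraction D \<longleftrightarrow>
     (\<forall>i. linear_map fgscale fgscale (cochains D) (brst_space D) (Phi D i) \<and>
        continuous_map (grass_topology (CZ_topology D) (ghosts D))
          (grass_topology (CM_topology D) (all_gens D)) (Phi D i) \<and>
        (\<forall>n. \<forall>u\<in>cochains D. homog n u \<longrightarrow> homog n (Phi D i u))) \<and>
     (\<forall>i. linear_map fgscale fgscale (brst_space D) (brst_space D) (Htpy D i) \<and>
        continuous_map (grass_topology (CM_topology D) (all_gens D))
          (grass_topology (CM_topology D) (all_gens D)) (Htpy D i) \<and>
        (\<forall>n. \<forall>x\<in>brst_space D. homog n x \<longrightarrow> homog (n - 1) (Htpy D i x))) \<and>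
     (\<forall>x\<in>brst_ser D. qres D (brst_diff D x) = gser_map (ce_diff D) (qres D x)) \<and>
     (\<forall>u\<in>cochain_ser D. brst_diff D (gser_app (Phi D) u) = gser_app (Phi D) (gser_map (ce_diff D) u)) \<and>
     (\<forall>u\<in>cochain_ser D. qres D (gser_app (Phi D) u) = u) \<and>
     (\<forall>x\<in>brst_ser D. x - gser_app (Phi D) (qres D x) =
        brst_diff D (gser_app (Htpy D) x) + gser_app (Htpy D) (brst_diff D x))"

end

theory Submission imports Defs begin

text \<open>
  Why the theorem holds. The BRST algebra \<open>\<A>[[\<nu>]]\<close> with its product \<open>*\<close> is associative, and
  \<open>\<delta> = 1/\<nu> [\<theta>, \<cdot>]\<close> is a graded derivation of it. The series \<open>\<Phi>\<close> and \<open>R\<close> (the quantum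
  restriction) are chain maps with \<open>R \<Phi> = id\<close> and \<open>id - \<Phi> R = \<delta> H + H \<delta>\<close>. So \<open>\<Phi>\<close> maps cocycles to
  closed elements, products of closed elements are closed, and a product with an exact factor is exact;
  hence \<open>[a] * [b] = [R (\<Phi> a * \<Phi> b)]\<close> is well defined (\<open>cprod_cong\<close>). A closed \<open>x\<close> differs from
  \<open>\<Phi> (R x)\<close> by an exact element, so \<open>[R x] * [R y] = [R (x * y)]\<close> for all closed \<open>x\<close>, \<open>y\<close> (\<open>cprod_R\<close>),
  and associativity descends from the BRST algebra (\<open>cprod_assoc\<close>).

  Associativity of \<open>*\<close> (\<open>bmul_assoc\<close>) rests on one commutation: left multiplication by a generator is
  exterior multiplication, corrected for an antighost by \<open>2 \<nu>\<close> times the derivation in the dual ghost, and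
  this operator commutes with all right multiplications (\<open>bmul_lmul\<close>). Induction on the number of
  generators then reduces associativity to that of the star product. The commutator with \<open>\<theta>\<close> is divisible
  by \<open>\<nu>\<close> because the product is supercommutative at \<open>\<nu> = 0\<close> (\<open>ad_nth_0\<close>), and it is a derivation as a
  commutator in an associative algebra (\<open>brst_diff_bmul\<close>).

  For an invariant function \<open>f\<close> on \<open>Z\<close>, the prolongation \<open>prol f\<close> is invariant, so by strong invariance it
  commutes with every coefficient of \<open>\<theta>\<close> and is closed (\<open>brst_diff_emb_invariant\<close>); and \<open>R (prol f) = f\<close>
  because \<open>h\<^sub>0 prol = 0\<close> makes the Neumann series of the quantum restriction trivial (\<open>qres_fun_prol\<close>). Hence
  \<open>prol f\<close> and \<open>prol g\<close> are closed representatives, and \<open>cprod_R\<close> gives the simplified formula.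

  The restriction \<open>\<psi>\<close> identifies \<open>C\<^sup>\<infinity>(M)\<^sup>G / I\<^sup>G\<close> with the invariants of \<open>C\<^sup>\<infinity>(Z)\<close>. Two facts about the
  geometry enter: for a connected group infinitesimal invariance implies invariance
  (\<open>connected_lie_group_constant\<close>), which makes \<open>\<psi>\<close> onto; and the ideal of \<open>Z\<close>, generated by the moment
  map, is stable under the action (\<open>poisson_IZ\<close>), so that restrictions of invariant functions are
  invariant. Transporting the product along \<open>\<psi>\<close> gives the algebra on the reduced space. Its coefficients
  are finite compositions of bidifferential operators, which satisfy seminorm estimates by the Leibniz rule
  (\<open>bidifferential_bound\<close>), and of the continuous maps \<open>h\<^sub>0\<close>, \<open>prol\<close> and \<open>res\<close>; so they are continuous.
\<close>

section \<open>Calculus of smooth functions\<close>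

lemma dir_deriv_cong:
  assumes "open T" "x \<in> T" "\<And>y. y \<in> T \<Longrightarrow> F y = G y"
  shows "dir_deriv v F x = dir_deriv v G x"
proof -
  have "(F has_derivative F') (at x) \<longleftrightarrow> (G has_derivative F') (at x)" for F'
    using has_derivative_transform_within_open[of F F' x UNIV T G]
      has_derivative_transform_within_open[of G F' x UNIV T F] assms by auto
  then show ?thesis
    by (simp add: dir_deriv_def frechet_derivative_def)
qed

lemma dir_deriv_eqI:
  assumes "(F has_derivative F') (at x)"
  shows "dir_deriv v F x = F' v"
  using frechet_derivative_at[OF assms] by (simp add: dir_deriv_def)

lemma has_derivative_dir_deriv:
  assumes "F differentiable_on T" "open T" "x \<in> T"
  shows "(F has_derivative (\<lambda>v. dir_deriv v F x)) (at x)"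
proof -
  have "F differentiable (at x)"
    using assms(1,3) at_within_open[OF assms(3,2)] unfolding differentiable_on_def by metis
  then show ?thesis
    unfolding dir_deriv_def using frechet_derivative_works by blast
qed

lemma differentiable_on_openI:
  assumes "open T" "\<And>x. x \<in> T \<Longrightarrow> (F has_derivative F' x) (at x)"
  shows "F differentiable_on T"
  unfolding differentiable_on_def differentiable_def
  using assms(2) at_within_open[OF _ assms(1)] by metis

lemma differentiable_on_cong:
  assumes "\<And>x. x \<in> T \<Longrightarrow> F x = G x"
  shows "F differentiable_on T \<longleftrightarrow> G differentiable_on T"
  unfolding differentiable_on_def differentiable_def
  using assms has_derivative_transform[of _ T F G] has_derivative_transform[of _ T G F] by metis

text \<open>
  Smoothness is an intersection of the following finite orders; on each of them closure properties are
  proved by induction on the order, since the derivative of a product or of a composition involves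
  products and compositions again.
\<close>

primrec times_diff :: "nat \<Rightarrow> 'e::real_normed_vector set \<Rightarrow> ('e \<Rightarrow> 'b::real_normed_vector) \<Rightarrow> bool" where
  "times_diff 0 T F \<longleftrightarrow> F differentiable_on T"
| "times_diff (Suc k) T F \<longleftrightarrow> F differentiable_on T \<and> (\<forall>v. times_diff k T (dir_deriv v F))"

lemma times_diff_iff_foldr:
  "times_diff k T F \<longleftrightarrow> (\<forall>vs. length vs \<le> k \<longrightarrow> foldr dir_deriv vs F differentiable_on T)"
proof (induction k arbitrary: F)
  case (Suc k)
  show ?case
  proof
    assume *: "times_diff (Suc k) T F"
    show "\<forall>vs. length vs \<le> Suc k \<longrightarrow> foldr dir_deriv vs F differentiable_on T"
    proof (intro allI impI)
      fix vs :: "'a list"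
      assume "length vs \<le> Suc k"
      with * show "foldr dir_deriv vs F differentiable_on T"
        by (cases vs rule: rev_cases) (auto simp: Suc)
    qed
  next
    assume *: "\<forall>vs. length vs \<le> Suc k \<longrightarrow> foldr dir_deriv vs F differentiable_on T"
    have "foldr dir_deriv vs (dir_deriv v F) differentiable_on T" if "length vs \<le> k" for vs v
      using *[rule_format, of "vs @ [v]"] that by simp
    moreover have "F differentiable_on T"
      using *[rule_format, of "[]"] by simp
    ultimately show "times_diff (Suc k) T F"
      by (simp add: Suc)
  qed
qed simp

lemma smooth_on_iff_times_diff: "smooth_on T F \<longleftrightarrow> (\<forall>k. times_diff k T F)"
  unfolding smooth_on_def times_diff_iff_foldr by blast

lemma times_diff_cong:
  assumes "open T" "\<And>x. x \<in> T \<Longrightarrow> F x = G x"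
  shows "times_diff k T F \<longleftrightarrow> times_diff k T G"
  using assms(2)
proof (induction k arbitrary: F G)
  case 0
  then show ?case using differentiable_on_cong[of T F G] by simp
next
  case (Suc k)
  have "times_diff k T (dir_deriv v F) \<longleftrightarrow> times_diff k T (dir_deriv v G)" for v
    by (rule Suc.IH) (use dir_deriv_cong[OF assms(1), of _ F G v] Suc.prems in blast)
  then show ?case using differentiable_on_cong[of T F G] Suc.prems by simp
qed

lemma times_diff_congI:
  "\<lbrakk>open T; \<And>x. x \<in> T \<Longrightarrow> F x = G x; times_diff k T G\<rbrakk> \<Longrightarrow> times_diff k T F"
  using times_diff_cong[of T F G] by blast

lemma times_diff_SucD: "times_diff (Suc k) T F \<Longrightarrow> times_diff k T F"
  unfolding times_diff_iff_foldr by simp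

lemma times_diff_const: "times_diff k T (\<lambda>_. c)"
proof (induction k arbitrary: c)
  case (Suc k)
  have "dir_deriv v (\<lambda>_::'a. c) = (\<lambda>_. 0)" for v
    by (rule ext) (use dir_deriv_eqI[OF has_derivative_const] in blast)
  then show ?case using Suc by simp
qed simp

lemma times_diff_bounded_linear:
  assumes "bounded_linear L" "open T" "times_diff k T F"
  shows "times_diff k T (\<lambda>x. L (F x))"
  using assms(3)
proof (induction k arbitrary: F)
  case 0
  then have "((\<lambda>x. L (F x)) has_derivative (\<lambda>v. L (dir_deriv v F x))) (at x)" if "x \<in> T" for x
    using bounded_linear.has_derivative[OF assms(1) has_derivative_dir_deriv] assms(2) that by auto
  then have "(\<lambda>x. L (F x)) differentiable_on T"
    by (rule differentiable_on_openI[OF assms(2)])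
  then show ?case by simp
next
  case (Suc k)
  then have der: "((\<lambda>x. L (F x)) has_derivative (\<lambda>v. L (dir_deriv v F x))) (at x)" if "x \<in> T" for x
    using bounded_linear.has_derivative[OF assms(1) has_derivative_dir_deriv] assms(2) that by auto
  have "times_diff k T (dir_deriv v (\<lambda>x. L (F x)))" for v
    by (rule times_diff_congI[OF assms(2) dir_deriv_eqI[OF der]]) (use Suc in simp_all)
  moreover have "(\<lambda>x. L (F x)) differentiable_on T"
    by (rule differentiable_on_openI[OF assms(2) der])
  ultimately show ?case by simp
qed

lemma dir_deriv_add:
  assumes "F differentiable_on T" "G differentiable_on T" "open T" "x \<in> T"
  shows "dir_deriv v (\<lambda>x. F x + G x) x = dir_deriv v F x + dir_deriv v G x"
  by (intro dir_deriv_eqI has_derivative_add has_derivative_dir_deriv[OF _ assms(3,4)] assms(1,2))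

lemma times_diff_add:
  assumes "open T" "times_diff k T F" "times_diff k T G"
  shows "times_diff k T (\<lambda>x. F x + G x)"
  using assms(2,3)
proof (induction k arbitrary: F G)
  case 0
  then show ?case by (simp add: differentiable_on_add)
next
  case (Suc k)
  have "times_diff k T (dir_deriv v (\<lambda>x. F x + G x))" for v
    by (rule times_diff_congI[OF assms(1) dir_deriv_add[OF _ _ assms(1)]]) (use Suc in simp_all)
  then show ?case
    using Suc.prems by (simp add: differentiable_on_add)
qed

lemma times_diff_sum:
  assumes "open T" "\<And>i. i \<in> I \<Longrightarrow> times_diff k T (F i)"
  shows "times_diff k T (\<lambda>x. \<Sum>i\<in>I. F i x)"
  using assms(2)
proof (induction I rule: infinite_finite_induct)
  case (insert i I)
  then show ?case
    using times_diff_add[OF assms(1), of k "F i" "\<lambda>x. \<Sum>i\<in>I. F i x"] by simp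
qed (simp_all add: times_diff_const)

lemma has_derivative_bilinear:
  assumes "bounded_bilinear B" "open T" "F differentiable_on T" "G differentiable_on T" "x \<in> T"
  shows "((\<lambda>x. B (F x) (G x)) has_derivative
     (\<lambda>v. B (F x) (dir_deriv v G x) + B (dir_deriv v F x) (G x))) (at x)"
  using bounded_bilinear.FDERIV[OF assms(1) has_derivative_dir_deriv[OF assms(3,2,5)]
    has_derivative_dir_deriv[OF assms(4,2,5)]] .

lemma times_diff_bilinear:
  assumes "bounded_bilinear B" "open T" "times_diff k T F" "times_diff k T G"
  shows "times_diff k T (\<lambda>x. B (F x) (G x))"
  using assms(3,4)
proof (induction k arbitrary: F G)
  case 0
  then have "(\<lambda>x. B (F x) (G x)) differentiable_on T"
    by (intro differentiable_on_openI[OF assms(2) has_derivative_bilinear[OF assms(1,2)]]) simp_all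
  then show ?case by simp
next
  case (Suc k)
  note der = has_derivative_bilinear[OF assms(1,2), of F G]
  have d: "F differentiable_on T" "G differentiable_on T"
    using Suc.prems by auto
  have "times_diff k T (\<lambda>x. B (F x) (dir_deriv v G x) + B (dir_deriv v F x) (G x))" for v
    using Suc.prems by (intro times_diff_add assms(2) Suc.IH) (auto intro: times_diff_SucD)
  then have "times_diff k T (dir_deriv v (\<lambda>x. B (F x) (G x)))" for v
    by (intro times_diff_congI[OF assms(2) dir_deriv_eqI[OF der[OF d]]])
  moreover have "(\<lambda>x. B (F x) (G x)) differentiable_on T"
    by (rule differentiable_on_openI[OF assms(2) der[OF d]])
  ultimately show ?case by simp
qed

text \<open>
  In a space spanned by finitely many vectors coordinates are continuous. By induction on the basis: the
  span of the smaller basis is complete, hence has positive distance from the new basis vector.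
\<close>

lemma coordinates_le_norm:
  fixes B :: "'b::real_normed_vector set"
  assumes "finite B" "independent B"
  shows "\<exists>C\<ge>0. \<forall>c. (\<Sum>b\<in>B. \<bar>c b\<bar>) \<le> C * norm (\<Sum>b\<in>B. c b *\<^sub>R b)"
  using assms
proof (induction B rule: finite_induct)
  case empty
  show ?case by (rule exI[of _ 0]) simp
next
  case (insert a B)
  then have "independent B" and a: "a \<notin> span B"
    by (auto simp: independent_insert)
  with insert obtain C where C: "C \<ge> 0" "\<And>c. (\<Sum>b\<in>B. \<bar>c b\<bar>) \<le> C * norm (\<Sum>b\<in>B. c b *\<^sub>R b)"
    by blast
  have "\<exists>\<delta>>0. \<forall>s\<in>span B. \<delta> \<le> norm (a - s)"
  proof (rule ccontr)
    assume "\<not> ?thesis"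
    then have "\<exists>s\<in>span B. norm (a - s) < inverse (real (Suc n))" for n
      by (metis inverse_positive_iff_positive not_le of_nat_0_less_iff zero_less_Suc)
    then obtain s where s: "\<And>n. s n \<in> span B" "\<And>n. norm (a - s n) < inverse (real (Suc n))"
      by metis
    have "\<exists>c. s n = (\<Sum>b\<in>B. c b *\<^sub>R b)" for n
      using s(1)[of n] span_finite[OF insert(1)] by auto
    then obtain c where c: "\<And>n. s n = (\<Sum>b\<in>B. c n b *\<^sub>R b)" by metis
    have "(\<lambda>n. norm (a - s n)) \<longlonglongrightarrow> 0"
      by (rule tendsto_sandwich[OF _ _ tendsto_const LIMSEQ_inverse_real_of_nat])
        (auto intro!: always_eventually less_imp_le[OF s(2)] simp del: of_nat_Suc)
    then have lim: "s \<longlonglongrightarrow> a"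
      by (subst LIM_zero_iff[symmetric], subst tendsto_norm_zero_iff[symmetric]) (simp add: norm_minus_commute)
    have "Cauchy (\<lambda>n. c n b)" if b: "b \<in> B" for b
    proof (rule metric_CauchyI)
      fix e :: real assume "e > 0"
      with C(1) have "e / (C + 1) > 0" by simp
      then obtain M where M: "\<And>m n. m \<ge> M \<Longrightarrow> n \<ge> M \<Longrightarrow> dist (s m) (s n) < e / (C + 1)"
        using lim LIMSEQ_imp_Cauchy metric_CauchyD by metis
      have "dist (c m b) (c n b) < e" if mn: "m \<ge> M" "n \<ge> M" for m n
      proof -
        have "\<bar>c m b - c n b\<bar> \<le> (\<Sum>b\<in>B. \<bar>c m b - c n b\<bar>)"
          using member_le_sum[of b B "\<lambda>b. \<bar>c m b - c n b\<bar>"] insert(1) b by simp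
        also have "\<dots> \<le> C * norm (\<Sum>b\<in>B. (c m b - c n b) *\<^sub>R b)" by (rule C(2))
        also have "(\<Sum>b\<in>B. (c m b - c n b) *\<^sub>R b) = s m - s n"
          by (simp add: c scaleR_left_diff_distrib sum_subtractf)
        also have "C * norm (s m - s n) \<le> C * (e / (C + 1))"
          using M[OF mn] C(1) by (intro mult_left_mono) (auto simp: dist_norm)
        also have "\<dots> < e" using C(1) \<open>e > 0\<close> by (simp add: field_simps)
        finally show ?thesis by (simp add: dist_real_def)
      qed
      then show "\<exists>M. \<forall>m\<ge>M. \<forall>n\<ge>M. dist (c m b) (c n b) < e" by blast
    qed
    then have "\<forall>b. \<exists>l. b \<in> B \<longrightarrow> (\<lambda>n. c n b) \<longlonglongrightarrow> l"
      using Cauchy_convergent convergent_def by metis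
    then obtain l where l: "\<And>b. b \<in> B \<Longrightarrow> (\<lambda>n. c n b) \<longlonglongrightarrow> l b" by metis
    have "s \<longlonglongrightarrow> (\<Sum>b\<in>B. l b *\<^sub>R b)"
      unfolding c[abs_def] by (intro tendsto_sum tendsto_scaleR tendsto_const l)
    then have "a = (\<Sum>b\<in>B. l b *\<^sub>R b)" using lim LIMSEQ_unique by blast
    moreover have "(\<Sum>b\<in>B. l b *\<^sub>R b) \<in> span B"
      by (intro span_sum span_scale span_base)
    ultimately show False using a by simp
  qed
  then obtain \<delta> where \<delta>: "\<delta> > 0" "\<And>s. s \<in> span B \<Longrightarrow> \<delta> \<le> norm (a - s)" by blast
  \<comment> \<open>The new coordinate is at most \<open>norm x / \<delta>\<close>; what remains of \<open>x\<close> lies in \<open>span B\<close>.\<close>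
  define C' where "C' = 1 / \<delta> + C * (1 + norm a / \<delta>)"
  have "(\<Sum>b\<in>insert a B. \<bar>c b\<bar>) \<le> C' * norm (\<Sum>b\<in>insert a B. c b *\<^sub>R b)" for c
  proof -
    let ?s = "\<Sum>b\<in>B. c b *\<^sub>R b"
    let ?x = "c a *\<^sub>R a + ?s"
    have ca: "\<bar>c a\<bar> \<le> norm ?x / \<delta>"
    proof (cases "c a = 0")
      case True then show ?thesis using \<delta>(1) by simp
    next
      case False
      have "\<delta> \<le> norm (a - (- inverse (c a)) *\<^sub>R ?s)"
        by (rule \<delta>(2)) (intro span_scale span_sum span_base)
      then have "\<bar>c a\<bar> * \<delta> \<le> norm (c a *\<^sub>R (a - (- inverse (c a)) *\<^sub>R ?s))"
        by (simp add: mult_left_mono del: scaleR_minus_left)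
      also have "c a *\<^sub>R (a - (- inverse (c a)) *\<^sub>R ?s) = ?x"
        using False by (simp add: algebra_simps)
      finally show ?thesis using \<delta>(1) by (simp add: field_simps)
    qed
    have "(\<Sum>b\<in>B. \<bar>c b\<bar>) \<le> C * norm ?s" by (rule C(2))
    also have "norm ?s \<le> norm ?x + norm (c a *\<^sub>R a)"
      by (metis add_diff_cancel_left' norm_triangle_ineq4)
    also have "\<dots> \<le> norm ?x + norm ?x / \<delta> * norm a"
      using mult_right_mono[OF ca, of "norm a"] by simp
    finally have "(\<Sum>b\<in>B. \<bar>c b\<bar>) \<le> C * (norm ?x + norm ?x / \<delta> * norm a)"
      using C(1) by (simp add: mult_left_mono)
    with ca have "\<bar>c a\<bar> + (\<Sum>b\<in>B. \<bar>c b\<bar>) \<le> C' * norm ?x"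
      unfolding C'_def by (simp add: algebra_simps)
    then show ?thesis using insert(1,2) by simp
  qed
  moreover have "C' \<ge> 0" using C(1) \<delta>(1) by (simp add: C'_def)
  ultimately show ?case by blast
qed

lemma finite_span_coordinates:
  assumes "finite A" "span A = (UNIV :: 'b::real_normed_vector set)"
  obtains B c where "finite B" "\<And>b. b \<in> B \<Longrightarrow> bounded_linear (c b)"
    "\<And>x::'b. x = (\<Sum>b\<in>B. c b x *\<^sub>R b)"
proof -
  obtain B where B: "B \<subseteq> A" "independent B" "A \<subseteq> span B"
    using maximal_independent_subset by blast
  have fin: "finite B" using B(1) assms(1) finite_subset by blast
  have sp: "x \<in> span B" for x
    using span_minimal[OF B(3) subspace_span] assms(2) by auto
  obtain C where C: "\<And>c. (\<Sum>b\<in>B. \<bar>c b\<bar>) \<le> C * norm (\<Sum>b\<in>B. c b *\<^sub>R b)"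
    using coordinates_le_norm[OF fin B(2)] by blast
  have repr: "x = (\<Sum>b\<in>B. representation B x b *\<^sub>R b)" for x
    using sum_representation_eq[OF B(2) sp fin subset_refl] by simp
  have "bounded_linear (\<lambda>x. representation B x b)" if b: "b \<in> B" for b
  proof (rule bounded_linear_intro[where K = C])
    show "representation B (x + y) b = representation B x b + representation B y b" for x y
      by (simp add: representation_add[OF B(2) sp sp])
    show "representation B (r *\<^sub>R x) b = r *\<^sub>R representation B x b" for r x
      by (simp add: representation_scale[OF B(2) sp])
    show "norm (representation B x b) \<le> norm x * C" for x
    proof -
      have "\<bar>representation B x b\<bar> \<le> (\<Sum>b\<in>B. \<bar>representation B x b\<bar>)"
        using member_le_sum[of b B "\<lambda>b. \<bar>representation B x b\<bar>"] fin b by simp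
      also have "\<dots> \<le> C * norm x" using C[of "representation B x"] repr[of x] by simp
      finally show ?thesis by (simp add: mult.commute)
    qed
  qed
  then show ?thesis by (rule that[OF fin _ repr])
qed

text \<open>
  The derivative of a composition is a sum over the coordinates of the middle space; this is where its
  finite dimension enters.
\<close>

lemma times_diff_compose:
  fixes F :: "'a::real_normed_vector \<Rightarrow> 'b::real_normed_vector"
    and G :: "'b \<Rightarrow> 'c::real_normed_vector"
  assumes "finite A" "span A = (UNIV :: 'b set)" "open S" "open T"
    and "times_diff k S F" "times_diff k T G" "F ` S \<subseteq> T"
  shows "times_diff k S (\<lambda>x. G (F x))"
proof -
  obtain B c where B: "finite B" "\<And>b. b \<in> B \<Longrightarrow> bounded_linear (c b)"
    "\<And>x::'b. x = (\<Sum>b\<in>B. c b x *\<^sub>R b)"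
    using finite_span_coordinates[OF assms(1,2)] by blast
  have der: "((\<lambda>x. G (F x)) has_derivative
      (\<lambda>v. \<Sum>b\<in>B. c b (dir_deriv v F x) *\<^sub>R dir_deriv b G (F x))) (at x)"
    if d: "F differentiable_on S" "G differentiable_on T" and x: "x \<in> S"
    for x and G :: "'b \<Rightarrow> 'c"
  proof -
    have Fx: "F x \<in> T" using x assms(7) by blast
    have G': "(G has_derivative (\<lambda>w. dir_deriv w G (F x))) (at (F x))"
      by (rule has_derivative_dir_deriv[OF d(2) assms(4) Fx])
    then have lin: "linear (\<lambda>w. dir_deriv w G (F x))"
      by (simp add: has_derivative_linear)
    have eq: "(\<lambda>w. dir_deriv w G (F x)) = (\<lambda>w. \<Sum>b\<in>B. c b w *\<^sub>R dir_deriv b G (F x))"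
    proof
      fix w
      have "dir_deriv (\<Sum>b\<in>B. c b w *\<^sub>R b) G (F x) = (\<Sum>b\<in>B. dir_deriv (c b w *\<^sub>R b) G (F x))"
        by (rule linear_sum[OF lin])
      also have "\<dots> = (\<Sum>b\<in>B. c b w *\<^sub>R dir_deriv b G (F x))"
        by (intro sum.cong refl linear_scale[OF lin])
      finally show "dir_deriv w G (F x) = (\<Sum>b\<in>B. c b w *\<^sub>R dir_deriv b G (F x))"
        using B(3)[of w] by simp
    qed
    show ?thesis
      by (rule has_derivative_compose[OF has_derivative_dir_deriv[OF d(1) assms(3) x]
        has_derivative_eq_rhs[OF G' eq]])
  qed
  show ?thesis using assms(5,6)
  proof (induction k arbitrary: G)
    case 0
    then have "(\<lambda>x. G (F x)) differentiable_on S"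
      by (intro differentiable_on_openI[OF assms(3) der]) simp_all
    then show ?case by simp
  next
    case (Suc k)
    have d: "F differentiable_on S" "G differentiable_on T"
      using Suc.prems by auto
    have "times_diff k S (\<lambda>x. \<Sum>b\<in>B. c b (dir_deriv v F x) *\<^sub>R dir_deriv b G (F x))" for v
    proof (intro times_diff_sum assms(3) times_diff_bilinear[OF bounded_bilinear_scaleR])
      fix b assume "b \<in> B"
      then show "times_diff k S (\<lambda>x. c b (dir_deriv v F x))"
        using times_diff_bounded_linear[OF B(2) assms(3)] Suc.prems by simp
      show "times_diff k S (\<lambda>x. dir_deriv b G (F x))"
        using Suc.prems by (intro Suc.IH) (auto intro: times_diff_SucD)
    qed
    then have "times_diff k S (dir_deriv v (\<lambda>x. G (F x)))" for v
      by (intro times_diff_congI[OF assms(3) dir_deriv_eqI[OF der[OF d]]])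
    moreover have "(\<lambda>x. G (F x)) differentiable_on S"
      by (rule differentiable_on_openI[OF assms(3) der[OF d]])
    ultimately show ?case by simp
  qed
qed

lemma smooth_on_cong:
  assumes "open T" "\<And>x. x \<in> T \<Longrightarrow> F x = G x"
  shows "smooth_on T F \<longleftrightarrow> smooth_on T G"
  unfolding smooth_on_iff_times_diff using times_diff_cong[OF assms] by simp

lemma smooth_on_const: "smooth_on T (\<lambda>_. c)"
  by (simp add: smooth_on_iff_times_diff times_diff_const)

lemma smooth_on_bounded_linear:
  "\<lbrakk>bounded_linear L; open T; smooth_on T F\<rbrakk> \<Longrightarrow> smooth_on T (\<lambda>x. L (F x))"
  by (simp add: smooth_on_iff_times_diff times_diff_bounded_linear)

lemma smooth_on_add:
  "\<lbrakk>open T; smooth_on T F; smooth_on T G\<rbrakk> \<Longrightarrow> smooth_on T (\<lambda>x. F x + G x)"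
  by (simp add: smooth_on_iff_times_diff times_diff_add)

lemma smooth_on_bilinear:
  assumes "bounded_bilinear B" "open T" "smooth_on T F" "smooth_on T G"
  shows "smooth_on T (\<lambda>x. B (F x) (G x))"
  unfolding smooth_on_iff_times_diff
proof
  fix k
  have "times_diff k T F" "times_diff k T G"
    using assms(3,4) smooth_on_iff_times_diff by blast+
  then show "times_diff k T (\<lambda>x. B (F x) (G x))"
    by (rule times_diff_bilinear[OF assms(1,2)])
qed

lemma smooth_on_compose:
  fixes F :: "'a::real_normed_vector \<Rightarrow> 'b::real_normed_vector"
  assumes "finite A" "span A = (UNIV :: 'b set)" "open S" "open T"
    and "smooth_on S F" "smooth_on T G" "F ` S \<subseteq> T"
  shows "smooth_on S (\<lambda>x. G (F x))"
  unfolding smooth_on_iff_times_diff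
proof
  fix k
  have "times_diff k S F" "times_diff k T G"
    using assms(5,6) smooth_on_iff_times_diff by blast+
  then show "times_diff k S (\<lambda>x. G (F x))"
    by (rule times_diff_compose[OF assms(1-4) _ _ assms(7)])
qed

lemma smooth_on_dir_deriv: "smooth_on T F \<Longrightarrow> smooth_on T (dir_deriv v F)"
  unfolding smooth_on_iff_times_diff by (meson times_diff.simps(2))

lemma smooth_on_foldr_dir_deriv: "smooth_on T F \<Longrightarrow> smooth_on T (foldr dir_deriv vs F)"
  by (induction vs) (auto simp: smooth_on_dir_deriv)

lemma smooth_on_imp_differentiable: "smooth_on T F \<Longrightarrow> F differentiable_on T"
  unfolding smooth_on_iff_times_diff by (meson times_diff.simps(1))

lemma smooth_on_local:
  assumes "\<And>x. x \<in> T \<Longrightarrow> \<exists>S. open S \<and> x \<in> S \<and> smooth_on S F"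
  shows "smooth_on T F"
  unfolding smooth_on_def
proof (intro allI)
  fix vs
  show "foldr dir_deriv vs F differentiable_on T"
    unfolding differentiable_on_def
  proof
    fix x assume "x \<in> T"
    then obtain S where "open S" "x \<in> S" "foldr dir_deriv vs F differentiable_on S"
      using assms smooth_on_def by blast
    then have "foldr dir_deriv vs F differentiable (at x)"
      unfolding differentiable_on_def using at_within_open[of x S] by metis
    then show "foldr dir_deriv vs F differentiable (at x within T)"
      by (rule differentiable_at_withinI)
  qed
qed

lemma foldr_dir_deriv_cong:
  assumes "open T" "\<And>y. y \<in> T \<Longrightarrow> F y = G y" "x \<in> T"
  shows "foldr dir_deriv vs F x = foldr dir_deriv vs G x"
  using assms(3)
proof (induction vs arbitrary: x)
  case Nil then show ?case using assms(2) by simp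
next
  case (Cons v vs)
  then show ?case by (auto intro: dir_deriv_cong[OF assms(1)])
qed

lemma foldr_dir_deriv_add:
  assumes "open T" "smooth_on T F" "smooth_on T G" "x \<in> T"
  shows "foldr dir_deriv vs (\<lambda>x. F x + G x) x = foldr dir_deriv vs F x + foldr dir_deriv vs G x"
  using assms(4)
proof (induction vs arbitrary: x)
  case (Cons v vs)
  have "dir_deriv v (foldr dir_deriv vs (\<lambda>x. F x + G x)) x
      = dir_deriv v (\<lambda>x. foldr dir_deriv vs F x + foldr dir_deriv vs G x) x"
    by (rule dir_deriv_cong[OF assms(1)]) (use Cons in auto)
  also have "\<dots> = dir_deriv v (foldr dir_deriv vs F) x + dir_deriv v (foldr dir_deriv vs G) x"
    by (rule dir_deriv_add[OF _ _ assms(1) Cons.prems])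
      (intro smooth_on_imp_differentiable smooth_on_foldr_dir_deriv assms)+
  finally show ?case by simp
qed simp

lemma foldr_dir_deriv_bounded_linear:
  assumes "bounded_linear L" "open T" "smooth_on T F" "x \<in> T"
  shows "foldr dir_deriv vs (\<lambda>x. L (F x)) x = L (foldr dir_deriv vs F x)"
  using assms(4)
proof (induction vs arbitrary: x)
  case (Cons v vs)
  have "dir_deriv v (foldr dir_deriv vs (\<lambda>x. L (F x))) x = dir_deriv v (\<lambda>x. L (foldr dir_deriv vs F x)) x"
    by (rule dir_deriv_cong[OF assms(2)]) (use Cons in auto)
  also have "\<dots> = L (dir_deriv v (foldr dir_deriv vs F) x)"
    by (rule dir_deriv_eqI, rule bounded_linear.has_derivative[OF assms(1) has_derivative_dir_deriv])
      (use assms Cons.prems in \<open>auto intro: smooth_on_imp_differentiable smooth_on_foldr_dir_deriv\<close>)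
  finally show ?case by simp
qed simp

section \<open>Charts, smooth maps and translations on a Lie group\<close>

text \<open>
  The part of an atlas that composition of smooth maps refers to. It passes to products by topology and
  linear algebra alone.
\<close>

definition chart_cover :: "('m::topological_space, 'e::real_normed_vector) atlas \<Rightarrow> bool" where
  "chart_cover A \<longleftrightarrow>
     (\<exists>B::'e set. finite B \<and> span B = UNIV) \<and>
     (\<forall>(U, \<phi>)\<in>A. open U \<and> open (\<phi> ` U) \<and> homeomorphism U (\<phi> ` U) \<phi> (inv_into U \<phi>)) \<and>
     (\<Union>(U, \<phi>)\<in>A. U) = UNIV"

lemma smooth_atlas_imp_chart_cover: "smooth_atlas A \<Longrightarrow> chart_cover A"
  by (simp add: smooth_atlas_def chart_cover_def)

lemma chart_coverD:
  assumes "chart_cover A" "(U, \<phi>) \<in> A"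
  shows "open U" "open (\<phi> ` U)" "homeomorphism U (\<phi> ` U) \<phi> (inv_into U \<phi>)" "inj_on \<phi> U"
proof -
  show "open U" "open (\<phi> ` U)" and h: "homeomorphism U (\<phi> ` U) \<phi> (inv_into U \<phi>)"
    using assms by (auto simp: chart_cover_def)
  show "inj_on \<phi> U"
    using homeomorphism_apply1[OF h] by (rule inj_on_inverseI)
qed

lemma chart_cover_obtain:
  assumes "chart_cover A"
  obtains U \<phi> where "(U, \<phi>) \<in> A" "p \<in> U"
proof -
  have "p \<in> (\<Union>(U, \<phi>)\<in>A. U)" using assms by (simp add: chart_cover_def)
  then show ?thesis using that by blast
qed

lemma open_chart_image:
  assumes "chart_cover A" "(U, \<phi>) \<in> A" "open W" "W \<subseteq> U"
  shows "open (\<phi> ` W)"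
proof -
  note c = chart_coverD[OF assms(1,2)]
  have "openin (top_of_set U) W"
    using assms(3,4) open_subset by blast
  then have "openin (top_of_set (\<phi> ` U)) (\<phi> ` W)"
    by (rule homeomorphism_imp_open_map[OF c(3)])
  then show ?thesis
    using c(2) openin_open_trans by blast
qed

text \<open>
  Smoothness is local, and near a point \<open>F\<close> maps into one chart domain of \<open>B\<close>, where the composition is one of
  maps between open sets of the model spaces.
\<close>

lemma smooth_fun_compose:
  fixes A :: "('m::topological_space, 'e::real_normed_vector) atlas"
    and B :: "('n::topological_space, 'd::real_normed_vector) atlas"
    and f :: "'n \<Rightarrow> 'b::real_normed_vector"
  assumes "chart_cover A" "chart_cover B" "smooth_map A B F" "smooth_fun B f"
  shows "smooth_fun A (\<lambda>p. f (F p))"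
  unfolding smooth_fun_def
proof clarify
  fix U \<phi> assume U: "(U, \<phi>) \<in> A"
  obtain C :: "'d set" where C: "finite C" "span C = UNIV"
    using assms(2) by (auto simp: chart_cover_def)
  show "smooth_on (\<phi> ` U) ((\<lambda>p. f (F p)) \<circ> inv_into U \<phi>)"
  proof (rule smooth_on_local)
    fix x assume "x \<in> \<phi> ` U"
    then obtain p where p: "p \<in> U" "x = \<phi> p" by blast
    obtain V \<psi> where V: "(V, \<psi>) \<in> B" "F p \<in> V"
      by (rule chart_cover_obtain[OF assms(2)])
    let ?W = "U \<inter> F -` V"
    have "open (F -` V)"
      using assms(3) chart_coverD(1)[OF assms(2) V(1)] by (auto simp: smooth_map_def continuous_on_open_vimage)
    then have op: "open (\<phi> ` ?W)"
      using chart_coverD(1)[OF assms(1) U] by (intro open_chart_image[OF assms(1) U]) auto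
    have inv: "inv_into U \<phi> (\<phi> q) = q" if "q \<in> U" for q
      using chart_coverD(4)[OF assms(1) U] that by simp
    have inv': "inv_into V \<psi> (\<psi> q) = q" if "q \<in> V" for q
      using chart_coverD(4)[OF assms(2) V(1)] that by simp
    have sm: "smooth_on (\<phi> ` ?W) (\<psi> \<circ> F \<circ> inv_into U \<phi>)"
      using assms(3) U V(1) by (auto simp: smooth_map_def)
    have "smooth_on (\<psi> ` V) (f \<circ> inv_into V \<psi>)"
      using assms(4) V(1) by (auto simp: smooth_fun_def)
    then have "smooth_on (\<phi> ` ?W) (\<lambda>x. (f \<circ> inv_into V \<psi>) ((\<psi> \<circ> F \<circ> inv_into U \<phi>) x))"
      by (rule smooth_on_compose[OF C op chart_coverD(2)[OF assms(2) V(1)] sm]) (auto simp: inv)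
    then have "smooth_on (\<phi> ` ?W) ((\<lambda>p. f (F p)) \<circ> inv_into U \<phi>)"
      by (subst smooth_on_cong[OF op, where G = "\<lambda>x. (f \<circ> inv_into V \<psi>) ((\<psi> \<circ> F \<circ> inv_into U \<phi>) x)"])
        (auto simp: inv inv')
    moreover have "x \<in> \<phi> ` ?W" using p V(2) by blast
    ultimately show "\<exists>S. open S \<and> x \<in> S \<and> smooth_on S ((\<lambda>p. f (F p)) \<circ> inv_into U \<phi>)"
      using op by blast
  qed
qed

lemma inv_into_map_prod:
  assumes "inj_on \<phi> U" "inj_on \<psi> V" "p \<in> U" "q \<in> V"
  shows "inv_into (U \<times> V) (map_prod \<phi> \<psi>) (\<phi> p, \<psi> q) = (p, q)"
proof -
  have "inj_on (map_prod \<phi> \<psi>) (U \<times> V)" by (rule map_prod_inj_on[OF assms(1,2)])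
  then have "inv_into (U \<times> V) (map_prod \<phi> \<psi>) (map_prod \<phi> \<psi> (p, q)) = (p, q)"
    using assms(3,4) by (intro inv_into_f_f) auto
  then show ?thesis by simp
qed

lemma chart_cover_prod_atlas:
  fixes A :: "('m::topological_space, 'e::real_normed_vector) atlas"
    and B :: "('n::topological_space, 'd::real_normed_vector) atlas"
  assumes "chart_cover A" "chart_cover B"
  shows "chart_cover (prod_atlas A B)"
  unfolding chart_cover_def
proof (intro conjI)
  obtain S :: "'e set" where S: "finite S" "span S = UNIV"
    using assms(1) by (auto simp: chart_cover_def)
  obtain T :: "'d set" where T: "finite T" "span T = UNIV"
    using assms(2) by (auto simp: chart_cover_def)
  let ?R = "(\<lambda>x. (x, 0)) ` S \<union> (\<lambda>y. (0, y)) ` T :: ('e \<times> 'd) set"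
  have l1: "linear (\<lambda>x::'e. (x, 0::'d))" and l2: "linear (\<lambda>y::'d. (0::'e, y))"
    by (auto simp: linear_iff)
  have "(x, y) \<in> span ?R" for x y
  proof -
    have "(x, 0::'d) \<in> span ((\<lambda>x. (x, 0)) ` S)"
      by (simp add: linear_span_image[OF l1] S(2))
    moreover have "(0::'e, y) \<in> span ((\<lambda>y. (0, y)) ` T)"
      by (simp add: linear_span_image[OF l2] T(2))
    ultimately have "(x, 0) \<in> span ?R" "(0, y) \<in> span ?R"
      using span_mono[of "(\<lambda>x. (x, 0)) ` S" ?R] span_mono[of "(\<lambda>y. (0, y)) ` T" ?R] by blast+
    then have "(x, 0) + (0, y) \<in> span ?R"
      by (rule span_add)
    then show ?thesis by simp
  qed
  then have "span ?R = UNIV" by auto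
  moreover have "finite ?R" using S T by simp
  ultimately show "\<exists>B::('e \<times> 'd) set. finite B \<and> span B = UNIV" by blast
  show "(\<Union>(U, \<phi>)\<in>prod_atlas A B. U) = UNIV"
  proof -
    have "p \<in> (\<Union>(U, \<phi>)\<in>prod_atlas A B. U)" for p :: "'m \<times> 'n"
    proof -
      obtain U \<phi> where 1: "(U, \<phi>) \<in> A" "fst p \<in> U" by (rule chart_cover_obtain[OF assms(1)])
      obtain V \<psi> where 2: "(V, \<psi>) \<in> B" "snd p \<in> V" by (rule chart_cover_obtain[OF assms(2)])
      have "(U \<times> V, map_prod \<phi> \<psi>) \<in> prod_atlas A B" using 1 2 by (auto simp: prod_atlas_def)
      moreover have "p \<in> U \<times> V" using 1 2 by (cases p) auto
      ultimately show ?thesis by blast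
    qed
    then show ?thesis by blast
  qed
  show "\<forall>(U, \<phi>)\<in>prod_atlas A B. open U \<and> open (\<phi> ` U) \<and> homeomorphism U (\<phi> ` U) \<phi> (inv_into U \<phi>)"
  proof clarify
    fix W \<kappa> assume "(W, \<kappa>) \<in> prod_atlas A B"
    then obtain U \<phi> V \<psi> where W: "W = U \<times> V" "\<kappa> = map_prod \<phi> \<psi>" "(U, \<phi>) \<in> A" "(V, \<psi>) \<in> B"
      by (auto simp: prod_atlas_def)
    note c = chart_coverD[OF assms(1) W(3)] chart_coverD[OF assms(2) W(4)]
    have im: "\<kappa> ` W = \<phi> ` U \<times> \<psi> ` V" using W by (auto simp: image_iff)
    have cont: "continuous_on (U \<times> V) (map_prod \<phi> \<psi>)"
    proof -
      have "continuous_on (U \<times> V) (\<lambda>z. (\<phi> (fst z), \<psi> (snd z)))"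
        by (rule continuous_on_Pair[OF
            continuous_on_compose2[OF homeomorphism_cont1[OF c(3)] continuous_on_fst[OF continuous_on_id]]
            continuous_on_compose2[OF homeomorphism_cont1[OF c(7)] continuous_on_snd[OF continuous_on_id]]]) auto
      then show ?thesis by (simp add: map_prod_def case_prod_beta)
    qed
    have "continuous_on (\<phi> ` U \<times> \<psi> ` V) (\<lambda>z. (inv_into U \<phi> (fst z), inv_into V \<psi> (snd z)))"
      by (rule continuous_on_Pair[OF
          continuous_on_compose2[OF homeomorphism_cont2[OF c(3)] continuous_on_fst[OF continuous_on_id]]
          continuous_on_compose2[OF homeomorphism_cont2[OF c(7)] continuous_on_snd[OF continuous_on_id]]]) auto
    then have cont': "continuous_on (\<phi> ` U \<times> \<psi> ` V) (inv_into (U \<times> V) (map_prod \<phi> \<psi>))"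
      by (subst continuous_on_cong[OF refl, where g = "\<lambda>z. (inv_into U \<phi> (fst z), inv_into V \<psi> (snd z))"])
        (auto simp: inv_into_map_prod c)
    have "homeomorphism W (\<kappa> ` W) \<kappa> (inv_into W \<kappa>)"
      unfolding homeomorphism_def
    proof (intro conjI)
      show "continuous_on W \<kappa>" "continuous_on (\<kappa> ` W) (inv_into W \<kappa>)"
        using cont cont' W im by simp_all
      have inj: "inj_on \<kappa> W" using W c by (simp add: map_prod_inj_on)
      show "\<forall>x\<in>W. inv_into W \<kappa> (\<kappa> x) = x" "\<forall>y\<in>\<kappa> ` W. \<kappa> (inv_into W \<kappa> y) = y"
        using inj by (auto simp: f_inv_into_f)
      show "inv_into W \<kappa> ` \<kappa> ` W = W" using inj by (simp add: inv_into_image_cancel)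
    qed simp
    then show "open W \<and> open (\<kappa> ` W) \<and> homeomorphism W (\<kappa> ` W) \<kappa> (inv_into W \<kappa>)"
      using c W(1) im by (auto simp: open_Times)
  qed
qed

text \<open>
  In product charts a slice is a transition map of one factor plus a constant vector.
\<close>

lemma smooth_map_slice:
  fixes A :: "('m::{t2_space, second_countable_topology}, 'e::real_normed_vector) atlas"
    and B :: "('n::{t2_space, second_countable_topology}, 'd::real_normed_vector) atlas"
  shows "smooth_atlas A \<Longrightarrow> smooth_map A (prod_atlas A B) (\<lambda>a. (a, p))"
    and "smooth_atlas B \<Longrightarrow> smooth_map B (prod_atlas A B) (\<lambda>b. (c, b))"
proof -
  have l1: "bounded_linear (\<lambda>x::'e. (x, 0::'d))"
    by (intro bounded_linear_Pair bounded_linear_ident bounded_linear_zero)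
  assume A: "smooth_atlas A"
  note cA = smooth_atlas_imp_chart_cover[OF A]
  show "smooth_map A (prod_atlas A B) (\<lambda>a. (a, p))"
    unfolding smooth_map_def
  proof (intro conjI, goal_cases)
    case 1
    show ?case by (intro continuous_intros)
  next
    case 2
    show ?case
    proof clarify
      fix U \<phi> T \<tau> assume U: "(U, \<phi>) \<in> A" and "(T, \<tau>) \<in> prod_atlas A B"
      then obtain V \<psi> W \<kappa> where w: "T = V \<times> W" "\<tau> = map_prod \<psi> \<kappa>" "(V, \<psi>) \<in> A"
        by (auto simp: prod_atlas_def)
      have op: "open (\<phi> ` (U \<inter> V))"
        using chart_coverD(1)[OF cA U] chart_coverD(1)[OF cA w(3)]
        by (intro open_chart_image[OF cA U]) auto
      have "smooth_on (\<phi> ` (U \<inter> V)) (\<psi> \<circ> inv_into U \<phi>)"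
        using A U w(3) by (auto simp: smooth_atlas_def)
      then have "smooth_on (\<phi> ` (U \<inter> V)) (\<lambda>x. ((\<psi> \<circ> inv_into U \<phi>) x, 0) + (0, \<kappa> p))"
        by (intro smooth_on_add[OF op] smooth_on_bounded_linear[OF l1 op] smooth_on_const)
      moreover have "\<tau> \<circ> (\<lambda>a. (a, p)) \<circ> inv_into U \<phi> = (\<lambda>x. ((\<psi> \<circ> inv_into U \<phi>) x, 0) + (0, \<kappa> p))"
        by (simp add: fun_eq_iff w(2))
      ultimately have *: "smooth_on (\<phi> ` (U \<inter> V)) (\<tau> \<circ> (\<lambda>a. (a, p)) \<circ> inv_into U \<phi>)"
        by simp
      have "U \<inter> (\<lambda>a. (a, p)) -` T = (if p \<in> W then U \<inter> V else {})" using w(1) by auto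
      then show "smooth_on (\<phi> ` (U \<inter> (\<lambda>a. (a, p)) -` T)) (\<tau> \<circ> (\<lambda>a. (a, p)) \<circ> inv_into U \<phi>)"
        using * by (auto simp: smooth_on_def differentiable_on_def)
    qed
  qed
next
  have l2: "bounded_linear (\<lambda>y::'d. (0::'e, y))"
    by (intro bounded_linear_Pair bounded_linear_ident bounded_linear_zero)
  assume B: "smooth_atlas B"
  note cB = smooth_atlas_imp_chart_cover[OF B]
  show "smooth_map B (prod_atlas A B) (\<lambda>b. (c, b))"
    unfolding smooth_map_def
  proof (intro conjI, goal_cases)
    case 1
    show ?case by (intro continuous_intros)
  next
    case 2
    show ?case
    proof clarify
      fix U \<phi> T \<tau> assume U: "(U, \<phi>) \<in> B" and "(T, \<tau>) \<in> prod_atlas A B"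
      then obtain V \<psi> W \<kappa> where w: "T = V \<times> W" "\<tau> = map_prod \<psi> \<kappa>" "(W, \<kappa>) \<in> B"
        by (auto simp: prod_atlas_def)
      have op: "open (\<phi> ` (U \<inter> W))"
        using chart_coverD(1)[OF cB U] chart_coverD(1)[OF cB w(3)]
        by (intro open_chart_image[OF cB U]) auto
      have "smooth_on (\<phi> ` (U \<inter> W)) (\<kappa> \<circ> inv_into U \<phi>)"
        using B U w(3) by (auto simp: smooth_atlas_def)
      then have "smooth_on (\<phi> ` (U \<inter> W)) (\<lambda>x. (0, (\<kappa> \<circ> inv_into U \<phi>) x) + (\<psi> c, 0))"
        by (intro smooth_on_add[OF op] smooth_on_bounded_linear[OF l2 op] smooth_on_const)
      moreover have "\<tau> \<circ> (\<lambda>b. (c, b)) \<circ> inv_into U \<phi> = (\<lambda>x. (0, (\<kappa> \<circ> inv_into U \<phi>) x) + (\<psi> c, 0))"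
        by (simp add: fun_eq_iff w(2))
      ultimately have *: "smooth_on (\<phi> ` (U \<inter> W)) (\<tau> \<circ> (\<lambda>b. (c, b)) \<circ> inv_into U \<phi>)"
        by simp
      have "U \<inter> (\<lambda>b. (c, b)) -` T = (if c \<in> V then U \<inter> W else {})" using w(1) by auto
      then show "smooth_on (\<phi> ` (U \<inter> (\<lambda>b. (c, b)) -` T)) (\<tau> \<circ> (\<lambda>b. (c, b)) \<circ> inv_into U \<phi>)"
        using * by (auto simp: smooth_on_def differentiable_on_def)
    qed
  qed
qed

lemma smooth_fun_add:
  assumes "chart_cover A" "smooth_fun A f" "smooth_fun A g"
  shows "smooth_fun A (\<lambda>p. f p + g p)"
  unfolding smooth_fun_def
proof clarify
  fix U \<phi> assume U: "(U, \<phi>) \<in> A"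
  then have "smooth_on (\<phi> ` U) (f \<circ> inv_into U \<phi>)" "smooth_on (\<phi> ` U) (g \<circ> inv_into U \<phi>)"
    using assms(2,3) by (auto simp: smooth_fun_def)
  then have "smooth_on (\<phi> ` U) (\<lambda>x. (f \<circ> inv_into U \<phi>) x + (g \<circ> inv_into U \<phi>) x)"
    by (rule smooth_on_add[OF chart_coverD(2)[OF assms(1) U]])
  then show "smooth_on (\<phi> ` U) ((\<lambda>p. f p + g p) \<circ> inv_into U \<phi>)" by (simp add: comp_def)
qed

lemma smooth_fun_bilinear:
  assumes "bounded_bilinear B" "chart_cover A" "smooth_fun A f" "smooth_fun A g"
  shows "smooth_fun A (\<lambda>p. B (f p) (g p))"
  unfolding smooth_fun_def
proof clarify
  fix U \<phi> assume U: "(U, \<phi>) \<in> A"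
  then have "smooth_on (\<phi> ` U) (f \<circ> inv_into U \<phi>)" "smooth_on (\<phi> ` U) (g \<circ> inv_into U \<phi>)"
    using assms(3,4) by (auto simp: smooth_fun_def)
  then have "smooth_on (\<phi> ` U) (\<lambda>x. B ((f \<circ> inv_into U \<phi>) x) ((g \<circ> inv_into U \<phi>) x))"
    by (rule smooth_on_bilinear[OF assms(1) chart_coverD(2)[OF assms(2) U]])
  then show "smooth_on (\<phi> ` U) ((\<lambda>p. B (f p) (g p)) \<circ> inv_into U \<phi>)" by (simp add: comp_def)
qed

lemma smooth_fun_bounded_linear:
  assumes "bounded_linear L" "chart_cover A" "smooth_fun A f"
  shows "smooth_fun A (\<lambda>p. L (f p))"
  unfolding smooth_fun_def
proof clarify
  fix U \<phi> assume U: "(U, \<phi>) \<in> A"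
  then have "smooth_on (\<phi> ` U) (f \<circ> inv_into U \<phi>)"
    using assms(3) by (auto simp: smooth_fun_def)
  then have "smooth_on (\<phi> ` U) (\<lambda>x. L ((f \<circ> inv_into U \<phi>) x))"
    by (rule smooth_on_bounded_linear[OF assms(1) chart_coverD(2)[OF assms(2) U]])
  then show "smooth_on (\<phi> ` U) ((\<lambda>p. L (f p)) \<circ> inv_into U \<phi>)" by (simp add: comp_def)
qed

lemma smooth_fun_const: "smooth_fun A (\<lambda>_. c)"
  by (auto simp: smooth_fun_def comp_def smooth_on_const)

lemma tangentD:
  assumes "v \<in> tangent A p"
  shows "smooth_fun A f \<Longrightarrow> smooth_fun A g \<Longrightarrow> v (f + g) = v f + v g"
    and "smooth_fun A f \<Longrightarrow> smooth_fun A g \<Longrightarrow> v (f * g) = v f * g p + f p * v g"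
    and "\<not> smooth_fun A f \<Longrightarrow> v f = 0"
  using assms by (auto simp: tangent_def)

lemma tangent_zero:
  assumes "v \<in> tangent A p"
  shows "v (\<lambda>_. 0) = 0"
proof -
  have "v (\<lambda>q. 0 * (\<lambda>_. 0) q) = 0 * v (\<lambda>_. 0)"
    using assms smooth_fun_const unfolding tangent_def by blast
  then show ?thesis by simp
qed

text \<open>
  A tangent vector is linear on smooth functions by definition and vanishes on all others; scaling by a nonzero
  constant preserves both kinds.
\<close>

lemma tangent_scale:
  assumes "v \<in> tangent A p" "chart_cover A"
  shows "v (\<lambda>q. c * f q) = c * v f"
proof (cases "smooth_fun A f \<or> c = 0")
  case True
  then show ?thesis using assms(1) tangent_zero[OF assms(1)] by (auto simp: tangent_def)
next
  case False
  have "smooth_fun A f" if "smooth_fun A (\<lambda>q. c * f q)"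
    using smooth_fun_bounded_linear[OF bounded_linear_mult_right[of "1 / c"] assms(2) that] False by simp
  then show ?thesis using False tangentD(3)[OF assms(1)] by auto
qed

text \<open>
  Leibniz for \<open>1 = 1 * 1\<close> at a point gives \<open>v 1 = 2 v 1\<close>.
\<close>

lemma tangent_const:
  assumes "v \<in> tangent A p" "chart_cover A"
  shows "v (\<lambda>_. c) = 0"
proof -
  have "v ((\<lambda>_. 1) * (\<lambda>_. 1)) = v (\<lambda>_. 1) * 1 + 1 * v (\<lambda>_. 1)"
    by (rule tangentD(2)[OF assms(1) smooth_fun_const smooth_fun_const])
  then have "v (\<lambda>_. 1) = 0" by (simp add: times_fun_def)
  then show ?thesis using tangent_scale[OF assms, of c "\<lambda>_. 1"] by simp
qed

lemma tangent_closed: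
  shows "v \<in> tangent A p \<Longrightarrow> w \<in> tangent A p \<Longrightarrow> v + w \<in> tangent A p"
    and "v \<in> tangent A p \<Longrightarrow> (\<lambda>f. c * v f) \<in> tangent A p"
    and "(\<lambda>_. 0) \<in> tangent A p"
  by (auto simp: tangent_def algebra_simps)

text \<open>
  The derivative at \<open>a\<close> in a chart, transported to the unit by left translation, is a tangent vector \<open>X\<close>
  at the unit with \<open>X (\<lambda>b. \<phi> (a b))\<close> equal to the derivative of \<open>\<phi>\<close>. Hence all derivatives vanish, and
  \<open>\<phi>\<close> is locally constant on a connected space.
\<close>

lemma connected_lie_group_constant:
  fixes A :: "('g::{t2_space, second_countable_topology}, 'd::real_normed_vector) atlas"
    and \<phi> :: "'g \<Rightarrow> real"
  assumes G: "lie_group A G" and conn: "connected (UNIV :: 'g set)"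
    and smooth: "smooth_fun A \<phi>"
    and zero: "\<And>X a. X \<in> tangent A \<one>\<^bsub>G\<^esub> \<Longrightarrow> X (\<lambda>b. \<phi> (a \<otimes>\<^bsub>G\<^esub> b)) = 0"
  shows "\<phi> a = \<phi> b"
proof -
  interpret group G using G by (simp add: lie_group_def)
  have UN: "x \<in> carrier G" for x using G by (simp add: lie_group_def)
  have A: "smooth_atlas A" using G by (simp add: lie_group_def)
  note cA = smooth_atlas_imp_chart_cover[OF A]
  have tr: "smooth_fun A (\<lambda>b. f (c \<otimes>\<^bsub>G\<^esub> b))" if "smooth_fun A f" for f :: "'g \<Rightarrow> real" and c
  proof -
    have "smooth_map (prod_atlas A A) A (\<lambda>(a, b). a \<otimes>\<^bsub>G\<^esub> b)" using G by (simp add: lie_group_def)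
    from smooth_fun_compose[OF chart_cover_prod_atlas[OF cA cA] cA this that]
    have "smooth_fun (prod_atlas A A) (\<lambda>p. f (case p of (a, b) \<Rightarrow> a \<otimes>\<^bsub>G\<^esub> b))" .
    from smooth_fun_compose[OF cA chart_cover_prod_atlas[OF cA cA] smooth_map_slice(2)[OF A] this]
    show ?thesis by simp
  qed
  have loc: "\<exists>T. open T \<and> c \<in> T \<and> (\<forall>y\<in>T. \<phi> y = \<phi> c)" for c
  proof -
    obtain U \<psi> where U: "(U, \<psi>) \<in> A" "c \<in> U" by (rule chart_cover_obtain[OF cA])
    note ch = chart_coverD[OF cA U(1)]
    have inv: "inv_into U \<psi> (\<psi> q) = q" if "q \<in> U" for q using ch(4) that by simp
    let ?F = "\<phi> \<circ> inv_into U \<psi>"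
    have sm: "smooth_on (\<psi> ` U) (f \<circ> inv_into U \<psi>)" if "smooth_fun A f" for f :: "'g \<Rightarrow> real"
      using that U(1) by (auto simp: smooth_fun_def)
    have der0: "dir_deriv u ?F x = 0" if x: "x \<in> \<psi> ` U" for x u
    proof -
      obtain a where a: "a \<in> U" "x = \<psi> a" using x by blast
      let ?t = "\<lambda>f::'g \<Rightarrow> real. (\<lambda>b. f (inv\<^bsub>G\<^esub> a \<otimes>\<^bsub>G\<^esub> b)) \<circ> inv_into U \<psi>"
      \<comment> \<open>Tangent vectors vanish on functions that are not smooth, by convention.\<close>
      define X where "X f = (if smooth_fun A f then dir_deriv u (?t f) x else 0)" for f :: "'g \<Rightarrow> real"
      have d: "?t f differentiable_on \<psi> ` U" if "smooth_fun A f" for f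
        using smooth_on_imp_differentiable[OF sm[OF tr[OF that]]] .
      have tx: "?t f x = f \<one>\<^bsub>G\<^esub>" for f using a UN by (simp add: inv)
      have "X \<in> tangent A \<one>\<^bsub>G\<^esub>"
        unfolding tangent_def
      proof (intro CollectI conjI allI impI)
        fix f g :: "'g \<Rightarrow> real" assume f: "smooth_fun A f" and g: "smooth_fun A g"
        have "smooth_fun A (f + g)" using smooth_fun_add[OF cA f g] by (simp add: plus_fun_def)
        moreover have "?t (f + g) = (\<lambda>y. ?t f y + ?t g y)" by (simp add: fun_eq_iff)
        ultimately show "X (f + g) = X f + X g"
          using dir_deriv_add[OF d[OF f] d[OF g] ch(2) x, of u] f g by (simp add: X_def)
        have "smooth_fun A (f * g)"
          using smooth_fun_bilinear[OF bounded_bilinear_mult cA f g] by (simp add: times_fun_def)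
        moreover have "?t (f * g) = (\<lambda>y. ?t f y * ?t g y)" by (simp add: fun_eq_iff)
        moreover have "dir_deriv u (\<lambda>y. ?t f y * ?t g y) x
            = ?t f x * dir_deriv u (?t g) x + dir_deriv u (?t f) x * ?t g x"
          by (rule dir_deriv_eqI[OF has_derivative_bilinear[OF bounded_bilinear_mult ch(2) d[OF f] d[OF g] x]])
        ultimately show "X (f * g) = X f * g \<one>\<^bsub>G\<^esub> + f \<one>\<^bsub>G\<^esub> * X g"
          using f g tx[of f] tx[of g] by (simp add: X_def)
      next
        fix c :: real and f :: "'g \<Rightarrow> real" assume f: "smooth_fun A f"
        have "smooth_fun A (\<lambda>q. c * f q)"
          by (rule smooth_fun_bounded_linear[OF bounded_linear_mult_right cA f])
        moreover have "dir_deriv u (\<lambda>y. c * ?t f y) x = c * dir_deriv u (?t f) x"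
          by (rule dir_deriv_eqI, rule bounded_linear.has_derivative[OF bounded_linear_mult_right],
              rule has_derivative_dir_deriv[OF d[OF f] ch(2) x])
        moreover have "?t (\<lambda>q. c * f q) = (\<lambda>y. c * ?t f y)" by (simp add: fun_eq_iff)
        ultimately show "X (\<lambda>q. c * f q) = c * X f" using f by (simp add: X_def)
      qed (simp add: X_def)
      then have "X (\<lambda>b. \<phi> (a \<otimes>\<^bsub>G\<^esub> b)) = 0" by (rule zero)
      moreover have "?t (\<lambda>b. \<phi> (a \<otimes>\<^bsub>G\<^esub> b)) = ?F"
        using UN by (simp add: fun_eq_iff m_assoc[symmetric])
      ultimately show ?thesis using tr[OF smooth, of a] by (simp add: X_def)
    qed
    have dF: "(?F has_derivative (\<lambda>_. 0)) (at x)" if "x \<in> \<psi> ` U" for x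
      using has_derivative_dir_deriv[OF smooth_on_imp_differentiable[OF sm[OF smooth]] ch(2) that] der0[OF that]
      by simp
    obtain e where e: "e > 0" "ball (\<psi> c) e \<subseteq> \<psi> ` U"
      using ch(2) U(2) open_contains_ball by blast
    have const: "?F y = ?F (\<psi> c)" if y: "y \<in> ball (\<psi> c) e" for y
    proof -
      have "\<exists>k. \<forall>x\<in>ball (\<psi> c) e. ?F x = k"
      proof (rule has_derivative_zero_constant[OF convex_ball])
        fix x assume "x \<in> ball (\<psi> c) e"
        then have "x \<in> \<psi> ` U" using e(2) by blast
        then show "(?F has_derivative (\<lambda>_. 0)) (at x within ball (\<psi> c) e)"
          by (rule has_derivative_at_withinI[OF dF])
      qed
      then obtain k where k: "\<And>x. x \<in> ball (\<psi> c) e \<Longrightarrow> ?F x = k" by blast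
      have "\<psi> c \<in> ball (\<psi> c) e" using e(1) by simp
      then show ?thesis by (simp only: k y)
    qed
    let ?T = "U \<inter> \<psi> -` ball (\<psi> c) e"
    have "open ?T"
      using continuous_open_preimage[OF homeomorphism_cont1[OF ch(3)] ch(1) open_ball] by simp
    moreover have "c \<in> ?T" using U(2) e(1) by simp
    moreover have "\<phi> y = \<phi> c" if "y \<in> ?T" for y
      using const[of "\<psi> y"] that U(2) by (simp add: inv)
    ultimately show ?thesis by blast
  qed
  have "\<phi> constant_on UNIV"
  proof (rule locally_constant_imp_constant[OF conn])
    fix c
    obtain T where "open T" "c \<in> T" "\<forall>y\<in>T. \<phi> y = \<phi> c" using loc by blast
    then show "\<exists>T. openin (top_of_set UNIV) T \<and> c \<in> T \<and> (\<forall>x\<in>T. \<phi> x = \<phi> c)"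
      using open_openin[of T] by (metis subtopology_UNIV)
  qed
  then show ?thesis by (auto simp: constant_on_def)
qed

section \<open>Functions on the Hamiltonian space\<close>

locale brst_setting =
  fixes D :: "('m::{t2_space, second_countable_topology}, 'e::real_normed_vector,
      'g::{t2_space, second_countable_topology}, 'd::real_normed_vector,
      'k::{real_normed_field, euclidean_space}) brst_data"
  assumes hamiltonian: "hamiltonian_system D"
    and basis: "lie_basis D"
    and generating: "generating_acyclic D"
    and contraction: "equivariant_contraction D"
    and starprod: "star_product D"
    and invariant: "strongly_invariant D"
    and qcontraction: "quantum_contraction D"
begin

lemma M_cover: "chart_cover (M_atlas D)"
  using hamiltonian by (simp add: hamiltonian_system_def smooth_atlas_imp_chart_cover)

lemma G_lie: "lie_group (G_atlas D) (G_grp D)"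
  using hamiltonian by (simp add: hamiltonian_system_def)

lemma G_atlas: "smooth_atlas (G_atlas D)"
  using G_lie by (simp add: lie_group_def)

lemmas G_cover = smooth_atlas_imp_chart_cover[OF G_atlas]

lemma CM_0: "0 \<in> CM D" and CM_const: "(\<lambda>_. c) \<in> CM D" and CM_1: "1 \<in> CM D"
  using smooth_fun_const[of "M_atlas D"] by (auto simp: CM_def zero_fun_def one_fun_def)

lemma CM_add: "f \<in> CM D \<Longrightarrow> g \<in> CM D \<Longrightarrow> f + g \<in> CM D"
  using smooth_fun_add[OF M_cover] by (simp add: CM_def plus_fun_def)

lemma CM_scale: "f \<in> CM D \<Longrightarrow> fscale c f \<in> CM D"
  using smooth_fun_bounded_linear[OF bounded_linear_mult_right M_cover] by (simp add: CM_def fscale_def)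

lemma CM_minus: "f \<in> CM D \<Longrightarrow> - f \<in> CM D"
  using CM_scale[of f "- 1"] by (simp add: fscale_def fun_Compl_def)

lemma CM_diff: "f \<in> CM D \<Longrightarrow> g \<in> CM D \<Longrightarrow> f - g \<in> CM D"
  using CM_add[of f "- g"] CM_minus[of g] by simp

lemma CM_mult: "f \<in> CM D \<Longrightarrow> g \<in> CM D \<Longrightarrow> f * g \<in> CM D"
  using smooth_fun_bilinear[OF bounded_bilinear_mult M_cover] by (simp add: CM_def times_fun_def)

lemma CM_sum: "(\<And>i. i \<in> I \<Longrightarrow> f i \<in> CM D) \<Longrightarrow> sum f I \<in> CM D"
  by (induction I rule: infinite_finite_induct) (simp_all add: CM_0 CM_add)

lemma CM_inner: "f \<in> CM D \<Longrightarrow> smooth_fun (M_atlas D) (\<lambda>p. f p \<bullet> b)"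
  using smooth_fun_bounded_linear[OF bounded_linear_inner_left M_cover] by (simp add: CM_def)

lemma moment_scale: "X \<in> lie_alg D \<Longrightarrow> moment D p (\<lambda>\<phi>. c * X \<phi>) = c * moment D p X"
  and moment_smooth: "X \<in> lie_alg D \<Longrightarrow> smooth_fun (M_atlas D) (\<lambda>p. moment D p X)"
  and moment_action: "X \<in> lie_alg D \<Longrightarrow> smooth_fun (M_atlas D) f \<Longrightarrow>
    poisson_real D (\<lambda>q. moment D q X) f p = X (\<lambda>a. f (act D (inv\<^bsub>G_grp D\<^esub> a) p))"
  and moment_bracket: "X \<in> lie_alg D \<Longrightarrow> Y \<in> lie_alg D \<Longrightarrow>
    poisson_real D (\<lambda>q. moment D q X) (\<lambda>q. moment D q Y) p = moment D p (alg_bracket (G_grp D) X Y)"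
  using hamiltonian unfolding hamiltonian_system_def by blast+

lemma lie_alg_scale: "X \<in> lie_alg D \<Longrightarrow> (\<lambda>\<phi>. c * X \<phi>) \<in> lie_alg D"
  and lie_alg_add: "X \<in> lie_alg D \<Longrightarrow> Y \<in> lie_alg D \<Longrightarrow> X + Y \<in> lie_alg D"
  and lie_alg_0: "(\<lambda>_. 0) \<in> lie_alg D"
  unfolding lie_alg_def by (simp_all add: tangent_closed)

lemma lie_alg_sum: "(\<And>i. i \<in> I \<Longrightarrow> X i \<in> lie_alg D) \<Longrightarrow> (\<lambda>\<phi>. \<Sum>i\<in>I. c i * X i \<phi>) \<in> lie_alg D"
proof (induction I rule: infinite_finite_induct)
  case (insert i I)
  then have "(\<lambda>\<phi>. c i * X i \<phi>) + (\<lambda>\<phi>. \<Sum>i\<in>I. c i * X i \<phi>) \<in> lie_alg D"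
    by (intro lie_alg_add lie_alg_scale) auto
  with insert show ?case by (simp add: plus_fun_def)
qed (simp_all add: lie_alg_0)

lemma gbasis_lie_alg: "a < gdim D \<Longrightarrow> gbasis D a \<in> lie_alg D"
  using basis by (simp add: lie_basis_def)

lemma J_CM: "X \<in> lie_alg D \<Longrightarrow> J_of D X \<in> CM D"
  using smooth_fun_bounded_linear[OF bounded_linear_of_real M_cover moment_smooth]
  by (simp add: CM_def J_of_def)

lemma Jc_CM: "a < gdim D \<Longrightarrow> Jc D a \<in> CM D"
  by (simp add: Jc_def J_CM gbasis_lie_alg)

lemma smooth_orbit_map:
  fixes f :: "'m \<Rightarrow> real"
  assumes "smooth_fun (M_atlas D) f"
  shows "smooth_fun (G_atlas D) (\<lambda>a. f (act D (inv\<^bsub>G_grp D\<^esub> a) p))"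
proof -
  have "smooth_map (prod_atlas (G_atlas D) (M_atlas D)) (M_atlas D) (\<lambda>(a, p). act D a p)"
    using hamiltonian by (simp add: hamiltonian_system_def)
  from smooth_fun_compose[OF chart_cover_prod_atlas[OF G_cover M_cover] M_cover this assms]
  have "smooth_fun (prod_atlas (G_atlas D) (M_atlas D)) (\<lambda>x. f (case x of (a, p) \<Rightarrow> act D a p))" .
  from smooth_fun_compose[OF G_cover chart_cover_prod_atlas[OF G_cover M_cover]
      smooth_map_slice(1)[OF G_atlas] this]
  have *: "smooth_fun (G_atlas D) (\<lambda>a. f (act D a p))" by simp
  have "smooth_map (G_atlas D) (G_atlas D) (\<lambda>a. inv\<^bsub>G_grp D\<^esub> a)"
    using G_lie by (simp add: lie_group_def)
  from smooth_fun_compose[OF G_cover G_cover this *] show ?thesis .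
qed

text \<open>
  The moment map generates the action. The bracket of \<open>\<bbbK>\<close>-valued functions is the bilinear extension of the
  real one over a real basis of \<open>\<bbbK>\<close>, and the values of \<open>J X\<close> are real multiples of \<open>1\<close>, so that the
  sum over the basis in the first argument collapses.
\<close>

lemma poisson_J:
  assumes X: "X \<in> lie_alg D" and f: "f \<in> CM D"
  shows "poisson D (J_of D X) f p
    = (\<Sum>c\<in>Basis. X (\<lambda>a. f (act D (inv\<^bsub>G_grp D\<^esub> a) p) \<bullet> c) *\<^sub>R c)"
proof -
  let ?d = "\<lambda>c. X (\<lambda>a. f (act D (inv\<^bsub>G_grp D\<^esub> a) p) \<bullet> c)"
  have "poisson_real D (\<lambda>q. J_of D X q \<bullet> b) (\<lambda>q. f q \<bullet> c) p = (1 \<bullet> b) * ?d c" for b c :: 'k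
  proof -
    have "J_of D X q \<bullet> b = moment D q (\<lambda>\<phi>. (1 \<bullet> b) * X \<phi>)" for q
      by (simp add: J_of_def moment_scale[OF X] of_real_def)
    then show ?thesis
      using moment_action[OF lie_alg_scale[OF X] CM_inner[OF f]] by simp
  qed
  then have "poisson D (J_of D X) f p = (\<Sum>b\<in>Basis. \<Sum>c\<in>Basis. ((1 \<bullet> b) * ?d c) *\<^sub>R (b * c))"
    by (simp add: poisson_def)
  also have "\<dots> = (\<Sum>c\<in>Basis. ?d c *\<^sub>R ((\<Sum>b\<in>Basis. (1 \<bullet> b) *\<^sub>R b) * c))"
    by (subst sum.swap)
      (simp add: sum_distrib_right scaleR_sum_right mult.commute[of "1 \<bullet> _"] flip: scaleR_scaleR)
  finally show ?thesis by (simp add: euclidean_representation)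
qed

text \<open>
  Infinitesimal invariance at all points of an orbit, through \<open>poisson_J\<close>, is the hypothesis of
  \<open>connected_lie_group_constant\<close> for the pullback of \<open>f\<close> to the group along the orbit map.
\<close>

lemma CM_inv_iff: "f \<in> CM_inv D \<longleftrightarrow> f \<in> CM D \<and> (\<forall>a<gdim D. poisson D (Jc D a) f = 0)"
proof (intro iffI conjI allI impI)
  assume f: "f \<in> CM_inv D"
  then show fM: "f \<in> CM D" by (simp add: CM_inv_def)
  fix a assume a: "a < gdim D"
  show "poisson D (Jc D a) f = 0"
  proof
    fix p
    have "gbasis D a (\<lambda>g. f (act D (inv\<^bsub>G_grp D\<^esub> g) p) \<bullet> c) = 0" for c
      using f tangent_const[OF gbasis_lie_alg[OF a, unfolded lie_alg_def] G_cover]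
      by (simp add: CM_inv_def)
    then show "poisson D (Jc D a) f p = 0 p"
      by (simp add: Jc_def poisson_J[OF gbasis_lie_alg[OF a] fM])
  qed
next
  assume "f \<in> CM D \<and> (\<forall>a<gdim D. poisson D (Jc D a) f = 0)"
  then have f: "f \<in> CM D" and pf: "\<And>a. a < gdim D \<Longrightarrow> poisson D (Jc D a) f = 0" by auto
  interpret group "G_grp D" using G_lie by (simp add: lie_group_def)
  have UN: "x \<in> carrier (G_grp D)" for x using G_lie by (simp add: lie_group_def)
  have act1: "act D \<one>\<^bsub>G_grp D\<^esub> p = p" and actm: "act D (a \<otimes>\<^bsub>G_grp D\<^esub> b) p = act D a (act D b p)" for a b p
    using hamiltonian by (auto simp: hamiltonian_system_def)
  have conn: "connected (UNIV :: 'g set)" using hamiltonian by (simp add: hamiltonian_system_def)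
  have basis0: "gbasis D a (\<lambda>g. f (act D (inv\<^bsub>G_grp D\<^esub> g) p) \<bullet> c) = 0"
    if a: "a < gdim D" and c: "c \<in> Basis" for a p c
  proof -
    have "0 = poisson D (J_of D (gbasis D a)) f p \<bullet> c"
      using pf[OF a] by (simp add: Jc_def)
    also have "\<dots> = gbasis D a (\<lambda>g. f (act D (inv\<^bsub>G_grp D\<^esub> g) p) \<bullet> c)"
      using c by (simp add: poisson_J[OF gbasis_lie_alg[OF a] f])
    finally show ?thesis by simp
  qed
  have zero: "X (\<lambda>g. f (act D (inv\<^bsub>G_grp D\<^esub> g) p) \<bullet> c) = 0"
    if X: "X \<in> lie_alg D" and c: "c \<in> Basis" for X p c
  proof -
    obtain u where "X = (\<lambda>\<phi>. \<Sum>a<gdim D. u a * gbasis D a \<phi>)"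
      using basis X unfolding lie_basis_def by blast
    then show ?thesis using basis0 c by simp
  qed
  have "f (act D a p) \<bullet> c = f p \<bullet> c" if c: "c \<in> Basis" for a p c
  proof -
    let ?h = "\<lambda>g. f (act D (inv\<^bsub>G_grp D\<^esub> g) p) \<bullet> c"
    have "?h (inv\<^bsub>G_grp D\<^esub> a) = ?h \<one>\<^bsub>G_grp D\<^esub>"
    proof (rule connected_lie_group_constant[OF G_lie conn smooth_orbit_map[OF CM_inner[OF f]]])
      fix X x assume "X \<in> tangent (G_atlas D) \<one>\<^bsub>G_grp D\<^esub>"
      then have "X (\<lambda>b. f (act D (inv\<^bsub>G_grp D\<^esub> b) (act D (inv\<^bsub>G_grp D\<^esub> x) p)) \<bullet> c) = 0"
        using zero[OF _ c] by (simp add: lie_alg_def)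
      then show "X (\<lambda>b. ?h (x \<otimes>\<^bsub>G_grp D\<^esub> b)) = 0"
        using UN by (simp add: inv_mult_group actm)
    qed
    then show ?thesis using UN by (simp add: act1)
  qed
  then show "f \<in> CM_inv D"
    using f euclidean_eqI unfolding CM_inv_def by blast
qed

lemma poisson_J_J:
  assumes "X \<in> lie_alg D" "Y \<in> lie_alg D"
  shows "poisson D (J_of D X) (J_of D Y) p = of_real (moment D p (alg_bracket (G_grp D) X Y))"
proof -
  let ?h = "\<lambda>a. moment D (act D (inv\<^bsub>G_grp D\<^esub> a) p) Y"
  have "X (\<lambda>a. J_of D Y (act D (inv\<^bsub>G_grp D\<^esub> a) p) \<bullet> c) = (1 \<bullet> c) * X ?h" for c :: 'k
  proof -
    have "(\<lambda>a. J_of D Y (act D (inv\<^bsub>G_grp D\<^esub> a) p) \<bullet> c) = (\<lambda>a. (1 \<bullet> c) * ?h a)"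
      by (simp add: J_of_def of_real_def fun_eq_iff)
    then show ?thesis
      using tangent_scale[OF _ G_cover] assms(1) by (simp add: lie_alg_def)
  qed
  then have "poisson D (J_of D X) (J_of D Y) p = (\<Sum>c\<in>Basis. ((1 \<bullet> c) * X ?h) *\<^sub>R c)"
    using poisson_J[OF assms(1) J_CM[OF assms(2)]] by simp
  also have "\<dots> = X ?h *\<^sub>R (\<Sum>c\<in>Basis. (1 \<bullet> c) *\<^sub>R c)"
    by (simp add: scaleR_sum_right mult.commute)
  also have "\<dots> = of_real (X ?h)"
    by (simp add: euclidean_representation of_real_def)
  finally show ?thesis
    using moment_action[OF assms(1) moment_smooth[OF assms(2)]] moment_bracket[OF assms] by simp
qed

text \<open>
  Equivariance: the bracket is a combination of components of the moment map, which vanish on \<open>Z\<close>.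
\<close>

lemma poisson_Jc_Jc_Zset:
  assumes "a < gdim D" "b < gdim D" "p \<in> Zset D"
  shows "poisson D (Jc D a) (Jc D b) p = 0"
proof -
  have "alg_bracket (G_grp D) (gbasis D a) (gbasis D b) = (\<lambda>\<phi>. \<Sum>c<gdim D. sconst D a b c * gbasis D c \<phi>)"
    using basis assms(1,2) by (simp add: lie_basis_def)
  also have "\<dots> \<in> lie_alg D" by (rule lie_alg_sum) (simp add: gbasis_lie_alg)
  finally have "alg_bracket (G_grp D) (gbasis D a) (gbasis D b) \<in> lie_alg D" .
  then show ?thesis
    using assms by (simp add: Jc_def poisson_J_J gbasis_lie_alg Zset_def)
qed

lemma res_CZ: "f \<in> CM D \<Longrightarrow> res D f \<in> CZ D"
  by (simp add: CZ_def)

lemma res_add: "res D (f + g) = res D f + res D g"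
  and res_diff: "res D (f - g) = res D f - res D g"
  and res_mult: "res D (f * g) = res D f * res D g"
  and res_0: "res D 0 = 0"
  and res_scale: "res D (fscale c f) = fscale c (res D f)"
  by (auto simp: res_def fun_eq_iff fscale_def)

lemma res_sum: "res D (sum f I) = (\<Sum>i\<in>I. res D (f i))"
  by (induction I rule: infinite_finite_induct) (simp_all only: sum.infinite sum.empty sum.insert res_0 res_add not_False_eq_True)

lemma res_eq_0_iff: "f \<in> CM D \<Longrightarrow> res D f = 0 \<longleftrightarrow> f \<in> IZ D"
  by (auto simp: res_def IZ_def fun_eq_iff)

lemma CZ_0: "0 \<in> CZ D"
  using res_CZ[OF CM_0] by (simp add: res_0)

lemma CZ_add: "u \<in> CZ D \<Longrightarrow> v \<in> CZ D \<Longrightarrow> u + v \<in> CZ D"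
  unfolding CZ_def by (auto simp: CM_add simp flip: res_add)

lemma CZ_scale: "u \<in> CZ D \<Longrightarrow> fscale c u \<in> CZ D"
  unfolding CZ_def by (auto simp: CM_scale simp flip: res_scale)

lemma CZ_minus: "u \<in> CZ D \<Longrightarrow> - u \<in> CZ D"
  using CZ_scale[of u "- 1"] by (simp add: fscale_def fun_Compl_def)

lemma CZ_sum: "(\<And>i. i \<in> I \<Longrightarrow> f i \<in> CZ D) \<Longrightarrow> sum f I \<in> CZ D"
  by (induction I rule: infinite_finite_induct) (simp_all add: CZ_0 CZ_add)

end

section \<open>Seminorms and continuity\<close>

lemma openin_quotient_topology:
  "openin (quotient_topology T q) U \<longleftrightarrow> U \<subseteq> q ` topspace T \<and> openin T {x \<in> topspace T. q x \<in> U}"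
proof -
  let ?P = "\<lambda>U. U \<subseteq> q ` topspace T \<and> openin T {x \<in> topspace T. q x \<in> U}"
  have "istopology ?P"
    unfolding istopology_def
  proof (intro conjI allI impI)
    fix S R assume "?P S" "?P R"
    moreover have "{x \<in> topspace T. q x \<in> S \<inter> R} = {x \<in> topspace T. q x \<in> S} \<inter> {x \<in> topspace T. q x \<in> R}"
      by blast
    ultimately show "openin T {x \<in> topspace T. q x \<in> S \<inter> R}" by auto
  next
    fix \<K> assume *: "\<forall>K\<in>\<K>. ?P K"
    have "{x \<in> topspace T. q x \<in> \<Union>\<K>} = \<Union> ((\<lambda>K. {x \<in> topspace T. q x \<in> K}) ` \<K>)"
      by blast
    then show "openin T {x \<in> topspace T. q x \<in> \<Union>\<K>}" using * by auto
  qed auto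
  then show ?thesis by (simp add: quotient_topology_def topology_inverse')
qed

lemma topspace_quotient_topology: "topspace (quotient_topology T q) = q ` topspace T"
proof (rule antisym)
  show "topspace (quotient_topology T q) \<subseteq> q ` topspace T"
    using openin_topspace[of "quotient_topology T q"] by (simp only: openin_quotient_topology)
  have "{x \<in> topspace T. q x \<in> q ` topspace T} = topspace T" by blast
  then have "openin (quotient_topology T q) (q ` topspace T)"
    by (simp add: openin_quotient_topology)
  then show "q ` topspace T \<subseteq> topspace (quotient_topology T q)"
    by (rule openin_subset)
qed

lemma continuous_map_to_quotient: "continuous_map T (quotient_topology T q) q"
  by (auto simp: continuous_map_def topspace_quotient_topology openin_quotient_topology)

lemma continuous_map_from_quotient:
  assumes "continuous_map T Y (\<lambda>x. f (q x))"
  shows "continuous_map (quotient_topology T q) Y f"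
  unfolding continuous_map_def
proof (intro conjI allI impI)
  show "f \<in> topspace (quotient_topology T q) \<rightarrow> topspace Y"
    using assms by (auto simp: topspace_quotient_topology continuous_map_def)
  fix U assume U: "openin Y U"
  have "{x \<in> topspace T. q x \<in> {y \<in> topspace (quotient_topology T q). f y \<in> U}}
      = {x \<in> topspace T. f (q x) \<in> U}"
    by (auto simp: topspace_quotient_topology)
  then show "openin (quotient_topology T q) {y \<in> topspace (quotient_topology T q). f y \<in> U}"
    using openin_continuous_map_preimage[OF assms U]
    by (auto simp: openin_quotient_topology topspace_quotient_topology)
qed

text \<open>
  The topology of \<open>C\<^sup>\<infinity>(M)\<close> is of this form; abstracting from derivatives on compact sets reduces
  continuity proofs to the triangle inequality and estimates of seminorms.
\<close>

definition seminorm_topology :: "'v::ab_group_add set \<Rightarrow> ('v \<Rightarrow> real) set \<Rightarrow> 'v topology" where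
  "seminorm_topology V Q =
     topology_generated_by {{f \<in> V. q (f - g) < \<epsilon>} | q g \<epsilon>. q \<in> Q \<and> g \<in> V \<and> \<epsilon> > 0}"

locale seminorm_space =
  fixes V :: "'v::ab_group_add set" and Q :: "('v \<Rightarrow> real) set"
  assumes zero: "0 \<in> V" and diff: "f \<in> V \<Longrightarrow> g \<in> V \<Longrightarrow> f - g \<in> V"
    and nonempty: "Q \<noteq> {}"
    and q_zero: "q \<in> Q \<Longrightarrow> q 0 = 0"
    and q_diff: "q \<in> Q \<Longrightarrow> f \<in> V \<Longrightarrow> g \<in> V \<Longrightarrow> q (f - g) \<le> q f + q g"
begin

lemma uminus: "f \<in> V \<Longrightarrow> - f \<in> V"
  using diff[OF zero] by fastforce

lemma add: "f \<in> V \<Longrightarrow> g \<in> V \<Longrightarrow> f + g \<in> V"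
  using diff[of f "- g"] uminus by simp

lemma q_minus: "q \<in> Q \<Longrightarrow> f \<in> V \<Longrightarrow> q (- f) = q f"
  using q_diff[of q 0 f] q_diff[of q 0 "- f"] q_zero zero uminus by fastforce

lemma q_add: "q \<in> Q \<Longrightarrow> f \<in> V \<Longrightarrow> g \<in> V \<Longrightarrow> q (f + g) \<le> q f + q g"
  using q_diff[of q f "- g"] q_minus[of q g] uminus by simp

lemma q_nonneg: "q \<in> Q \<Longrightarrow> f \<in> V \<Longrightarrow> 0 \<le> q f"
  using q_diff[of q f f] q_zero[of q] by simp

lemma topspace_seminorm: "topspace (seminorm_topology V Q) = V"
proof -
  obtain q where q: "q \<in> Q" using nonempty by blast
  have "f \<in> \<Union> {{f \<in> V. q (f - g) < \<epsilon>} | q g \<epsilon>. q \<in> Q \<and> g \<in> V \<and> \<epsilon> > 0}" if f: "f \<in> V" for f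
  proof -
    have "f \<in> {h \<in> V. q (h - f) < 1}" using f q_zero[OF q] by simp
    moreover have "{h \<in> V. q (h - f) < 1} \<in> {{f \<in> V. q (f - g) < \<epsilon>} | q g \<epsilon>. q \<in> Q \<and> g \<in> V \<and> \<epsilon> > 0}"
      using f q zero_less_one by blast
    ultimately show ?thesis by blast
  qed
  then show ?thesis
    unfolding seminorm_topology_def topology_generated_by_topspace by blast
qed

lemma continuous_map_iff:
  "continuous_map X (seminorm_topology V Q) f \<longleftrightarrow>
     (\<forall>x\<in>topspace X. f x \<in> V) \<and>
     (\<forall>x\<in>topspace X. \<forall>q\<in>Q. \<forall>\<epsilon>>0. \<exists>U. openin X U \<and> x \<in> U \<and> (\<forall>y\<in>U. q (f y - f x) < \<epsilon>))"
  (is "?L \<longleftrightarrow> ?R")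
proof
  assume L: ?L
  then have V: "f x \<in> V" if "x \<in> topspace X" for x
    using that by (auto simp: continuous_map_def topspace_seminorm)
  have "\<exists>U. openin X U \<and> x \<in> U \<and> (\<forall>y\<in>U. q (f y - f x) < \<epsilon>)"
    if x: "x \<in> topspace X" and q: "q \<in> Q" and e: "\<epsilon> > 0" for x q \<epsilon>
  proof -
    have "openin (seminorm_topology V Q) {h \<in> V. q (h - f x) < \<epsilon>}"
      unfolding seminorm_topology_def using V[OF x] q e by (intro topology_generated_by_Basis) blast
    then have "openin X {y \<in> topspace X. f y \<in> {h \<in> V. q (h - f x) < \<epsilon>}}"
      using L openin_continuous_map_preimage by blast
    moreover have "x \<in> {y \<in> topspace X. f y \<in> {h \<in> V. q (h - f x) < \<epsilon>}}"
      using x V[OF x] e q_zero[OF q] by simp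
    ultimately show ?thesis by blast
  qed
  then show ?R using V by blast
next
  assume R: ?R
  show ?L
    unfolding seminorm_topology_def continuous_on_generated_topo_iff
  proof (intro conjI allI impI)
    fix S assume "S \<in> {{f \<in> V. q (f - g) < \<epsilon>} | q g \<epsilon>. q \<in> Q \<and> g \<in> V \<and> \<epsilon> > 0}"
    then obtain q g \<epsilon> where S: "S = {f \<in> V. q (f - g) < \<epsilon>}" "q \<in> Q" "g \<in> V" "\<epsilon> > 0" by blast
    show "openin X (f -` S \<inter> topspace X)"
    proof (subst openin_subopen, intro ballI)
      fix x assume x: "x \<in> f -` S \<inter> topspace X"
      then have fx: "f x \<in> V" "q (f x - g) < \<epsilon>" "x \<in> topspace X" using S(1) by auto
      then have "\<epsilon> - q (f x - g) > 0" by simp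
      with R fx(3) S(2) obtain U where U: "openin X U" "x \<in> U"
        "\<And>y. y \<in> U \<Longrightarrow> q (f y - f x) < \<epsilon> - q (f x - g)" by meson
      have "f y \<in> S" if y: "y \<in> U" for y
      proof -
        have fy: "f y \<in> V" using R y openin_subset[OF U(1)] by blast
        have "q ((f y - f x) + (f x - g)) \<le> q (f y - f x) + q (f x - g)"
          using S fx fy by (intro q_add diff) auto
        then have "q (f y - g) < \<epsilon>" using U(3)[OF y] by simp
        then show ?thesis using S(1) fy by simp
      qed
      then have "U \<subseteq> f -` S \<inter> topspace X" using openin_subset[OF U(1)] by blast
      then show "\<exists>T. openin X T \<and> x \<in> T \<and> T \<subseteq> f -` S \<inter> topspace X" using U by blast
    qed
  next
    show "f ` topspace X \<subseteq> \<Union> {{f \<in> V. q (f - g) < \<epsilon>} | q g \<epsilon>. q \<in> Q \<and> g \<in> V \<and> \<epsilon> > 0}"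
      using R topspace_seminorm unfolding seminorm_topology_def topology_generated_by_topspace by blast
  qed
qed

lemma continuous_map_seminorm_nbhd:
  assumes "continuous_map X (seminorm_topology V Q) f" "x \<in> topspace X" "finite F" "F \<subseteq> Q" "\<epsilon> > 0"
  obtains U where "openin X U" "x \<in> U" "\<And>y q. y \<in> U \<Longrightarrow> q \<in> F \<Longrightarrow> q (f y - f x) < \<epsilon>"
proof -
  have "\<forall>q. \<exists>U. q \<in> F \<longrightarrow> openin X U \<and> x \<in> U \<and> (\<forall>y\<in>U. q (f y - f x) < \<epsilon>)"
    using assms(1,2,4,5) unfolding continuous_map_iff by blast
  then obtain U where U: "\<And>q. q \<in> F \<Longrightarrow> openin X (U q) \<and> x \<in> U q \<and> (\<forall>y\<in>U q. q (f y - f x) < \<epsilon>)"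
    by metis
  have "openin X (topspace X \<inter> \<Inter> (U ` F))"
  proof (cases "F = {}")
    case False
    then have "openin X (\<Inter> (U ` F))" using assms(3) U by (intro openin_Inter) auto
    then show ?thesis by blast
  qed simp
  then show ?thesis using U assms(2) by (intro that[of "topspace X \<inter> \<Inter> (U ` F)"]) blast+
qed

lemma continuous_map_plus:
  assumes "continuous_map X (seminorm_topology V Q) f" "continuous_map X (seminorm_topology V Q) g"
  shows "continuous_map X (seminorm_topology V Q) (\<lambda>x. f x + g x)"
  unfolding continuous_map_iff
proof (intro conjI ballI allI impI)
  have V: "f x \<in> V" "g x \<in> V" if "x \<in> topspace X" for x
    using assms that unfolding continuous_map_iff by blast+
  then show "f x + g x \<in> V" if "x \<in> topspace X" for x using that add by blast
  fix x q and \<epsilon> :: real assume x: "x \<in> topspace X" and q: "q \<in> Q" and e: "\<epsilon> > 0"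
  obtain U where U: "openin X U" "x \<in> U" "\<And>y. y \<in> U \<Longrightarrow> q (f y - f x) < \<epsilon> / 2"
    by (rule continuous_map_seminorm_nbhd[OF assms(1) x, of "{q}" "\<epsilon> / 2"]) (use q e in simp_all)
  obtain W where W: "openin X W" "x \<in> W" "\<And>y. y \<in> W \<Longrightarrow> q (g y - g x) < \<epsilon> / 2"
    by (rule continuous_map_seminorm_nbhd[OF assms(2) x, of "{q}" "\<epsilon> / 2"]) (use q e in simp_all)
  have "q (f y + g y - (f x + g x)) < \<epsilon>" if y: "y \<in> U \<inter> W" for y
  proof -
    have yX: "y \<in> topspace X" using y openin_subset[OF U(1)] by blast
    have "q ((f y - f x) + (g y - g x)) \<le> q (f y - f x) + q (g y - g x)"
      using V yX x q by (intro q_add diff) auto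
    also have "\<dots> < \<epsilon>" using U(3)[of y] W(3)[of y] y by simp
    finally show ?thesis by (simp add: algebra_simps)
  qed
  then show "\<exists>U. openin X U \<and> x \<in> U \<and> (\<forall>y\<in>U. q (f y + g y - (f x + g x)) < \<epsilon>)"
    using U W by (intro exI[of _ "U \<inter> W"]) auto
qed

lemma continuous_map_zero: "continuous_map X (seminorm_topology V Q) (\<lambda>x. 0)"
  by (simp add: zero topspace_seminorm)

lemma continuous_map_setsum:
  assumes "\<And>i. i \<in> I \<Longrightarrow> continuous_map X (seminorm_topology V Q) (f i)"
  shows "continuous_map X (seminorm_topology V Q) (\<lambda>x. \<Sum>i\<in>I. f i x)"
  using assms
proof (induction I rule: infinite_finite_induct)
  case (insert i I)
  then show ?case using continuous_map_plus[of X "f i" "\<lambda>x. \<Sum>i\<in>I. f i x"] by simp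
qed (use continuous_map_zero in simp_all)

text \<open>
  The bound is by the same seminorm, which suffices for multiplication by a scalar.
\<close>

lemma continuous_map_linear:
  assumes "continuous_map X (seminorm_topology V Q) f"
    and V: "\<And>u. u \<in> V \<Longrightarrow> L u \<in> V" and lin: "\<And>u v. u \<in> V \<Longrightarrow> v \<in> V \<Longrightarrow> L (u - v) = L u - L v"
    and bound: "\<And>q u. q \<in> Q \<Longrightarrow> u \<in> V \<Longrightarrow> q (L u) \<le> C * q u"
  shows "continuous_map X (seminorm_topology V Q) (\<lambda>x. L (f x))"
  unfolding continuous_map_iff
proof (intro conjI ballI allI impI)
  have fV: "f x \<in> V" if "x \<in> topspace X" for x
    using assms(1) that unfolding continuous_map_iff by blast
  then show "L (f x) \<in> V" if "x \<in> topspace X" for x using that V by blast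
  fix x q and \<epsilon> :: real assume x: "x \<in> topspace X" and q: "q \<in> Q" and e: "\<epsilon> > 0"
  let ?d = "\<epsilon> / (\<bar>C\<bar> + 1)"
  obtain U where U: "openin X U" "x \<in> U" "\<And>y. y \<in> U \<Longrightarrow> q (f y - f x) < ?d"
    by (rule continuous_map_seminorm_nbhd[OF assms(1) x, of "{q}" ?d]) (use q e in simp_all)
  have "q (L (f y) - L (f x)) < \<epsilon>" if y: "y \<in> U" for y
  proof -
    have yV: "f y \<in> V" using y openin_subset[OF U(1)] fV by blast
    have "q (L (f y) - L (f x)) \<le> C * q (f y - f x)"
      using bound[OF q diff[OF yV fV[OF x]]] lin[OF yV fV[OF x]] by simp
    also have "\<dots> \<le> \<bar>C\<bar> * q (f y - f x)"
      using q_nonneg[OF q diff[OF yV fV[OF x]]] by (intro mult_right_mono) auto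
    also have "\<dots> \<le> \<bar>C\<bar> * ?d"
      using U(3)[OF y] by (intro mult_left_mono) auto
    also have "\<dots> < \<epsilon>" using e by (simp add: field_simps)
    finally show ?thesis .
  qed
  then show "\<exists>U. openin X U \<and> x \<in> U \<and> (\<forall>y\<in>U. q (L (f y) - L (f x)) < \<epsilon>)"
    using U by blast
qed

text \<open>
  Joint continuity of a bounded bilinear operation:
  \<open>B u v - B u\<^sub>0 v\<^sub>0 = B (u - u\<^sub>0) (v - v\<^sub>0) + B (u - u\<^sub>0) v\<^sub>0 + B u\<^sub>0 (v - v\<^sub>0)\<close>.
\<close>

lemma continuous_map_bilinear:
  assumes f: "continuous_map X (seminorm_topology V Q) f" and g: "continuous_map X (seminorm_topology V Q) g"
    and V: "\<And>u v. u \<in> V \<Longrightarrow> v \<in> V \<Longrightarrow> B u v \<in> V"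
    and l: "\<And>u u' v. u \<in> V \<Longrightarrow> u' \<in> V \<Longrightarrow> v \<in> V \<Longrightarrow> B (u + u') v = B u v + B u' v"
    and r: "\<And>u v v'. u \<in> V \<Longrightarrow> v \<in> V \<Longrightarrow> v' \<in> V \<Longrightarrow> B u (v + v') = B u v + B u v'"
    and bound: "\<And>q. q \<in> Q \<Longrightarrow> \<exists>F C. finite F \<and> F \<subseteq> Q \<and>
      (\<forall>u\<in>V. \<forall>v\<in>V. q (B u v) \<le> C * (\<Sum>p\<in>F. p u) * (\<Sum>p\<in>F. p v))"
  shows "continuous_map X (seminorm_topology V Q) (\<lambda>x. B (f x) (g x))"
  unfolding continuous_map_iff
proof (intro conjI ballI allI impI)
  have fV: "f x \<in> V" "g x \<in> V" if "x \<in> topspace X" for x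
    using f g that unfolding continuous_map_iff by blast+
  then show "B (f x) (g x) \<in> V" if "x \<in> topspace X" for x using that V by blast
  fix x q and \<epsilon> :: real assume x: "x \<in> topspace X" and q: "q \<in> Q" and e: "\<epsilon> > 0"
  obtain F C where F: "finite F" "F \<subseteq> Q"
    and C: "\<And>u v. u \<in> V \<Longrightarrow> v \<in> V \<Longrightarrow> q (B u v) \<le> C * (\<Sum>p\<in>F. p u) * (\<Sum>p\<in>F. p v)"
    using bound[OF q] by blast
  define P where "P u = (\<Sum>p\<in>F. p u)" for u
  have P0: "0 \<le> P u" if "u \<in> V" for u
    unfolding P_def using that F q_nonneg by (intro sum_nonneg) auto
  have C': "q (B u v) \<le> \<bar>C\<bar> * P u * P v" if "u \<in> V" "v \<in> V" for u v
  proof -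
    have "q (B u v) \<le> C * (P u * P v)" using C[OF that] by (simp add: P_def mult.assoc)
    also have "\<dots> \<le> \<bar>C\<bar> * (P u * P v)"
      using P0 that by (intro mult_right_mono) auto
    finally show ?thesis by (simp add: mult.assoc)
  qed
  define M where "M = \<bar>C\<bar> * (1 + P (f x) + P (g x)) + 1"
  have M: "M > 0" unfolding M_def using P0[OF fV(1)[OF x]] P0[OF fV(2)[OF x]]
    by (intro add_nonneg_pos mult_nonneg_nonneg) auto
  define d where "d = min 1 (\<epsilon> / M)"
  have d: "d > 0" "d \<le> 1" "d * M \<le> \<epsilon>"
    using M e by (auto simp: d_def min_def field_simps)
  define n where "n = real (card F) + 1"
  have n: "n > 0" by (simp add: n_def)
  obtain U where U: "openin X U" "x \<in> U" "\<And>y p. y \<in> U \<Longrightarrow> p \<in> F \<Longrightarrow> p (f y - f x) < d / n"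
    by (rule continuous_map_seminorm_nbhd[OF f x F, of "d / n"]) (use d n in simp_all)
  obtain W where W: "openin X W" "x \<in> W" "\<And>y p. y \<in> W \<Longrightarrow> p \<in> F \<Longrightarrow> p (g y - g x) < d / n"
    by (rule continuous_map_seminorm_nbhd[OF g x F, of "d / n"]) (use d n in simp_all)
  have small: "P u \<le> d" if "\<And>p. p \<in> F \<Longrightarrow> p u < d / n" for u
  proof -
    have "P u \<le> (\<Sum>p\<in>F. d / n)" unfolding P_def using that by (intro sum_mono less_imp_le)
    also have "\<dots> = d * (real (card F) / n)" by simp
    also have "\<dots> \<le> d * 1" using d n by (intro mult_left_mono) (auto simp: n_def)
    finally show ?thesis by simp
  qed
  have "q (B (f y) (g y) - B (f x) (g x)) < \<epsilon>" if y: "y \<in> U \<inter> W" for y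
  proof -
    have yX: "y \<in> topspace X" using y openin_subset[OF U(1)] by blast
    let ?u = "f y - f x" and ?v = "g y - g x"
    have u: "?u \<in> V" "?v \<in> V" using fV x yX diff by auto
    have Pu: "P ?u \<le> d" "P ?v \<le> d" using U(3) W(3) y by (auto intro!: small)
    have "B (f y) (g y) = B (?u + f x) (?v + g x)" by simp
    also have "\<dots> = B ?u ?v + B ?u (g x) + (B (f x) ?v + B (f x) (g x))"
      using l[OF u(1) fV(1)[OF x] add[OF u(2) fV(2)[OF x]]] r[OF u(1) u(2) fV(2)[OF x]]
        r[OF fV(1)[OF x] u(2) fV(2)[OF x]] by simp
    finally have "B (f y) (g y) - B (f x) (g x) = B ?u ?v + B ?u (g x) + B (f x) ?v" by simp
    also have "q \<dots> \<le> q (B ?u ?v + B ?u (g x)) + q (B (f x) ?v)"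
      using u fV[OF x] V q by (intro q_add add) auto
    also have "\<dots> \<le> q (B ?u ?v) + q (B ?u (g x)) + q (B (f x) ?v)"
      using u fV[OF x] V q_add[OF q, of "B ?u ?v" "B ?u (g x)"] by simp
    also have "\<dots> \<le> \<bar>C\<bar> * P ?u * P ?v + \<bar>C\<bar> * P ?u * P (g x) + \<bar>C\<bar> * P (f x) * P ?v"
      using u fV[OF x] by (intro add_mono C')
    also have "\<dots> \<le> \<bar>C\<bar> * d * 1 + \<bar>C\<bar> * d * P (g x) + \<bar>C\<bar> * P (f x) * d"
      using Pu d P0[OF u(1)] P0[OF u(2)] P0[OF fV(1)[OF x]] P0[OF fV(2)[OF x]]
      by (intro add_mono mult_mono mult_nonneg_nonneg) auto
    also have "\<dots> = d * (M - 1)" by (simp add: M_def algebra_simps)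
    also have "\<dots> < d * M" using d by simp
    finally show ?thesis using d(3) by simp
  qed
  then show "\<exists>U. openin X U \<and> x \<in> U \<and> (\<forall>y\<in>U. q (B (f y) (g y) - B (f x) (g x)) < \<epsilon>)"
    using U W by (intro exI[of _ "U \<inter> W"]) auto
qed

end

lemma continuous_map_grass_topology:
  assumes "continuous_map X (grass_topology T E) F" "S \<subseteq> E"
  shows "continuous_map X T (\<lambda>x. F x S)"
proof -
  have "continuous_map (product_topology (\<lambda>_. T) (Pow E)) T (\<lambda>a. a S)"
    using assms(2) by (intro continuous_map_product_projection) simp
  then have "continuous_map (grass_topology T E) T ((\<lambda>a. a S) \<circ> (\<lambda>a. restrict a (Pow E)))"
    unfolding grass_topology_def by (rule continuous_map_pullback)
  then have "continuous_map (grass_topology T E) T (\<lambda>a. a S)"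
    using assms(2) by (simp add: comp_def)
  then show ?thesis
    using continuous_map_compose[OF assms(1)] by (simp add: comp_def)
qed

text \<open>
  On each of the finitely many monomials the embedding is the identity or zero.
\<close>

lemma continuous_map_emb:
  assumes "0 \<in> topspace T"
  shows "continuous_map T (grass_topology T E) emb"
  unfolding grass_topology_def
proof (rule continuous_map_pullback')
  show "topspace T \<subseteq> emb -` grass_over (topspace T) E"
    using assms by (auto simp: grass_over_def emb_def)
  show "continuous_map T (product_topology (\<lambda>_. T) (Pow E)) ((\<lambda>a. restrict a (Pow E)) \<circ> emb)"
    unfolding continuous_map_componentwise
  proof (intro conjI ballI)
    fix S assume S: "S \<in> Pow E"
    have "continuous_map T T (\<lambda>x. if S = {} then x else 0)"
      using assms by (cases "S = {}") simp_all
    then show "continuous_map T T (\<lambda>x. ((\<lambda>a. restrict a (Pow E)) \<circ> emb) x S)"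
      using S by (simp add: emb_def comp_def)
  qed auto
qed

section \<open>Bidifferential operators are continuous\<close>

text \<open>Local expressions of bidifferential operators, as lists of coefficients with multi-indices.\<close>

definition bidiff_expr :: "(('e::real_normed_vector \<Rightarrow> 'k::real_normed_field) \<times> 'e list \<times> 'e list) list \<Rightarrow>
    ('e \<Rightarrow> 'k) \<Rightarrow> ('e \<Rightarrow> 'k) \<Rightarrow> 'e \<Rightarrow> 'k" where
  "bidiff_expr L F G x = (\<Sum>(\<gamma>, vs, ws)\<leftarrow>L. \<gamma> x * foldr dir_deriv vs F x * foldr dir_deriv ws G x)"

lemma bidiff_expr_simps:
  "bidiff_expr [] F G x = 0"
  "bidiff_expr ((\<gamma>, vs, ws) # L) F G x
    = \<gamma> x * foldr dir_deriv vs F x * foldr dir_deriv ws G x + bidiff_expr L F G x"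
  "bidiff_expr (L @ L') F G x = bidiff_expr L F G x + bidiff_expr L' F G x"
  by (simp_all add: bidiff_expr_def)

lemma smooth_on_bidiff_term:
  fixes \<gamma> :: "'e::real_normed_vector \<Rightarrow> 'k::real_normed_field"
  assumes "open T" "smooth_on T \<gamma>" "smooth_on T F" "smooth_on T G"
  shows "smooth_on T (\<lambda>x. \<gamma> x * F x * G x)"
  by (intro smooth_on_bilinear[OF bounded_bilinear_mult] assms)

lemma smooth_on_bidiff_expr:
  assumes "open T" "smooth_on T F" "smooth_on T G" "\<And>c. c \<in> set L \<Longrightarrow> smooth_on T (fst c)"
  shows "smooth_on T (bidiff_expr L F G)"
  using assms(4)
proof (induction L)
  case Nil
  have "bidiff_expr [] F G = (\<lambda>_. 0)" by (rule ext) (rule bidiff_expr_simps)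
  then show ?case using smooth_on_const by metis
next
  case (Cons c L)
  obtain \<gamma> vs ws where c: "c = (\<gamma>, vs, ws)" by (cases c) auto
  have \<gamma>: "smooth_on T \<gamma>" using Cons.prems[of c] c by simp
  have L: "smooth_on T (bidiff_expr L F G)" using Cons by simp
  have "smooth_on T (\<lambda>x. \<gamma> x * foldr dir_deriv vs F x * foldr dir_deriv ws G x + bidiff_expr L F G x)"
    by (intro smooth_on_add smooth_on_bidiff_term smooth_on_foldr_dir_deriv assms(1-3) \<gamma> L)
  moreover have "bidiff_expr (c # L) F G
      = (\<lambda>x. \<gamma> x * foldr dir_deriv vs F x * foldr dir_deriv ws G x + bidiff_expr L F G x)"
    by (rule ext) (simp only: c bidiff_expr_simps)
  ultimately show ?case by simp
qed

text \<open>
  By the Leibniz rule the derivative of a bidifferential expression is again one: each term splits into three,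
  according to the factor that is differentiated.
\<close>

lemma dir_deriv_bidiff_expr:
  fixes L :: "(('e::real_normed_vector \<Rightarrow> 'k::real_normed_field) \<times> 'e list \<times> 'e list) list"
  assumes "open T" "\<And>c. c \<in> set L \<Longrightarrow> smooth_on T (fst c)"
  obtains L' where "\<And>c. c \<in> set L' \<Longrightarrow> smooth_on T (fst c)"
    "\<And>F G x. smooth_on T F \<Longrightarrow> smooth_on T G \<Longrightarrow> x \<in> T \<Longrightarrow>
       dir_deriv v (bidiff_expr L F G) x = bidiff_expr L' F G x"
proof -
  let ?d = "\<lambda>(\<gamma>, vs, ws). [(dir_deriv v \<gamma>, vs, ws), (\<gamma>, v # vs, ws), (\<gamma>, vs, v # ws)]"
  have "(\<forall>c\<in>set (concat (map ?d L)). smooth_on T (fst c)) \<and>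
    (\<forall>F G x. smooth_on T F \<longrightarrow> smooth_on T G \<longrightarrow> x \<in> T \<longrightarrow>
       dir_deriv v (bidiff_expr L F G) x = bidiff_expr (concat (map ?d L)) F G x)"
    using assms(2)
  proof (induction L)
    case Nil
    have "dir_deriv v (\<lambda>_. 0) x = (0::'k)" for x by (rule dir_deriv_eqI) (rule has_derivative_const)
    moreover have "bidiff_expr [] F G = (\<lambda>_. 0)" for F G :: "'e \<Rightarrow> 'k"
      by (rule ext) (rule bidiff_expr_simps)
    ultimately show ?case by (simp add: bidiff_expr_simps)
  next
    case (Cons c L)
    obtain \<gamma> vs ws where c: "c = (\<gamma>, vs, ws)" by (cases c) auto
    have \<gamma>: "smooth_on T \<gamma>" using Cons.prems[of c] c by simp
    have smL: "smooth_on T (fst c)" if "c \<in> set L" for c using Cons.prems that by simp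
    have "dir_deriv v (bidiff_expr (c # L) F G) x = bidiff_expr (concat (map ?d (c # L))) F G x"
      if F: "smooth_on T F" and G: "smooth_on T G" and x: "x \<in> T" for F G x
    proof -
      let ?F = "foldr dir_deriv vs F" and ?G = "foldr dir_deriv ws G"
      have d: "\<gamma> differentiable_on T" "?F differentiable_on T" "?G differentiable_on T"
        using \<gamma> F G by (auto intro: smooth_on_imp_differentiable smooth_on_foldr_dir_deriv)
      have d2: "(\<lambda>x. \<gamma> x * ?F x) differentiable_on T"
        by (rule smooth_on_imp_differentiable)
          (intro smooth_on_bilinear[OF bounded_bilinear_mult] assms \<gamma> smooth_on_foldr_dir_deriv F)
      have e2: "dir_deriv v (\<lambda>x. \<gamma> x * ?F x) x = \<gamma> x * dir_deriv v ?F x + dir_deriv v \<gamma> x * ?F x"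
        by (rule dir_deriv_eqI[OF has_derivative_bilinear[OF bounded_bilinear_mult assms(1) d(1,2) x]])
      have e3: "dir_deriv v (\<lambda>x. (\<gamma> x * ?F x) * ?G x) x
          = (\<gamma> x * ?F x) * dir_deriv v ?G x + dir_deriv v (\<lambda>x. \<gamma> x * ?F x) x * ?G x"
        by (rule dir_deriv_eqI[OF has_derivative_bilinear[OF bounded_bilinear_mult assms(1) d2 d(3) x]])
      have "dir_deriv v (bidiff_expr (c # L) F G) x
          = dir_deriv v (\<lambda>x. \<gamma> x * ?F x * ?G x + bidiff_expr L F G x) x"
        by (rule arg_cong[where f = "\<lambda>F. dir_deriv v F x"], rule ext) (simp only: c bidiff_expr_simps)
      also have "\<dots> = dir_deriv v (\<lambda>x. \<gamma> x * ?F x * ?G x) x + dir_deriv v (bidiff_expr L F G) x"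
        by (intro dir_deriv_add[OF _ _ assms(1) x] smooth_on_imp_differentiable smooth_on_bidiff_term
            smooth_on_bidiff_expr smooth_on_foldr_dir_deriv assms(1) F G \<gamma> smL)
      also have "dir_deriv v (bidiff_expr L F G) x = bidiff_expr (concat (map ?d L)) F G x"
        using Cons.IH[OF smL] F G x by blast
      also have "dir_deriv v (\<lambda>x. \<gamma> x * ?F x * ?G x) x = bidiff_expr (?d c) F G x"
        unfolding e3 e2 by (simp add: c bidiff_expr_simps algebra_simps)
      finally show ?thesis by (simp add: bidiff_expr_simps)
    qed
    moreover have "\<forall>c\<in>set (concat (map ?d (c # L))). smooth_on T (fst c)"
      using Cons \<gamma> c smooth_on_dir_deriv by auto
    ultimately show ?case by blast
  qed
  then show ?thesis using that by blast
qed

lemma foldr_dir_deriv_bidiff_expr: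
  fixes L :: "(('e::real_normed_vector \<Rightarrow> 'k::real_normed_field) \<times> 'e list \<times> 'e list) list"
  assumes "open T" "\<And>c. c \<in> set L \<Longrightarrow> smooth_on T (fst c)"
  obtains L' where "\<And>c. c \<in> set L' \<Longrightarrow> smooth_on T (fst c)"
    "\<And>F G x. smooth_on T F \<Longrightarrow> smooth_on T G \<Longrightarrow> x \<in> T \<Longrightarrow>
       foldr dir_deriv us (bidiff_expr L F G) x = bidiff_expr L' F G x"
proof (induction us arbitrary: thesis)
  case Nil
  then show ?case using assms(2) by (metis foldr_Nil id_apply)
next
  case (Cons v us)
  obtain L' where L': "\<And>c. c \<in> set L' \<Longrightarrow> smooth_on T (fst c)"
    "\<And>F G x. smooth_on T F \<Longrightarrow> smooth_on T G \<Longrightarrow> x \<in> T \<Longrightarrow>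
       foldr dir_deriv us (bidiff_expr L F G) x = bidiff_expr L' F G x"
    using Cons.IH by blast
  obtain L'' where L'': "\<And>c. c \<in> set L'' \<Longrightarrow> smooth_on T (fst c)"
    "\<And>F G x. smooth_on T F \<Longrightarrow> smooth_on T G \<Longrightarrow> x \<in> T \<Longrightarrow>
       dir_deriv v (bidiff_expr L' F G) x = bidiff_expr L'' F G x"
    using dir_deriv_bidiff_expr[OF assms(1) L'(1)] by blast
  have "foldr dir_deriv (v # us) (bidiff_expr L F G) x = bidiff_expr L'' F G x"
    if "smooth_on T F" "smooth_on T G" "x \<in> T" for F G x
    using dir_deriv_cong[OF assms(1) that(3), of "foldr dir_deriv us (bidiff_expr L F G)" "bidiff_expr L' F G" v]
      L'(2) L''(2) that by simp
  then show ?case using Cons.prems[OF L''(1)] by blast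
qed

definition chart_seminorm ::
    "'m set \<times> ('m \<Rightarrow> 'e::real_normed_vector) \<Rightarrow> 'm set \<Rightarrow> 'e list \<Rightarrow> ('m \<Rightarrow> 'k::real_normed_field) \<Rightarrow> real" where
  "chart_seminorm c K vs f = (if K = {} then 0 else SUP p\<in>K. norm (chart_deriv c vs f p))"

context brst_setting
begin

definition seminorms :: "(('m \<Rightarrow> 'k) \<Rightarrow> real) set" where
  "seminorms = {chart_seminorm c K vs | c K vs. c \<in> M_atlas D \<and> compact K \<and> K \<subseteq> fst c}"

lemma CM_chart: "f \<in> CM D \<Longrightarrow> (U, \<phi>) \<in> M_atlas D \<Longrightarrow> smooth_on (\<phi> ` U) (f \<circ> inv_into U \<phi>)"
  by (auto simp: CM_def smooth_fun_def)

lemma continuous_on_chart: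
  assumes "(U, \<phi>) \<in> M_atlas D" "smooth_on (\<phi> ` U) F" "K \<subseteq> U"
  shows "continuous_on K (\<lambda>p. F (\<phi> p))"
proof -
  have "continuous_on (\<phi> ` U) F"
    using assms(2) by (intro differentiable_imp_continuous_on smooth_on_imp_differentiable)
  moreover have "continuous_on K \<phi>"
    using homeomorphism_cont1[OF chart_coverD(3)[OF M_cover assms(1)]] assms(3) continuous_on_subset by blast
  ultimately show ?thesis
    by (rule continuous_on_compose2) (use assms(3) in blast)
qed

lemma continuous_on_chart_deriv:
  assumes "c \<in> M_atlas D" "f \<in> CM D" "K \<subseteq> fst c"
  shows "continuous_on K (chart_deriv c vs f)"
proof -
  obtain U \<phi> where c: "c = (U, \<phi>)" by force
  then show ?thesis
    using continuous_on_chart[OF _ smooth_on_foldr_dir_deriv[OF CM_chart[OF assms(2)]], of U \<phi> K vs] assms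
    by (simp add: chart_deriv_def[abs_def])
qed

lemma norm_le_chart_seminorm:
  assumes "c \<in> M_atlas D" "f \<in> CM D" "compact K" "K \<subseteq> fst c" "p \<in> K"
  shows "norm (chart_deriv c vs f p) \<le> chart_seminorm c K vs f"
proof -
  have "compact ((\<lambda>p. norm (chart_deriv c vs f p)) ` K)"
    by (intro compact_continuous_image continuous_on_norm continuous_on_chart_deriv assms)
  then have "bdd_above ((\<lambda>p. norm (chart_deriv c vs f p)) ` K)"
    by (intro bounded_imp_bdd_above compact_imp_bounded)
  then show ?thesis
    using assms(5) by (auto simp: chart_seminorm_def intro: cSUP_upper)
qed

lemma chart_seminorm_le:
  assumes "\<And>p. p \<in> K \<Longrightarrow> norm (chart_deriv c vs f p) \<le> r" "0 \<le> r"
  shows "chart_seminorm c K vs f \<le> r"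
  using assms by (auto simp: chart_seminorm_def intro: cSUP_least)

lemma chart_seminorm_less_iff:
  assumes "c \<in> M_atlas D" "f \<in> CM D" "compact K" "K \<subseteq> fst c" "\<epsilon> > 0"
  shows "chart_seminorm c K vs f < \<epsilon> \<longleftrightarrow> (\<forall>p\<in>K. norm (chart_deriv c vs f p) < \<epsilon>)"
proof
  assume "chart_seminorm c K vs f < \<epsilon>"
  then show "\<forall>p\<in>K. norm (chart_deriv c vs f p) < \<epsilon>"
    using norm_le_chart_seminorm[OF assms(1-4), of _ vs] by fastforce
next
  assume *: "\<forall>p\<in>K. norm (chart_deriv c vs f p) < \<epsilon>"
  show "chart_seminorm c K vs f < \<epsilon>"
  proof (cases "K = {}")
    case False
    have "continuous_on K (\<lambda>p. norm (chart_deriv c vs f p))"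
      by (intro continuous_on_norm continuous_on_chart_deriv assms)
    then obtain p where p: "p \<in> K" "\<And>q. q \<in> K \<Longrightarrow> norm (chart_deriv c vs f q) \<le> norm (chart_deriv c vs f p)"
      using continuous_attains_sup[OF assms(3) False] by blast
    then have "chart_seminorm c K vs f \<le> norm (chart_deriv c vs f p)"
      by (intro chart_seminorm_le) auto
    then show ?thesis using * p(1) by fastforce
  qed (use assms(5) in \<open>simp add: chart_seminorm_def\<close>)
qed

lemma chart_deriv_linear:
  assumes "c \<in> M_atlas D" "f \<in> CM D" "p \<in> fst c"
  shows "g \<in> CM D \<Longrightarrow> chart_deriv c vs (f - g) p = chart_deriv c vs f p - chart_deriv c vs g p"
    and "chart_deriv c vs (fscale r f) p = r * chart_deriv c vs f p"
proof -
  obtain U \<phi> where c: "c = (U, \<phi>)" by force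
  have op: "open (\<phi> ` U)" using chart_coverD(2)[OF M_cover] assms(1) c by blast
  have p: "\<phi> p \<in> \<phi> ` U" using assms(3) c by simp
  have sc: "chart_deriv c vs (fscale k f) p = k * chart_deriv c vs f p" if "f \<in> CM D" for k and f :: "'m \<Rightarrow> 'k"
    using foldr_dir_deriv_bounded_linear[OF bounded_linear_mult_right op CM_chart[OF that] p] assms(1) c
    by (simp add: chart_deriv_def fscale_def comp_def)
  then show "chart_deriv c vs (fscale r f) p = r * chart_deriv c vs f p" using assms(2) by blast
  assume g: "g \<in> CM D"
  have "fscale (- 1) g \<in> CM D" by (rule CM_scale[OF g])
  then have "chart_deriv c vs (f + fscale (- 1) g) p = chart_deriv c vs f p + chart_deriv c vs (fscale (- 1) g) p"
    using foldr_dir_deriv_add[OF op CM_chart[OF assms(2)] CM_chart p, of "fscale (- 1) g" vs] assms(1) c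
    by (simp add: chart_deriv_def comp_def)
  moreover have "f + fscale (- 1) g = f - g" by (simp add: fun_eq_iff fscale_def)
  ultimately show "chart_deriv c vs (f - g) p = chart_deriv c vs f p - chart_deriv c vs g p"
    using sc[OF g, of "- 1"] by simp
qed

lemma chart_seminorm_nonneg:
  assumes "c \<in> M_atlas D" "f \<in> CM D" "compact K" "K \<subseteq> fst c"
  shows "0 \<le> chart_seminorm c K vs f"
proof (cases "K = {}")
  case False
  then obtain p where "p \<in> K" by blast
  then show ?thesis using norm_le_chart_seminorm[OF assms] norm_ge_zero order_trans by blast
qed (simp add: chart_seminorm_def)

sublocale CMs: seminorm_space "CM D" seminorms
proof
  show "0 \<in> CM D" by (rule CM_0)
  show "f - g \<in> CM D" if "f \<in> CM D" "g \<in> CM D" for f g using that by (rule CM_diff)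
  obtain U \<phi> where "(U, \<phi>) \<in> M_atlas D" by (rule chart_cover_obtain[OF M_cover])
  then have "chart_seminorm (U, \<phi>) {} [] \<in> seminorms"
    unfolding seminorms_def using compact_empty empty_subsetI by blast
  then show "seminorms \<noteq> {}" by blast
next
  fix q assume "q \<in> seminorms"
  then obtain c K vs where q: "q = chart_seminorm c K vs" "c \<in> M_atlas D" "compact K" "K \<subseteq> fst c"
    by (auto simp: seminorms_def)
  have "chart_seminorm c K vs (0 :: 'm \<Rightarrow> 'k) \<le> 0"
  proof (rule chart_seminorm_le)
    fix p assume "p \<in> K"
    then have "p \<in> fst c" using q(4) by blast
    then have "chart_deriv c vs ((0 :: 'm \<Rightarrow> 'k) - 0) p = chart_deriv c vs 0 p - chart_deriv c vs 0 p"
      by (rule chart_deriv_linear(1)[OF q(2) CM_0 _ CM_0])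
    then show "norm (chart_deriv c vs (0 :: 'm \<Rightarrow> 'k) p) \<le> 0" by simp
  qed simp
  then show "q 0 = 0" using chart_seminorm_nonneg[OF q(2) CM_0 q(3,4), of vs] q(1) by simp
  fix f g assume f: "f \<in> CM D" and g: "g \<in> CM D"
  have "chart_seminorm c K vs (f - g) \<le> chart_seminorm c K vs f + chart_seminorm c K vs g"
  proof (rule chart_seminorm_le)
    fix p assume p: "p \<in> K"
    have "norm (chart_deriv c vs (f - g) p) \<le> norm (chart_deriv c vs f p) + norm (chart_deriv c vs g p)"
      using chart_deriv_linear(1)[OF q(2) f _ g] p q(4) norm_triangle_ineq4 by fastforce
    then show "norm (chart_deriv c vs (f - g) p) \<le> chart_seminorm c K vs f + chart_seminorm c K vs g"
      using norm_le_chart_seminorm[OF q(2) f q(3,4) p, of vs] norm_le_chart_seminorm[OF q(2) g q(3,4) p, of vs]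
      by linarith
  qed (use chart_seminorm_nonneg q f g in \<open>simp add: add_nonneg_nonneg\<close>)
  then show "q (f - g) \<le> q f + q g" using q(1) by simp
qed

text \<open>
  On a compact set a continuous derivative is everywhere smaller than \<open>\<epsilon>\<close> iff its supremum is; so the subbasic sets of both topologies agree.
\<close>

lemma CM_topology_eq: "CM_topology D = seminorm_topology (CM D) seminorms"
proof -
  have eq: "{f \<in> CM D. chart_seminorm c K vs (f - g) < \<epsilon>}
      = {f \<in> CM D. \<forall>p\<in>K. norm (chart_deriv c vs (f - g) p) < \<epsilon>}"
    if "c \<in> M_atlas D" "compact K" "K \<subseteq> fst c" "g \<in> CM D" "\<epsilon> > 0" for c K vs g \<epsilon>
    using chart_seminorm_less_iff[OF that(1) CM_diff[OF _ that(4)] that(2,3,5)] by blast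
  have "{{f \<in> CM D. q (f - g) < \<epsilon>} | q g \<epsilon>. q \<in> seminorms \<and> g \<in> CM D \<and> \<epsilon> > 0}
      = {{f \<in> CM D. \<forall>p\<in>K. norm (chart_deriv c vs (f - g) p) < \<epsilon>} | K c vs g \<epsilon>.
        c \<in> M_atlas D \<and> compact K \<and> K \<subseteq> fst c \<and> g \<in> CM D \<and> (\<epsilon>::real) > 0}" (is "?A = ?B")
  proof (rule Set.set_eqI, rule iffI)
    fix S assume "S \<in> ?A"
    then obtain q g \<epsilon> where S: "S = {f \<in> CM D. q (f - g) < \<epsilon>}" "q \<in> seminorms" "g \<in> CM D" "\<epsilon> > 0"
      by blast
    then obtain c K vs where "q = chart_seminorm c K vs" "c \<in> M_atlas D" "compact K" "K \<subseteq> fst c"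
      unfolding seminorms_def by blast
    with S have "S = {f \<in> CM D. \<forall>p\<in>K. norm (chart_deriv c vs (f - g) p) < \<epsilon>} \<and>
        c \<in> M_atlas D \<and> compact K \<and> K \<subseteq> fst c \<and> g \<in> CM D \<and> \<epsilon> > 0"
      using eq[of c K g \<epsilon> vs] by simp
    then show "S \<in> ?B" by (intro CollectI exI)
  next
    fix S assume "S \<in> ?B"
    then obtain c K vs g \<epsilon> where S: "S = {f \<in> CM D. \<forall>p\<in>K. norm (chart_deriv c vs (f - g) p) < \<epsilon>}"
      "c \<in> M_atlas D" "compact K" "K \<subseteq> fst c" "g \<in> CM D" "\<epsilon> > 0" by blast
    have "S = {f \<in> CM D. chart_seminorm c K vs (f - g) < \<epsilon>}"
      using eq[OF S(2-6)] S(1) by simp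
    moreover have "chart_seminorm c K vs \<in> seminorms" using S(2-4) unfolding seminorms_def by blast
    ultimately have "S = {f \<in> CM D. chart_seminorm c K vs (f - g) < \<epsilon>} \<and>
        chart_seminorm c K vs \<in> seminorms \<and> g \<in> CM D \<and> \<epsilon> > 0"
      using S(5,6) by simp
    then show "S \<in> ?A" by (intro CollectI exI)
  qed
  then show ?thesis by (simp add: CM_topology_def seminorm_topology_def)
qed

lemma topspace_CM: "topspace (CM_topology D) = CM D"
  by (simp add: CM_topology_eq CMs.topspace_seminorm)

lemma continuous_res: "continuous_map (CM_topology D) (CZ_topology D) (res D)"
  unfolding CZ_topology_def by (rule continuous_map_to_quotient)

text \<open>
  In the chart \<open>c\<close> the derivative \<open>us\<close> of \<open>B u v\<close> is a bidifferential expression in \<open>u\<close> and \<open>v\<close>, whose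
  coefficients are bounded on the compact set \<open>K\<close>. This is the estimate that makes \<open>B\<close> jointly continuous.
\<close>

lemma bidifferential_bound:
  assumes B: "bidifferential D B" and q: "q \<in> seminorms"
  shows "\<exists>F C. finite F \<and> F \<subseteq> seminorms \<and>
    (\<forall>u\<in>CM D. \<forall>v\<in>CM D. q (B u v) \<le> C * (\<Sum>p\<in>F. p u) * (\<Sum>p\<in>F. p v))"
proof -
  obtain c K us where q': "q = chart_seminorm c K us" "c \<in> M_atlas D" "compact K" "K \<subseteq> fst c"
    using q by (auto simp: seminorms_def)
  obtain U \<phi> where c: "c = (U, \<phi>)" by force
  let ?T = "\<phi> ` U"
  have cU: "(U, \<phi>) \<in> M_atlas D" using q'(2) c by simp
  note ch = chart_coverD[OF M_cover cU]
  obtain I \<gamma> where I: "finite I"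
    and sm: "\<And>vs ws. (vs, ws) \<in> I \<Longrightarrow> smooth_on ?T (\<gamma> vs ws \<circ> inv_into U \<phi>)"
    and ex: "\<And>f g p. f \<in> CM D \<Longrightarrow> g \<in> CM D \<Longrightarrow> p \<in> U \<Longrightarrow>
      B f g p = (\<Sum>(vs, ws)\<in>I. \<gamma> vs ws p * chart_deriv c vs f p * chart_deriv c ws g p)"
    using B q'(2) c unfolding bidifferential_def by fastforce
  obtain xs where xs: "set xs = I" "distinct xs" using finite_distinct_list[OF I] by blast
  define L where "L = map (\<lambda>(vs, ws). (\<gamma> vs ws \<circ> inv_into U \<phi>, vs, ws)) xs"
  have smL: "smooth_on ?T (fst c)" if "c \<in> set L" for c
    using that sm xs(1) by (auto simp: L_def)
  have BL: "(B f g \<circ> inv_into U \<phi>) x = bidiff_expr L (f \<circ> inv_into U \<phi>) (g \<circ> inv_into U \<phi>) x"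
    if "f \<in> CM D" "g \<in> CM D" "x \<in> ?T" for f g x
  proof -
    have p: "inv_into U \<phi> x \<in> U" "\<phi> (inv_into U \<phi> x) = x"
      using that(3) by (auto simp: inv_into_into f_inv_into_f)
    have "(B f g \<circ> inv_into U \<phi>) x = (\<Sum>(vs, ws)\<in>set xs. (\<gamma> vs ws \<circ> inv_into U \<phi>) x *
        foldr dir_deriv vs (f \<circ> inv_into U \<phi>) x * foldr dir_deriv ws (g \<circ> inv_into U \<phi>) x)"
      using ex[OF that(1,2) p(1)] p(2) xs(1) by (simp add: chart_deriv_def c)
    also have "\<dots> = (\<Sum>(vs, ws)\<leftarrow>xs. (\<gamma> vs ws \<circ> inv_into U \<phi>) x *
        foldr dir_deriv vs (f \<circ> inv_into U \<phi>) x * foldr dir_deriv ws (g \<circ> inv_into U \<phi>) x)"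
      using xs(2) by (simp add: sum_list_distinct_conv_sum_set)
    also have "\<dots> = bidiff_expr (map (\<lambda>(vs, ws). (\<gamma> vs ws \<circ> inv_into U \<phi>, vs, ws)) ys)
        (f \<circ> inv_into U \<phi>) (g \<circ> inv_into U \<phi>) x" if "ys = xs" for ys
      unfolding that[symmetric] by (induction ys) (auto simp: bidiff_expr_simps)
    finally show ?thesis by (simp add: L_def)
  qed
  obtain L' where L': "\<And>c. c \<in> set L' \<Longrightarrow> smooth_on ?T (fst c)"
    "\<And>F G x. smooth_on ?T F \<Longrightarrow> smooth_on ?T G \<Longrightarrow> x \<in> ?T \<Longrightarrow>
       foldr dir_deriv us (bidiff_expr L F G) x = bidiff_expr L' F G x"
    using foldr_dir_deriv_bidiff_expr[where L = L and us = us, OF ch(2) smL] by blast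
  have der: "chart_deriv c us (B f g) p = bidiff_expr L' (f \<circ> inv_into U \<phi>) (g \<circ> inv_into U \<phi>) (\<phi> p)"
    if "f \<in> CM D" "g \<in> CM D" "p \<in> U" for f g p
  proof -
    have "chart_deriv c us (B f g) p
        = foldr dir_deriv us (bidiff_expr L (f \<circ> inv_into U \<phi>) (g \<circ> inv_into U \<phi>)) (\<phi> p)"
      unfolding chart_deriv_def c fst_conv snd_conv
      using BL[OF that(1,2)] that(3) by (intro foldr_dir_deriv_cong[OF ch(2)]) auto
    then show ?thesis using L'(2)[OF CM_chart[OF that(1) cU] CM_chart[OF that(2) cU]] that(3) by simp
  qed
  have bd: "\<exists>C W. C \<ge> 0 \<and> finite W \<and> (\<forall>u\<in>CM D. \<forall>v\<in>CM D. \<forall>p\<in>K.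
      norm (bidiff_expr L' (u \<circ> inv_into U \<phi>) (v \<circ> inv_into U \<phi>) (\<phi> p))
        \<le> C * (\<Sum>w\<in>W. chart_seminorm c K w u) * (\<Sum>w\<in>W. chart_seminorm c K w v))"
    using L'(1)
  proof (induction L')
    case Nil
    show ?case by (rule exI[of _ 0], rule exI[of _ "{}"]) (simp add: bidiff_expr_def)
  next
    case (Cons t L')
    obtain \<eta> vs ws where t: "t = (\<eta>, vs, ws)" by (cases t) auto
    obtain C W where CW: "C \<ge> 0" "finite W" "\<And>u v p. u \<in> CM D \<Longrightarrow> v \<in> CM D \<Longrightarrow> p \<in> K \<Longrightarrow>
      norm (bidiff_expr L' (u \<circ> inv_into U \<phi>) (v \<circ> inv_into U \<phi>) (\<phi> p))
        \<le> C * (\<Sum>w\<in>W. chart_seminorm c K w u) * (\<Sum>w\<in>W. chart_seminorm c K w v)"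
      using Cons.IH Cons.prems list.set_intros(2) by metis
    have "smooth_on ?T \<eta>" using Cons.prems[of t] t by simp
    then have "continuous_on K (\<lambda>p. \<eta> (\<phi> p))"
      using q'(4) c by (intro continuous_on_chart[OF cU]) simp_all
    then have "bounded ((\<lambda>p. \<eta> (\<phi> p)) ` K)"
      using q'(3) by (intro compact_imp_bounded compact_continuous_image)
    then obtain E where E: "E > 0" "\<And>p. p \<in> K \<Longrightarrow> norm (\<eta> (\<phi> p)) \<le> E"
      unfolding bounded_pos by blast
    define W' where "W' = W \<union> {vs, ws}"
    have fin: "finite W'" using CW(2) by (simp add: W'_def)
    let ?P = "\<lambda>W u. \<Sum>w\<in>W. chart_seminorm c K w u"
    have nn: "0 \<le> chart_seminorm c K w u" if "u \<in> CM D" for u w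
      by (rule chart_seminorm_nonneg[OF q'(2) that q'(3,4)])
    have "norm (bidiff_expr (t # L') (u \<circ> inv_into U \<phi>) (v \<circ> inv_into U \<phi>) (\<phi> p)) \<le> (E + C) * ?P W' u * ?P W' v"
      if u: "u \<in> CM D" and v: "v \<in> CM D" and p: "p \<in> K" for u v p
    proof -
      have W: "?P W u \<le> ?P W' u" "?P W v \<le> ?P W' v" "0 \<le> ?P W' u" "0 \<le> ?P W' v" "0 \<le> ?P W u" "0 \<le> ?P W v"
        using nn u v fin by (auto intro!: sum_mono2 sum_nonneg simp: W'_def)
      have vu: "norm (chart_deriv c vs u p) \<le> ?P W' u"
        using norm_le_chart_seminorm[OF q'(2) u q'(3,4) p, of vs]
          member_le_sum[of vs W' "\<lambda>w. chart_seminorm c K w u"] nn[OF u] fin by (auto simp: W'_def)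
      have wv: "norm (chart_deriv c ws v p) \<le> ?P W' v"
        using norm_le_chart_seminorm[OF q'(2) v q'(3,4) p, of ws]
          member_le_sum[of ws W' "\<lambda>w. chart_seminorm c K w v"] nn[OF v] fin by (auto simp: W'_def)
      have "norm (bidiff_expr (t # L') (u \<circ> inv_into U \<phi>) (v \<circ> inv_into U \<phi>) (\<phi> p))
          \<le> norm (\<eta> (\<phi> p) * chart_deriv c vs u p * chart_deriv c ws v p)
            + norm (bidiff_expr L' (u \<circ> inv_into U \<phi>) (v \<circ> inv_into U \<phi>) (\<phi> p))"
        unfolding t bidiff_expr_simps chart_deriv_def c fst_conv snd_conv by (rule norm_triangle_ineq)
      also have "norm (\<eta> (\<phi> p) * chart_deriv c vs u p * chart_deriv c ws v p) \<le> E * ?P W' u * ?P W' v"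
        unfolding norm_mult using E(2)[OF p] E(1) vu wv W by (intro mult_mono mult_nonneg_nonneg) auto
      also have "norm (bidiff_expr L' (u \<circ> inv_into U \<phi>) (v \<circ> inv_into U \<phi>) (\<phi> p)) \<le> C * ?P W' u * ?P W' v"
        using CW(3)[OF u v p] mult_mono[OF mult_mono[OF order_refl[of C] W(1)] W(2)] CW(1) W
        by (smt (verit) mult_nonneg_nonneg)
      finally show ?thesis by (simp add: algebra_simps)
    qed
    moreover have "0 \<le> E + C" using E(1) CW(1) by simp
    ultimately show ?case using fin by blast
  qed
  then obtain C W where CW: "C \<ge> 0" "finite W" "\<And>u v p. u \<in> CM D \<Longrightarrow> v \<in> CM D \<Longrightarrow> p \<in> K \<Longrightarrow>
      norm (bidiff_expr L' (u \<circ> inv_into U \<phi>) (v \<circ> inv_into U \<phi>) (\<phi> p))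
        \<le> C * (\<Sum>w\<in>W. chart_seminorm c K w u) * (\<Sum>w\<in>W. chart_seminorm c K w v)"
    by blast
  define F :: "(('m \<Rightarrow> 'k) \<Rightarrow> real) set" where "F = chart_seminorm c K ` W"
  let ?P = "\<lambda>u. \<Sum>w\<in>W. chart_seminorm c K w u"
  let ?N = "real (card W) + 1"
  have F: "finite F" "F \<subseteq> seminorms" using CW(2) q'(2-4) unfolding F_def seminorms_def by blast+
  have nnF: "0 \<le> (\<Sum>p\<in>F. p u)" if "u \<in> CM D" for u
    using CMs.q_nonneg[OF _ that] F(2) by (intro sum_nonneg) auto
  \<comment> \<open>Distinct multi-indices may give the same seminorm, hence the factor.\<close>
  have PF: "?P u \<le> ?N * (\<Sum>p\<in>F. p u)" if u: "u \<in> CM D" for u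
  proof -
    have "chart_seminorm c K w u \<le> (\<Sum>p\<in>F. p u)" if "w \<in> W" for w
      using member_le_sum[of "chart_seminorm c K w" F "\<lambda>p. p u"] F CMs.q_nonneg[OF _ u] that
      by (auto simp: F_def)
    then have "?P u \<le> (\<Sum>w\<in>W. \<Sum>p\<in>F. p u)" by (rule sum_mono)
    also have "\<dots> \<le> ?N * (\<Sum>p\<in>F. p u)" using nnF[OF u] by (simp add: algebra_simps)
    finally show ?thesis .
  qed
  have "q (B u v) \<le> (C * ?N * ?N) * (\<Sum>p\<in>F. p u) * (\<Sum>p\<in>F. p v)" if u: "u \<in> CM D" and v: "v \<in> CM D" for u v
    unfolding q'(1)
  proof (rule chart_seminorm_le)
    fix p assume p: "p \<in> K"
    have nn: "0 \<le> ?P u" "0 \<le> ?P v"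
      using chart_seminorm_nonneg[OF q'(2) _ q'(3,4)] u v by (auto intro!: sum_nonneg)
    have "p \<in> U" using p q'(4) c by auto
    then have "norm (chart_deriv c us (B u v) p) \<le> C * (?P u * ?P v)"
      using CW(3)[OF u v p] der[OF u v] by (simp add: mult.assoc)
    also have "\<dots> \<le> C * ((?N * (\<Sum>p\<in>F. p u)) * (?N * (\<Sum>p\<in>F. p v)))"
      using PF u v nn nnF CW(1) by (intro mult_left_mono mult_mono mult_nonneg_nonneg) auto
    finally show "norm (chart_deriv c us (B u v) p) \<le> (C * ?N * ?N) * (\<Sum>p\<in>F. p u) * (\<Sum>p\<in>F. p v)"
      by (simp add: mult.assoc mult.left_commute)
  qed (use nnF u v CW(1) in \<open>auto intro!: mult_nonneg_nonneg\<close>)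
  then show ?thesis using F by blast
qed

lemma bidifferential_bilinear:
  assumes "bidifferential D B"
  shows "u \<in> CM D \<Longrightarrow> v \<in> CM D \<Longrightarrow> B u v \<in> CM D"
    and "u \<in> CM D \<Longrightarrow> u' \<in> CM D \<Longrightarrow> v \<in> CM D \<Longrightarrow> B (u + u') v = B u v + B u' v"
    and "u \<in> CM D \<Longrightarrow> v \<in> CM D \<Longrightarrow> v' \<in> CM D \<Longrightarrow> B u (v + v') = B u v + B u v'"
    and "u \<in> CM D \<Longrightarrow> v \<in> CM D \<Longrightarrow> B (fscale k u) v = fscale k (B u v)"
    and "u \<in> CM D \<Longrightarrow> v \<in> CM D \<Longrightarrow> B u (fscale k v) = fscale k (B u v)"
  using assms unfolding bidifferential_def bilinear_op_def linear_map_def by blast+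

lemma continuous_map_bidifferential:
  assumes "bidifferential D B" "continuous_map X (CM_topology D) f" "continuous_map X (CM_topology D) g"
  shows "continuous_map X (CM_topology D) (\<lambda>x. B (f x) (g x))"
  using assms(2,3) unfolding CM_topology_eq
  by (rule CMs.continuous_map_bilinear)
    (fact bidifferential_bilinear[OF assms(1)] bidifferential_bound[OF assms(1)])+

lemma continuous_map_CM_scale:
  assumes "continuous_map X (CM_topology D) f"
  shows "continuous_map X (CM_topology D) (\<lambda>x. fscale k (f x))"
  using assms unfolding CM_topology_eq
proof (rule CMs.continuous_map_linear[where C = "norm k"])
  show "fscale k u \<in> CM D" if "u \<in> CM D" for u using that by (rule CM_scale)
  show "fscale k (u - v) = fscale k u - fscale k v" for u v :: "'m \<Rightarrow> 'k"
    by (simp add: fscale_def fun_eq_iff algebra_simps)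
  fix q u assume q: "q \<in> seminorms" and u: "u \<in> CM D"
  then obtain c K vs where q': "q = chart_seminorm c K vs" "c \<in> M_atlas D" "compact K" "K \<subseteq> fst c"
    by (auto simp: seminorms_def)
  show "q (fscale k u) \<le> norm k * q u"
    unfolding q'(1)
  proof (rule chart_seminorm_le)
    fix p assume p: "p \<in> K"
    then have "chart_deriv c vs (fscale k u) p = k * chart_deriv c vs u p"
      using chart_deriv_linear(2)[OF q'(2) u] q'(4) by blast
    then show "norm (chart_deriv c vs (fscale k u) p) \<le> norm k * chart_seminorm c K vs u"
      using norm_le_chart_seminorm[OF q'(2) u q'(3,4) p, of vs] by (simp add: norm_mult mult_left_mono)
  qed (simp add: chart_seminorm_nonneg[OF q'(2) u q'(3,4)])
qed

lemma continuous_map_CM_sum: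
  "(\<And>i. i \<in> I \<Longrightarrow> continuous_map X (CM_topology D) (f i)) \<Longrightarrow>
    continuous_map X (CM_topology D) (\<lambda>x. \<Sum>i\<in>I. f i x)"
  unfolding CM_topology_eq by (rule CMs.continuous_map_setsum)

end

section \<open>Grassmann calculus on tensors\<close>

lemma signed_simps [simp]:
  "signed n 0 = 0"
  "signed 0 x = x"
  "signed (Suc n) x = - signed n x"
  "signed n (signed m x) = signed (n + m) x"
  by (auto simp: signed_def)

lemma signed_cong: "even (m + n) \<Longrightarrow> signed m x = signed n x"
  by (auto simp: signed_def)

lemma signed_add: "signed n (x + y) = signed n x + signed n y"
  and signed_minus: "signed n (- x) = - signed n x"
  and signed_diff: "signed n (x - y) = signed n x - signed n y"
  by (auto simp: signed_def)

lemma signed_sum: "signed n (\<Sum>i\<in>I. f i) = (\<Sum>i\<in>I. signed n (f i))"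
  by (simp add: signed_def sum_negf)

lemma signed_mult: "signed n (c * x) = (c :: 'c::ring) * signed n x"
  by (simp add: signed_def)

text \<open>Every sign below counts the generators of a monomial preceding a given one.\<close>

definition below :: "nat set \<Rightarrow> nat \<Rightarrow> nat" where
  "below S i = card {s \<in> S. s < i}"

lemma below_insert: "j \<notin> S \<Longrightarrow> below (insert j S) i = below S i + (if j < i then 1 else 0)"
proof -
  assume j: "j \<notin> S"
  have "{s \<in> insert j S. s < i} = (if j < i then insert j {s \<in> S. s < i} else {s \<in> S. s < i})"
    by auto
  moreover have "finite {s \<in> S. s < i}" by (rule finite_subset[of _ "{..<i}"]) auto
  ultimately show ?thesis using j by (simp add: below_def)
qed

lemma inversions_eq_sum: "finite S \<Longrightarrow> finite T \<Longrightarrow> inversions S T = (\<Sum>s\<in>S. below T s)"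
proof -
  assume fin: "finite S" "finite T"
  have "{(s, t). s \<in> S \<and> t \<in> T \<and> t < s} = (SIGMA s:S. {t \<in> T. t < s})" by auto
  then show ?thesis using fin by (simp add: inversions_def below_def card_SigmaI)
qed

lemma inversions_insert_left:
  "\<lbrakk>finite S; finite T; i \<notin> S\<rbrakk> \<Longrightarrow> inversions (insert i S) T = inversions S T + below T i"
  by (simp add: inversions_eq_sum)

lemma inversions_insert_right:
  assumes "finite S" "finite T" "j \<notin> T" "j \<notin> S"
  shows "inversions S (insert j T) + below S j = inversions S T + card S"
  using assms(1,4)
proof (induction S rule: finite_induct)
  case empty
  show ?case using assms(2) by (simp add: inversions_eq_sum below_def)
next
  case (insert s S)
  then show ?case using assms(2,3)
    by (simp add: inversions_insert_left below_insert)
qed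

text \<open>
  Every pair of generators is an inversion in exactly one of the two orders.
\<close>

lemma inversions_swap:
  assumes "finite S" "finite T" "S \<inter> T = {}"
  shows "inversions S T + inversions T S = card S * card T"
  using assms(1,3)
proof (induction S rule: finite_induct)
  case empty
  show ?case using assms(2) by (simp add: inversions_eq_sum below_def)
next
  case (insert s S)
  then have "inversions T (insert s S) + below T s = inversions T S + card T"
    using assms(2) by (intro inversions_insert_right) auto
  then show ?case using insert assms(2) by (simp add: inversions_insert_left)
qed

lemma sum_Pow_insert:
  assumes "finite R" "i \<notin> R"
  shows "(\<Sum>S\<in>Pow (insert i R). g S) = (\<Sum>S\<in>Pow R. g S + g (insert i S))"
proof -
  have "inj_on (insert i) (Pow R)" using assms(2) by (auto simp: inj_on_def)
  then have "sum g (insert i ` Pow R) = (\<Sum>S\<in>Pow R. g (insert i S))"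
    by (simp add: sum.reindex)
  moreover have "Pow R \<inter> insert i ` Pow R = {}" using assms(2) by blast
  ultimately show ?thesis
    using assms(1) by (simp add: Pow_insert sum.union_disjoint sum.distrib)
qed

text \<open>Exterior multiplication by a generator from the left.\<close>

definition wedge :: "nat \<Rightarrow> 'c::ab_group_add grass \<Rightarrow> 'c grass" where
  "wedge i x = (\<lambda>T. if i \<in> T then signed (below T i) (x (T - {i})) else 0)"

lemma wedge_insert: "i \<notin> T \<Longrightarrow> wedge i x (insert i T) = signed (below T i) (x T)"
  by (simp add: wedge_def below_insert)

lemma wedge_notin: "i \<notin> T \<Longrightarrow> wedge i x T = 0"
  by (simp add: wedge_def)

lemma gder_eq: "gder i x T = (if i \<in> T then 0 else signed (below T i) (x (insert i T)))"
  by (simp add: gder_def below_def)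

text \<open>
  On tensors, \<open>wedge1\<close> and \<open>gder1\<close> act on the first factor and \<open>gder2\<close> on the second one, with the
  Koszul sign for moving past the first factor.
\<close>

definition wedge1 :: "nat \<Rightarrow> (nat set \<Rightarrow> 'c::ab_group_add grass) \<Rightarrow> nat set \<Rightarrow> 'c grass" where
  "wedge1 i t = (\<lambda>S T. wedge i (\<lambda>S'. t S' T) S)"

definition gder1 :: "nat \<Rightarrow> (nat set \<Rightarrow> 'c::ab_group_add grass) \<Rightarrow> nat set \<Rightarrow> 'c grass" where
  "gder1 j t = (\<lambda>S T. gder j (\<lambda>S'. t S' T) S)"

definition gder2 :: "nat \<Rightarrow> (nat set \<Rightarrow> 'c::ab_group_add grass) \<Rightarrow> nat set \<Rightarrow> 'c grass" where
  "gder2 j t = (\<lambda>S T. signed (card S) (gder j (t S) T))"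

text \<open>
  Multiplication \<open>\<mu>\<close> of a tensor, given by its coefficients at pairs of monomials.
\<close>

definition gprod :: "(nat set \<Rightarrow> 'c::ab_group_add grass) \<Rightarrow> 'c grass" where
  "gprod t = (\<lambda>R. \<Sum>S\<in>Pow R. signed (inversions S (R - S)) (t S (R - S)))"

lemma gprod_infinite: "infinite R \<Longrightarrow> gprod t R = 0"
  by (simp add: gprod_def)

lemma gprod_cong: "(\<And>S T. finite S \<Longrightarrow> t S T = t' S T) \<Longrightarrow> gprod t = gprod t'"
proof
  fix R assume *: "\<And>S T. finite S \<Longrightarrow> t S T = t' S T"
  show "gprod t R = gprod t' R"
  proof (cases "finite R")
    case True
    show ?thesis unfolding gprod_def
    proof (rule sum.cong[OF refl])
      fix S assume "S \<in> Pow R"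
      then have "finite S" using True finite_subset by blast
      then show "signed (inversions S (R - S)) (t S (R - S)) = signed (inversions S (R - S)) (t' S (R - S))"
        by (simp only: *)
    qed
  qed (simp add: gprod_infinite)
qed

lemma gprod_add: "gprod (\<lambda>S T. t S T + t' S T) = gprod t + gprod t'"
  by (rule ext) (simp add: gprod_def signed_add sum.distrib)

lemma gprod_mult: "gprod (\<lambda>S T. c * t S T) = gscale (c :: 'c::comm_ring_1) (gprod t)"
  by (rule ext) (simp add: gprod_def signed_mult sum_distrib_left gscale_def)

text \<open>
  A generator multiplied to the first factor can be pulled out of the product; the signs match because
  \<open>below R i\<close> splits into the generators in \<open>S\<close>, passed inside the first factor, and those in \<open>R - S\<close>, counted as
  inversions.
\<close>

lemma gprod_wedge1: "gprod (wedge1 i t) = wedge i (gprod t)"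
proof
  fix R
  show "gprod (wedge1 i t) R = wedge i (gprod t) R"
  proof (cases "finite R \<and> i \<in> R")
    case False
    show ?thesis
    proof (cases "i \<in> R")
      case True
      with False show ?thesis by (simp add: gprod_infinite wedge_def)
    next
      case False
      then have "gprod (wedge1 i t) R = (\<Sum>S\<in>Pow R. 0)"
        unfolding gprod_def by (intro sum.cong) (auto simp: wedge1_def wedge_def)
      with False show ?thesis by (simp add: wedge_def)
    qed
  next
    case True
    define R0 where "R0 = R - {i}"
    have R: "R = insert i R0" "i \<notin> R0" "finite R0" using True by (auto simp: R0_def)
    have "gprod (wedge1 i t) R = (\<Sum>S\<in>Pow R0.
        signed (inversions S (R - S)) (wedge1 i t S (R - S))
        + signed (inversions (insert i S) (R - insert i S)) (wedge1 i t (insert i S) (R - insert i S)))"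
      unfolding gprod_def R(1) by (rule sum_Pow_insert[OF R(3,2)])
    also have "\<dots> = (\<Sum>S\<in>Pow R0. signed (below R0 i) (signed (inversions S (R0 - S)) (t S (R0 - S))))"
    proof (rule sum.cong[OF refl])
      fix S assume S: "S \<in> Pow R0"
      then have fin: "finite S" "finite (R0 - S)" and i: "i \<notin> S" using R finite_subset by auto
      have RS: "R - insert i S = R0 - S" using R i by auto
      have "below R0 i = below S i + below (R0 - S) i"
      proof -
        have "{s \<in> R0. s < i} = {s \<in> S. s < i} \<union> {s \<in> R0 - S. s < i}" using S by auto
        moreover have "{s \<in> S. s < i} \<inter> {s \<in> R0 - S. s < i} = {}" by auto
        ultimately show ?thesis using fin by (simp add: below_def card_Un_disjoint)
      qed
      then have "signed (inversions (insert i S) (R0 - S)) (wedge1 i t (insert i S) (R0 - S))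
          = signed (below R0 i) (signed (inversions S (R0 - S)) (t S (R0 - S)))"
        using i fin by (simp add: wedge1_def wedge_insert inversions_insert_left)
          (rule signed_cong, auto)
      moreover have "wedge1 i t S (R - S) = 0" using i by (simp add: wedge1_def wedge_notin)
      ultimately show "signed (inversions S (R - S)) (wedge1 i t S (R - S))
        + signed (inversions (insert i S) (R - insert i S)) (wedge1 i t (insert i S) (R - insert i S))
        = signed (below R0 i) (signed (inversions S (R0 - S)) (t S (R0 - S)))" using RS by simp
    qed
    also have "\<dots> = wedge i (gprod t) R"
      unfolding R(1) wedge_insert[OF R(2)] by (simp only: gprod_def signed_sum)
    finally show ?thesis .
  qed
qed

text \<open>The Leibniz rule of the left derivations.\<close>

lemma gprod_gder: "gprod (gder1 j t) R + gprod (gder2 j t) R = gder j (gprod t) R"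
proof (cases "finite R")
  case False
  then show ?thesis by (simp add: gprod_infinite gder_eq)
next
  case fR: True
  show ?thesis
  proof (cases "j \<in> R")
    case False
    have "gder j (gprod t) R = signed (below R j) (\<Sum>S\<in>Pow R.
        signed (inversions S (insert j R - S)) (t S (insert j R - S))
        + signed (inversions (insert j S) (insert j R - insert j S)) (t (insert j S) (insert j R - insert j S)))"
      unfolding gder_eq gprod_def sum_Pow_insert[OF fR False] using False by simp
    also have "\<dots> = (\<Sum>S\<in>Pow R. signed (inversions S (R - S)) (gder1 j t S (R - S))
        + signed (inversions S (R - S)) (gder2 j t S (R - S)))"
      unfolding signed_sum
    proof (rule sum.cong[OF refl])
      fix S assume S: "S \<in> Pow R"
      then have fin: "finite S" "finite (R - S)" and j: "j \<notin> S" "j \<notin> R - S"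
        using fR False finite_subset by auto
      have RS: "insert j R - S = insert j (R - S)" "insert j R - insert j S = R - S" using j False by auto
      have b: "below R j = below S j + below (R - S) j"
      proof -
        have "{s \<in> R. s < j} = {s \<in> S. s < j} \<union> {s \<in> R - S. s < j}" using S by auto
        moreover have "{s \<in> S. s < j} \<inter> {s \<in> R - S. s < j} = {}" by auto
        ultimately show ?thesis using fin by (simp add: below_def card_Un_disjoint)
      qed
      have "inversions S (insert j (R - S)) + below S j = inversions S (R - S) + card S"
        by (rule inversions_insert_right[OF fin j(2,1)])
      then have "even (below R j + inversions S (insert j (R - S)) + (inversions S (R - S) + (card S + below (R - S) j)))"
        unfolding b by presburger
      then have 2: "signed (below R j) (signed (inversions S (insert j R - S)) (t S (insert j R - S)))
          = signed (inversions S (R - S)) (gder2 j t S (R - S))"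
        using j by (simp add: gder2_def gder_eq RS) (rule signed_cong, simp)
      have 1: "signed (below R j) (signed (inversions (insert j S) (insert j R - insert j S))
            (t (insert j S) (insert j R - insert j S)))
          = signed (inversions S (R - S)) (gder1 j t S (R - S))"
        using j fin by (simp add: gder1_def gder_eq RS inversions_insert_left b) (rule signed_cong, auto)
      show "signed (below R j) (signed (inversions S (insert j R - S)) (t S (insert j R - S))
          + signed (inversions (insert j S) (insert j R - insert j S)) (t (insert j S) (insert j R - insert j S)))
        = signed (inversions S (R - S)) (gder1 j t S (R - S)) + signed (inversions S (R - S)) (gder2 j t S (R - S))"
        by (simp only: signed_add 1 2 add.commute)
    qed
    finally show ?thesis by (simp only: gprod_def sum.distrib)
  next
    case True
    define R0 where "R0 = R - {j}"
    have R: "R = insert j R0" "j \<notin> R0" "finite R0" using True fR by (auto simp: R0_def)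
    let ?f = "\<lambda>S. signed (inversions S (R - S)) (gder1 j t S (R - S) + gder2 j t S (R - S))"
    have "gprod (gder1 j t) R + gprod (gder2 j t) R = (\<Sum>S\<in>Pow R. ?f S)"
      by (simp only: gprod_def signed_add sum.distrib)
    also have "\<dots> = (\<Sum>S\<in>Pow R0. ?f S + ?f (insert j S))"
      unfolding R(1) by (rule sum_Pow_insert[OF R(3,2)])
    also have "\<dots> = (\<Sum>S\<in>Pow R0. 0)"
    proof (rule sum.cong[OF refl])
      fix S assume S: "S \<in> Pow R0"
      then have fin: "finite S" "finite (R0 - S)" and j: "j \<notin> S" "j \<notin> R0 - S" using R finite_subset by auto
      have RS: "R - S = insert j (R0 - S)" "R - insert j S = R0 - S" using R j by auto
      have 1: "?f S = signed (inversions S (insert j (R0 - S)) + below S j) (t (insert j S) (insert j (R0 - S)))"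
        using j by (simp add: RS gder1_def gder2_def gder_eq)
      have 2: "?f (insert j S) = - signed (inversions S (R0 - S) + card S) (t (insert j S) (insert j (R0 - S)))"
        using j fin by (simp add: RS gder1_def gder2_def gder_eq inversions_insert_left signed_minus)
          (rule signed_cong, auto)
      show "?f S + ?f (insert j S) = 0"
        unfolding 1 2 inversions_insert_right[OF fin j(2,1)] by simp
    qed
    finally show ?thesis using True by (simp add: gder_eq)
  qed
qed

section \<open>The contraction\<close>

text \<open>
  The contraction is \<open>\<Sum>a. \<partial>/\<partial>\<xi>\<^sub>a \<otimes> \<partial>/\<partial>\<xi>\<^sup>a\<close>: the antighost is removed from the first
  factor and the ghost from the second.
\<close>

lemma contraction_eq:
  "contraction l t S T = (\<Sum>a<l. if ag a \<in> S \<or> gh a \<in> T then 0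
     else signed (Suc (card S) + below S (ag a) + below T (gh a)) (t (insert (ag a) S) (insert (gh a) T)))"
  unfolding contraction_def by (intro sum.cong) (auto simp: gder_eq signed_minus add.assoc)

lemma contraction_cong:
  assumes "\<And>S T. finite S \<Longrightarrow> t S T = t' S T" "finite S"
  shows "contraction l t S T = contraction l t' S T"
  unfolding contraction_eq
  by (rule sum.cong) (simp_all add: assms(1)[OF finite.insertI[OF assms(2)]])

lemma contraction_add: "contraction l (\<lambda>S T. t S T + t' S T) S T = contraction l t S T + contraction l t' S T"
  unfolding contraction_eq by (subst sum.distrib[symmetric]) (auto intro!: sum.cong simp: signed_add)

lemma contraction_mult:
  "contraction l (\<lambda>S T. c * t S T) S T = (c :: 'c::comm_ring_1) * contraction l t S T"
  unfolding contraction_eq sum_distrib_left by (auto intro!: sum.cong simp: signed_mult simp del: signed_simps)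

lemma contraction_funpow_add:
  "(contraction l ^^ k) (\<lambda>S T. t S T + t' S T) S T = (contraction l ^^ k) t S T + (contraction l ^^ k) t' S T"
proof (induction k arbitrary: S T)
  case (Suc k)
  then have "(contraction l ^^ k) (\<lambda>S T. t S T + t' S T)
      = (\<lambda>S T. (contraction l ^^ k) t S T + (contraction l ^^ k) t' S T)" by (intro ext)
  then show ?case by (simp add: contraction_add)
qed simp

lemma contraction_funpow_mult:
  "(contraction l ^^ k) (\<lambda>S T. c * t S T) S T = (c :: 'c::comm_ring_1) * (contraction l ^^ k) t S T"
proof (induction k arbitrary: S T)
  case (Suc k)
  then have "(contraction l ^^ k) (\<lambda>S T. c * t S T) = (\<lambda>S T. c * (contraction l ^^ k) t S T)"
    by (intro ext)
  then show ?case by (simp add: contraction_mult)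
qed simp

lemma ag_inj [simp]: "ag a = ag b \<longleftrightarrow> a = b" and gh_inj [simp]: "gh a = gh b \<longleftrightarrow> a = b"
  by (auto simp: gh_def ag_def)

lemma contraction_gder1: "finite S \<Longrightarrow> contraction l (gder1 j t) S T = gder1 j (contraction l t) S T"
proof -
  assume S: "finite S"
  have "(if ag a \<in> S \<or> gh a \<in> T then 0
     else signed (Suc (card S) + below S (ag a) + below T (gh a)) (gder1 j t (insert (ag a) S) (insert (gh a) T)))
    = (if j \<in> S then 0 else signed (below S j) (if ag a \<in> insert j S \<or> gh a \<in> T then 0
     else signed (Suc (card (insert j S)) + below (insert j S) (ag a) + below T (gh a))
       (t (insert (ag a) (insert j S)) (insert (gh a) T))))" for a
    using S by (cases "j = ag a")
      (auto simp: gder1_def gder_eq below_insert insert_commute simp del: signed_simps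
        simp add: signed_simps(1,4) intro!: signed_cong)
  then show ?thesis
    by (auto simp: contraction_eq gder1_def[of j "contraction l t"] gder_eq signed_sum intro!: sum.cong)
qed

lemma contraction_gder2: "finite S \<Longrightarrow> contraction l (gder2 j t) S T = gder2 j (contraction l t) S T"
proof -
  assume S: "finite S"
  have "(if ag a \<in> S \<or> gh a \<in> T then 0
     else signed (Suc (card S) + below S (ag a) + below T (gh a)) (gder2 j t (insert (ag a) S) (insert (gh a) T)))
    = (if j \<in> T then 0 else signed (card S) (signed (below T j) (if ag a \<in> S \<or> gh a \<in> insert j T then 0
     else signed (Suc (card S) + below S (ag a) + below (insert j T) (gh a))
       (t (insert (ag a) S) (insert (gh a) (insert j T))))))" for a
    using S by (cases "j = gh a")
      (auto simp: gder2_def gder_eq below_insert insert_commute simp del: signed_simps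
        simp add: signed_simps(1,4) intro!: signed_cong)
  then show ?thesis
    by (auto simp: contraction_eq gder2_def[of j "contraction l t"] gder_eq signed_sum intro!: sum.cong)
qed

text \<open>
  The contraction differentiates the first factor in antighosts only. So a ghost is moved past it with
  matching signs, while an antighost leaves the derivation in its dual ghost on the second factor.
\<close>

lemma contraction_wedge1:
  assumes "finite S"
  shows "contraction l (wedge1 i t) S T
    = wedge1 i (contraction l t) S T - (\<Sum>a<l. if i = ag a then gder2 (gh a) t S T else 0)"
proof -
  have "(if ag a \<in> S \<or> gh a \<in> T then 0
     else signed (Suc (card S) + below S (ag a) + below T (gh a)) (wedge1 i t (insert (ag a) S) (insert (gh a) T)))
    = (if i \<in> S then signed (below S i) (if ag a \<in> S - {i} \<or> gh a \<in> T then 0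
     else signed (Suc (card (S - {i})) + below (S - {i}) (ag a) + below T (gh a))
       (t (insert (ag a) (S - {i})) (insert (gh a) T))) else 0)
     - (if i = ag a then gder2 (gh a) t S T else 0)" (is "?l = ?r - ?d") for a
  proof (cases "i \<in> S")
    case True
    define S0 where "S0 = S - {i}"
    have S0: "S = insert i S0" "i \<notin> S0" "finite S0" using True assms by (auto simp: S0_def)
    have S0': "insert i S0 - {i} = S0" using S0 by simp
    show ?thesis
    proof (cases "i = ag a")
      case True
      then show ?thesis
        using S0(2,3) unfolding S0(1) S0'
        by (auto simp: gder2_def gder_eq below_insert signed_def)
    next
      case False
      have ne: "insert (ag a) (insert i S0) = insert i (insert (ag a) S0)" by (rule insert_commute)
      show ?thesis
      proof (cases "ag a \<in> S0 \<or> gh a \<in> T")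
        case True
        then show ?thesis using False S0(2) unfolding S0(1) S0' by auto
      next
        case nT: False
        have "?l = signed (Suc (card (insert i S0)) + below (insert i S0) (ag a) + below T (gh a))
            (signed (below (insert (ag a) S0) i) (t (insert (ag a) S0) (insert (gh a) T)))"
          using nT False S0(2) unfolding S0(1) wedge1_def ne by (subst wedge_insert) auto
        also have "\<dots> = signed (below S0 i) (signed (Suc (card S0) + below S0 (ag a) + below T (gh a))
            (t (insert (ag a) S0) (insert (gh a) T)))"
          using nT False S0(2,3)
          by (auto simp: below_insert signed_def)
        finally show ?thesis using nT False S0(2) unfolding S0(1) S0' by (simp add: below_insert)
      qed
    qed
  next
    case False
    show ?thesis
    proof (cases "i = ag a")
      case True
      show ?thesis using False assms unfolding True
        by (auto simp: wedge1_def wedge_insert gder2_def gder_eq signed_def)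
    next
      case ne: False
      then show ?thesis using False by (simp add: wedge1_def wedge_def)
    qed
  qed
  then have "contraction l (wedge1 i t) S T = (\<Sum>a<l. (if i \<in> S then signed (below S i) (if ag a \<in> S - {i} \<or> gh a \<in> T then 0
     else signed (Suc (card (S - {i})) + below (S - {i}) (ag a) + below T (gh a))
       (t (insert (ag a) (S - {i})) (insert (gh a) T))) else 0)
     - (if i = ag a then gder2 (gh a) t S T else 0))"
    unfolding contraction_eq by (intro sum.cong refl)
  also have "\<dots> = wedge1 i (contraction l t) S T - (\<Sum>a<l. if i = ag a then gder2 (gh a) t S T else 0)"
    by (auto simp: sum_subtractf wedge1_def wedge_def contraction_eq signed_sum)
  finally show ?thesis .
qed

lemma contraction_funpow_gder1:
  "finite S \<Longrightarrow> (contraction l ^^ k) (gder1 j t) S T = gder1 j ((contraction l ^^ k) t) S T"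
proof (induction k arbitrary: S T)
  case (Suc k)
  then show ?case
    using contraction_cong[of "(contraction l ^^ k) (gder1 j t)" "gder1 j ((contraction l ^^ k) t)" S l T]
      contraction_gder1[of S l j "(contraction l ^^ k) t" T] by simp
qed simp

lemma contraction_funpow_ghost:
  assumes "even i"
  shows "finite S \<Longrightarrow> (contraction l ^^ k) (wedge1 i t) S T = wedge1 i ((contraction l ^^ k) t) S T"
proof (induction k arbitrary: S T)
  case (Suc k)
  have "i \<noteq> ag a" for a using assms by (auto simp: ag_def)
  then show ?case
    using Suc contraction_cong[of "(contraction l ^^ k) (wedge1 i t)" "wedge1 i ((contraction l ^^ k) t)" S l T]
      contraction_wedge1[of S l i "(contraction l ^^ k) t" T] by simp
qed simp

text \<open>
  A commutator with the contraction that itself commutes with the contraction: \<open>[C\<^sup>k, W] = k C\<^sup>k\<^sup>-\<^sup>1 [C, W]\<close>.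
  For \<open>k = 0\<close> the factor \<open>of_nat k\<close> makes the truncated exponent \<open>k - 1\<close> harmless.
\<close>

lemma contraction_funpow_antighost:
  fixes t :: "nat set \<Rightarrow> 'c::comm_ring_1 grass"
  assumes "a < l"
  shows "finite S \<Longrightarrow> (contraction l ^^ k) (wedge1 (ag a) t) S T
    = wedge1 (ag a) ((contraction l ^^ k) t) S T - of_nat k * gder2 (gh a) ((contraction l ^^ (k - 1)) t) S T"
proof (induction k arbitrary: S T)
  case (Suc k)
  let ?C = "contraction l"
  let ?u = "\<lambda>S T. wedge1 (ag a) ((?C ^^ k) t) S T + (- of_nat k) * gder2 (gh a) ((?C ^^ (k - 1)) t) S T"
  have "?C ((?C ^^ k) (wedge1 (ag a) t)) S T = ?C ?u S T"
    by (rule contraction_cong) (use Suc in auto)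
  also have "\<dots> = ?C (wedge1 (ag a) ((?C ^^ k) t)) S T + (- of_nat k) * ?C (gder2 (gh a) ((?C ^^ (k - 1)) t)) S T"
    by (simp only: contraction_add contraction_mult)
  also have "?C (gder2 (gh a) ((?C ^^ (k - 1)) t)) S T = gder2 (gh a) (?C ((?C ^^ (k - 1)) t)) S T"
    by (rule contraction_gder2[OF Suc.prems])
  also have "(- of_nat k) * gder2 (gh a) (?C ((?C ^^ (k - 1)) t)) S T = (- of_nat k) * gder2 (gh a) ((?C ^^ k) t) S T"
    by (cases k) simp_all
  also have "?C (wedge1 (ag a) ((?C ^^ k) t)) S T
      = wedge1 (ag a) (?C ((?C ^^ k) t)) S T - gder2 (gh a) ((?C ^^ k) t) S T"
    using contraction_wedge1[OF Suc.prems, of l "ag a" "(?C ^^ k) t" T] assms by (simp add: sum.delta)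
  finally show ?case by (simp add: algebra_simps)
qed simp

section \<open>The exponential of the contraction\<close>

text \<open>
  The series \<open>\<Sum>k. (-2 \<nu>)\<^sup>k / k! c\<^sub>k\<close>, whose coefficients are finite sums since the \<open>k\<close>-th term is divisible
  by \<open>\<nu>\<^sup>k\<close>.
\<close>

definition exp_series :: "(nat \<Rightarrow> ('m \<Rightarrow> 'k::real_normed_field) fps) \<Rightarrow> ('m \<Rightarrow> 'k) fps" where
  "exp_series c = Abs_fps (\<lambda>n. \<Sum>k\<le>n. fscale ((- 2) ^ k / fact k) (fps_nth (c k) (n - k)))"

lemma exp_contraction_eq: "exp_contraction l t S T = exp_series (\<lambda>k. (contraction l ^^ k) t S T)"
  by (simp add: exp_contraction_def exp_series_def)

lemma fscale_simps:
  fixes f g :: "'m \<Rightarrow> 'k::real_normed_field"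
  shows "fscale c (f + g) = fscale c f + fscale c g" "fscale c (- f) = - fscale c f" "fscale c 0 = (0 :: 'm \<Rightarrow> 'k)"
    "fscale c (f - g) = fscale c f - fscale c g" "fscale 1 f = f" "fscale 0 f = 0" "fscale c (fscale d f) = fscale (c * d) f"
    "fscale c (g * f) = g * fscale c f" "fscale c (f * g) = fscale c f * g"
  by (simp_all add: fscale_def fun_eq_iff algebra_simps)

lemma fscale_sum: "fscale c (\<Sum>i\<in>I. f i) = (\<Sum>i\<in>I. fscale (c :: 'k::real_normed_field) (f i))"
proof (induction I rule: infinite_finite_induct)
  case (insert x F)
  then show ?case by (simp only: sum.insert fscale_simps(1) not_False_eq_True)
qed (simp_all only: sum.infinite sum.empty fscale_simps(3) not_False_eq_True)

lemma exp_series_add: "exp_series (\<lambda>k. c k + d k) = exp_series c + exp_series d"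
  by (rule fps_ext) (simp add: exp_series_def fscale_simps sum.distrib)

lemma exp_series_uminus: "exp_series (\<lambda>k. - c k) = - exp_series c"
  by (rule fps_ext) (simp add: exp_series_def fscale_simps sum_negf)

lemma exp_series_0: "exp_series (\<lambda>k. 0) = 0"
  by (rule fps_ext) (simp add: exp_series_def fscale_simps)

lemma exp_series_signed: "exp_series (\<lambda>k. signed m (c k)) = signed m (exp_series c)"
  by (simp add: signed_def exp_series_uminus)

lemma exp_series_const: "exp_series (\<lambda>k. fps_const f * c k) = fps_const f * exp_series c"
proof (rule fps_ext)
  fix n
  show "fps_nth (exp_series (\<lambda>k. fps_const f * c k)) n = fps_nth (fps_const f * exp_series c) n"
    unfolding exp_series_def fps_nth_Abs_fps fps_mult_left_const_nth sum_distrib_left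
    by (intro sum.cong refl) (rule fscale_simps(8))
qed

lemma exp_series_X: "exp_series (\<lambda>k. fps_X * c k) = fps_X * exp_series c"
proof (rule fps_ext)
  fix n
  show "fps_nth (exp_series (\<lambda>k. fps_X * c k)) n = fps_nth (fps_X * exp_series c) n"
  proof (cases n)
    case (Suc m)
    have "(\<Sum>k\<le>m. fscale ((- 2) ^ k / fact k) (fps_nth (fps_X * c k) (Suc m - k)))
        = (\<Sum>k\<le>m. fscale ((- 2) ^ k / fact k) (fps_nth (c k) (m - k)))"
      by (intro sum.cong refl) (auto simp: Suc_diff_le)
    then show ?thesis by (simp add: exp_series_def Suc fscale_simps)
  qed (simp add: exp_series_def fscale_simps)
qed

lemma exp_series_single: "exp_series (\<lambda>k. if k = 0 then c else 0) = c"
proof (rule fps_ext)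
  fix n
  have "(\<Sum>k\<le>n. fscale ((- 2) ^ k / fact k) (fps_nth (if k = 0 then c else 0) (n - k)))
      = (\<Sum>k\<le>n. if k = 0 then fps_nth c n else 0)"
    by (intro sum.cong refl) (auto simp: fscale_simps)
  then show "fps_nth (exp_series (\<lambda>k. if k = 0 then c else 0)) n = fps_nth c n"
    by (simp add: exp_series_def)
qed

lemma fps_of_nat_mult_nth: "fps_nth (of_nat k * (F :: ('m \<Rightarrow> 'k::real_normed_field) fps)) n = fscale (of_nat k) (fps_nth F n)"
proof (induction k)
  case (Suc k)
  have "fscale (of_nat (Suc k)) f = f + fscale (of_nat k) f" for f :: "'m \<Rightarrow> 'k"
    by (simp add: fscale_def fun_eq_iff algebra_simps)
  then show ?case by (simp only: of_nat_Suc distrib_right mult_1 fps_add_nth Suc)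
qed (simp add: fscale_simps(6))

text \<open>The derivative of the exponential, \<open>\<Sum>k. k (-2 \<nu>)^k / k! c_(k-1) = -2 \<nu> \<Sum>k. (-2 \<nu>)^k / k! c_k\<close>.\<close>

lemma exp_series_deriv: "exp_series (\<lambda>k. of_nat k * c (k - 1)) = - (2 * fps_X * exp_series c)"
proof (rule fps_ext)
  fix n
  show "fps_nth (exp_series (\<lambda>k. of_nat k * c (k - 1))) n = fps_nth (- (2 * fps_X * exp_series c)) n"
  proof (cases n)
    case 0
    have two: "2 * fps_X * F = fps_X * F + fps_X * F" for F :: "('a \<Rightarrow> 'b) fps"
      by (simp only: mult_2 distrib_right)
    show ?thesis unfolding two 0 by (simp add: exp_series_def fscale_simps(3))
  next
    case (Suc m)
    have coef: "(- 2) ^ Suc k / fact (Suc k) * of_nat (Suc k) = (- 2) * ((- 2) ^ k / fact k :: 'b)" for k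
    proof -
      have "(fact (Suc k) :: 'b) = of_nat (Suc k) * fact k" by simp
      moreover have "(of_nat (Suc k) :: 'b) \<noteq> 0" by (simp only: of_nat_eq_0_iff)
      ultimately show ?thesis by (simp del: fact_Suc of_nat_Suc add: field_simps)
    qed
    have "fps_nth (exp_series (\<lambda>k. of_nat k * c (k - 1))) n
        = (\<Sum>k\<le>m. fscale ((- 2) ^ Suc k / fact (Suc k)) (fscale (of_nat (Suc k)) (fps_nth (c k) (m - k))))"
      unfolding exp_series_def fps_nth_Abs_fps Suc fps_of_nat_mult_nth
      by (subst sum.atMost_Suc_shift) (simp add: fscale_simps)
    also have "\<dots> = fscale (- 2) (\<Sum>k\<le>m. fscale ((- 2) ^ k / fact k) (fps_nth (c k) (m - k)))"
      unfolding fscale_sum fscale_simps(7) coef ..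
    also have "\<dots> = fps_nth (- (2 * fps_X * exp_series c)) n"
    proof -
      have two: "2 * fps_X * F = fps_X * F + fps_X * F" for F :: "('a \<Rightarrow> 'b) fps"
        by (simp only: mult_2 distrib_right)
      have "fscale (- 2) f = - (f + f)" for f :: "'a \<Rightarrow> 'b" by (simp add: fscale_def fun_eq_iff)
      then show ?thesis
        unfolding two Suc fps_neg_nth fps_add_nth fps_X_mult_nth exp_series_def fps_nth_Abs_fps
        by simp
    qed
    finally show ?thesis .
  qed
qed

lemma exp_contraction_add:
  "exp_contraction l (\<lambda>S T. t S T + t' S T) S T = exp_contraction l t S T + exp_contraction l t' S T"
  unfolding exp_contraction_eq contraction_funpow_add exp_series_add ..

lemma exp_contraction_X: "exp_contraction l (\<lambda>S T. fps_X * t S T) S T = fps_X * exp_contraction l t S T"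
  unfolding exp_contraction_eq contraction_funpow_mult exp_series_X ..

lemma exp_contraction_const:
  "exp_contraction l (\<lambda>S T. fps_const f * t S T) S T = fps_const f * exp_contraction l t S T"
  unfolding exp_contraction_eq contraction_funpow_mult exp_series_const ..

lemma exp_contraction_gder1:
  assumes "finite S"
  shows "exp_contraction l (gder1 j t) S T = gder1 j (exp_contraction l t) S T"
proof -
  have "exp_contraction l (gder1 j t) S T = exp_series (\<lambda>k. gder1 j ((contraction l ^^ k) t) S T)"
    unfolding exp_contraction_eq contraction_funpow_gder1[OF assms] ..
  then show ?thesis
    by (simp add: gder1_def gder_eq exp_contraction_eq exp_series_signed exp_series_0)
qed

lemma exp_contraction_ghost:
  assumes "even i" "finite S"
  shows "exp_contraction l (wedge1 i t) S T = wedge1 i (exp_contraction l t) S T"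
proof -
  have "exp_contraction l (wedge1 i t) S T = exp_series (\<lambda>k. wedge1 i ((contraction l ^^ k) t) S T)"
    unfolding exp_contraction_eq contraction_funpow_ghost[OF assms] ..
  then show ?thesis
    by (simp add: wedge1_def wedge_def exp_contraction_eq exp_series_signed exp_series_0)
qed

text \<open>
  The correction term \<open>2 \<nu> \<partial>/\<partial>\<xi>\<^sup>a\<close> on the second factor is what turns left multiplication by an
  antighost into \<open>lmul\<close> below.
\<close>

lemma exp_contraction_antighost:
  assumes "a < l" "finite S"
  shows "exp_contraction l (wedge1 (ag a) t) S T
    = wedge1 (ag a) (exp_contraction l t) S T + 2 * fps_X * gder2 (gh a) (exp_contraction l t) S T"
proof -
  let ?c = "\<lambda>k. (contraction l ^^ k) t"
  have "exp_contraction l (wedge1 (ag a) t) S T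
      = exp_series (\<lambda>k. wedge1 (ag a) (?c k) S T + - (of_nat k * gder2 (gh a) (?c (k - 1)) S T))"
    by (simp add: exp_contraction_eq contraction_funpow_antighost[OF assms])
  also have "\<dots> = exp_series (\<lambda>k. wedge1 (ag a) (?c k) S T) + 2 * fps_X * exp_series (\<lambda>k. gder2 (gh a) (?c k) S T)"
    unfolding exp_series_add exp_series_uminus
    using exp_series_deriv[of "\<lambda>k. gder2 (gh a) (?c k) S T"] by simp
  also have "exp_series (\<lambda>k. wedge1 (ag a) (?c k) S T) = wedge1 (ag a) (exp_contraction l t) S T"
    by (simp add: exp_contraction_eq wedge1_def wedge_def exp_series_signed exp_series_0)
  also have "exp_series (\<lambda>k. gder2 (gh a) (?c k) S T) = gder2 (gh a) (exp_contraction l t) S T"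
    by (simp add: exp_contraction_eq gder2_def gder_eq exp_series_signed exp_series_0)
  finally show ?thesis .
qed

text \<open>A contraction removes two generators in total, hence preserves the total parity.\<close>

lemma contraction_parity:
  assumes "finite S" "finite T"
  shows "contraction l (\<lambda>S T. signed (card S + card T) (t S T)) S T = signed (card S + card T) (contraction l t S T)"
  using assms unfolding contraction_eq signed_sum
  by (intro sum.cong refl) (auto simp: signed_def)

lemma contraction_funpow_parity:
  assumes "finite S" "finite T"
  shows "(contraction l ^^ k) (\<lambda>S T. signed (card S + card T) (t S T)) S T
    = signed (card S + card T) ((contraction l ^^ k) t S T)"
  using assms
proof (induction k arbitrary: S T)
  case (Suc k)
  have "contraction l ((contraction l ^^ k) (\<lambda>S T. signed (card S + card T) (t S T))) S T
     = contraction l (\<lambda>S T. signed (card S + card T) ((contraction l ^^ k) t S T)) S T"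
    unfolding contraction_eq[where S = S and T = T]
    by (rule sum.cong)
      (simp_all only: Suc.IH[OF finite.insertI[OF Suc.prems(1)] finite.insertI[OF Suc.prems(2)]])
  then show ?case by (simp only: funpow.simps comp_apply contraction_parity[OF Suc.prems])
qed simp

lemma gprod_exp_parity:
  "gprod (exp_contraction l (\<lambda>S T. signed (card S + card T) (t S T))) R
    = signed (card R) (gprod (exp_contraction l t) R)"
proof (cases "finite R")
  case True
  have "signed (inversions S (R - S)) (exp_contraction l (\<lambda>S T. signed (card S + card T) (t S T)) S (R - S))
    = signed (card R) (signed (inversions S (R - S)) (exp_contraction l t S (R - S)))" if S: "S \<in> Pow R" for S
  proof -
    have fin: "finite S" "finite (R - S)" using S True finite_subset by auto
    have "card S + card (R - S) = card R" using S True card_mono[of R S] by (auto simp: card_Diff_subset fin)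
    then have "exp_contraction l (\<lambda>S T. signed (card S + card T) (t S T)) S (R - S)
        = signed (card R) (exp_contraction l t S (R - S))"
      by (simp add: exp_contraction_eq contraction_funpow_parity[OF fin] exp_series_signed)
    then show ?thesis by (simp add: add.commute)
  qed
  then show ?thesis unfolding gprod_def signed_sum by (intro sum.cong refl)
qed (simp add: gprod_infinite)

text \<open>Each contraction removes a ghost and an antighost, so that the degree is additive.\<close>

lemma gdeg_insert: "finite S \<Longrightarrow> i \<notin> S \<Longrightarrow> gdeg (insert i S) = (if even i then 1 else - 1) + gdeg S"
  by (simp add: gdeg_def)

lemma contraction_funpow_support:
  assumes "\<And>S T. t S T \<noteq> 0 \<Longrightarrow> S \<subseteq> E \<and> T \<subseteq> E \<and> P (gdeg S + gdeg T)" "finite E"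
    and "(contraction l ^^ k) t S T \<noteq> 0"
  shows "S \<subseteq> E \<and> T \<subseteq> E \<and> P (gdeg S + gdeg T)"
  using assms(3)
proof (induction k arbitrary: S T)
  case 0
  then show ?case using assms(1) by simp
next
  case (Suc k)
  then have "contraction l ((contraction l ^^ k) t) S T \<noteq> 0" by simp
  have "\<exists>a. ag a \<notin> S \<and> gh a \<notin> T \<and> (contraction l ^^ k) t (insert (ag a) S) (insert (gh a) T) \<noteq> 0"
  proof (rule ccontr)
    assume "\<not> ?thesis"
    then have "contraction l ((contraction l ^^ k) t) S T = 0"
      unfolding contraction_eq[where S = S and T = T] by (intro sum.neutral) auto
    with \<open>contraction l ((contraction l ^^ k) t) S T \<noteq> 0\<close> show False by blast
  qed
  then obtain a where a: "ag a \<notin> S" "gh a \<notin> T" "(contraction l ^^ k) t (insert (ag a) S) (insert (gh a) T) \<noteq> 0"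
    by blast
  from Suc.IH[OF a(3)] have *: "insert (ag a) S \<subseteq> E" "insert (gh a) T \<subseteq> E"
    "P (gdeg (insert (ag a) S) + gdeg (insert (gh a) T))" by auto
  then have "finite S" "finite T" using assms(2) finite_subset by auto
  then have "gdeg (insert (ag a) S) = - 1 + gdeg S" "gdeg (insert (gh a) T) = 1 + gdeg T"
    using a(1,2) by (simp_all add: gdeg_insert, simp_all add: ag_def gh_def)
  then show ?case using * by simp
qed

lemma gprod_exp_support:
  assumes "\<And>S T. t S T \<noteq> 0 \<Longrightarrow> S \<subseteq> E \<and> T \<subseteq> E \<and> P (gdeg S + gdeg T)" "finite E"
    and "gprod (exp_contraction l t) R \<noteq> 0"
  shows "R \<subseteq> E \<and> P (gdeg R)"
proof -
  have fR: "finite R" using assms(3) gprod_infinite by blast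
  obtain S where S: "S \<in> Pow R" "exp_contraction l t S (R - S) \<noteq> 0"
    using assms(3) unfolding gprod_def by (metis (no_types, lifting) signed_simps(1) sum.neutral)
  have "\<exists>k. (contraction l ^^ k) t S (R - S) \<noteq> 0"
  proof (rule ccontr)
    assume "\<nexists>k. (contraction l ^^ k) t S (R - S) \<noteq> 0"
    then have "exp_contraction l t S (R - S) = 0" unfolding exp_contraction_eq using exp_series_0 by simp
    with S(2) show False by blast
  qed
  then obtain k where "(contraction l ^^ k) t S (R - S) \<noteq> 0" by blast
  from contraction_funpow_support[OF assms(1,2) this]
  have *: "S \<subseteq> E" "R - S \<subseteq> E" "P (gdeg S + gdeg (R - S))" by auto
  have "gdeg R = gdeg S + gdeg (R - S)"
    using S(1) fR unfolding gdeg_def by (subst sum.subset_diff[of S R]) auto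
  then show ?thesis using * by auto
qed

section \<open>Coefficient groups\<close>

definition add_closed :: "'c::ab_group_add set \<Rightarrow> bool" where
  "add_closed A \<longleftrightarrow> 0 \<in> A \<and> (\<forall>x\<in>A. \<forall>y\<in>A. x + y \<in> A) \<and> (\<forall>x\<in>A. - x \<in> A)"

lemma add_closedD:
  assumes "add_closed A"
  shows "0 \<in> A" "x \<in> A \<Longrightarrow> y \<in> A \<Longrightarrow> x + y \<in> A" "x \<in> A \<Longrightarrow> - x \<in> A"
    "x \<in> A \<Longrightarrow> y \<in> A \<Longrightarrow> x - y \<in> A" "x \<in> A \<Longrightarrow> signed n x \<in> A"
proof -
  show *: "0 \<in> A" "x \<in> A \<Longrightarrow> y \<in> A \<Longrightarrow> x + y \<in> A" "x \<in> A \<Longrightarrow> - x \<in> A" for x y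
    using assms by (auto simp: add_closed_def)
  show "x \<in> A \<Longrightarrow> y \<in> A \<Longrightarrow> x - y \<in> A" using *(2)[of x "- y"] *(3)[of y] by simp
  show "x \<in> A \<Longrightarrow> signed n x \<in> A" using *(3) by (simp add: signed_def)
qed

lemma add_closed_sum:
  assumes "add_closed A" "\<And>i. i \<in> I \<Longrightarrow> f i \<in> A"
  shows "sum f I \<in> A"
  using assms(2) by (induction I rule: infinite_finite_induct) (auto intro: add_closedD[OF assms(1)])

lemma add_closed_ser: "add_closed A \<Longrightarrow> add_closed (ser A)"
  by (auto simp: add_closed_def ser_def)

lemma sum_apply: "(\<Sum>i\<in>I. f i) x = (\<Sum>i\<in>I. f i x :: 'c::comm_monoid_add)"
  by (induction I rule: infinite_finite_induct) simp_all

lemma grass_over_iff: "x \<in> grass_over A E \<longleftrightarrow> (\<forall>S\<subseteq>E. x S \<in> A) \<and> (\<forall>S. \<not> S \<subseteq> E \<longrightarrow> x S = 0)"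
  by (auto simp: grass_over_def)

lemma grass_over_coeff: "add_closed A \<Longrightarrow> x \<in> grass_over A E \<Longrightarrow> x S \<in> A"
  by (cases "S \<subseteq> E") (auto simp: grass_over_iff dest: add_closedD)

lemma add_closed_grass_over: "add_closed A \<Longrightarrow> add_closed (grass_over A E)"
  unfolding add_closed_def Ball_def grass_over_iff by auto

lemma grass_over_wedge:
  assumes "add_closed A" "x \<in> grass_over A E" "i \<in> E"
  shows "wedge i x \<in> grass_over A E"
  unfolding grass_over_iff
proof (intro conjI allI impI)
  show "wedge i x S \<in> A" if "S \<subseteq> E" for S
    using add_closedD[OF assms(1)] grass_over_coeff[OF assms(1,2)] by (simp add: wedge_def)
  show "wedge i x S = 0" if "\<not> S \<subseteq> E" for S
  proof -
    have "\<not> S - {i} \<subseteq> E" using that assms(3) by blast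
    then show ?thesis using assms(2) by (simp add: wedge_def grass_over_iff)
  qed
qed

lemma grass_over_gder:
  assumes "add_closed A" "x \<in> grass_over A E"
  shows "gder i x \<in> grass_over A E"
  unfolding grass_over_iff
proof (intro conjI allI impI)
  show "gder i x S \<in> A" if "S \<subseteq> E" for S
    using add_closedD[OF assms(1)] grass_over_coeff[OF assms(1,2)] by (simp add: gder_eq)
  show "gder i x S = 0" if "\<not> S \<subseteq> E" for S
    using that assms(2) by (simp add: gder_eq grass_over_iff)
qed

lemma grass_over_emb: "add_closed A \<Longrightarrow> f \<in> A \<Longrightarrow> emb f \<in> grass_over A E"
  by (auto simp: grass_over_iff emb_def add_closed_def)

lemma contraction_funpow_mem:
  assumes "add_closed A" "\<And>S T. t S T \<in> A"
  shows "(contraction l ^^ k) t S T \<in> A"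
proof (induction k arbitrary: S T)
  case (Suc k)
  have "contraction l ((contraction l ^^ k) t) S T \<in> A"
    unfolding contraction_eq[where S = S and T = T]
    using Suc add_closedD[OF assms(1)] by (intro add_closed_sum[OF assms(1)]) simp
  then show ?case by simp
qed (simp add: assms(2))

lemma gmul_eq_gprod: "gmul a b = gprod (\<lambda>S T. a S * b T)"
  by (simp add: gmul_def gprod_def)

lemma gmul_wedge: "gmul (wedge i a) (b :: 'c::comm_ring_1 grass) = wedge i (gmul a b)"
proof -
  have "(\<lambda>S T. wedge i a S * b T) = wedge1 i (\<lambda>S T. a S * b T)"
    by (intro ext) (simp add: wedge1_def wedge_def signed_def)
  then show ?thesis by (simp add: gmul_eq_gprod gprod_wedge1)
qed

lemma inversions_empty [simp]: "inversions {} T = 0" "inversions S {} = 0"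
  by (simp_all add: inversions_def)

text \<open>
  With functions as first or second factor there is a single decomposition of a monomial, without inversions.
\<close>

lemma gprod_emb_left:
  assumes "\<And>S T. S \<noteq> {} \<Longrightarrow> t S T = 0" "finite R"
  shows "gprod t R = t {} R"
proof -
  have "gprod t R = (\<Sum>S\<in>Pow R. if S = {} then t {} R else 0)"
    unfolding gprod_def by (intro sum.cong refl) (auto simp: assms(1))
  then show ?thesis using assms(2) by simp
qed

lemma gprod_emb_right:
  assumes "\<And>S T. T \<noteq> {} \<Longrightarrow> t S T = 0" "finite R"
  shows "gprod t R = t R {}"
proof -
  have "gprod t R = (\<Sum>S\<in>Pow R. if S = R then t R {} else 0)"
    unfolding gprod_def by (intro sum.cong refl) (auto simp: assms(1))
  then show ?thesis using assms(2) by simp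
qed

lemma gmul_emb_1:
  assumes "\<And>R. infinite R \<Longrightarrow> b R = 0"
  shows "gmul (emb 1) b = (b :: 'c::comm_ring_1 grass)"
proof
  fix R
  show "gmul (emb 1) b R = b R"
  proof (cases "finite R")
    case True
    have "gprod (\<lambda>S T. emb 1 S * b T) R = emb 1 {} * b R"
      by (rule gprod_emb_left[OF _ True]) (simp add: emb_def)
    moreover have "emb 1 {} * b R = b R" by (simp add: emb_def)
    ultimately show ?thesis unfolding gmul_eq_gprod by (rule trans)
  qed (simp add: gmul_eq_gprod gprod_infinite assms)
qed

lemma gen_eq_wedge: "gen i = wedge i (emb (1 :: 'c::comm_ring_1))"
proof
  fix T
  show "gen i T = wedge i (emb (1 :: 'c)) T"
  proof (cases "T = {i}")
    case True
    have "below {i} i = 0" by (simp add: below_def)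
    then show ?thesis unfolding True by (simp add: gen_def wedge_def emb_def)
  next
    case False
    then have "i \<notin> T \<or> T - {i} \<noteq> {}" by blast
    then have "wedge i (emb (1 :: 'c)) T = 0" by (auto simp only: wedge_def emb_def if_False signed_simps split: if_split)
    then show ?thesis using False by (simp only: gen_def if_False)
  qed
qed

lemma gmul_gen:
  assumes "\<And>R. infinite R \<Longrightarrow> b R = 0"
  shows "gmul (gen i) b = wedge i (b :: 'c::comm_ring_1 grass)"
  by (simp add: gen_eq_wedge gmul_wedge gmul_emb_1[OF assms])

lemma gscale_wedge: "gscale c (wedge i x) = wedge i (gscale (c :: 'c::comm_ring_1) x)"
  by (rule ext) (simp add: gscale_def wedge_def signed_mult)

lemma gscale_emb: "gscale c (emb x) = emb (c * x :: 'c::comm_ring_1)"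
  by (rule ext) (simp add: gscale_def emb_def)

lemma gmul_gen_gen_gen:
  "gscale c (gmul (gmul (gen i) (gen j)) (gen k)) = wedge i (wedge j (wedge k (emb (c :: 'c::comm_ring_1))))"
proof -
  have w: "wedge k (emb (1::'c)) R = 0" if "infinite R" for k R
  proof -
    have "R - {k} \<noteq> {}" using that by (metis finite.emptyI finite_Diff_insert Diff_empty)
    then show ?thesis by (simp add: wedge_def emb_def)
  qed
  have g: "gmul (emb 1) (wedge k (emb (1::'c))) = wedge k (emb 1)" for k
    by (rule gmul_emb_1) (rule w)
  have "gmul (gmul (gen i) (gen j)) (gen k) = wedge i (gmul (wedge j (emb 1)) (wedge k (emb (1::'c))))"
    by (simp only: gen_eq_wedge gmul_wedge g)
  also have "\<dots> = wedge i (wedge j (wedge k (emb 1)))"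
    by (simp only: gmul_wedge g)
  finally show ?thesis by (simp add: gscale_wedge gscale_emb)
qed

section \<open>The star product\<close>

lemma fps_X_cancel: "fps_X * F = fps_X * (G :: 'c::comm_ring_1 fps) \<Longrightarrow> F = G"
  by (rule fps_ext) (metis fps_X_mult_nth diff_Suc_1 nat.distinct(1))

lemma scal_mult_nth: "fps_nth (scal c * F) n = fscale c (fps_nth F n)"
  by (simp add: scal_def fscale_def fun_eq_iff)

context brst_setting
begin

lemma CM_closed: "add_closed (CM D)"
  using CM_0 CM_add CM_minus by (auto simp: add_closed_def)

lemma CZ_closed: "add_closed (CZ D)"
  using CZ_0 CZ_add CZ_minus by (auto simp: add_closed_def)

abbreviation "SM \<equiv> ser (CM D)"

lemmas SM_closed = add_closed_ser[OF CM_closed]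
lemmas SM_0 = add_closedD(1)[OF SM_closed]
lemmas SM_add = add_closedD(2)[OF SM_closed]
lemmas SM_minus = add_closedD(3)[OF SM_closed]
lemmas SM_diff = add_closedD(4)[OF SM_closed]
lemmas SM_signed = add_closedD(5)[OF SM_closed]

lemma SM_X: "F \<in> SM \<Longrightarrow> fps_X * F \<in> SM"
  by (simp add: ser_def CM_0)

lemma SM_scal_mult: "F \<in> SM \<Longrightarrow> scal c * F \<in> SM"
  by (simp add: ser_def scal_mult_nth CM_scale)

lemma SM_const: "f \<in> CM D \<Longrightarrow> fps_const f \<in> SM"
  by (simp add: ser_def CM_0)

lemma SM_scal: "scal c \<in> SM"
  by (simp add: scal_def SM_const CM_const)

lemma SM_1: "1 \<in> SM"
  using SM_const[OF CM_1] by simp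

lemma mu_bidifferential: "bidifferential D (mu D i)"
  using starprod by (simp add: star_product_def)

lemmas mu_CM = bidifferential_bilinear(1)[OF mu_bidifferential]
lemmas mu_add_left = bidifferential_bilinear(2)[OF mu_bidifferential]
lemmas mu_add_right = bidifferential_bilinear(3)[OF mu_bidifferential]
lemmas mu_scale_left = bidifferential_bilinear(4)[OF mu_bidifferential]
lemmas mu_scale_right = bidifferential_bilinear(5)[OF mu_bidifferential]

lemma mu_0_left: "f \<in> CM D \<Longrightarrow> mu D i 0 f = 0"
  using mu_add_left[OF CM_0 CM_0, of f i] by simp

lemma mu_0_right: "f \<in> CM D \<Longrightarrow> mu D i f 0 = 0"
  using mu_add_right[OF _ CM_0 CM_0, of f i] by simp

lemma mu_0: "f \<in> CM D \<Longrightarrow> g \<in> CM D \<Longrightarrow> mu D 0 f g = f * g"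
  using starprod by (simp add: star_product_def)

lemma SM_nth: "F \<in> SM \<Longrightarrow> fps_nth F n \<in> CM D"
  by (simp add: ser_def)

lemma star_nth: "fps_nth (star D F G) n = (\<Sum>i\<le>n. \<Sum>j\<le>n - i. mu D i (fps_nth F j) (fps_nth G (n - i - j)))"
  by (simp add: star_def ser_bilin_def)

lemma star_SM: "F \<in> SM \<Longrightarrow> G \<in> SM \<Longrightarrow> star D F G \<in> SM"
  unfolding ser_def[of "CM D"] mem_Collect_eq star_nth by (intro allI CM_sum mu_CM) auto

lemma star_add_left: "F \<in> SM \<Longrightarrow> F' \<in> SM \<Longrightarrow> G \<in> SM \<Longrightarrow> star D (F + F') G = star D F G + star D F' G"
  by (rule fps_ext) (simp add: star_nth mu_add_left SM_nth sum.distrib)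

lemma star_add_right: "F \<in> SM \<Longrightarrow> G \<in> SM \<Longrightarrow> G' \<in> SM \<Longrightarrow> star D F (G + G') = star D F G + star D F G'"
  by (rule fps_ext) (simp add: star_nth mu_add_right SM_nth sum.distrib)

lemma star_0_left: "G \<in> SM \<Longrightarrow> star D 0 G = 0"
  using star_add_left[OF SM_0 SM_0, of G] by simp

lemma star_0_right: "F \<in> SM \<Longrightarrow> star D F 0 = 0"
  using star_add_right[OF _ SM_0 SM_0, of F] by simp

lemma star_minus_left: "F \<in> SM \<Longrightarrow> G \<in> SM \<Longrightarrow> star D (- F) G = - star D F G"
  using star_add_left[of F "- F" G] SM_minus[of F] star_0_left[of G] by (simp add: eq_neg_iff_add_eq_0 add.commute)

lemma star_minus_right: "F \<in> SM \<Longrightarrow> G \<in> SM \<Longrightarrow> star D F (- G) = - star D F G"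
  using star_add_right[of F G "- G"] SM_minus[of G] star_0_right[of F] by (simp add: eq_neg_iff_add_eq_0 add.commute)

lemma star_signed_left: "F \<in> SM \<Longrightarrow> G \<in> SM \<Longrightarrow> star D (signed n F) G = signed n (star D F G)"
  by (simp add: signed_def star_minus_left)

lemma star_signed_right: "F \<in> SM \<Longrightarrow> G \<in> SM \<Longrightarrow> star D F (signed n G) = signed n (star D F G)"
  by (simp add: signed_def star_minus_right)

lemma star_scal_left:
  assumes "F \<in> SM" "G \<in> SM"
  shows "star D (scal c * F) G = scal c * star D F G"
proof (rule fps_ext)
  fix n
  show "fps_nth (star D (scal c * F) G) n = fps_nth (scal c * star D F G) n"
    unfolding scal_mult_nth star_nth fscale_sum
    by (intro sum.cong refl) (simp add: scal_mult_nth mu_scale_left SM_nth assms)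
qed

lemma star_scal_right:
  assumes "F \<in> SM" "G \<in> SM"
  shows "star D F (scal c * G) = scal c * star D F G"
proof (rule fps_ext)
  fix n
  show "fps_nth (star D F (scal c * G)) n = fps_nth (scal c * star D F G) n"
    unfolding scal_mult_nth star_nth fscale_sum
    by (intro sum.cong refl) (simp add: scal_mult_nth mu_scale_right SM_nth assms)
qed

lemma star_X_left:
  assumes "F \<in> SM" "G \<in> SM"
  shows "star D (fps_X * F) G = fps_X * star D F G"
proof (rule fps_ext)
  fix n
  have 0: "mu D i 0 (fps_nth G m) = 0" for i m by (rule mu_0_left[OF SM_nth[OF assms(2)]])
  show "fps_nth (star D (fps_X * F) G) n = fps_nth (fps_X * star D F G) n"
  proof (cases n)
    case (Suc m)
    have "(\<Sum>j\<le>Suc m - i. mu D i (fps_nth (fps_X * F) j) (fps_nth G (Suc m - i - j)))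
        = (\<Sum>j\<le>m - i. mu D i (fps_nth F j) (fps_nth G (m - i - j)))" if "i \<le> m" for i
      using that by (simp add: Suc_diff_le sum.atMost_Suc_shift 0 del: sum.atMost_Suc)
    then show ?thesis by (simp add: star_nth Suc 0)
  qed (simp add: star_nth 0)
qed

lemma star_X_right:
  assumes "F \<in> SM" "G \<in> SM"
  shows "star D F (fps_X * G) = fps_X * star D F G"
proof (rule fps_ext)
  fix n
  have 0: "mu D i (fps_nth F m) 0 = 0" for i m by (rule mu_0_right[OF SM_nth[OF assms(1)]])
  show "fps_nth (star D F (fps_X * G)) n = fps_nth (fps_X * star D F G) n"
  proof (cases n)
    case (Suc m)
    have shift: "(\<Sum>j\<le>Suc r. mu D i (fps_nth F j) (fps_nth (fps_X * G) (Suc r - j)))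
        = (\<Sum>j\<le>r. mu D i (fps_nth F j) (fps_nth G (r - j)))" for i r
    proof -
      have "(\<Sum>j\<le>r. mu D i (fps_nth F j) (fps_nth (fps_X * G) (Suc r - j)))
          = (\<Sum>j\<le>r. mu D i (fps_nth F j) (fps_nth G (r - j)))"
        by (rule sum.cong[OF refl]) (simp add: Suc_diff_le)
      then show ?thesis by (simp add: 0)
    qed
    have "(\<Sum>j\<le>Suc m - i. mu D i (fps_nth F j) (fps_nth (fps_X * G) (Suc m - i - j)))
        = (\<Sum>j\<le>m - i. mu D i (fps_nth F j) (fps_nth G (m - i - j)))" if "i \<le> m" for i
      using shift[of i "m - i"] that by (simp only: Suc_diff_le)
    then show ?thesis by (simp add: star_nth Suc 0)
  qed (simp add: star_nth 0)
qed

lemma star_assoc: "F \<in> SM \<Longrightarrow> G \<in> SM \<Longrightarrow> H \<in> SM \<Longrightarrow> star D (star D F G) H = star D F (star D G H)"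
  using starprod unfolding star_product_def by blast

lemma star_1: "F \<in> SM \<Longrightarrow> star D 1 F = F" "F \<in> SM \<Longrightarrow> star D F 1 = F"
  using starprod unfolding star_product_def by blast+

lemma star_scal: "F \<in> SM \<Longrightarrow> star D (scal c) F = scal c * F" "F \<in> SM \<Longrightarrow> star D F (scal c) = scal c * F"
  using star_scal_left[OF SM_1, of F c] star_scal_right[OF _ SM_1, of F c] star_1[of F] by simp_all

lemma star_const_left_nth:
  assumes "f \<in> CM D" "G \<in> SM"
  shows "fps_nth (star D (fps_const f) G) n = (\<Sum>i\<le>n. mu D i f (fps_nth G (n - i)))"
  unfolding star_nth
proof (rule sum.cong[OF refl])
  fix i
  have "(\<Sum>j\<le>n - i. mu D i (fps_nth (fps_const f) j) (fps_nth G (n - i - j)))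
      = (\<Sum>j\<le>n - i. if j = 0 then mu D i f (fps_nth G (n - i)) else 0)"
    using assms by (intro sum.cong refl) (auto simp: mu_0_left SM_nth)
  then show "(\<Sum>j\<le>n - i. mu D i (fps_nth (fps_const f) j) (fps_nth G (n - i - j)))
      = mu D i f (fps_nth G (n - i))" by simp
qed

lemma star_const_right_nth:
  assumes "F \<in> SM" "g \<in> CM D"
  shows "fps_nth (star D F (fps_const g)) n = (\<Sum>i\<le>n. mu D i (fps_nth F (n - i)) g)"
  unfolding star_nth
proof (rule sum.cong[OF refl])
  fix i
  have "(\<Sum>j\<le>n - i. mu D i (fps_nth F j) (fps_nth (fps_const g) (n - i - j)))
      = (\<Sum>j\<le>n - i. if j = n - i then mu D i (fps_nth F (n - i)) g else 0)"
    using assms by (intro sum.cong refl) (auto simp: mu_0_right SM_nth)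
  then show "(\<Sum>j\<le>n - i. mu D i (fps_nth F j) (fps_nth (fps_const g) (n - i - j)))
      = mu D i (fps_nth F (n - i)) g" by simp
qed

text \<open>
  Strong invariance, read off at each order of \<open>\<nu>\<close>: the commutator with a component of the moment map has the
  Poisson bracket as its only term. This passes from functions to power series in \<open>star_commutator_J\<close>.
\<close>

lemma mu_commutator_J:
  assumes "X \<in> lie_alg D" "f \<in> CM D"
  shows "mu D i (J_of D X) f - mu D i f (J_of D X) = (if i = 1 then poisson D (J_of D X) f else 0)"
proof -
  have *: "(\<Sum>j\<le>i. mu D j g (fps_nth (fps_const h) (i - j))) = mu D i g h"
    "(\<Sum>j\<le>i. mu D j (fps_nth (fps_const h) (i - j)) g) = mu D i h g" if "g \<in> CM D" for g h
  proof -
    have "(\<Sum>j\<le>i. mu D j g (fps_nth (fps_const h) (i - j))) = (\<Sum>j\<le>i. if j = i then mu D i g h else 0)"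
      using that by (intro sum.cong refl) (auto simp: mu_0_right)
    then show "(\<Sum>j\<le>i. mu D j g (fps_nth (fps_const h) (i - j))) = mu D i g h" by simp
    have "(\<Sum>j\<le>i. mu D j (fps_nth (fps_const h) (i - j)) g) = (\<Sum>j\<le>i. if j = i then mu D i h g else 0)"
      using that by (intro sum.cong refl) (auto simp: mu_0_left)
    then show "(\<Sum>j\<le>i. mu D j (fps_nth (fps_const h) (i - j)) g) = mu D i h g" by simp
  qed
  have "fps_nth (star D (fps_const (J_of D X)) (fps_const f)) i - fps_nth (star D (fps_const f) (fps_const (J_of D X))) i
      = fps_nth (fps_X * fps_const (poisson D (J_of D X) f)) i"
    using invariant assms by (simp add: strongly_invariant_def flip: fps_sub_nth)
  then show ?thesis
    unfolding star_const_left_nth[OF J_CM[OF assms(1)] SM_const[OF assms(2)]]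
      star_const_right_nth[OF SM_const[OF assms(2)] J_CM[OF assms(1)]] *[OF J_CM[OF assms(1)]]
    by (cases i) auto
qed

lemma poisson_J_linear:
  assumes "X \<in> lie_alg D" "f \<in> CM D"
  shows "poisson D (J_of D X) f \<in> CM D"
    and "g \<in> CM D \<Longrightarrow> poisson D (J_of D X) (f + g) = poisson D (J_of D X) f + poisson D (J_of D X) g"
    and "poisson D (J_of D X) (fscale c f) = fscale c (poisson D (J_of D X) f)"
proof -
  have eq: "poisson D (J_of D X) f = mu D 1 (J_of D X) f - mu D 1 f (J_of D X)" if "f \<in> CM D" for f
    using mu_commutator_J[OF assms(1) that, of 1] by simp
  note J = J_CM[OF assms(1)]
  show "poisson D (J_of D X) f \<in> CM D"
    unfolding eq[OF assms(2)] by (intro CM_diff mu_CM J assms)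
  show "poisson D (J_of D X) (f + g) = poisson D (J_of D X) f + poisson D (J_of D X) g" if "g \<in> CM D"
    using eq[OF assms(2)] eq[OF that] eq[OF CM_add[OF assms(2) that]]
      mu_add_left[OF assms(2) that J] mu_add_right[OF J assms(2) that] by simp
  show "poisson D (J_of D X) (fscale c f) = fscale c (poisson D (J_of D X) f)"
    using eq[OF assms(2)] eq[OF CM_scale[OF assms(2)]]
      mu_scale_left[OF assms(2) J] mu_scale_right[OF J assms(2)] by (simp only: fscale_simps(4))
qed

lemma star_commutator_J:
  assumes "X \<in> lie_alg D" "F \<in> SM"
  shows "star D (fps_const (J_of D X)) F - star D F (fps_const (J_of D X))
    = fps_X * ser_map (poisson D (J_of D X)) F"
proof (rule fps_ext)
  fix n
  have "fps_nth (star D (fps_const (J_of D X)) F - star D F (fps_const (J_of D X))) n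
      = (\<Sum>i\<le>n. mu D i (J_of D X) (fps_nth F (n - i)) - mu D i (fps_nth F (n - i)) (J_of D X))"
    unfolding fps_sub_nth star_const_left_nth[OF J_CM[OF assms(1)] assms(2)]
      star_const_right_nth[OF assms(2) J_CM[OF assms(1)]] sum_subtractf ..
  also have "\<dots> = (\<Sum>i\<le>n. if i = 1 then poisson D (J_of D X) (fps_nth F (n - i)) else 0)"
    by (intro sum.cong refl mu_commutator_J assms(1) SM_nth[OF assms(2)])
  also have "\<dots> = fps_nth (fps_X * ser_map (poisson D (J_of D X)) F) n"
    by (cases n) (auto simp: ser_map_def)
  finally show "fps_nth (star D (fps_const (J_of D X)) F - star D F (fps_const (J_of D X))) n
      = fps_nth (fps_X * ser_map (poisson D (J_of D X)) F) n" .
qed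

text \<open>
  The Poisson action of \<open>J\<close> is a derivation because it is the commutator with \<open>J\<close> divided by the
  deformation parameter: the star commutator is a derivation of the star product, whose term of order
  zero is the pointwise product.
\<close>

lemma poisson_J_mult:
  assumes X: "X \<in> lie_alg D" and f: "f \<in> CM D" and g: "g \<in> CM D"
  shows "poisson D (J_of D X) (f * g) = poisson D (J_of D X) f * g + f * poisson D (J_of D X) g"
proof -
  let ?J = "fps_const (J_of D X)" and ?F = "fps_const f" and ?G = "fps_const g"
  let ?P = "ser_map (poisson D (J_of D X))"
  have J: "?J \<in> SM" and F: "?F \<in> SM" and G: "?G \<in> SM" by (simp_all add: SM_const J_CM X f g)
  have P: "?P H \<in> SM" if "H \<in> SM" for H
    using that poisson_J_linear(1)[OF X] by (simp add: ser_def ser_map_def)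
  have "fps_X * ?P (star D ?F ?G) = star D ?J (star D ?F ?G) - star D (star D ?F ?G) ?J"
    by (rule star_commutator_J[OF X star_SM[OF F G], symmetric])
  also have "\<dots> = (star D (star D ?J ?F) ?G - star D (star D ?F ?J) ?G)
      + (star D ?F (star D ?J ?G) - star D ?F (star D ?G ?J))"
    by (simp add: star_assoc J F G)
  also have "\<dots> = star D (star D ?J ?F - star D ?F ?J) ?G + star D ?F (star D ?J ?G - star D ?G ?J)"
    using star_add_left[of "star D ?J ?F" "- star D ?F ?J" ?G] star_minus_left[of "star D ?F ?J" ?G]
      star_add_right[of ?F "star D ?J ?G" "- star D ?G ?J"] star_minus_right[of ?F "star D ?G ?J"]
    by (simp add: star_SM SM_minus J F G)
  also have "\<dots> = fps_X * (star D (?P ?F) ?G + star D ?F (?P ?G))"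
    unfolding star_commutator_J[OF X F] star_commutator_J[OF X G]
      star_X_left[OF P[OF F] G] star_X_right[OF F P[OF G]] by (simp add: distrib_left)
  finally have eq: "?P (star D ?F ?G) = star D (?P ?F) ?G + star D ?F (?P ?G)"
    by (rule fps_X_cancel)
  have "fps_nth (star D A B) 0 = fps_nth A 0 * fps_nth B 0" if "A \<in> SM" "B \<in> SM" for A B
    using that by (simp add: star_nth mu_0 SM_nth)
  then show ?thesis
    using arg_cong[OF eq, of "\<lambda>A. fps_nth A 0"] F G P[OF F] P[OF G] by (simp add: ser_map_def)
qed

section \<open>The BRST product\<close>

abbreviation "Q \<equiv> brst_ser D"
abbreviation "E \<equiv> all_gens D"

lemmas Q_def = brst_ser_def[of D]

lemma Q_closed: "add_closed Q"
  unfolding Q_def by (rule add_closed_grass_over[OF SM_closed])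

lemmas Q_0 = add_closedD(1)[OF Q_closed]
lemmas Q_add = add_closedD(2)[OF Q_closed]
lemmas Q_minus = add_closedD(3)[OF Q_closed]
lemmas Q_diff = add_closedD(4)[OF Q_closed]

lemma Q_coeff: "x \<in> Q \<Longrightarrow> x S \<in> SM"
  unfolding Q_def by (rule grass_over_coeff[OF SM_closed])

lemma Q_support: "x \<in> Q \<Longrightarrow> x S \<noteq> 0 \<Longrightarrow> S \<subseteq> E"
  unfolding Q_def grass_over_iff by blast

lemma finite_E: "finite E"
  by (simp add: all_gens_def)

lemma Q_infinite: "x \<in> Q \<Longrightarrow> infinite S \<Longrightarrow> x S = 0"
  using Q_support finite_E finite_subset by blast

lemma QI: "(\<And>S. x S \<in> SM) \<Longrightarrow> (\<And>S. x S \<noteq> 0 \<Longrightarrow> S \<subseteq> E) \<Longrightarrow> x \<in> Q"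
  unfolding Q_def grass_over_iff by blast

lemma Q_gscale:
  assumes "x \<in> Q" "\<And>F. F \<in> SM \<Longrightarrow> c * F \<in> SM"
  shows "gscale c x \<in> Q"
proof (rule QI)
  show "gscale c x S \<in> SM" for S
    unfolding gscale_def by (rule assms(2)[OF Q_coeff[OF assms(1)]])
  fix S assume "gscale c x S \<noteq> 0"
  then have "x S \<noteq> 0" unfolding gscale_def by (metis mult_zero_right)
  then show "S \<subseteq> E" by (rule Q_support[OF assms(1)])
qed

lemma Q_X: "x \<in> Q \<Longrightarrow> gscale fps_X x \<in> Q"
  by (erule Q_gscale) (rule SM_X)

lemma Q_wedge: "x \<in> Q \<Longrightarrow> i \<in> E \<Longrightarrow> wedge i x \<in> Q"
  unfolding Q_def by (rule grass_over_wedge[OF SM_closed])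

lemma Q_gder: "x \<in> Q \<Longrightarrow> gder i x \<in> Q"
  unfolding Q_def by (rule grass_over_gder[OF SM_closed])

lemma Q_emb: "F \<in> SM \<Longrightarrow> emb F \<in> Q"
  unfolding Q_def by (rule grass_over_emb[OF SM_closed])

abbreviation bmul (infixl "\<bullet>\<bullet>" 70) where "x \<bullet>\<bullet> y \<equiv> brst_mult D x y"

lemma bmul_eq: "x \<bullet>\<bullet> y = gprod (exp_contraction (gdim D) (\<lambda>S T. star D (x S) (y T)))"
  by (simp add: brst_mult_def gprod_def)

text \<open>
  A property \<open>P\<close> of degrees instead of a degree, so that the same statement bounds the support and gives
  additivity of the degree.
\<close>

lemma bmul_nonzero:
  assumes "x \<in> Q" "y \<in> Q" "\<And>S T. x S \<noteq> 0 \<Longrightarrow> y T \<noteq> 0 \<Longrightarrow> P (gdeg S + gdeg T)" "(x \<bullet>\<bullet> y) R \<noteq> 0"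
  shows "R \<subseteq> E \<and> P (gdeg R)"
proof (rule gprod_exp_support[OF _ finite_E assms(4)[unfolded bmul_eq]])
  fix S T assume "star D (x S) (y T) \<noteq> 0"
  then have "x S \<noteq> 0" "y T \<noteq> 0" using star_0_left star_0_right Q_coeff assms(1,2) by auto
  then show "S \<subseteq> E \<and> T \<subseteq> E \<and> P (gdeg S + gdeg T)" using Q_support assms by blast
qed

lemma exp_series_SM: "(\<And>k. c k \<in> SM) \<Longrightarrow> exp_series c \<in> SM"
  unfolding ser_def[of "CM D"] mem_Collect_eq exp_series_def fps_nth_Abs_fps
  by (intro allI CM_sum CM_scale) auto

lemma bmul_Q: "x \<in> Q \<Longrightarrow> y \<in> Q \<Longrightarrow> x \<bullet>\<bullet> y \<in> Q"
proof (rule QI)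
  assume x: "x \<in> Q" and y: "y \<in> Q"
  show "(x \<bullet>\<bullet> y) R \<in> SM" for R
    unfolding bmul_eq gprod_def exp_contraction_eq
    by (intro add_closed_sum[OF SM_closed] SM_signed exp_series_SM contraction_funpow_mem[OF SM_closed]
        star_SM Q_coeff x y)
  show "R \<subseteq> E" if "(x \<bullet>\<bullet> y) R \<noteq> 0" for R
    using bmul_nonzero[OF x y, of "\<lambda>_. True"] that by blast
qed

lemma exp_contraction_add':
  "exp_contraction l (\<lambda>S T. t S T + t' S T) = (\<lambda>S T. exp_contraction l t S T + exp_contraction l t' S T)"
  by (intro ext exp_contraction_add)

lemma bmul_add_left: "x \<in> Q \<Longrightarrow> x' \<in> Q \<Longrightarrow> y \<in> Q \<Longrightarrow> (x + x') \<bullet>\<bullet> y = x \<bullet>\<bullet> y + x' \<bullet>\<bullet> y"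
  by (simp add: bmul_eq star_add_left Q_coeff exp_contraction_add' gprod_add)

lemma bmul_add_right: "x \<in> Q \<Longrightarrow> y \<in> Q \<Longrightarrow> y' \<in> Q \<Longrightarrow> x \<bullet>\<bullet> (y + y') = x \<bullet>\<bullet> y + x \<bullet>\<bullet> y'"
  by (simp add: bmul_eq star_add_right Q_coeff exp_contraction_add' gprod_add)

lemma exp_contraction_X':
  "exp_contraction l (\<lambda>S T. fps_X * t S T) = (\<lambda>S T. fps_X * exp_contraction l t S T)"
  by (intro ext exp_contraction_X)

lemma exp_contraction_scal:
  "exp_contraction l (\<lambda>S T. scal c * t S T) = (\<lambda>S T. scal c * exp_contraction l t S T)"
  unfolding scal_def by (intro ext exp_contraction_const)

lemma bmul_X_left: "x \<in> Q \<Longrightarrow> y \<in> Q \<Longrightarrow> gscale fps_X x \<bullet>\<bullet> y = gscale fps_X (x \<bullet>\<bullet> y)"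
  by (simp add: bmul_eq gscale_def[of fps_X x] star_X_left Q_coeff exp_contraction_X' gprod_mult)

lemma bmul_X_right: "x \<in> Q \<Longrightarrow> y \<in> Q \<Longrightarrow> x \<bullet>\<bullet> gscale fps_X y = gscale fps_X (x \<bullet>\<bullet> y)"
  by (simp add: bmul_eq gscale_def[of fps_X y] star_X_right Q_coeff exp_contraction_X' gprod_mult)

lemma bmul_scal_left: "x \<in> Q \<Longrightarrow> y \<in> Q \<Longrightarrow> gscale (scal c) x \<bullet>\<bullet> y = gscale (scal c) (x \<bullet>\<bullet> y)"
  by (simp add: bmul_eq gscale_def[of "scal c" x] star_scal_left Q_coeff exp_contraction_scal gprod_mult)

lemma bmul_scal_right: "x \<in> Q \<Longrightarrow> y \<in> Q \<Longrightarrow> x \<bullet>\<bullet> gscale (scal c) y = gscale (scal c) (x \<bullet>\<bullet> y)"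
  by (simp add: bmul_eq gscale_def[of "scal c" y] star_scal_right Q_coeff exp_contraction_scal gprod_mult)

lemma bmul_0: "y \<in> Q \<Longrightarrow> 0 \<bullet>\<bullet> y = 0" "x \<in> Q \<Longrightarrow> x \<bullet>\<bullet> 0 = 0"
  using bmul_add_left[OF Q_0 Q_0, of y] bmul_add_right[OF _ Q_0 Q_0, of x] by simp_all

lemma bmul_minus_left: "x \<in> Q \<Longrightarrow> y \<in> Q \<Longrightarrow> (- x) \<bullet>\<bullet> y = - (x \<bullet>\<bullet> y)"
  using bmul_add_left[of x "- x" y] Q_minus[of x] bmul_0(1)[of y] by (simp add: eq_neg_iff_add_eq_0 add.commute)

lemma bmul_minus_right: "x \<in> Q \<Longrightarrow> y \<in> Q \<Longrightarrow> x \<bullet>\<bullet> (- y) = - (x \<bullet>\<bullet> y)"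
  using bmul_add_right[of x y "- y"] Q_minus[of y] bmul_0(2)[of x] by (simp add: eq_neg_iff_add_eq_0 add.commute)

lemma bmul_diff_left: "x \<in> Q \<Longrightarrow> x' \<in> Q \<Longrightarrow> y \<in> Q \<Longrightarrow> (x - x') \<bullet>\<bullet> y = x \<bullet>\<bullet> y - x' \<bullet>\<bullet> y"
  using bmul_add_left[of x "- x'" y] bmul_minus_left[of x' y] Q_minus[of x'] by simp

lemma bmul_diff_right: "x \<in> Q \<Longrightarrow> y \<in> Q \<Longrightarrow> y' \<in> Q \<Longrightarrow> x \<bullet>\<bullet> (y - y') = x \<bullet>\<bullet> y - x \<bullet>\<bullet> y'"
  using bmul_add_right[of x y "- y'"] bmul_minus_right[of x y'] Q_minus[of y'] by simp

text \<open>
  A factor without generators has nothing to contract.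
\<close>

lemma contraction_funpow_emb:
  "(\<forall>S T. S \<noteq> {} \<longrightarrow> t S T = 0) \<or> (\<forall>S T. T \<noteq> {} \<longrightarrow> t S T = 0) \<Longrightarrow>
    (contraction l ^^ k) t = (if k = 0 then t else (\<lambda>S T. 0))"
proof (induction k)
  case (Suc k)
  have "contraction l t S T = 0" "contraction l (\<lambda>S T. 0) S T = 0" for S T
    unfolding contraction_eq using Suc.prems by (auto intro!: sum.neutral)
  then have "contraction l t = (\<lambda>S T. 0)" "contraction l (\<lambda>S T. 0) = (\<lambda>S T. 0)" by (intro ext; simp)+
  with Suc show ?case by (cases k) auto
qed simp

lemma bmul_emb_left: "F \<in> SM \<Longrightarrow> y \<in> Q \<Longrightarrow> emb F \<bullet>\<bullet> y = (\<lambda>S. star D F (y S))"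
proof
  fix R assume F: "F \<in> SM" and y: "y \<in> Q"
  let ?t = "\<lambda>S T. star D (emb F S) (y T)"
  have t0: "?t S T = 0" if "S \<noteq> {}" for S T using that by (simp add: emb_def star_0_left Q_coeff[OF y])
  have "exp_contraction (gdim D) ?t S T = ?t S T" for S T
    using contraction_funpow_emb[of ?t] t0 exp_series_single[of "?t S T"]
    unfolding exp_contraction_eq by (simp add: if_distribR cong: if_cong)
  then have e: "exp_contraction (gdim D) ?t = ?t" by (intro ext)
  show "(emb F \<bullet>\<bullet> y) R = star D F (y R)"
  proof (cases "finite R")
    case True
    then show ?thesis unfolding bmul_eq e using gprod_emb_left[of ?t R] t0 by (simp add: emb_def)
  next
    case False
    then show ?thesis unfolding bmul_eq by (simp add: gprod_infinite Q_infinite[OF y] star_0_right[OF F])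
  qed
qed

lemma bmul_emb_right: "F \<in> SM \<Longrightarrow> y \<in> Q \<Longrightarrow> y \<bullet>\<bullet> emb F = (\<lambda>S. star D (y S) F)"
proof
  fix R assume F: "F \<in> SM" and y: "y \<in> Q"
  let ?t = "\<lambda>S T. star D (y S) (emb F T)"
  have t0: "?t S T = 0" if "T \<noteq> {}" for S T using that by (simp add: emb_def star_0_right Q_coeff[OF y])
  have "exp_contraction (gdim D) ?t S T = ?t S T" for S T
    using contraction_funpow_emb[of ?t] t0 exp_series_single[of "?t S T"]
    unfolding exp_contraction_eq by (simp add: if_distribR cong: if_cong)
  then have e: "exp_contraction (gdim D) ?t = ?t" by (intro ext)
  show "(y \<bullet>\<bullet> emb F) R = star D (y R) F"
  proof (cases "finite R")
    case True
    then show ?thesis unfolding bmul_eq e using gprod_emb_right[of ?t R] t0 by (simp add: emb_def)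
  next
    case False
    then show ?thesis unfolding bmul_eq by (simp add: gprod_infinite Q_infinite[OF y] star_0_left[OF F])
  qed
qed

text \<open>
  Left multiplication by the generator \<open>i\<close> in the BRST algebra: exterior multiplication for a ghost, and
  for an antighost its sum with the derivation \<open>2 \<nu> \<partial>/\<partial>\<xi>\<^sup>a\<close> in the dual ghost, whose index is
  \<open>i - 1\<close>.
\<close>

definition lmul :: "nat \<Rightarrow> ('m \<Rightarrow> 'k) fps grass \<Rightarrow> ('m \<Rightarrow> 'k) fps grass" where
  "lmul i x = (if even i then wedge i x else wedge i x + gscale (2 * fps_X) (gder (i - 1) x))"

lemma gscale_2X: "gscale (2 * fps_X) x = gscale fps_X (x + (x :: ('m \<Rightarrow> 'k) fps grass))"
  by (rule ext) (simp only: gscale_def plus_fun_apply mult_2 distrib_left distrib_right)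

lemma Q_2X: "x \<in> Q \<Longrightarrow> gscale (2 * fps_X) x \<in> Q"
  unfolding gscale_2X by (intro Q_X Q_add)

lemma bmul_2X_left: "x \<in> Q \<Longrightarrow> y \<in> Q \<Longrightarrow> gscale (2 * fps_X) x \<bullet>\<bullet> y = gscale (2 * fps_X) (x \<bullet>\<bullet> y)"
  unfolding gscale_2X by (simp only: bmul_X_left bmul_add_left Q_add)

lemma lmul_Q: "x \<in> Q \<Longrightarrow> i \<in> E \<Longrightarrow> lmul i x \<in> Q"
  unfolding lmul_def by (simp only: Q_add Q_2X Q_wedge Q_gder split: if_split) blast

text \<open>
  The reason for associativity: \<open>lmul i\<close> commutes with all right multiplications. For an antighost, contracting
  it against the second factor gives a derivation in the dual ghost there; adding the same derivation on the
  first factor completes it, by the Leibniz rule, to a derivation of the product.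
\<close>

lemma bmul_lmul:
  assumes i: "i \<in> E" and x: "x \<in> Q" and y: "y \<in> Q"
  shows "lmul i x \<bullet>\<bullet> y = lmul i (x \<bullet>\<bullet> y)"
proof -
  let ?t = "\<lambda>S T. star D (x S) (y T)"
  let ?e = "exp_contraction (gdim D)"
  have tw: "(\<lambda>S T. star D (wedge i x S) (y T)) = wedge1 i ?t"
    by (intro ext) (simp add: wedge1_def wedge_def star_signed_left star_0_left Q_coeff x y)
  have tg: "(\<lambda>S T. star D (gder j x S) (y T)) = gder1 j ?t" for j
    by (intro ext) (simp add: gder1_def gder_eq star_signed_left star_0_left Q_coeff x y)
  show ?thesis
  proof (cases "even i")
    case True
    have "wedge i x \<bullet>\<bullet> y = gprod (wedge1 i (?e ?t))"
      unfolding bmul_eq tw by (rule gprod_cong) (rule exp_contraction_ghost[OF True])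
    then show ?thesis using True by (simp add: lmul_def gprod_wedge1 bmul_eq)
  next
    case False
    define a where "a = i div 2"
    have ia: "i = ag a" "i - 1 = gh a" using False by (auto simp: a_def ag_def gh_def)
    have a: "a < gdim D" using i ia(1) by (simp add: all_gens_def ag_def)
    have "wedge i x \<bullet>\<bullet> y = gprod (\<lambda>S T. wedge1 i (?e ?t) S T + 2 * fps_X * gder2 (i - 1) (?e ?t) S T)"
      unfolding bmul_eq tw ia(2) by (rule gprod_cong) (simp only: ia(1) exp_contraction_antighost[OF a])
    also have "\<dots> = wedge i (x \<bullet>\<bullet> y) + gscale (2 * fps_X) (gprod (gder2 (i - 1) (?e ?t)))"
      unfolding gprod_add gprod_mult gprod_wedge1 bmul_eq ..
    finally have 1: "wedge i x \<bullet>\<bullet> y = wedge i (x \<bullet>\<bullet> y) + gscale (2 * fps_X) (gprod (gder2 (i - 1) (?e ?t)))" .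
    have 2: "gder (i - 1) x \<bullet>\<bullet> y = gprod (gder1 (i - 1) (?e ?t))"
      unfolding bmul_eq tg by (rule gprod_cong) (rule exp_contraction_gder1)
    have 3: "gprod (gder1 (i - 1) (?e ?t)) + gprod (gder2 (i - 1) (?e ?t)) = gder (i - 1) (x \<bullet>\<bullet> y)"
      by (rule ext) (simp add: gprod_gder bmul_eq)
    have g: "gder (i - 1) x \<in> Q" by (rule Q_gder[OF x])
    have "lmul i x \<bullet>\<bullet> y = wedge i x \<bullet>\<bullet> y + gscale (2 * fps_X) (gder (i - 1) x) \<bullet>\<bullet> y"
      using False bmul_add_left[OF Q_wedge[OF x i] Q_2X[OF g] y] by (simp only: lmul_def if_False)
    also have "gscale (2 * fps_X) (gder (i - 1) x) \<bullet>\<bullet> y = gscale (2 * fps_X) (gder (i - 1) x \<bullet>\<bullet> y)"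
      by (rule bmul_2X_left[OF g y])
    also have "wedge i x \<bullet>\<bullet> y + gscale (2 * fps_X) (gder (i - 1) x \<bullet>\<bullet> y)
        = wedge i (x \<bullet>\<bullet> y) + gscale (2 * fps_X) (gder (i - 1) (x \<bullet>\<bullet> y))"
      unfolding 1 2 3[symmetric] by (rule ext) (simp add: gscale_def distrib_left)
    finally show ?thesis using False by (simp only: lmul_def if_False)
  qed
qed

definition mono :: "nat set \<Rightarrow> 'c::zero \<Rightarrow> 'c grass" where
  "mono S f = (\<lambda>T. if T = S then f else 0)"

lemma mono_Q: "S \<subseteq> E \<Longrightarrow> F \<in> SM \<Longrightarrow> mono S F \<in> Q"
  by (rule QI) (auto simp: mono_def SM_0 split: if_splits)

text \<open>
  An operator on coefficients that is linear over \<open>\<bbbK>\<close> and over \<open>\<nu>\<close> commutes with the fermionic part of the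
  product. It is applied to \<open>star D F\<close>, which reduces associativity with a function to associativity of the star
  product.
\<close>

lemma gprod_exp_linear:
  assumes t: "\<And>S T. t S T \<in> SM" and L: "\<And>F. F \<in> SM \<Longrightarrow> L F \<in> SM"
    and add: "\<And>F G. F \<in> SM \<Longrightarrow> G \<in> SM \<Longrightarrow> L (F + G) = L F + L G"
    and X: "\<And>F. F \<in> SM \<Longrightarrow> L (fps_X * F) = fps_X * L F"
    and scal: "\<And>c F. F \<in> SM \<Longrightarrow> L (scal c * F) = scal c * L F"
  shows "gprod (exp_contraction l (\<lambda>S T. L (t S T))) R = L (gprod (exp_contraction l t) R)"
proof -
  have L0: "L 0 = 0" using add[OF SM_0 SM_0] by simp
  have Lm: "L (- F) = - L F" if "F \<in> SM" for F
    using add[OF that SM_minus[OF that]] L0 by (simp add: eq_neg_iff_add_eq_0 add.commute)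
  have Ls: "L (signed n F) = signed n (L F)" if "F \<in> SM" for n F
    using Lm[OF that] by (simp add: signed_def)
  have Lsum: "L (\<Sum>i\<in>I. f i) = (\<Sum>i\<in>I. L (f i))" if "\<And>i. i \<in> I \<Longrightarrow> f i \<in> SM" for f and I :: "'i set"
    using that
  proof (induction I rule: infinite_finite_induct)
    case (insert i I)
    then have "L (f i + (\<Sum>i\<in>I. f i)) = L (f i) + L (\<Sum>i\<in>I. f i)"
      by (intro add add_closed_sum[OF SM_closed]) auto
    with insert show ?case by simp
  qed (simp_all add: L0)
  have con: "(contraction l ^^ k) (\<lambda>S T. L (t S T)) S T = L ((contraction l ^^ k) t S T)" for k S T
  proof (induction k arbitrary: S T)
    case (Suc k)
    let ?c = "(contraction l ^^ k) t"
    have c: "?c S T \<in> SM" for S T by (rule contraction_funpow_mem[OF SM_closed t])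
    have eq: "(contraction l ^^ k) (\<lambda>S T. L (t S T)) = (\<lambda>S T. L (?c S T))"
      by (intro ext Suc)
    have "contraction l (\<lambda>S T. L (?c S T)) S T
        = (\<Sum>a<l. L (if ag a \<in> S \<or> gh a \<in> T then 0
          else signed (Suc (card S) + below S (ag a) + below T (gh a)) (?c (insert (ag a) S) (insert (gh a) T))))"
      unfolding contraction_eq[where S = S and T = T]
      by (rule sum.cong[OF refl]) (simp add: L0 Ls Lm c SM_signed del: signed_simps)
    also have "\<dots> = L (contraction l ?c S T)"
      unfolding contraction_eq[where S = S and T = T]
      by (rule Lsum[symmetric]) (use c SM_signed SM_0 in \<open>simp del: signed_simps\<close>)
    finally show ?case by (simp add: eq)
  qed simp
  have expL: "exp_series (\<lambda>k. L (c k)) = L (exp_series c)" if c: "\<And>k. c k \<in> SM" for c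
  proof (rule fps_ext)
    fix n
    let ?w = "\<lambda>k. scal ((- 2) ^ k / fact k) * c k"
    have w: "?w k \<in> SM" for k by (rule SM_scal_mult[OF c])
    have Xp: "fps_X ^ k * H \<in> SM \<and> L (fps_X ^ k * H) = fps_X ^ k * L H" if "H \<in> SM" for H k
    proof (induction k)
      case (Suc k)
      then show ?case using X[of "fps_X ^ k * H"] SM_X[of "fps_X ^ k * H"] by (simp add: mult.assoc)
    qed (use that in simp)
    \<comment> \<open>The exponential agrees with a finite sum up to a multiple of a high power of the parameter.\<close>
    define R where "R = Abs_fps (\<lambda>m. fps_nth (exp_series c - (\<Sum>k\<le>n. fps_X ^ k * ?w k)) (m + Suc n))"
    have sumSM: "(\<Sum>k\<le>n. fps_X ^ k * ?w k) \<in> SM"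
      using Xp[OF w] by (intro add_closed_sum[OF SM_closed]) blast
    then have dSM: "exp_series c - (\<Sum>k\<le>n. fps_X ^ k * ?w k) \<in> SM"
      by (intro SM_diff exp_series_SM c)
    have "fps_nth R m \<in> CM D" for m
      unfolding R_def fps_nth_Abs_fps by (rule SM_nth[OF dSM])
    then have R: "R \<in> SM" unfolding ser_def by blast
    have low: "fps_nth (\<Sum>k\<le>n. fps_X ^ k * ?w k) m = fps_nth (exp_series c) m" if m: "m \<le> n" for m
    proof -
      have "fps_nth (\<Sum>k\<le>n. fps_X ^ k * ?w k) m
          = (\<Sum>k\<le>n. if k \<le> m then fscale ((- 2) ^ k / fact k) (fps_nth (c k) (m - k)) else 0)"
        unfolding fps_sum_nth by (rule sum.cong[OF refl]) (simp add: fps_X_power_mult_nth scal_mult_nth)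
      also have "\<dots> = (\<Sum>k\<le>m. fscale ((- 2) ^ k / fact k) (fps_nth (c k) (m - k)))"
      proof -
        have "{..n} \<inter> {..m} = {..m}" using m by auto
        then show ?thesis
          using sum.inter_restrict[of "{..n}" "\<lambda>k. fscale ((- 2) ^ k / fact k) (fps_nth (c k) (m - k))" "{..m}"]
          by (simp only: finite_atMost atMost_iff)
      qed
      finally show ?thesis by (simp add: exp_series_def)
    qed
    have "fps_X ^ Suc n * R = exp_series c - (\<Sum>k\<le>n. fps_X ^ k * ?w k)"
    proof (rule fps_ext)
      fix m
      show "fps_nth (fps_X ^ Suc n * R) m = fps_nth (exp_series c - (\<Sum>k\<le>n. fps_X ^ k * ?w k)) m"
        using low[of m] by (cases "m \<le> n") (simp_all add: fps_X_power_mult_nth R_def del: power_Suc)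
    qed
    then have split: "exp_series c = (\<Sum>k\<le>n. fps_X ^ k * ?w k) + fps_X ^ Suc n * R" by simp
    have "L (exp_series c) = L (\<Sum>k\<le>n. fps_X ^ k * ?w k) + fps_X ^ Suc n * L R"
      unfolding split using add[OF sumSM, of "fps_X ^ Suc n * R"] Xp[OF R, of "Suc n"] by simp
    also have "L (\<Sum>k\<le>n. fps_X ^ k * ?w k) = (\<Sum>k\<le>n. fps_X ^ k * (scal ((- 2) ^ k / fact k) * L (c k)))"
      using Xp[OF w] by (simp add: Lsum scal[OF c])
    finally have "fps_nth (L (exp_series c)) n
        = (\<Sum>k\<le>n. fps_nth (fps_X ^ k * (scal ((- 2) ^ k / fact k) * L (c k))) n)"
      by (simp add: fps_sum_nth fps_X_power_mult_nth[of "Suc n"] del: power_Suc)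
    also have "\<dots> = fps_nth (exp_series (\<lambda>k. L (c k))) n"
      unfolding exp_series_def fps_nth_Abs_fps
      by (rule sum.cong[OF refl]) (simp add: fps_X_power_mult_nth scal_mult_nth)
    finally show "fps_nth (exp_series (\<lambda>k. L (c k))) n = fps_nth (L (exp_series c)) n" by simp
  qed
  have expt: "exp_contraction l (\<lambda>S T. L (t S T)) S T = L (exp_contraction l t S T)" for S T
    unfolding exp_contraction_eq con by (rule expL) (rule contraction_funpow_mem[OF SM_closed t])
  have expSM: "exp_contraction l t S T \<in> SM" for S T
    unfolding exp_contraction_eq by (intro exp_series_SM contraction_funpow_mem[OF SM_closed t])
  show ?thesis
    unfolding gprod_def expt by (subst Lsum) (simp_all add: SM_signed expSM Ls)
qed

text \<open>
  Associativity: the elements associating with everything in the first slot contain the functions and are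
  closed under the operators \<open>lmul i\<close>, since these commute with right multiplications; by induction on
  the number of generators they contain every monomial.
\<close>

lemma mono_assoc:
  assumes "S \<subseteq> E" "F \<in> SM" "y \<in> Q" "z \<in> Q"
  shows "(mono S F \<bullet>\<bullet> y) \<bullet>\<bullet> z = mono S F \<bullet>\<bullet> (y \<bullet>\<bullet> z)"
  using assms(1,2)
proof (induction "card S" arbitrary: S F rule: less_induct)
  case less
  note y = assms(3) and z = assms(4)
  show ?case
  proof (cases "S = {}")
    case True
    have e: "mono S F = emb F" using True by (simp add: mono_def emb_def)
    let ?t = "\<lambda>S T. star D (y S) (z T)"
    have "(emb F \<bullet>\<bullet> y) \<bullet>\<bullet> z = gprod (exp_contraction (gdim D) (\<lambda>S T. star D F (?t S T)))"
      unfolding bmul_emb_left[OF less.prems(2) y] bmul_eq[where y = z]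
      by (simp add: star_assoc less.prems Q_coeff y z)
    also have "\<dots> = (\<lambda>R. star D F ((y \<bullet>\<bullet> z) R))"
      unfolding bmul_eq
      by (rule ext, rule gprod_exp_linear)
        (simp_all add: less.prems star_SM star_add_right star_X_right star_scal_right Q_coeff y z)
    also have "\<dots> = emb F \<bullet>\<bullet> (y \<bullet>\<bullet> z)"
      by (rule bmul_emb_left[symmetric, OF less.prems(2) bmul_Q[OF y z]])
    finally show ?thesis unfolding e .
  next
    case False
    then obtain i where i: "i \<in> S" by blast
    have fin: "finite S" using less.prems(1) finite_E finite_subset by blast
    have iE: "i \<in> E" using i less.prems(1) by blast
    define S' where "S' = S - {i}"
    have S': "S = insert i S'" "i \<notin> S'" "S' \<subseteq> E" "card S' < card S"
      unfolding S'_def using i less.prems(1) card_Diff1_less[OF fin i] by auto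
    let ?G = "signed (below S' i) F"
    let ?u = "mono S' ?G"
    have G: "?G \<in> SM" by (rule SM_signed[OF less.prems(2)])
    have u: "?u \<in> Q" by (rule mono_Q[OF S'(3) G])
    have w: "wedge i ?u = mono S F"
    proof
      fix T
      show "wedge i ?u T = mono S F T"
      proof (cases "i \<in> T \<and> T - {i} = S'")
        case True
        then have "T = S" using S' by auto
        moreover have "below S i = below S' i" using S'(2) by (simp add: S'(1) below_insert)
        moreover have "signed (below S' i + below S' i) F = F" by (simp add: signed_def)
        ultimately show ?thesis using S' i by (simp add: wedge_def mono_def S'_def[symmetric])
      next
        case False
        then have "T \<noteq> S" using S' by auto
        with False show ?thesis by (auto simp: wedge_def mono_def)
      qed
    qed
    have assoc_u: "(?u \<bullet>\<bullet> y) \<bullet>\<bullet> z = ?u \<bullet>\<bullet> (y \<bullet>\<bullet> z)"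
      by (rule less.hyps[OF S'(4,3) G])
    have assoc_l: "(lmul i ?u \<bullet>\<bullet> y) \<bullet>\<bullet> z = lmul i ?u \<bullet>\<bullet> (y \<bullet>\<bullet> z)"
      by (simp add: bmul_lmul iE u y z bmul_Q assoc_u)
    show ?thesis
    proof (cases "even i")
      case True
      then show ?thesis using assoc_l w by (simp add: lmul_def)
    next
      case odd: False
      \<comment> \<open>The correction term of \<open>lmul i\<close> is again a monomial, with fewer generators than \<open>S\<close>.\<close>
      let ?d = "gscale (2 * fps_X) (gder (i - 1) ?u)"
      have d: "?d \<in> Q" by (intro Q_2X Q_gder u)
      let ?S2 = "S' - {i - 1}"
      have "?d = mono ?S2 (?d ?S2)"
        by (rule ext) (auto simp: gscale_def gder_eq mono_def)
      moreover have "card ?S2 < card S"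
        using S'(4) card_Diff1_le[of S' "i - 1"] by linarith
      moreover have "?S2 \<subseteq> E" using S'(3) by blast
      ultimately have assoc_d: "(?d \<bullet>\<bullet> y) \<bullet>\<bullet> z = ?d \<bullet>\<bullet> (y \<bullet>\<bullet> z)"
        using less.hyps[of ?S2 "?d ?S2"] Q_coeff[OF d] by metis
      have eq: "mono S F = lmul i ?u - ?d"
        using odd by (simp only: lmul_def if_False w add_diff_cancel_right')
      show ?thesis unfolding eq
        by (simp only: bmul_diff_left lmul_Q iE u d y z bmul_Q assoc_l assoc_d)
    qed
  qed
qed

text \<open>
  Elements are finite sums of monomials with coefficients.
\<close>

lemma bmul_assoc:
  assumes "x \<in> Q" "y \<in> Q" "z \<in> Q"
  shows "(x \<bullet>\<bullet> y) \<bullet>\<bullet> z = x \<bullet>\<bullet> (y \<bullet>\<bullet> z)"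
proof -
  have "(\<Sum>S\<in>I. mono S (x S)) \<in> Q \<and>
    ((\<Sum>S\<in>I. mono S (x S)) \<bullet>\<bullet> y) \<bullet>\<bullet> z = (\<Sum>S\<in>I. mono S (x S)) \<bullet>\<bullet> (y \<bullet>\<bullet> z)" if "I \<subseteq> Pow E" for I
    using finite_subset[OF that] that finite_E
  proof (induction I rule: infinite_finite_induct)
    case (insert S I)
    then have S: "mono S (x S) \<in> Q" using mono_Q Q_coeff[OF assms(1)] by auto
    have "(mono S (x S) \<bullet>\<bullet> y) \<bullet>\<bullet> z = mono S (x S) \<bullet>\<bullet> (y \<bullet>\<bullet> z)"
      using insert.prems Q_coeff[OF assms(1)] by (intro mono_assoc assms) auto
    moreover let ?s = "\<Sum>S\<in>I. mono S (x S)"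
    have IH: "?s \<in> Q" "(?s \<bullet>\<bullet> y) \<bullet>\<bullet> z = ?s \<bullet>\<bullet> (y \<bullet>\<bullet> z)" using insert by auto
    ultimately have "mono S (x S) + ?s \<in> Q \<and>
        ((mono S (x S) + ?s) \<bullet>\<bullet> y) \<bullet>\<bullet> z = (mono S (x S) + ?s) \<bullet>\<bullet> (y \<bullet>\<bullet> z)"
      using S by (simp only: bmul_add_left bmul_Q Q_add assms)
    then show ?case unfolding sum.insert[OF insert.hyps] .
  qed (simp_all add: Q_0 bmul_0 bmul_Q assms)
  from this[OF subset_refl] have assoc: "((\<Sum>S\<in>Pow E. mono S (x S)) \<bullet>\<bullet> y) \<bullet>\<bullet> z
      = (\<Sum>S\<in>Pow E. mono S (x S)) \<bullet>\<bullet> (y \<bullet>\<bullet> z)" by blast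
  have "(\<Sum>S\<in>Pow E. mono S (x S)) = x"
  proof
    fix T
    have "(\<Sum>S\<in>Pow E. mono S (x S)) T = (\<Sum>S\<in>Pow E. mono S (x S) T)"
      by (rule sum_apply)
    also have "\<dots> = (\<Sum>S\<in>Pow E. if T = S then x T else 0)"
      by (intro sum.cong refl) (simp add: mono_def)
    also have "\<dots> = x T" using finite_E Q_support[OF assms(1), of T] by (auto simp: sum.delta')
    finally show "(\<Sum>S\<in>Pow E. mono S (x S)) T = x T" .
  qed
  then show ?thesis using assoc by (simp only:)
qed

end

section \<open>The BRST differential is a derivation\<close>

text \<open>
  The parity automorphism, \<open>(-1)\<^sup>|\<^sup>x\<^sup>|\<close> on homogeneous elements; it carries the signs of graded commutators
  and derivations.
\<close>

definition par :: "'c::ab_group_add grass \<Rightarrow> 'c grass" where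
  "par x = (\<lambda>S. signed (card S) (x S))"

lemma par_par [simp]: "par (par x) = x"
  by (rule ext) (simp add: par_def signed_def)

lemma par_add: "par (x + y) = par x + par y" and par_minus: "par (- x) = - par x"
  and par_diff: "par (x - y) = par x - par y"
  by (rule ext, simp add: par_def signed_add signed_minus signed_diff)+

lemma par_0: "par 0 = 0"
  by (rule ext) (simp add: par_def)

lemma par_sum: "par (\<Sum>i\<in>I. f i) = (\<Sum>i\<in>I. par (f i))"
  by (rule ext) (simp add: par_def sum_apply signed_sum)

lemma par_emb: "par (emb c) = emb c"
  by (rule ext) (simp add: par_def emb_def)

lemma par_wedge:
  assumes "\<And>S. infinite S \<Longrightarrow> x S = 0"
  shows "par (wedge i x) = - wedge i (par x)"
proof
  fix T
  show "par (wedge i x) T = (- wedge i (par x)) T"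
  proof (cases "finite T \<and> i \<in> T")
    case True
    then obtain n where n: "card T = Suc n" "card (T - {i}) = n" by (metis card_Suc_Diff1)
    show ?thesis using True by (simp add: par_def wedge_def n add.commute del: card_Diff_insert)
  next
    case False
    show ?thesis
    proof (cases "i \<in> T")
      case True
      with False have "infinite (T - {i})" by simp
      then show ?thesis by (simp add: par_def wedge_def assms)
    qed (simp add: par_def wedge_def)
  qed
qed

lemma wedge_minus: "wedge i (- x) = - wedge i x"
  by (rule ext) (simp add: wedge_def signed_minus)

lemma wedge_infinite: "(\<And>S. infinite S \<Longrightarrow> x S = 0) \<Longrightarrow> infinite T \<Longrightarrow> wedge i x T = 0"
  by (simp add: wedge_def)

lemma emb_infinite: "infinite T \<Longrightarrow> emb c T = 0"
  by (auto simp: emb_def)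

lemma fps_nth_signed: "fps_nth (signed n F) m = signed n (fps_nth F m)"
  by (simp add: signed_def)

lemma gscale_X_cancel: "gscale fps_X x = gscale fps_X (y :: 'c::comm_ring_1 fps grass) \<Longrightarrow> x = y"
  by (rule ext) (metis fps_X_cancel gscale_def)

lemma gscale_X_add: "gscale fps_X (x + y) = gscale fps_X x + gscale fps_X (y :: 'c::comm_ring_1 fps grass)"
  and gscale_X_minus: "gscale fps_X (- x) = - gscale fps_X x"
  by (rule ext, simp add: gscale_def algebra_simps)+

lemma fps_X_shift: "fps_nth F 0 = 0 \<Longrightarrow> fps_X * fps_shift 1 F = (F :: 'c::comm_ring_1 fps)"
proof (rule fps_ext)
  fix n assume "fps_nth F 0 = 0"
  then show "fps_nth (fps_X * fps_shift 1 F) n = fps_nth F n" by (cases n) auto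
qed

context brst_setting
begin

lemma par_Q: "x \<in> Q \<Longrightarrow> par x \<in> Q"
proof (rule QI)
  assume x: "x \<in> Q"
  show "par x S \<in> SM" for S unfolding par_def by (rule SM_signed[OF Q_coeff[OF x]])
  show "S \<subseteq> E" if "par x S \<noteq> 0" for S
    using that Q_support[OF x, of S] by (cases "x S = 0") (simp_all add: par_def)
qed

lemma par_bmul: "x \<in> Q \<Longrightarrow> y \<in> Q \<Longrightarrow> par (x \<bullet>\<bullet> y) = par x \<bullet>\<bullet> par y"
proof -
  assume x: "x \<in> Q" and y: "y \<in> Q"
  have e: "(\<lambda>S T. star D (par x S) (par y T)) = (\<lambda>S T. signed (card S + card T) (star D (x S) (y T)))"
    by (intro ext) (simp add: par_def star_signed_left star_signed_right SM_signed Q_coeff x y add.commute)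
  show ?thesis
    unfolding bmul_eq e by (rule ext) (simp only: par_def gprod_exp_parity)
qed

lemma gh_E: "a < gdim D \<Longrightarrow> gh a \<in> E" and ag_E: "a < gdim D \<Longrightarrow> ag a \<in> E"
  by (auto simp: gh_def ag_def all_gens_def)

lemma theta_eq:
  "theta D = (\<Sum>a<gdim D. \<Sum>b<gdim D. \<Sum>c<gdim D.
        wedge (gh a) (wedge (gh b) (wedge (ag c) (emb (scal (- (1 / 4) * fc D a b c))))))
     + (\<Sum>a<gdim D. wedge (gh a) (emb (fps_const (Jc D a))))
     + (\<Sum>a<gdim D. \<Sum>b<gdim D. wedge (gh a) (emb (fps_X * scal (1 / 2 * fc D a b b))))"
proof -
  have "gscale c (gen i) = wedge i (emb c)" for c :: "('m \<Rightarrow> 'k) fps" and i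
    by (simp add: gen_eq_wedge gscale_wedge gscale_emb)
  then show ?thesis by (simp only: theta_def gmul_gen_gen_gen)
qed

text \<open>
  The coefficients of \<open>\<theta>\<close> lie in every additive group containing the constants and the components of
  the moment map; besides smoothness this is applied to the commutant of an invariant function.
\<close>

lemma theta_coefficients:
  assumes A: "add_closed A" and "\<And>c. scal c \<in> A" "\<And>c. fps_X * scal c \<in> A"
    "\<And>a. a < gdim D \<Longrightarrow> fps_const (Jc D a) \<in> A"
  shows "theta D \<in> grass_over A E"
proof -
  note G = add_closed_grass_over[OF A, of E]
  show ?thesis
    unfolding theta_eq
    by (intro add_closedD(2)[OF G] add_closed_sum[OF G] grass_over_wedge[OF A] grass_over_emb[OF A] assms(2-4))
      (simp_all add: gh_E ag_E)
qed

lemma theta_Q: "theta D \<in> Q"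
  unfolding Q_def
  by (rule theta_coefficients[OF SM_closed]) (simp_all add: SM_scal SM_X SM_const Jc_CM)

lemma par_theta: "par (theta D) = - theta D"
proof -
  have 1: "par (wedge i (emb c)) = - wedge i (emb c)" for i and c :: "('m \<Rightarrow> 'k) fps"
    by (simp add: par_wedge emb_infinite par_emb)
  have 3: "par (wedge i (wedge j (wedge k (emb c)))) = - wedge i (wedge j (wedge k (emb c)))"
    for i j k and c :: "('m \<Rightarrow> 'k) fps"
    by (simp add: par_wedge emb_infinite wedge_infinite par_emb wedge_minus)
  show ?thesis
    unfolding theta_eq par_add par_sum 1 3 sum_negf by (simp only: minus_add_distrib)
qed

text \<open>
  The graded commutator with the odd element \<open>\<theta>\<close>, that is \<open>\<nu>\<close> times the BRST differential.
\<close>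

definition ad :: "('m \<Rightarrow> 'k) fps grass \<Rightarrow> ('m \<Rightarrow> 'k) fps grass" where
  "ad x = theta D \<bullet>\<bullet> x - par x \<bullet>\<bullet> theta D"

lemma fps_eq_minus_zero: "F = - F \<Longrightarrow> F = (0 :: ('m \<Rightarrow> 'k) fps)"
proof (rule fps_ext, rule ext)
  fix n p assume "F = - F"
  then have "fps_nth F n = fps_nth (- F) n" by (rule arg_cong)
  then have "fps_nth F n p = (- fps_nth F n) p" by (simp only: fps_neg_nth)
  then have "fps_nth F n p = - fps_nth F n p" by (simp only: uminus_apply)
  then have "fps_nth F n p + fps_nth F n p = 0" by (rule eq_neg_iff_add_eq_0[THEN iffD1])
  then have "2 * fps_nth F n p = 0" by (simp only: mult_2)
  then show "fps_nth F n p = fps_nth 0 n p" by simp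
qed

lemma brst_comm_theta: "x \<in> Q \<Longrightarrow> brst_comm D (theta D) x = ad x"
proof -
  assume x: "x \<in> Q"
  have th: "theta D S = 0" if "even (card S)" for S
  proof (rule fps_eq_minus_zero)
    have "par (theta D) S = theta D S" using that by (simp add: par_def signed_def)
    then show "theta D S = - theta D S" by (simp add: par_theta)
  qed
  have e: "even_part (theta D) = 0" and o: "odd_part (theta D) = theta D"
    by (rule ext, simp add: even_part_def odd_part_def th)+
  have ev: "even_part x \<in> Q" and od: "odd_part x \<in> Q"
    by (rule QI, auto simp: even_part_def odd_part_def SM_0 Q_coeff[OF x] dest: Q_support[OF x] split: if_splits)+
  have "par x = even_part x - odd_part x"
    by (rule ext) (simp add: par_def even_part_def odd_part_def signed_def)
  then have "par x \<bullet>\<bullet> theta D = even_part x \<bullet>\<bullet> theta D - odd_part x \<bullet>\<bullet> theta D"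
    by (simp only: bmul_diff_left[OF ev od theta_Q])
  then show ?thesis
    unfolding brst_comm_def e o ad_def bmul_0(2)[OF od] by simp
qed

lemma bmul_nth_0:
  assumes "x \<in> Q" "y \<in> Q"
  shows "fps_nth ((x \<bullet>\<bullet> y) R) 0
    = (\<Sum>S\<in>Pow R. signed (inversions S (R - S)) (fps_nth (x S) 0 * fps_nth (y (R - S)) 0))"
proof -
  have s: "fps_nth (star D F G) 0 = fps_nth F 0 * fps_nth G 0" if "F \<in> SM" "G \<in> SM" for F G
    using that by (simp add: star_nth mu_0 SM_nth)
  have "fps_nth (exp_series c) 0 = fps_nth (c 0) 0" for c :: "nat \<Rightarrow> ('m \<Rightarrow> 'k) fps"
    by (simp add: exp_series_def fscale_simps(5))
  then show ?thesis
    by (simp add: bmul_eq gprod_def fps_sum_nth fps_nth_signed exp_contraction_eq s Q_coeff assms)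
qed

text \<open>
  At \<open>\<nu> = 0\<close> the product is supercommutative, so that the graded commutator with the odd element
  \<open>\<theta>\<close> is divisible by \<open>\<nu>\<close>.
\<close>

lemma ad_nth_0:
  assumes x: "x \<in> Q"
  shows "fps_nth (ad x R) 0 = 0"
proof (cases "finite R")
  case False
  then show ?thesis by (simp add: ad_def bmul_nth_0 theta_Q par_Q x)
next
  case True
  let ?t = "\<lambda>S. fps_nth (theta D S) 0" and ?x = "\<lambda>S. fps_nth (x S) 0"
  have "(\<Sum>S\<in>Pow R. signed (inversions S (R - S)) (fps_nth (par x S) 0 * ?t (R - S)))
      = (\<Sum>S\<in>Pow R. signed (inversions (R - S) S) (fps_nth (par x (R - S)) 0 * ?t S))"
    by (rule sum.reindex_bij_witness[where i = "\<lambda>S. R - S" and j = "\<lambda>S. R - S"]) (auto simp: double_diff)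
  also have "\<dots> = (\<Sum>S\<in>Pow R. signed (inversions S (R - S)) (?t S * ?x (R - S)))"
  proof (rule sum.cong[OF refl])
    fix S assume S: "S \<in> Pow R"
    then have fin: "finite S" "finite (R - S)" using True finite_subset by auto
    show "signed (inversions (R - S) S) (fps_nth (par x (R - S)) 0 * ?t S)
        = signed (inversions S (R - S)) (?t S * ?x (R - S))"
    proof (cases "even (card S)")
      case True
      have "par (theta D) S = theta D S" using True by (simp add: par_def signed_def)
      then have "theta D S = 0" by (intro fps_eq_minus_zero) (simp add: par_theta)
      then show ?thesis by simp
    next
      case False
      have "inversions S (R - S) + inversions (R - S) S = card S * card (R - S)"
        using S fin by (intro inversions_swap) auto
      then have "even (inversions (R - S) S + card (R - S) + inversions S (R - S))"
        using False by (metis even_add even_mult_iff add.commute)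
      then have "signed (inversions (R - S) S + card (R - S)) (?x (R - S) * ?t S)
          = signed (inversions S (R - S)) (?x (R - S) * ?t S)"
        by (rule signed_cong)
      then show ?thesis
        by (simp add: par_def fps_nth_signed signed_mult mult.commute[of _ "?t S"])
    qed
  qed
  finally show ?thesis by (simp add: ad_def bmul_nth_0 theta_Q par_Q x)
qed

lemma X_brst_diff: "x \<in> Q \<Longrightarrow> gscale fps_X (brst_diff D x) = ad x"
  unfolding gscale_def brst_diff_def by (rule ext) (simp only: brst_comm_theta fps_X_shift ad_nth_0)

lemma ad_Q: "x \<in> Q \<Longrightarrow> ad x \<in> Q"
  unfolding ad_def by (intro Q_diff bmul_Q theta_Q par_Q)

lemma brst_diff_Q: "x \<in> Q \<Longrightarrow> brst_diff D x \<in> Q"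
proof (rule QI)
  assume x: "x \<in> Q"
  show "brst_diff D x S \<in> SM" for S
    using Q_coeff[OF ad_Q[OF x], of S] by (simp add: brst_diff_def brst_comm_theta[OF x] ser_def)
  show "S \<subseteq> E" if "brst_diff D x S \<noteq> 0" for S
    using that Q_support[OF ad_Q[OF x], of S]
    by (cases "ad x S = 0") (simp_all add: brst_diff_def brst_comm_theta[OF x])
qed

text \<open>
  A graded commutator in an associative algebra is a graded derivation; then \<open>\<nu>\<close> is cancelled.
\<close>

lemma brst_diff_bmul:
  assumes x: "x \<in> Q" and y: "y \<in> Q"
  shows "brst_diff D (x \<bullet>\<bullet> y) = brst_diff D x \<bullet>\<bullet> y + par x \<bullet>\<bullet> brst_diff D y"
proof (rule gscale_X_cancel)
  note t = theta_Q and px = par_Q[OF x] and py = par_Q[OF y]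
  have "gscale fps_X (brst_diff D (x \<bullet>\<bullet> y)) = ad (x \<bullet>\<bullet> y)"
    by (rule X_brst_diff[OF bmul_Q[OF x y]])
  also have "\<dots> = (theta D \<bullet>\<bullet> x) \<bullet>\<bullet> y - (par x \<bullet>\<bullet> theta D) \<bullet>\<bullet> y
      + (par x \<bullet>\<bullet> (theta D \<bullet>\<bullet> y) - par x \<bullet>\<bullet> (par y \<bullet>\<bullet> theta D))"
    by (simp add: ad_def par_bmul x y bmul_assoc t px py)
  also have "\<dots> = ad x \<bullet>\<bullet> y + par x \<bullet>\<bullet> ad y"
    by (simp only: ad_def bmul_diff_left bmul_diff_right bmul_Q x y t px py)
  also have "\<dots> = gscale fps_X (brst_diff D x \<bullet>\<bullet> y + par x \<bullet>\<bullet> brst_diff D y)"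
    by (simp only: gscale_X_add bmul_X_left[OF brst_diff_Q[OF x] y, symmetric]
        bmul_X_right[OF px brst_diff_Q[OF y], symmetric] X_brst_diff x y)
  finally show "gscale fps_X (brst_diff D (x \<bullet>\<bullet> y))
      = gscale fps_X (brst_diff D x \<bullet>\<bullet> y + par x \<bullet>\<bullet> brst_diff D y)" .
qed

lemma brst_diff_par:
  assumes x: "x \<in> Q"
  shows "brst_diff D (par x) = - par (brst_diff D x)"
proof (rule gscale_X_cancel)
  have "gscale fps_X (brst_diff D (par x)) = ad (par x)"
    by (rule X_brst_diff[OF par_Q[OF x]])
  also have "\<dots> = - par (ad x)"
    by (simp add: ad_def par_diff par_bmul theta_Q par_Q x par_theta bmul_minus_left bmul_minus_right)
  also have "par (ad x) = gscale fps_X (par (brst_diff D x))"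
    unfolding X_brst_diff[OF x, symmetric] by (rule ext) (simp add: par_def gscale_def signed_mult)
  finally show "gscale fps_X (brst_diff D (par x)) = gscale fps_X (- par (brst_diff D x))"
    by (simp only: gscale_X_minus)
qed

lemma closed_bmul:
  assumes "x \<in> Q" "y \<in> Q" "brst_diff D x = 0" "brst_diff D y = 0"
  shows "brst_diff D (x \<bullet>\<bullet> y) = 0"
  using brst_diff_bmul[OF assms(1,2)] assms by (simp add: bmul_0 par_Q)

lemma exact_bmul_closed:
  assumes "x \<in> Q" "y \<in> Q" "brst_diff D y = 0"
  shows "brst_diff D x \<bullet>\<bullet> y = brst_diff D (x \<bullet>\<bullet> y)"
  using brst_diff_bmul[OF assms(1,2)] assms by (simp add: bmul_0 par_Q)

lemma closed_bmul_exact: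
  assumes "x \<in> Q" "y \<in> Q" "brst_diff D x = 0"
  shows "x \<bullet>\<bullet> brst_diff D y = brst_diff D (par x \<bullet>\<bullet> y)"
  using brst_diff_bmul[OF par_Q[OF assms(1)] assms(2)] assms brst_diff_par[OF assms(1)]
  by (simp add: bmul_0 par_0)

text \<open>
  By strong invariance an invariant function star-commutes with the components of the moment map, hence
  with all coefficients of \<open>\<theta>\<close>.
\<close>

lemma brst_diff_emb_invariant:
  assumes F: "F \<in> SM" and inv: "\<And>a n. a < gdim D \<Longrightarrow> poisson D (Jc D a) (fps_nth F n) = 0"
  shows "brst_diff D (emb F) = 0"
proof (rule gscale_X_cancel)
  \<comment> \<open>The commutant of \<open>F\<close>.\<close>
  let ?A = "{u \<in> SM. star D u F = star D F u}"
  have "add_closed ?A"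
    using SM_0 SM_add SM_minus
    by (auto simp: add_closed_def star_0_left star_0_right star_add_left star_add_right
        star_minus_left star_minus_right F)
  moreover have "scal c \<in> ?A" for c
    by (simp add: SM_scal star_scal F)
  moreover from this have "fps_X * scal c \<in> ?A" for c
    using star_X_left[OF SM_scal F] star_X_right[OF F SM_scal] SM_X by simp
  moreover have "fps_const (Jc D a) \<in> ?A" if a: "a < gdim D" for a
  proof -
    have "ser_map (poisson D (Jc D a)) F = 0" by (rule fps_ext) (simp add: ser_map_def inv[OF a])
    then have "star D (fps_const (Jc D a)) F - star D F (fps_const (Jc D a)) = 0"
      using star_commutator_J[OF gbasis_lie_alg[OF a] F] by (simp add: Jc_def)
    then show ?thesis using a by (simp add: SM_const Jc_CM)
  qed
  ultimately have "theta D \<in> grass_over ?A E" by (intro theta_coefficients)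
  then have "theta D S \<in> ?A" for S
    using grass_over_coeff[OF \<open>add_closed ?A\<close>] by blast
  then have "theta D \<bullet>\<bullet> emb F = emb F \<bullet>\<bullet> theta D"
    by (simp add: bmul_emb_left bmul_emb_right F theta_Q)
  then have "ad (emb F) = 0" by (simp add: ad_def par_emb)
  then show "gscale fps_X (brst_diff D (emb F)) = gscale fps_X 0"
    using X_brst_diff[OF Q_emb[OF F]] by (simp add: gscale_def fun_eq_iff)
qed

section \<open>The quantum restriction\<close>

lemma koszul_0: "emb f \<in> koszul_space D" if "f \<in> CM D"
  unfolding koszul_space_def by (rule grass_over_emb[OF CM_closed that])

lemma contraction_facts:
  shows hmap_linear: "linear_map fgscale fgscale (koszul_space D) (koszul_space D) (hmap D)"
    and prol_linear: "linear_map fscale fscale (CZ D) (CM D) (prol D)"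
    and prol_continuous: "continuous_map (CZ_topology D) (CM_topology D) (prol D)"
    and prol_equivariant: "\<And>a u. a < gdim D \<Longrightarrow> u \<in> CZ D \<Longrightarrow>
      prol D (act_Z D a u) = poisson D (Jc D a) (prol D u)"
    and hmap_continuous: "continuous_map (grass_topology (CM_topology D) (antighosts D))
       (grass_topology (CM_topology D) (antighosts D)) (hmap D)"
    and res_prol: "\<And>u. u \<in> CZ D \<Longrightarrow> res D (prol D u) = u"
    and hmap_prol: "\<And>u. u \<in> CZ D \<Longrightarrow> hmap D (emb (prol D u)) = 0"
  using contraction unfolding equivariant_contraction_def by blast+

lemma prol_CM: "u \<in> CZ D \<Longrightarrow> prol D u \<in> CM D"
  and prol_add: "u \<in> CZ D \<Longrightarrow> v \<in> CZ D \<Longrightarrow> prol D (u + v) = prol D u + prol D v"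
  and prol_scale: "u \<in> CZ D \<Longrightarrow> prol D (fscale c u) = fscale c (prol D u)"
  using prol_linear unfolding linear_map_def by blast+

lemma prol_0: "prol D 0 = 0"
  using prol_add[OF CZ_0 CZ_0] by simp

lemma fscale_minus_1: "fscale (- 1) g = - (g :: 'm \<Rightarrow> 'k)"
  by (rule ext) (simp add: fscale_def)

text \<open>
  The coefficient of \<open>h\<^sub>0 f\<close> at the antighost \<open>\<xi>\<^sub>a\<close>.
\<close>

definition hmap_coeff :: "nat \<Rightarrow> ('m \<Rightarrow> 'k) \<Rightarrow> 'm \<Rightarrow> 'k" where
  "hmap_coeff a f = hmap D (emb f) {ag a}"

lemma hmap_coeff_CM: "f \<in> CM D \<Longrightarrow> hmap_coeff a f \<in> CM D"
proof -
  assume f: "f \<in> CM D"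
  have "hmap D (emb f) \<in> koszul_space D"
    using hmap_linear koszul_0[OF f] unfolding linear_map_def by blast
  then show ?thesis
    unfolding hmap_coeff_def koszul_space_def by (rule grass_over_coeff[OF CM_closed])
qed

lemma hmap_coeff_add:
  assumes "f \<in> CM D" "g \<in> CM D"
  shows "hmap_coeff a (f + g) = hmap_coeff a f + hmap_coeff a g"
proof -
  have "emb (f + g) = emb f + emb g" by (rule ext) (simp add: emb_def)
  then have "hmap D (emb (f + g)) = hmap D (emb f) + hmap D (emb g)"
    using hmap_linear koszul_0 assms unfolding linear_map_def by metis
  then show ?thesis by (simp only: hmap_coeff_def plus_fun_apply)
qed

lemma hmap_coeff_scale:
  assumes "f \<in> CM D"
  shows "hmap_coeff a (fscale c f) = fscale c (hmap_coeff a f)"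
proof -
  have "emb (fscale c f) = fgscale c (emb f)" by (rule ext) (simp add: emb_def fgscale_def fscale_simps(3))
  then have "hmap D (emb (fscale c f)) = fgscale c (hmap D (emb f))"
    using hmap_linear koszul_0[OF assms] unfolding linear_map_def by metis
  then show ?thesis by (simp only: hmap_coeff_def fgscale_def)
qed

lemma hmap_coeff_prol: "u \<in> CZ D \<Longrightarrow> hmap_coeff a (prol D u) = 0"
  by (simp add: hmap_coeff_def hmap_prol)

text \<open>
  The coefficient of \<open>\<nu>\<^sup>i\<^sup>+\<^sup>1\<close> in the difference of the deformed and the classical Koszul differential, applied
  after \<open>h\<^sub>0\<close>. The classical differential cancels the term of order zero of the star product, and the trace of
  the structure constants enters at order one.
\<close>

definition koszul_correction :: "nat \<Rightarrow> ('m \<Rightarrow> 'k) \<Rightarrow> 'm \<Rightarrow> 'k" where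
  "koszul_correction i f = (\<Sum>a<gdim D. mu D (Suc i) (hmap_coeff a f) (Jc D a))
     + (\<Sum>a<gdim D. \<Sum>b<gdim D. fscale (if i = 0 then 1 / 2 * fc D a b b else 0) (hmap_coeff a f))"

lemma koszul_correction_CM: "f \<in> CM D \<Longrightarrow> koszul_correction i f \<in> CM D"
  unfolding koszul_correction_def by (intro CM_add CM_sum CM_scale mu_CM hmap_coeff_CM) (simp_all add: Jc_CM)

lemma koszul_correction_add: "f \<in> CM D \<Longrightarrow> g \<in> CM D \<Longrightarrow> koszul_correction i (f + g) = koszul_correction i f + koszul_correction i g"
proof -
  assume f: "f \<in> CM D" and g: "g \<in> CM D"
  have "(\<Sum>a<gdim D. mu D (Suc i) (hmap_coeff a (f + g)) (Jc D a))
      = (\<Sum>a<gdim D. mu D (Suc i) (hmap_coeff a f) (Jc D a) + mu D (Suc i) (hmap_coeff a g) (Jc D a))"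
    by (intro sum.cong refl) (simp add: hmap_coeff_add mu_add_left hmap_coeff_CM Jc_CM f g)
  then show ?thesis
    unfolding koszul_correction_def hmap_coeff_add[OF f g] fscale_simps(1) sum.distrib by (simp only: add.assoc add.left_commute)
qed

lemma koszul_correction_scale: "f \<in> CM D \<Longrightarrow> koszul_correction i (fscale c f) = fscale c (koszul_correction i f)"
proof -
  assume f: "f \<in> CM D"
  have 1: "mu D (Suc i) (fscale c (hmap_coeff a f)) (Jc D a) = fscale c (mu D (Suc i) (hmap_coeff a f) (Jc D a))"
    if "a < gdim D" for a by (rule mu_scale_left[OF hmap_coeff_CM[OF f] Jc_CM[OF that]])
  have 2: "fscale d (fscale c h) = fscale c (fscale d h)" for d and h :: "'m \<Rightarrow> 'k"
    by (simp only: fscale_simps(7) mult.commute)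
  have 3: "(\<Sum>a<gdim D. mu D (Suc i) (fscale c (hmap_coeff a f)) (Jc D a))
      = (\<Sum>a<gdim D. fscale c (mu D (Suc i) (hmap_coeff a f) (Jc D a)))"
    by (intro sum.cong refl 1) simp
  show ?thesis
    unfolding koszul_correction_def hmap_coeff_scale[OF f] 2[of _ "hmap_coeff _ f"] 3 fscale_sum[symmetric] fscale_simps(1) ..
qed

lemma koszul_correction_0: "koszul_correction i 0 = 0"
  using koszul_correction_add[OF CM_0 CM_0] by simp

lemma koszul_correction_sum: "(\<And>j. j \<in> I \<Longrightarrow> f j \<in> CM D) \<Longrightarrow> koszul_correction i (\<Sum>j\<in>I. f j) = (\<Sum>j\<in>I. koszul_correction i (f j))"
proof (induction I rule: infinite_finite_induct)
  case (insert j I)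
  have IH: "koszul_correction i (\<Sum>j\<in>I. f j) = (\<Sum>j\<in>I. koszul_correction i (f j))"
    by (rule insert.IH) (simp add: insert.prems)
  have "f j \<in> CM D" "(\<Sum>j\<in>I. f j) \<in> CM D"
    using insert.prems by (auto intro: CM_sum)
  then show ?case unfolding sum.insert[OF insert.hyps] IH[symmetric] by (rule koszul_correction_add)
qed (simp_all only: sum.infinite sum.empty koszul_correction_0 not_False_eq_True)

text \<open>
  Here the side condition \<open>h\<^sub>0 prol = 0\<close> enters.
\<close>

lemma koszul_correction_prol: "u \<in> CZ D \<Longrightarrow> koszul_correction i (prol D u) = 0"
  unfolding koszul_correction_def hmap_coeff_prol fscale_simps(3) by (simp add: mu_0_left Jc_CM)

text \<open>
  The perturbation of the identity that is inverted in the definition of the quantum restriction.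
\<close>

definition res_op :: "('m \<Rightarrow> 'k) fps \<Rightarrow> ('m \<Rightarrow> 'k) fps" where
  "res_op F = F + (let y = gser_map (hmap D) (emb F) in qkoszul D y - gser_map (koszul D) y) {}"

text \<open>
  The perturbation raises the order in \<open>\<nu>\<close>, so that \<open>res_op\<close> is unitriangular.
\<close>

lemma res_op_nth:
  assumes F: "F \<in> SM"
  shows "fps_nth (res_op F) n = fps_nth F n + (\<Sum>i<n. koszul_correction i (fps_nth F (n - Suc i)))"
proof -
  define y where "y = gser_map (hmap D) (emb F)"
  define Y where "Y a = y {ag a}" for a
  have gc: "gcoeff (emb F) n = emb (fps_nth F n)" for n
    by (rule ext) (simp add: gcoeff_def emb_def)
  have Yn: "fps_nth (Y a) n = hmap_coeff a (fps_nth F n)" for a n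
    by (simp add: Y_def y_def gser_map_def gc hmap_coeff_def)
  have YS: "Y a \<in> SM" for a
    unfolding ser_def mem_Collect_eq Yn using hmap_coeff_CM SM_nth[OF F] by blast
  have gd: "gder (ag a) x {} = x {ag a}" for a and x :: "'c::ab_group_add grass"
    by (simp add: gder_eq below_def)
  have gm: "gscale c (gmul (gen i) x) {} = 0" for c i and x :: "'c::comm_ring_1 grass"
    by (simp add: gscale_def gmul_def gen_def)
  have "qkoszul D y {} = (\<Sum>a<gdim D. star D (Y a) (fps_const (Jc D a)))
      + (\<Sum>a<gdim D. \<Sum>b<gdim D. fps_X * (scal (1 / 2 * fc D a b b) * Y a))"
    unfolding qkoszul_def plus_fun_apply sum_apply gm gd by (simp add: gscale_def gd Y_def mult.assoc)
  moreover have "gser_map (koszul D) y {} = Abs_fps (\<lambda>n. \<Sum>a<gdim D. Jc D a * hmap_coeff a (fps_nth F n))"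
    unfolding gser_map_def koszul_def sum_apply by (simp add: gscale_def gd gcoeff_def Yn[unfolded Y_def])
  ultimately have "fps_nth (res_op F) n = fps_nth F n
      + ((\<Sum>a<gdim D. fps_nth (star D (Y a) (fps_const (Jc D a))) n)
      + (\<Sum>a<gdim D. \<Sum>b<gdim D. fps_nth (fps_X * (scal (1 / 2 * fc D a b b) * Y a)) n)
      - (\<Sum>a<gdim D. Jc D a * hmap_coeff a (fps_nth F n)))"
    by (simp add: res_op_def y_def[symmetric] fps_sum_nth)
  also have "(\<Sum>a<gdim D. fps_nth (star D (Y a) (fps_const (Jc D a))) n)
      = (\<Sum>a<gdim D. Jc D a * hmap_coeff a (fps_nth F n)
        + (\<Sum>i<n. mu D (Suc i) (hmap_coeff a (fps_nth F (n - Suc i))) (Jc D a)))"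
  proof (rule sum.cong[OF refl])
    fix a assume "a \<in> {..<gdim D}"
    then have J: "Jc D a \<in> CM D" by (simp add: Jc_CM)
    have "fps_nth (star D (Y a) (fps_const (Jc D a))) n = (\<Sum>i<Suc n. mu D i (hmap_coeff a (fps_nth F (n - i))) (Jc D a))"
      unfolding star_const_right_nth[OF YS J] Yn lessThan_Suc_atMost ..
    also have "\<dots> = mu D 0 (hmap_coeff a (fps_nth F n)) (Jc D a)
        + (\<Sum>i<n. mu D (Suc i) (hmap_coeff a (fps_nth F (n - Suc i))) (Jc D a))"
      by (subst sum.lessThan_Suc_shift) simp
    finally show "fps_nth (star D (Y a) (fps_const (Jc D a))) n = Jc D a * hmap_coeff a (fps_nth F n)
        + (\<Sum>i<n. mu D (Suc i) (hmap_coeff a (fps_nth F (n - Suc i))) (Jc D a))"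
      by (simp only: mu_0[OF hmap_coeff_CM[OF SM_nth[OF F]] J] mult.commute)
  qed
  also have "(\<Sum>a<gdim D. \<Sum>b<gdim D. fps_nth (fps_X * (scal (1 / 2 * fc D a b b) * Y a)) n)
      = (\<Sum>i<n. \<Sum>a<gdim D. \<Sum>b<gdim D. fscale (if i = 0 then 1 / 2 * fc D a b b else 0) (hmap_coeff a (fps_nth F (n - Suc i))))"
  proof (cases n)
    case (Suc m)
    have "(\<Sum>i<Suc m. \<Sum>a<gdim D. \<Sum>b<gdim D. fscale (if i = 0 then 1 / 2 * fc D a b b else 0) (hmap_coeff a (fps_nth F (Suc m - Suc i))))
        = (\<Sum>a<gdim D. \<Sum>b<gdim D. fscale (1 / 2 * fc D a b b) (hmap_coeff a (fps_nth F m)))"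
      by (subst sum.lessThan_Suc_shift) (simp add: fscale_simps(6))
    then show ?thesis unfolding Suc fps_X_mult_nth scal_mult_nth Yn by simp
  qed simp
  also have "(\<Sum>a<gdim D. Jc D a * hmap_coeff a (fps_nth F n)
        + (\<Sum>i<n. mu D (Suc i) (hmap_coeff a (fps_nth F (n - Suc i))) (Jc D a)))
      = (\<Sum>a<gdim D. Jc D a * hmap_coeff a (fps_nth F n))
        + (\<Sum>i<n. \<Sum>a<gdim D. mu D (Suc i) (hmap_coeff a (fps_nth F (n - Suc i))) (Jc D a))"
    unfolding sum.distrib by (subst sum.swap) (rule refl)
  finally show ?thesis
    by (simp only: koszul_correction_def sum.distrib add.assoc add_diff_cancel_left' diff_add_eq[symmetric])
qed

text \<open>The components of the Neumann series inverting \<open>res_op\<close>.\<close>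

fun neumann_op :: "nat \<Rightarrow> ('m \<Rightarrow> 'k) \<Rightarrow> 'm \<Rightarrow> 'k" where
  "neumann_op 0 f = f"
| "neumann_op (Suc n) f = - (\<Sum>i\<le>n. koszul_correction i (neumann_op (n - i) f))"

declare neumann_op.simps(2) [simp del]

lemma neumann_op_CM: "f \<in> CM D \<Longrightarrow> neumann_op n f \<in> CM D"
proof (induction n rule: less_induct)
  case (less n)
  show ?case
  proof (cases n)
    case (Suc m)
    show ?thesis unfolding Suc neumann_op.simps(2)
      by (intro CM_minus CM_sum koszul_correction_CM less) (auto simp: Suc)
  qed (simp add: less.prems)
qed

lemma neumann_op_add: "f \<in> CM D \<Longrightarrow> g \<in> CM D \<Longrightarrow> neumann_op n (f + g) = neumann_op n f + neumann_op n g"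
proof (induction n rule: less_induct)
  case (less n)
  show ?case
  proof (cases n)
    case (Suc m)
    have "neumann_op (m - i) (f + g) = neumann_op (m - i) f + neumann_op (m - i) g" for i
      by (rule less.IH[OF _ less.prems]) (simp add: Suc less_Suc_eq_le)
    then show ?thesis
      unfolding Suc neumann_op.simps(2)
      by (simp only: koszul_correction_add neumann_op_CM less.prems sum.distrib minus_add_distrib)
  qed simp
qed

lemma neumann_op_scale: "f \<in> CM D \<Longrightarrow> neumann_op n (fscale c f) = fscale c (neumann_op n f)"
proof (induction n rule: less_induct)
  case (less n)
  show ?case
  proof (cases n)
    case (Suc m)
    have "neumann_op (m - i) (fscale c f) = fscale c (neumann_op (m - i) f)" for i
      by (rule less.IH[OF _ less.prems]) (simp add: Suc less_Suc_eq_le)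
    then show ?thesis
      unfolding Suc neumann_op.simps(2)
      by (simp only: koszul_correction_scale neumann_op_CM less.prems fscale_sum fscale_simps(2))
  qed simp
qed

lemma neumann_op_0: "neumann_op n 0 = 0"
  using neumann_op_add[OF CM_0 CM_0] by simp

definition neumann :: "('m \<Rightarrow> 'k) fps \<Rightarrow> ('m \<Rightarrow> 'k) fps" where
  "neumann F = Abs_fps (\<lambda>n. \<Sum>i\<le>n. neumann_op i (fps_nth F (n - i)))"

lemma neumann_SM: "F \<in> SM \<Longrightarrow> neumann F \<in> SM"
  unfolding ser_def[of "CM D"] mem_Collect_eq neumann_def fps_nth_Abs_fps by (intro allI CM_sum neumann_op_CM) blast

lemma sum_triangle:
  "(\<Sum>i\<le>m. \<Sum>j\<le>m - i. g i j) = (\<Sum>k\<le>(m::nat). \<Sum>i\<le>k. (g i (k - i) :: 'c::comm_monoid_add))"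
proof -
  have "(\<Sum>i\<le>m. \<Sum>j\<le>m - i. g i j) = (\<Sum>(i, j)\<in>(SIGMA i:{..m}. {..m - i}). g i j)"
    by (rule sum.Sigma) auto
  also have "(SIGMA i:{..m}. {..m - i}) = {(i, j). i + j \<le> m}" by auto
  finally show ?thesis by (simp only: sum.triangle_reindex_eq)
qed

lemma res_op_neumann:
  assumes F: "F \<in> SM"
  shows "res_op (neumann F) = F"
proof (rule fps_ext)
  fix n
  show "fps_nth (res_op (neumann F)) n = fps_nth F n"
  proof (cases n)
    case 0
    then show ?thesis by (simp add: res_op_nth neumann_SM F) (simp add: neumann_def)
  next
    case (Suc m)
    have RF: "neumann_op j (fps_nth F k) \<in> CM D" for j k by (rule neumann_op_CM[OF SM_nth[OF F]])
    have "(\<Sum>i<n. koszul_correction i (fps_nth (neumann F) (n - Suc i))) = (\<Sum>i\<le>m. \<Sum>j\<le>m - i. koszul_correction i (neumann_op j (fps_nth F (m - i - j))))"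
      by (simp add: Suc lessThan_Suc_atMost neumann_def koszul_correction_sum RF del: sum.lessThan_Suc)
    also have "\<dots> = (\<Sum>k\<le>m. \<Sum>i\<le>k. koszul_correction i (neumann_op (k - i) (fps_nth F (m - i - (k - i)))))"
      by (rule sum_triangle)
    also have "\<dots> = (\<Sum>k\<le>m. - neumann_op (Suc k) (fps_nth F (m - k)))"
      unfolding neumann_op.simps(2) minus_minus by (intro sum.cong refl) simp
    finally have 1: "(\<Sum>i<n. koszul_correction i (fps_nth (neumann F) (n - Suc i))) = - (\<Sum>k\<le>m. neumann_op (Suc k) (fps_nth F (m - k)))"
      by (simp only: sum_negf)
    have 2: "fps_nth (neumann F) n = fps_nth F n + (\<Sum>k\<le>m. neumann_op (Suc k) (fps_nth F (m - k)))"
      unfolding neumann_def fps_nth_Abs_fps Suc by (subst sum.atMost_Suc_shift) simp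
    show ?thesis
      unfolding res_op_nth[OF neumann_SM[OF F]] 1 2 by simp
  qed
qed

lemma inj_on_res_op: "inj_on res_op SM"
proof (rule inj_onI)
  fix F G assume F: "F \<in> SM" and G: "G \<in> SM" and eq: "res_op F = res_op G"
  have "fps_nth F n = fps_nth G n" for n
  proof (induction n rule: less_induct)
    case (less n)
    have "(\<Sum>i<n. koszul_correction i (fps_nth F (n - Suc i))) = (\<Sum>i<n. koszul_correction i (fps_nth G (n - Suc i)))"
      using less by (intro sum.cong refl) simp
    then show ?case
      using res_op_nth[OF F, of n] res_op_nth[OF G, of n] eq by simp
  qed
  then show "F = G" by (rule fps_ext)
qed

lemma qres_fun_eq_inv: "qres_fun D F = ser_map (res D) (inv_into SM res_op F)"
proof -
  have "(\<lambda>F. F + (let y = gser_map (hmap D) (emb F) in qkoszul D y - gser_map (koszul D) y) {}) = res_op"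
    by (rule ext) (simp only: res_op_def)
  then show ?thesis by (simp only: qres_fun_def)
qed

lemma qres_fun_eq:
  assumes "F \<in> SM"
  shows "qres_fun D F = Abs_fps (\<lambda>n. \<Sum>i\<le>n. res D (neumann_op i (fps_nth F (n - i))))"
proof -
  have "inv_into SM res_op F = neumann F"
    using inv_into_f_eq[OF inj_on_res_op neumann_SM[OF assms] res_op_neumann[OF assms]] .
  then show ?thesis
    by (simp add: qres_fun_eq_inv ser_map_def neumann_def res_sum)
qed

lemma qres_fun_prol:
  assumes f: "f \<in> ser (CZ D)"
  shows "qres_fun D (ser_map (prol D) f) = f"
proof -
  have u: "fps_nth f n \<in> CZ D" for n using f by (simp add: ser_def)
  then have P: "ser_map (prol D) f \<in> SM" by (simp add: ser_def ser_map_def prol_CM)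
  have "res_op (ser_map (prol D) f) = ser_map (prol D) f"
  proof (rule fps_ext)
    fix n
    have "fps_nth (ser_map (prol D) f) k = prol D (fps_nth f k)" for k by (simp add: ser_map_def)
    then show "fps_nth (res_op (ser_map (prol D) f)) n = fps_nth (ser_map (prol D) f) n"
      unfolding res_op_nth[OF P] by (simp only: koszul_correction_prol[OF u] sum.neutral_const add_0_right)
  qed
  then have "inv_into SM res_op (ser_map (prol D) f) = ser_map (prol D) f"
    using inv_into_f_eq[OF inj_on_res_op P] by blast
  then show ?thesis
    unfolding qres_fun_eq_inv by (intro fps_ext) (simp add: ser_map_def res_prol u)
qed

lemma qres_fun_SZ: "F \<in> SM \<Longrightarrow> qres_fun D F \<in> ser (CZ D)"
  unfolding ser_def[of "CZ D"] mem_Collect_eq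
  by (simp only: qres_fun_eq fps_nth_Abs_fps) (intro allI CZ_sum res_CZ neumann_op_CM SM_nth)

lemma qres_fun_add: "F \<in> SM \<Longrightarrow> G \<in> SM \<Longrightarrow> qres_fun D (F + G) = qres_fun D F + qres_fun D G"
  by (rule fps_ext) (simp add: qres_fun_eq SM_add neumann_op_add SM_nth res_add sum.distrib)

lemma qres_fun_0: "qres_fun D 0 = 0"
  using qres_fun_add[OF SM_0 SM_0] by simp

lemma qres_fun_X: "F \<in> SM \<Longrightarrow> qres_fun D (fps_X * F) = fps_X * qres_fun D F"
proof (rule fps_ext)
  fix n assume F: "F \<in> SM"
  show "fps_nth (qres_fun D (fps_X * F)) n = fps_nth (fps_X * qres_fun D F) n"
  proof (cases n)
    case (Suc m)
    have "(\<Sum>i\<le>m. res D (neumann_op i (fps_nth (fps_X * F) (Suc m - i)))) = (\<Sum>i\<le>m. res D (neumann_op i (fps_nth F (m - i))))"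
      by (intro sum.cong refl) (simp add: Suc_diff_le)
    then show ?thesis using F by (simp add: qres_fun_eq SM_X Suc neumann_op_0 res_0)
  qed (simp add: qres_fun_eq SM_X F neumann_op_0 res_0)
qed

lemma qres_fun_scal: "F \<in> SM \<Longrightarrow> qres_fun D (scal c * F) = scal c * qres_fun D F"
proof (rule fps_ext)
  fix n assume F: "F \<in> SM"
  show "fps_nth (qres_fun D (scal c * F)) n = fps_nth (scal c * qres_fun D F) n"
    unfolding qres_fun_eq[OF F] qres_fun_eq[OF SM_scal_mult[OF F]] scal_mult_nth fps_nth_Abs_fps
      neumann_op_scale[OF SM_nth[OF F]] res_scale fscale_sum ..
qed

lemma qres_add: "x \<in> Q \<Longrightarrow> y \<in> Q \<Longrightarrow> qres D (x + y) = qres D x + qres D y"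
  by (rule ext) (simp add: qres_def qres_fun_add Q_coeff)

lemma qres_0: "qres D 0 = 0"
  by (rule ext) (simp add: qres_def qres_fun_0)

lemma qres_X: "x \<in> Q \<Longrightarrow> qres D (gscale fps_X x) = gscale fps_X (qres D x)"
  by (rule ext) (simp add: qres_def gscale_def qres_fun_X Q_coeff)

lemma qres_scal: "x \<in> Q \<Longrightarrow> qres D (gscale (scal c) x) = gscale (scal c) (qres D x)"
  by (rule ext) (simp add: qres_def gscale_def qres_fun_scal Q_coeff)

lemma qres_minus: "x \<in> Q \<Longrightarrow> qres D (- x) = - qres D x"
  using qres_add[of x "- x"] Q_minus[of x] qres_0 by (simp add: eq_neg_iff_add_eq_0 add.commute)

lemma qres_diff: "x \<in> Q \<Longrightarrow> y \<in> Q \<Longrightarrow> qres D (x - y) = qres D x - qres D y"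
  using qres_add[of x "- y"] qres_minus[of y] Q_minus[of y] by simp

lemma qres_emb: "qres D (emb F) = emb (qres_fun D F)"
  by (rule ext) (simp add: qres_def emb_def qres_fun_0)

lemma ghosts_iff: "S \<subseteq> ghosts D \<longleftrightarrow> S \<subseteq> E \<and> (\<forall>i\<in>S. even i)"
proof
  assume "S \<subseteq> ghosts D"
  then show "S \<subseteq> E \<and> (\<forall>i\<in>S. even i)"
    by (fastforce simp: ghosts_def all_gens_def gh_def)
next
  assume S: "S \<subseteq> E \<and> (\<forall>i\<in>S. even i)"
  show "S \<subseteq> ghosts D"
  proof
    fix i assume "i \<in> S"
    then have "i = gh (i div 2)" "i div 2 < gdim D" using S by (auto simp: gh_def all_gens_def)
    then show "i \<in> ghosts D" unfolding ghosts_def by blast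
  qed
qed

lemma qres_cochain: "x \<in> Q \<Longrightarrow> qres D x \<in> cochain_ser D"
  unfolding cochain_ser_def grass_over_iff
proof (intro conjI allI impI)
  assume x: "x \<in> Q"
  show "qres D x S \<in> ser (CZ D)" if "S \<subseteq> ghosts D" for S
    using that qres_fun_SZ[OF Q_coeff[OF x], of S] by (simp add: ghosts_iff qres_def)
  show "qres D x S = 0" if S: "\<not> S \<subseteq> ghosts D" for S
  proof (cases "\<forall>i\<in>S. even i")
    case True
    then have "x S = 0" using S Q_support[OF x, of S] by (auto simp: ghosts_iff)
    then show ?thesis by (simp add: qres_def qres_fun_0)
  next
    case False
    then show ?thesis unfolding qres_def by (simp only: if_False)
  qed
qed

lemma continuous_hmap_coeff:
  assumes f: "continuous_map X (CM_topology D) f" and a: "a < gdim D"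
  shows "continuous_map X (CM_topology D) (\<lambda>x. hmap_coeff a (f x))"
proof -
  have "continuous_map (CM_topology D) (grass_topology (CM_topology D) (antighosts D)) emb"
    by (rule continuous_map_emb) (simp add: topspace_CM CM_0)
  from continuous_map_compose[OF continuous_map_compose[OF f this] hmap_continuous]
  have "continuous_map X (grass_topology (CM_topology D) (antighosts D)) (\<lambda>x. hmap D (emb (f x)))"
    by (simp add: comp_def)
  then show ?thesis
    unfolding hmap_coeff_def by (rule continuous_map_grass_topology) (use a in \<open>auto simp: antighosts_def\<close>)
qed

lemma continuous_map_CM_plus:
  "continuous_map X (CM_topology D) f \<Longrightarrow> continuous_map X (CM_topology D) g \<Longrightarrow>
    continuous_map X (CM_topology D) (\<lambda>x. f x + g x)"
  unfolding CM_topology_eq by (rule CMs.continuous_map_plus)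

lemma continuous_koszul_correction:
  assumes "continuous_map X (CM_topology D) f"
  shows "continuous_map X (CM_topology D) (\<lambda>x. koszul_correction i (f x))"
proof -
  have "continuous_map X (CM_topology D) (\<lambda>x. Jc D a)" if "a < gdim D" for a
    using that by (simp add: topspace_CM Jc_CM)
  then show ?thesis
    unfolding koszul_correction_def
    by (intro continuous_map_CM_plus continuous_map_CM_sum continuous_map_CM_scale
        continuous_map_bidifferential[OF mu_bidifferential] continuous_hmap_coeff assms) auto
qed

text \<open>
  Each coefficient of the quantum restriction is a finite composition of \<open>h\<^sub>0\<close> and bidifferential operators; this
  is what makes the reduced product continuous at every order.
\<close>

lemma continuous_neumann_op:
  assumes "continuous_map X (CM_topology D) f"
  shows "continuous_map X (CM_topology D) (\<lambda>x. neumann_op n (f x))"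
proof (induction n rule: less_induct)
  case (less n)
  show ?case
  proof (cases n)
    case (Suc m)
    have "continuous_map X (CM_topology D) (\<lambda>x. fscale (- 1) (\<Sum>i\<le>m. koszul_correction i (neumann_op (m - i) (f x))))"
      by (intro continuous_map_CM_scale continuous_map_CM_sum continuous_koszul_correction less) (simp add: Suc)
    moreover have "(\<lambda>x. neumann_op n (f x)) = (\<lambda>x. fscale (- 1) (\<Sum>i\<le>m. koszul_correction i (neumann_op (m - i) (f x))))"
      by (rule ext) (simp only: Suc neumann_op.simps(2) fscale_minus_1)
    ultimately show ?thesis by (simp only:)
  qed (simp add: assms)
qed

end

section \<open>Cosets and coefficients\<close>

lemma coset_eq_iff:
  assumes "add_closed W"
  shows "coset W x = coset W y \<longleftrightarrow> x - y \<in> W"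
proof
  assume "coset W x = coset W y"
  moreover have "x \<in> coset W x"
    unfolding coset_def by (rule image_eqI[of _ _ 0]) (simp_all add: add_closedD(1)[OF assms])
  ultimately have "x \<in> coset W y" by simp
  then obtain w where "x = y + w" "w \<in> W" unfolding coset_def by blast
  then show "x - y \<in> W" by simp
next
  have sub: "coset W x \<subseteq> coset W y" if "x - y \<in> W" for x y
  proof
    fix z assume "z \<in> coset W x"
    then obtain w where w: "z = x + w" "w \<in> W" unfolding coset_def by blast
    then have "z = y + ((x - y) + w)" by simp
    moreover have "(x - y) + w \<in> W" by (rule add_closedD(2)[OF assms that w(2)])
    ultimately show "z \<in> coset W y" unfolding coset_def by blast
  qed
  assume "x - y \<in> W"
  moreover from this have "y - x \<in> W" using add_closedD(3)[OF assms, of "x - y"] by simp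
  ultimately show "coset W x = coset W y" using sub by blast
qed

lemma coset_plus:
  assumes "add_closed W"
  shows "coset W x + coset W y = coset W (x + y)"
proof (rule Set.set_eqI, rule iffI)
  fix z assume "z \<in> coset W x + coset W y"
  then obtain u v where "z = (x + u) + (y + v)" "u \<in> W" "v \<in> W"
    unfolding coset_def set_plus_def by blast
  then have "z = x + y + (u + v)" "u + v \<in> W"
    using add_closedD(2)[OF assms] by (auto simp: algebra_simps)
  then show "z \<in> coset W (x + y)" unfolding coset_def by blast
next
  fix z assume "z \<in> coset W (x + y)"
  then obtain w where w: "z = x + y + w" "w \<in> W" unfolding coset_def by blast
  then have "z = (x + w) + (y + 0)" by (simp add: algebra_simps)
  moreover have "x + w \<in> coset W x" "y + 0 \<in> coset W y"
    using w(2) add_closedD(1)[OF assms] unfolding coset_def by blast+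
  ultimately show "z \<in> coset W x + coset W y" unfolding set_plus_def by blast
qed

text \<open>
  The summand \<open>W\<close> in \<open>coset_scale\<close> matters for \<open>c = 0\<close>, when \<open>s c\<close> maps the coset to a point.
\<close>

lemma coset_scale_coset:
  assumes W: "add_closed W" and s: "\<And>x y. s c (x + y) = s c x + s c y" "\<And>w. w \<in> W \<Longrightarrow> s c w \<in> W"
  shows "coset_scale s W c (coset W x) = coset W (s c x)"
proof (rule Set.set_eqI, rule iffI)
  fix z assume "z \<in> coset_scale s W c (coset W x)"
  then obtain u v where z: "z = s c (x + u) + v" "u \<in> W" "v \<in> W"
    unfolding coset_scale_def coset_def set_plus_def by blast
  have "z = s c x + (s c u + v)" unfolding z(1) s(1) by (rule add.assoc)
  moreover have "s c u + v \<in> W" by (intro add_closedD(2)[OF W] s(2) z)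
  ultimately show "z \<in> coset W (s c x)" unfolding coset_def by blast
next
  fix z assume "z \<in> coset W (s c x)"
  then obtain w where w: "z = s c x + w" "w \<in> W" unfolding coset_def by blast
  have "x \<in> coset W x"
    unfolding coset_def by (rule image_eqI[of _ _ 0]) (simp_all add: add_closedD(1)[OF W])
  then show "z \<in> coset_scale s W c (coset W x)"
    unfolding coset_scale_def set_plus_def w(1) using w(2) by blast
qed

lemma coset_sum:
  assumes "add_closed W"
  shows "(\<Sum>i\<le>(n::nat). coset W (x i)) = coset W (\<Sum>i\<le>n. x i)"
  by (induction n) (simp_all add: coset_plus[OF assms])

lemma bilinear_op_iff:
  "bilinear_op s V m \<longleftrightarrow> (\<forall>x\<in>V. \<forall>y\<in>V. m x y \<in> V) \<and>
    (\<forall>x\<in>V. \<forall>y\<in>V. \<forall>z\<in>V. m x (y + z) = m x y + m x z \<and> m (y + z) x = m y x + m z x) \<and>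
    (\<forall>c. \<forall>x\<in>V. \<forall>y\<in>V. m x (s c y) = s c (m x y) \<and> m (s c x) y = s c (m x y))"
  unfolding bilinear_op_def linear_map_def image_subset_iff by blast

definition from_coeffs :: "(nat \<Rightarrow> 'c grass) \<Rightarrow> 'c fps grass" where
  "from_coeffs c = (\<lambda>S. Abs_fps (\<lambda>n. c n S))"

lemma gcoeff_from_coeffs: "gcoeff (from_coeffs c) n = c n"
  by (rule ext) (simp add: gcoeff_def from_coeffs_def)

lemma gcoeff_eqI: "(\<And>n. gcoeff a n = gcoeff b n) \<Longrightarrow> a = b"
  by (rule ext, rule fps_ext) (metis gcoeff_def)

lemma gcoeff_add: "gcoeff (a + b) n = gcoeff a n + gcoeff b n"
  and gcoeff_diff: "gcoeff (a' - b') n = gcoeff a' n - gcoeff (b' :: 'c::ab_group_add fps grass) n"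
  and gcoeff_0: "gcoeff 0 n = 0"
  by (rule ext, simp add: gcoeff_def)+

lemma gcoeff_gser_map: "gcoeff (gser_map T a) n = T (gcoeff a n)"
  unfolding gser_map_def by (subst gcoeff_def) simp

lemma gcoeff_gser_app: "gcoeff (gser_app P a) n = (\<Sum>i\<le>n. P i (gcoeff a (n - i)))"
  unfolding gser_app_def by (subst gcoeff_def) (rule ext, simp add: sum_apply)

lemma gcoeff_gscale_X: "gcoeff (gscale fps_X a) n = (if n = 0 then 0 else gcoeff (a :: 'c::comm_ring_1 fps grass) (n - 1))"
  by (rule ext) (simp add: gcoeff_def gscale_def)

lemma gcoeff_gscale_scal: "gcoeff (gscale (scal c) a) n = fgscale c (gcoeff a n)"
  by (rule ext) (simp add: gcoeff_def gscale_def scal_mult_nth fgscale_def)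

lemma gcoeff_emb: "gcoeff (emb F) n = emb (fps_nth F n)"
  by (rule ext) (simp add: gcoeff_def emb_def)

lemma grass_ser_iff: "a \<in> grass_over (ser A) G \<longleftrightarrow> (\<forall>n. gcoeff a n \<in> grass_over A G)"
proof
  assume "a \<in> grass_over (ser A) G"
  then show "\<forall>n. gcoeff a n \<in> grass_over A G" by (simp add: grass_over_iff gcoeff_def ser_def)
next
  assume *: "\<forall>n. gcoeff a n \<in> grass_over A G"
  have "a S = 0" if "\<not> S \<subseteq> G" for S
  proof (rule fps_ext)
    fix n
    have "gcoeff a n S = 0" using * that unfolding grass_over_iff by blast
    then show "fps_nth (a S) n = fps_nth 0 n" by (simp add: gcoeff_def)
  qed
  moreover have "a S \<in> ser A" if "S \<subseteq> G" for S
    using * that by (simp add: grass_over_iff gcoeff_def ser_def)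
  ultimately show "a \<in> grass_over (ser A) G" by (simp add: grass_over_iff)
qed

lemma homog_gcoeff: "homog n a \<longleftrightarrow> (\<forall>m. homog n (gcoeff a m))"
proof
  assume *: "homog n a"
  show "\<forall>m. homog n (gcoeff a m)"
    unfolding homog_def
  proof (intro allI impI)
    fix m S assume "gcoeff a m S \<noteq> 0"
    then have "a S \<noteq> 0" by (auto simp: gcoeff_def)
    then show "gdeg S = n" using * by (simp add: homog_def)
  qed
next
  assume *: "\<forall>m. homog n (gcoeff a m)"
  show "homog n a"
    unfolding homog_def
  proof (intro allI impI)
    fix S assume "a S \<noteq> 0"
    then obtain m where "fps_nth (a S) m \<noteq> 0" by (metis fps_ext fps_zero_nth)
    then show "gdeg S = n" using * by (simp add: homog_def gcoeff_def)
  qed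
qed

lemma homog_sum: "(\<And>i. i \<in> I \<Longrightarrow> homog n (f i)) \<Longrightarrow> homog n (\<Sum>i\<in>I. f i :: 'c::comm_monoid_add grass)"
  unfolding homog_def sum_apply by (metis sum.neutral)

text \<open>The scalars \<open>\<bbbK>[[\<nu>]]\<close> inside the coefficient ring, and linearity over them.\<close>

definition kser :: "'k fps \<Rightarrow> ('m \<Rightarrow> 'k::real_normed_field) fps" where
  "kser c = Abs_fps (\<lambda>n _. fps_nth c n)"

lemma kser_mult_nth: "fps_nth (kser c * F) n = (\<Sum>i\<le>n. fscale (fps_nth c i) (fps_nth F (n - i)))"
  unfolding fps_mult_nth kser_def fps_nth_Abs_fps atMost_atLeast0
  by (intro sum.cong refl) (simp add: fscale_def times_fun_def)

lemma kser_unfold: "kser c * F = scal (fps_nth c 0) * F + fps_X * (kser (fps_shift 1 c) * F)"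
proof -
  have "kser c = scal (fps_nth c 0) + fps_X * kser (fps_shift 1 c)"
  proof (rule fps_ext)
    fix n
    show "fps_nth (kser c) n = fps_nth (scal (fps_nth c 0) + fps_X * kser (fps_shift 1 c)) n"
      by (cases n) (simp_all add: kser_def scal_def)
  qed
  from arg_cong[OF this, of "\<lambda>k. k * F"] show ?thesis by (simp only: distrib_right mult.assoc)
qed

lemma gscale_kser_unfold:
  "gscale (kser c) a = gscale (scal (fps_nth c 0)) a + gscale fps_X (gscale (kser (fps_shift 1 c)) a)"
proof
  fix S
  show "gscale (kser c) a S = (gscale (scal (fps_nth c 0)) a + gscale fps_X (gscale (kser (fps_shift 1 c)) a)) S"
    using kser_unfold[of c "a S"] by (simp only: gscale_def plus_fun_apply)
qed

lemma gcoeff_gscale_kser: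
  "gcoeff (gscale (kser c) a) n = (\<Sum>i\<le>n. fgscale (fps_nth c i) (gcoeff a (n - i)))"
  by (rule ext) (simp add: gcoeff_def gscale_def kser_mult_nth sum_apply fgscale_def)

text \<open>
  An additive map commuting with constants and with the parameter is linear over power series: the
  defect for \<open>c\<close> is \<open>\<nu>\<close> times the defect for the shifted series.
\<close>

lemma kser_linear:
  assumes add: "\<And>a b. a \<in> A \<Longrightarrow> b \<in> A \<Longrightarrow> T (a + b) = T a + T b"
    and X: "\<And>a. a \<in> A \<Longrightarrow> T (gscale fps_X a) = gscale fps_X (T a)"
    and scal: "\<And>c a. a \<in> A \<Longrightarrow> T (gscale (scal c) a) = gscale (scal c) (T a)"
    and A: "\<And>a. a \<in> A \<Longrightarrow> gscale fps_X a \<in> A" "\<And>c a. a \<in> A \<Longrightarrow> gscale (scal c) a \<in> A"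
      "\<And>c a. a \<in> A \<Longrightarrow> gscale (kser c) a \<in> A"
    and a: "a \<in> A"
  shows "T (gscale (kser c) a) = gscale (kser c) (T a :: ('m \<Rightarrow> 'k::real_normed_field) fps grass)"
proof (rule gcoeff_eqI)
  fix n
  show "gcoeff (T (gscale (kser c) a)) n = gcoeff (gscale (kser c) (T a)) n"
  proof (induction n arbitrary: c)
    case 0
    have "T (gscale (kser c) a) = gscale (scal (fps_nth c 0)) (T a) + gscale fps_X (T (gscale (kser (fps_shift 1 c)) a))"
      unfolding gscale_kser_unfold[of c a] by (simp only: add X scal A a)
    then show ?case
      by (simp only: gscale_kser_unfold[of c "T a"] gcoeff_add gcoeff_gscale_X simp_thms if_True)
  next
    case (Suc n)
    have "T (gscale (kser c) a) = gscale (scal (fps_nth c 0)) (T a) + gscale fps_X (T (gscale (kser (fps_shift 1 c)) a))"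
      unfolding gscale_kser_unfold[of c a] by (simp only: add X scal A a)
    then show ?case
      by (simp only: gscale_kser_unfold[of c "T a"] gcoeff_add gcoeff_gscale_X Suc nat.simps if_False diff_Suc_1)
  qed
qed

definition component :: "int \<Rightarrow> 'c::zero grass \<Rightarrow> 'c grass" where
  "component n a = (\<lambda>S. if gdeg S = n then a S else 0)"

lemma component_diff: "component n (a - b) = component n a - component n (b :: 'c::ab_group_add grass)"
  by (rule ext) (simp add: component_def)

lemma component_sum: "component n (\<Sum>i\<in>I. f i) = (\<Sum>i\<in>I. component n (f i :: 'c::ab_group_add grass))"
  by (rule ext) (simp add: component_def sum_apply)

lemma component_homog: "homog m a \<Longrightarrow> component n a = (if n = m then a else 0)"
  by (rule ext) (auto simp: component_def homog_def)

lemma homog_component: "homog n (component n a)"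
  by (simp add: homog_def component_def)

lemma gcoeff_component: "gcoeff (component n a) m = component n (gcoeff a m)"
  by (rule ext) (simp add: gcoeff_def component_def)

lemma fgscale_component: "fgscale c (component n a) = component n (fgscale (c :: 'k::real_normed_field) a)"
  by (rule ext) (simp add: fgscale_def component_def fscale_simps(3))

lemma grass_over_component: "add_closed A \<Longrightarrow> a \<in> grass_over A G \<Longrightarrow> component n a \<in> grass_over A G"
  by (auto simp: grass_over_iff component_def dest: add_closedD(1))

lemma wedge_add: "wedge i (a + b) = wedge i a + wedge i b"
  by (rule ext) (simp add: wedge_def signed_add)

lemma gder_add: "gder i (a + b) = gder i a + gder i (b :: 'c::ab_group_add grass)"
  by (rule ext) (simp add: gder_eq signed_add)

lemma fscale_signed: "fscale c (signed n f) = signed n (fscale (c :: 'k::real_normed_field) f)"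
  by (simp add: signed_def fscale_simps(2))

lemma wedge_fgscale: "wedge i (fgscale c a) = fgscale (c :: 'k::real_normed_field) (wedge i a)"
  by (rule ext) (simp add: wedge_def fgscale_def fscale_signed fscale_simps(3))

lemma gder_fgscale: "gder i (fgscale c a) = fgscale (c :: 'k::real_normed_field) (gder i a)"
  by (rule ext) (simp add: gder_eq fgscale_def fscale_signed fscale_simps(3))

lemma fgscale_add: "fgscale c (a + b) = fgscale c a + fgscale (c :: 'k::real_normed_field) b"
  by (rule ext) (simp add: fgscale_def fscale_simps(1))

lemma fgscale_sum: "fgscale c (\<Sum>i\<in>I. f i) = (\<Sum>i\<in>I. fgscale (c :: 'k::real_normed_field) (f i))"
  by (rule ext) (simp add: fgscale_def sum_apply fscale_sum)

lemma fgscale_diff: "fgscale c (a - b) = fgscale c a - fgscale (c :: 'k::real_normed_field) b"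
  by (rule ext) (simp add: fgscale_def fscale_simps(4))

lemma fgscale_fgscale: "fgscale c (fgscale d a) = fgscale d (fgscale (c :: 'k::real_normed_field) a)"
  by (rule ext) (simp add: fgscale_def fscale_simps(7) mult.commute)

lemma wedge_component:
  assumes "even i" "\<And>S. infinite S \<Longrightarrow> a S = 0"
  shows "wedge i (component n a) = component (n + 1) (wedge i a)"
proof
  fix T
  show "wedge i (component n a) T = component (n + 1) (wedge i a) T"
  proof (cases "i \<in> T \<and> finite T")
    case True
    then have "insert i (T - {i}) = T" "finite (T - {i})" "i \<notin> T - {i}" by auto
    then have "gdeg T = 1 + gdeg (T - {i})"
      using gdeg_insert[of "T - {i}" i] assms(1) by (simp only: if_True simp_thms)
    then have "gdeg (T - {i}) = n \<longleftrightarrow> gdeg T = n + 1" by linarith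
    then show ?thesis unfolding wedge_def component_def by (cases "gdeg T = n + 1") simp_all
  next
    case False
    show ?thesis
    proof (cases "i \<in> T")
      case True
      with False have "a (T - {i}) = 0" by (intro assms(2)) simp
      then show ?thesis by (simp add: wedge_def component_def)
    qed (simp add: wedge_def component_def)
  qed
qed

lemma gder_component:
  assumes "even i" "\<And>S. infinite S \<Longrightarrow> a S = 0"
  shows "gder i (component n a) = component (n - 1) (gder i a :: 'c::ab_group_add grass)"
proof
  fix T
  show "gder i (component n a) T = component (n - 1) (gder i a) T"
  proof (cases "i \<notin> T \<and> finite T")
    case True
    then have "gdeg (insert i T) = gdeg T + 1"
      using gdeg_insert[of T i] assms(1) by simp
    then show ?thesis by (simp add: gder_eq component_def)
  next
    case False
    show ?thesis
    proof (cases "i \<in> T")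
      case i: False
      with False have "a (insert i T) = 0" by (intro assms(2)) simp
      then show ?thesis by (simp add: gder_eq component_def)
    qed (simp add: gder_eq component_def)
  qed
qed

context brst_setting
begin

section \<open>The Lie algebra complex\<close>

lemma poisson_Jc_CM: "a < gdim D \<Longrightarrow> f \<in> CM D \<Longrightarrow> poisson D (Jc D a) f \<in> CM D"
  and poisson_Jc_add: "a < gdim D \<Longrightarrow> f \<in> CM D \<Longrightarrow> g \<in> CM D \<Longrightarrow>
    poisson D (Jc D a) (f + g) = poisson D (Jc D a) f + poisson D (Jc D a) g"
  and poisson_Jc_scale: "a < gdim D \<Longrightarrow> f \<in> CM D \<Longrightarrow>
    poisson D (Jc D a) (fscale c f) = fscale c (poisson D (Jc D a) f)"
  and poisson_Jc_mult: "a < gdim D \<Longrightarrow> f \<in> CM D \<Longrightarrow> g \<in> CM D \<Longrightarrow>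
    poisson D (Jc D a) (f * g) = poisson D (Jc D a) f * g + f * poisson D (Jc D a) g"
  unfolding Jc_def by (simp_all only: poisson_J_linear poisson_J_mult gbasis_lie_alg)

lemma act_Z_CZ: "a < gdim D \<Longrightarrow> u \<in> CZ D \<Longrightarrow> act_Z D a u \<in> CZ D"
proof -
  assume a: "a < gdim D" and u: "u \<in> CZ D"
  then have "\<exists>f. f \<in> CM D \<and> res D f = u" by (auto simp: CZ_def)
  then have "(SOME f. f \<in> CM D \<and> res D f = u) \<in> CM D" by (rule someI2_ex) blast
  then show ?thesis unfolding act_Z_def by (intro res_CZ poisson_Jc_CM[OF a])
qed

text \<open>
  The action on \<open>Z\<close> is defined through an arbitrary extension; equivariance of \<open>prol\<close> computes it with the
  extension \<open>prol u\<close>, which makes it linear.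
\<close>

lemma act_Z_eq: "a < gdim D \<Longrightarrow> u \<in> CZ D \<Longrightarrow> act_Z D a u = res D (poisson D (Jc D a) (prol D u))"
  using res_prol[OF act_Z_CZ] prol_equivariant by simp

lemma act_Z_add: "a < gdim D \<Longrightarrow> u \<in> CZ D \<Longrightarrow> v \<in> CZ D \<Longrightarrow> act_Z D a (u + v) = act_Z D a u + act_Z D a v"
  by (simp add: act_Z_eq CZ_add prol_add poisson_Jc_add prol_CM res_add)

lemma act_Z_scale: "a < gdim D \<Longrightarrow> u \<in> CZ D \<Longrightarrow> act_Z D a (fscale c u) = fscale c (act_Z D a u)"
  by (simp add: act_Z_eq CZ_scale prol_scale poisson_Jc_scale prol_CM res_scale)

lemma act_Z_0: "a < gdim D \<Longrightarrow> act_Z D a 0 = 0"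
  using act_Z_add[OF _ CZ_0 CZ_0, of a] by simp

lemma cochains_closed: "add_closed (cochains D)"
  unfolding cochains_def by (rule add_closed_grass_over[OF CZ_closed])

lemma cochain_coeff: "u \<in> cochains D \<Longrightarrow> u S \<in> CZ D"
  unfolding cochains_def by (rule grass_over_coeff[OF CZ_closed])

lemma ghosts_finite: "S \<subseteq> ghosts D \<Longrightarrow> finite S"
  using finite_subset[of S "ghosts D"] by (simp add: ghosts_def)

lemma cochain_infinite: "u \<in> cochains D \<Longrightarrow> infinite S \<Longrightarrow> u S = 0"
  using ghosts_finite[of S] by (auto simp: cochains_def grass_over_iff)

lemma gder_infinite: "(\<And>S. infinite S \<Longrightarrow> u S = 0) \<Longrightarrow> infinite S \<Longrightarrow> gder i u S = 0"
  by (simp add: gder_eq)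

lemma ce_diff_eq:
  assumes u: "u \<in> cochains D"
  shows "ce_diff D u = (\<Sum>a<gdim D. wedge (gh a) (\<lambda>S. act_Z D a (u S)))
    - (\<Sum>a<gdim D. \<Sum>b<gdim D. \<Sum>c<gdim D.
        fgscale (1 / 2 * fc D a b c) (wedge (gh a) (wedge (gh b) (gder (gh c) u))))"
proof -
  have 1: "gmul (gen (gh a)) (\<lambda>S. act_Z D a (u S)) = wedge (gh a) (\<lambda>S. act_Z D a (u S))"
    if "a < gdim D" for a
    using that by (intro gmul_gen) (simp add: cochain_infinite[OF u] act_Z_0)
  have 2: "gmul (gmul (gen i) (gen j)) (gder k u) = wedge i (wedge j (gder k u))" for i j k
  proof -
    have g: "gmul (gen j) (gder k u) = wedge j (gder k u)"
      by (rule gmul_gen) (rule gder_infinite[OF cochain_infinite[OF u]])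
    have w: "gmul (emb 1) (gen j) = (gen j :: ('m \<Rightarrow> 'k) grass)"
      by (rule gmul_emb_1) (auto simp: gen_def)
    have "gmul (gmul (gen i) (gen j)) (gder k u) = wedge i (gmul (gen j) (gder k u))"
      by (simp only: gen_eq_wedge[of i] gmul_wedge w)
    then show ?thesis by (simp only: g)
  qed
  have 3: "gscale (\<lambda>_. c) x = fgscale c x" for c and x :: "('m \<Rightarrow> 'k) grass"
    by (rule ext, rule ext) (simp add: gscale_def fgscale_def fscale_def)
  have "(\<Sum>a<gdim D. gmul (gen (gh a)) (\<lambda>S. act_Z D a (u S))) = (\<Sum>a<gdim D. wedge (gh a) (\<lambda>S. act_Z D a (u S)))"
    by (intro sum.cong refl 1) simp
  then show ?thesis unfolding ce_diff_def 2 3 by (simp only:)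
qed

lemma ce_diff_add:
  assumes u: "u \<in> cochains D" and v: "v \<in> cochains D"
  shows "ce_diff D (u + v) = ce_diff D u + ce_diff D v"
proof -
  have "(\<lambda>S. act_Z D a ((u + v) S)) = (\<lambda>S. act_Z D a (u S)) + (\<lambda>S. act_Z D a (v S))" if "a < gdim D" for a
    by (rule ext) (simp only: plus_fun_apply act_Z_add[OF that cochain_coeff[OF u] cochain_coeff[OF v]])
  then have "(\<Sum>a<gdim D. wedge (gh a) (\<lambda>S. act_Z D a ((u + v) S)))
      = (\<Sum>a<gdim D. wedge (gh a) (\<lambda>S. act_Z D a (u S)) + wedge (gh a) (\<lambda>S. act_Z D a (v S)))"
    by (intro sum.cong refl) (simp only: wedge_add lessThan_iff)
  then show ?thesis
    unfolding ce_diff_eq[OF u] ce_diff_eq[OF v] ce_diff_eq[OF add_closedD(2)[OF cochains_closed u v]]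
      gder_add wedge_add fgscale_add sum.distrib by (simp only: add_diff_add)
qed

lemma ce_diff_scale:
  assumes u: "u \<in> cochains D"
  shows "fgscale c u \<in> cochains D" "ce_diff D (fgscale c u) = fgscale c (ce_diff D u)"
proof -
  show cu: "fgscale c u \<in> cochains D"
    using u unfolding cochains_def grass_over_iff by (auto simp: fgscale_def CZ_scale fscale_simps(3))
  have "(\<lambda>S. act_Z D a (fgscale c u S)) = fgscale c (\<lambda>S. act_Z D a (u S))" if "a < gdim D" for a
    by (rule ext) (simp only: fgscale_def act_Z_scale[OF that cochain_coeff[OF u]])
  then have 1: "(\<Sum>a<gdim D. wedge (gh a) (\<lambda>S. act_Z D a (fgscale c u S)))
      = (\<Sum>a<gdim D. fgscale c (wedge (gh a) (\<lambda>S. act_Z D a (u S))))"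
    by (intro sum.cong refl) (simp only: wedge_fgscale lessThan_iff)
  show "ce_diff D (fgscale c u) = fgscale c (ce_diff D u)"
    unfolding ce_diff_eq[OF u] ce_diff_eq[OF cu] 1 gder_fgscale wedge_fgscale
      fgscale_fgscale[of _ c] fgscale_sum[symmetric] fgscale_diff ..
qed

lemma ce_diff_0: "ce_diff D 0 = 0"
  using ce_diff_add[OF add_closedD(1)[OF cochains_closed] add_closedD(1)[OF cochains_closed]] by simp

lemma ce_diff_minus: "u \<in> cochains D \<Longrightarrow> ce_diff D (- u) = - ce_diff D u"
  using ce_diff_add[of u "- u"] add_closedD(3)[OF cochains_closed, of u] ce_diff_0
  by (simp add: eq_neg_iff_add_eq_0 add.commute)

lemma ce_diff_component:
  assumes u: "u \<in> cochains D"
  shows "component n u \<in> cochains D" "ce_diff D (component n u) = component (n + 1) (ce_diff D u)"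
proof -
  show cu: "component n u \<in> cochains D"
    using u unfolding cochains_def by (rule grass_over_component[OF CZ_closed])
  have ev: "even (gh a)" for a by (simp add: gh_def)
  have "wedge (gh a) (\<lambda>S. act_Z D a (component n u S)) = component (n + 1) (wedge (gh a) (\<lambda>S. act_Z D a (u S)))"
    if a: "a < gdim D" for a
  proof -
    have "(\<lambda>S. act_Z D a (component n u S)) = component n (\<lambda>S. act_Z D a (u S))"
      by (rule ext) (simp add: component_def act_Z_0[OF a])
    moreover have "wedge (gh a) (component n (\<lambda>S. act_Z D a (u S))) = component (n + 1) (wedge (gh a) (\<lambda>S. act_Z D a (u S)))"
      by (rule wedge_component[OF ev]) (simp add: cochain_infinite[OF u] act_Z_0[OF a])
    ultimately show ?thesis by (simp only:)
  qed
  then have 1: "(\<Sum>a<gdim D. wedge (gh a) (\<lambda>S. act_Z D a (component n u S)))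
      = (\<Sum>a<gdim D. component (n + 1) (wedge (gh a) (\<lambda>S. act_Z D a (u S))))"
    by (intro sum.cong refl) simp
  have 2: "wedge (gh a) (wedge (gh b) (gder (gh c) (component n u)))
      = component (n + 1) (wedge (gh a) (wedge (gh b) (gder (gh c) u)))" for a b c
  proof -
    note i = cochain_infinite[OF u]
    have "gder (gh c) (component n u) = component (n - 1) (gder (gh c) u)"
      by (rule gder_component[OF ev]) (rule i)
    moreover have "wedge (gh b) (component (n - 1) (gder (gh c) u)) = component (n - 1 + 1) (wedge (gh b) (gder (gh c) u))"
      by (rule wedge_component[OF ev]) (rule gder_infinite[OF i])
    moreover have "wedge (gh a) (component n (wedge (gh b) (gder (gh c) u)))
        = component (n + 1) (wedge (gh a) (wedge (gh b) (gder (gh c) u)))"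
      by (rule wedge_component[OF ev]) (rule wedge_infinite[OF gder_infinite[OF i]])
    ultimately show ?thesis by simp
  qed
  show "ce_diff D (component n u) = component (n + 1) (ce_diff D u)"
    unfolding ce_diff_eq[OF u] ce_diff_eq[OF cu] 1 2 fgscale_component component_sum[symmetric]
      component_diff ..
qed

lemma ce_diff_emb:
  assumes u: "u \<in> CZ D"
  shows "emb u \<in> cochains D" "ce_diff D (emb u) = (\<Sum>a<gdim D. wedge (gh a) (emb (act_Z D a u)))"
proof -
  show e: "emb u \<in> cochains D"
    unfolding cochains_def by (rule grass_over_emb[OF CZ_closed u])
  have "(\<lambda>S. act_Z D a (emb u S)) = emb (act_Z D a u)" if "a < gdim D" for a
    by (rule ext) (simp add: emb_def act_Z_0[OF that])
  then have 1: "(\<Sum>a<gdim D. wedge (gh a) (\<lambda>S. act_Z D a (emb u S))) = (\<Sum>a<gdim D. wedge (gh a) (emb (act_Z D a u)))"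
    by (intro sum.cong refl) simp
  have 2: "fgscale c (wedge i (wedge j (gder k (emb u)))) = 0" for c i j k
  proof -
    have "gder k (emb u) = 0" by (rule ext) (simp add: gder_eq emb_def)
    then show ?thesis by (intro ext[of "fgscale c _"]) (simp add: wedge_def fgscale_def fscale_simps(3))
  qed
  show "ce_diff D (emb u) = (\<Sum>a<gdim D. wedge (gh a) (emb (act_Z D a u)))"
    unfolding ce_diff_eq[OF e] 1 2 by simp
qed

text \<open>
  The differential of a function has its derivatives along the basis as coefficients at the ghosts.
\<close>

lemma ce_diff_emb_eq_0_iff:
  assumes u: "u \<in> CZ D"
  shows "ce_diff D (emb u) = 0 \<longleftrightarrow> u \<in> CZ_inv D"
proof
  assume "u \<in> CZ_inv D"
  then have "act_Z D a u = 0" if "a < gdim D" for a using that by (simp add: CZ_inv_def)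
  moreover have "wedge i (emb 0) = (0 :: ('m \<Rightarrow> 'k) grass)" for i
    by (rule ext) (simp add: wedge_def emb_def)
  ultimately show "ce_diff D (emb u) = 0"
    unfolding ce_diff_emb(2)[OF u] by (intro sum.neutral) simp
next
  assume *: "ce_diff D (emb u) = 0"
  have "act_Z D a u = 0" if a: "a < gdim D" for a
  proof -
    have "wedge (gh b) (emb (act_Z D b u)) {gh a} = (if b = a then act_Z D a u else 0)" for b
    proof -
      have "below {gh a} (gh a) = 0" unfolding below_def card_eq_0_iff by auto
      then show ?thesis by (auto simp: wedge_def emb_def)
    qed
    then have "ce_diff D (emb u) {gh a} = (\<Sum>b<gdim D. if b = a then act_Z D a u else 0)"
      unfolding ce_diff_emb(2)[OF u] sum_apply by simp
    then show ?thesis using * a by simp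
  qed
  then show "u \<in> CZ_inv D" using u by (simp add: CZ_inv_def)
qed

text \<open>
  Both parts of the differential multiply by a ghost.
\<close>

lemma ce_diff_empty: "u \<in> cochains D \<Longrightarrow> ce_diff D u {} = 0"
  by (simp add: ce_diff_eq sum_apply wedge_def fgscale_def fscale_simps(3))

abbreviation "B \<equiv> coboundaries D"
abbreviation "C \<equiv> cochain_ser D"
abbreviation "d \<equiv> gser_map (ce_diff D)"
abbreviation "\<Phi> \<equiv> gser_app (Phi D)"
abbreviation "\<h> \<equiv> gser_app (Htpy D)"
abbreviation "\<delta> \<equiv> brst_diff D"
abbreviation "R \<equiv> qres D"

lemma B_closed: "add_closed B"
  unfolding add_closed_def coboundaries_def
proof (intro conjI ballI)
  note C = add_closedD[OF cochains_closed]
  show "0 \<in> ce_diff D ` cochains D" using ce_diff_0 C(1) by (metis imageI)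
  fix x assume "x \<in> ce_diff D ` cochains D"
  then obtain u where u: "x = ce_diff D u" "u \<in> cochains D" by blast
  then show "- x \<in> ce_diff D ` cochains D" using ce_diff_minus C(3) by (metis imageI)
  fix y assume "y \<in> ce_diff D ` cochains D"
  then obtain v where v: "y = ce_diff D v" "v \<in> cochains D" by blast
  show "x + y \<in> ce_diff D ` cochains D"
    unfolding u(1) v(1) ce_diff_add[OF u(2) v(2), symmetric] using C(2)[OF u(2) v(2)] by (rule imageI)
qed

lemma B_scale: "b \<in> B \<Longrightarrow> fgscale c b \<in> B"
  unfolding coboundaries_def by (elim imageE) (simp flip: ce_diff_scale(2) add: ce_diff_scale(1))

lemma C_iff: "u \<in> C \<longleftrightarrow> (\<forall>n. gcoeff u n \<in> cochains D)"
  unfolding cochain_ser_def cochains_def by (rule grass_ser_iff)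

lemma Q_iff: "x \<in> Q \<longleftrightarrow> (\<forall>n. gcoeff x n \<in> brst_space D)"
  unfolding Q_def brst_space_def by (rule grass_ser_iff)

lemma C_closed: "add_closed C"
  unfolding cochain_ser_def by (rule add_closed_grass_over[OF add_closed_ser[OF CZ_closed]])

lemmas C_0 = add_closedD(1)[OF C_closed]
lemmas C_add = add_closedD(2)[OF C_closed]
lemmas C_diff = add_closedD(4)[OF C_closed]

lemma C_X: "u \<in> C \<Longrightarrow> gscale fps_X u \<in> C"
  by (simp add: C_iff gcoeff_gscale_X add_closedD(1)[OF cochains_closed])

lemma C_scal: "u \<in> C \<Longrightarrow> gscale (scal c) u \<in> C"
  by (simp add: C_iff gcoeff_gscale_scal ce_diff_scale(1))

lemma C_kser: "u \<in> C \<Longrightarrow> gscale (kser c) u \<in> C"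
  unfolding C_iff gcoeff_gscale_kser
  by (intro allI add_closed_sum[OF cochains_closed] ce_diff_scale(1)) blast

lemma d_add: "u \<in> C \<Longrightarrow> v \<in> C \<Longrightarrow> d (u + v) = d u + d v"
  by (rule gcoeff_eqI) (simp only: gcoeff_gser_map gcoeff_add ce_diff_add C_iff)

lemma d_X: "u \<in> C \<Longrightarrow> d (gscale fps_X u) = gscale fps_X (d u)"
  by (rule gcoeff_eqI) (simp only: gcoeff_gser_map gcoeff_gscale_X ce_diff_0 if_distrib[of "ce_diff D"])

lemma d_scal: "u \<in> C \<Longrightarrow> d (gscale (scal c) u) = gscale (scal c) (d u)"
  by (rule gcoeff_eqI) (simp add: gcoeff_gser_map gcoeff_gscale_scal ce_diff_scale C_iff)

lemma qcontraction_facts: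
  shows Phi_linear: "\<And>i. linear_map fgscale fgscale (cochains D) (brst_space D) (Phi D i)"
    and Phi_homog: "\<And>i n u. u \<in> cochains D \<Longrightarrow> homog n u \<Longrightarrow> homog n (Phi D i u)"
    and Htpy_linear: "\<And>i. linear_map fgscale fgscale (brst_space D) (brst_space D) (Htpy D i)"
    and R_chain: "\<And>x. x \<in> Q \<Longrightarrow> R (\<delta> x) = d (R x)"
    and Phi_chain: "\<And>u. u \<in> C \<Longrightarrow> \<delta> (\<Phi> u) = \<Phi> (d u)"
    and R_Phi: "\<And>u. u \<in> C \<Longrightarrow> R (\<Phi> u) = u"
    and homotopy: "\<And>x. x \<in> Q \<Longrightarrow> x - \<Phi> (R x) = \<delta> (\<h> x) + \<h> (\<delta> x)"
  using qcontraction unfolding quantum_contraction_def by blast+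

lemma brst_space_closed: "add_closed (brst_space D)"
  unfolding brst_space_def by (rule add_closed_grass_over[OF CM_closed])

lemma Phi_space: "u \<in> cochains D \<Longrightarrow> Phi D i u \<in> brst_space D"
  and Phi_add': "u \<in> cochains D \<Longrightarrow> v \<in> cochains D \<Longrightarrow> Phi D i (u + v) = Phi D i u + Phi D i v"
  and Phi_scale': "u \<in> cochains D \<Longrightarrow> Phi D i (fgscale c u) = fgscale c (Phi D i u)"
  using Phi_linear[of i] unfolding linear_map_def by blast+

lemma Phi_0': "Phi D i 0 = 0"
  using Phi_add'[OF add_closedD(1)[OF cochains_closed] add_closedD(1)[OF cochains_closed]] by simp

lemma Phi_Q: "u \<in> C \<Longrightarrow> \<Phi> u \<in> Q"
  unfolding Q_iff C_iff gcoeff_gser_app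
  by (intro allI add_closed_sum[OF brst_space_closed] Phi_space) blast

lemma Phi_add: "u \<in> C \<Longrightarrow> v \<in> C \<Longrightarrow> \<Phi> (u + v) = \<Phi> u + \<Phi> v"
  by (rule gcoeff_eqI) (simp add: gcoeff_gser_app gcoeff_add Phi_add' C_iff sum.distrib)

lemma Phi_0: "\<Phi> 0 = 0"
  using Phi_add[OF C_0 C_0] by simp

lemma Phi_diff: "u \<in> C \<Longrightarrow> v \<in> C \<Longrightarrow> \<Phi> (u - v) = \<Phi> u - \<Phi> v"
  using Phi_add[OF C_diff, of u v v] by simp

lemma Phi_X: "u \<in> C \<Longrightarrow> \<Phi> (gscale fps_X u) = gscale fps_X (\<Phi> u)"
proof (rule gcoeff_eqI)
  fix n
  show "gcoeff (\<Phi> (gscale fps_X u)) n = gcoeff (gscale fps_X (\<Phi> u)) n"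
  proof (cases n)
    case 0
    then show ?thesis by (simp add: gcoeff_gser_app gcoeff_gscale_X Phi_0')
  next
    case (Suc m)
    have "(\<Sum>i\<le>m. Phi D i (gcoeff (gscale fps_X u) (Suc m - i))) = (\<Sum>i\<le>m. Phi D i (gcoeff u (m - i)))"
      by (intro sum.cong refl) (simp add: gcoeff_gscale_X Suc_diff_le)
    then show ?thesis
      unfolding Suc gcoeff_gser_app sum.atMost_Suc gcoeff_gscale_X by (simp add: Phi_0' gcoeff_gser_app)
  qed
qed

lemma Phi_scal: "u \<in> C \<Longrightarrow> \<Phi> (gscale (scal c) u) = gscale (scal c) (\<Phi> u)"
  by (rule gcoeff_eqI) (simp add: gcoeff_gser_app gcoeff_gscale_scal Phi_scale' C_iff fgscale_sum)

lemma Phi_homog_ser: "u \<in> C \<Longrightarrow> homog n u \<Longrightarrow> homog n (\<Phi> u)"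
  unfolding homog_gcoeff[of n "\<Phi> u"] gcoeff_gser_app C_iff
  by (intro allI homog_sum Phi_homog) (auto simp: homog_gcoeff)

lemma Htpy_space: "x \<in> brst_space D \<Longrightarrow> Htpy D i x \<in> brst_space D"
  using Htpy_linear[of i] unfolding linear_map_def by blast

lemma Htpy_Q: "x \<in> Q \<Longrightarrow> \<h> x \<in> Q"
  unfolding Q_iff gcoeff_gser_app
  by (intro allI add_closed_sum[OF brst_space_closed] Htpy_space) blast

lemma Htpy_0: "\<h> 0 = 0"
proof (rule gcoeff_eqI)
  fix n
  have 0: "(0 :: ('m \<Rightarrow> 'k) grass) \<in> brst_space D" by (rule add_closedD(1)[OF brst_space_closed])
  have "Htpy D i (0 + 0) = Htpy D i 0 + Htpy D i 0" for i
    using Htpy_linear[of i] 0 unfolding linear_map_def by blast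
  then have "Htpy D i 0 = 0" for i by (metis add_0 add_right_cancel)
  then show "gcoeff (\<h> 0) n = gcoeff 0 n" by (simp add: gcoeff_gser_app gcoeff_0)
qed

section \<open>Classes and their product\<close>

text \<open>
  Equality is coefficientwise membership in the coboundaries; choosing primitives of all coefficients gives a
  primitive of the series.
\<close>

lemma cls_eq_iff:
  assumes u: "u \<in> C" and v: "v \<in> C"
  shows "cls D u = cls D v \<longleftrightarrow> (\<exists>w\<in>C. u - v = d w)"
proof
  assume eq: "cls D u = cls D v"
  have "gcoeff u n - gcoeff v n \<in> B" for n
  proof -
    have "fps_nth (cls D u) n = fps_nth (cls D v) n" by (simp only: eq)
    then have "coset B (gcoeff u n) = coset B (gcoeff v n)" by (simp only: cls_def fps_nth_Abs_fps)
    then show ?thesis by (simp only: coset_eq_iff[OF B_closed])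
  qed
  then have "\<exists>w. \<forall>n. w n \<in> cochains D \<and> gcoeff u n - gcoeff v n = ce_diff D (w n)"
    unfolding coboundaries_def by (intro choice) blast
  then obtain w where w: "\<And>n. w n \<in> cochains D" "\<And>n. gcoeff u n - gcoeff v n = ce_diff D (w n)" by blast
  have "from_coeffs w \<in> C" by (simp add: C_iff gcoeff_from_coeffs w(1))
  moreover have "u - v = d (from_coeffs w)"
    by (rule gcoeff_eqI) (simp only: gcoeff_diff gcoeff_gser_map gcoeff_from_coeffs w(2))
  ultimately show "\<exists>w\<in>C. u - v = d w" by blast
next
  assume "\<exists>w\<in>C. u - v = d w"
  then obtain w where w: "w \<in> C" "u - v = d w" by blast
  show "cls D u = cls D v"
  proof (rule fps_ext)
    fix n
    have "gcoeff u n - gcoeff v n = ce_diff D (gcoeff w n)"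
      using arg_cong[OF w(2), of "\<lambda>x. gcoeff x n"] by (simp only: gcoeff_diff gcoeff_gser_map)
    moreover have "gcoeff w n \<in> cochains D" using w(1) C_iff by blast
    ultimately have "gcoeff u n - gcoeff v n \<in> B" unfolding coboundaries_def by simp
    then show "fps_nth (cls D u) n = fps_nth (cls D v) n"
      by (simp only: cls_def fps_nth_Abs_fps coset_eq_iff[OF B_closed])
  qed
qed

lemma cls_add: "cls D (u + v) = cls D u + cls D v"
  by (rule fps_ext) (simp add: cls_def gcoeff_add coset_plus[OF B_closed])

lemma cls_kser: "cls D (gscale (kser c) u) = ser_scale (cohom_scale D) c (cls D u)"
proof (rule fps_ext)
  fix n
  have "cohom_scale D k (coset B x) = coset B (fgscale k x)" for k x
    unfolding cohom_scale_def by (rule coset_scale_coset[OF B_closed]) (simp_all add: fgscale_add B_scale)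
  then show "fps_nth (cls D (gscale (kser c) u)) n = fps_nth (ser_scale (cohom_scale D) c (cls D u)) n"
    by (simp add: cls_def ser_scale_def gcoeff_gscale_kser coset_sum[OF B_closed])
qed

abbreviation "ZC \<equiv> cocycle_ser D"

lemma ZC_iff: "u \<in> ZC \<longleftrightarrow> u \<in> C \<and> d u = 0"
  by (simp add: cocycle_ser_def)

lemma ZC_add: "u \<in> ZC \<Longrightarrow> v \<in> ZC \<Longrightarrow> u + v \<in> ZC"
  by (simp add: ZC_iff C_add d_add)

lemma ZC_kser: "u \<in> ZC \<Longrightarrow> gscale (kser c) u \<in> ZC"
proof -
  assume u: "u \<in> ZC"
  have "d (gscale (kser c) u) = gscale (kser c) (d u)"
    using u by (intro kser_linear[where A = C and T = d] d_add d_X d_scal C_X C_scal C_kser) (simp_all only: ZC_iff)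
  moreover have "gscale (kser c) 0 = 0" by (rule ext) (simp add: gscale_def)
  ultimately show ?thesis using u by (simp add: ZC_iff C_kser)
qed

lemma ZC_gcoeff: "u \<in> ZC \<Longrightarrow> gcoeff u n \<in> cochains D \<and> ce_diff D (gcoeff u n) = 0"
  using gcoeff_gser_map[of "ce_diff D" u n] by (simp add: ZC_iff C_iff gcoeff_0)

lemma ZC_from_coeffs:
  assumes "\<And>n. c n \<in> cochains D" "\<And>n. ce_diff D (c n) = 0"
  shows "from_coeffs c \<in> ZC"
proof -
  have "d (from_coeffs c) = 0"
    by (rule gcoeff_eqI) (simp only: gcoeff_gser_map gcoeff_from_coeffs gcoeff_0 assms(2))
  then show ?thesis by (simp add: ZC_iff C_iff gcoeff_from_coeffs assms(1))
qed

lemma cls_cohom: "u \<in> ZC \<Longrightarrow> cls D u \<in> ser (cohom D)"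
  using ZC_gcoeff[of u] by (auto simp: ser_def cls_def cohom_def)

lemma cls_cohom_deg: "u \<in> ZC \<Longrightarrow> homog n u \<Longrightarrow> cls D u \<in> ser (cohom_deg D n)"
  using ZC_gcoeff[of u] by (auto simp: ser_def cls_def cohom_deg_def homog_gcoeff[of n u])

lemma cohom_deg_obtain:
  assumes "F \<in> ser (cohom_deg D n)"
  obtains u where "u \<in> ZC" "homog n u" "F = cls D u"
proof -
  have "\<forall>m. \<exists>c. fps_nth F m = coset B c \<and> c \<in> cochains D \<and> ce_diff D c = 0 \<and> homog n c"
    using assms by (auto simp: ser_def cohom_deg_def)
  then obtain c where c: "\<And>m. fps_nth F m = coset B (c m)" "\<And>m. c m \<in> cochains D"
    "\<And>m. ce_diff D (c m) = 0" "\<And>m. homog n (c m)"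
    using choice[of "\<lambda>m c. fps_nth F m = coset B c \<and> c \<in> cochains D \<and> ce_diff D c = 0 \<and> homog n c"] by blast
  have "F = cls D (from_coeffs c)"
    by (rule fps_ext) (simp add: cls_def gcoeff_from_coeffs c(1))
  moreover have "homog n (from_coeffs c)"
    unfolding homog_gcoeff[of n "from_coeffs c"] gcoeff_from_coeffs using c(4) by blast
  ultimately show ?thesis using that[of "from_coeffs c"] ZC_from_coeffs[of c, OF c(2,3)] by blast
qed

lemma cohom_obtain:
  assumes "F \<in> ser (cohom D)"
  obtains u where "u \<in> ZC" "F = cls D u"
proof -
  have "\<forall>m. \<exists>c. fps_nth F m = coset B c \<and> c \<in> cochains D \<and> ce_diff D c = 0"
    using assms by (auto simp: ser_def cohom_def)
  then obtain c where c: "\<And>m. fps_nth F m = coset B (c m)" "\<And>m. c m \<in> cochains D" "\<And>m. ce_diff D (c m) = 0"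
    using choice[of "\<lambda>m c. fps_nth F m = coset B c \<and> c \<in> cochains D \<and> ce_diff D c = 0"] by blast
  have "F = cls D (from_coeffs c)"
    by (rule fps_ext) (simp add: cls_def gcoeff_from_coeffs c(1))
  then show ?thesis using that[of "from_coeffs c"] ZC_from_coeffs[of c, OF c(2,3)] by blast
qed

text \<open>
  The product of cochains inducing the product of classes.
\<close>

definition cprod :: "('m \<Rightarrow> 'k) fps grass \<Rightarrow> ('m \<Rightarrow> 'k) fps grass \<Rightarrow> ('m \<Rightarrow> 'k) fps grass" where
  "cprod a b = R (\<Phi> a \<bullet>\<bullet> \<Phi> b)"

lemma Phi_closed: "u \<in> ZC \<Longrightarrow> \<delta> (\<Phi> u) = 0"
  using Phi_chain[of u] Phi_0 by (simp add: ZC_iff)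

lemma R_closed: "x \<in> Q \<Longrightarrow> \<delta> x = 0 \<Longrightarrow> R x \<in> ZC"
  using R_chain[of x] qres_0 qres_cochain by (simp add: ZC_iff)

lemma cprod_ZC: "a \<in> ZC \<Longrightarrow> b \<in> ZC \<Longrightarrow> cprod a b \<in> ZC"
  unfolding cprod_def by (intro R_closed bmul_Q closed_bmul Phi_Q Phi_closed) (simp_all add: ZC_iff)

text \<open>
  Since \<open>\<delta>\<close> is a derivation, \<open>x y - x' y' = (x - x') y + x' (y - y')\<close> is exact, and \<open>R\<close> is a chain map.
\<close>

lemma R_bmul_exact:
  assumes "x \<in> Q" "x' \<in> Q" "y \<in> Q" "y' \<in> Q" "w \<in> Q" "z \<in> Q" "\<delta> x' = 0" "\<delta> y = 0"
    and "x - x' = \<delta> w" "y - y' = \<delta> z"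
  shows "cls D (R (x \<bullet>\<bullet> y)) = cls D (R (x' \<bullet>\<bullet> y'))"
proof -
  have px: "par x' \<in> Q" by (rule par_Q[OF assms(2)])
  have "x \<bullet>\<bullet> y - x' \<bullet>\<bullet> y' = (x - x') \<bullet>\<bullet> y + x' \<bullet>\<bullet> (y - y')"
    by (simp only: bmul_diff_left bmul_diff_right assms(1-4)) simp
  also have "\<dots> = \<delta> (w \<bullet>\<bullet> y) + \<delta> (par x' \<bullet>\<bullet> z)"
    by (simp only: assms(9,10) exact_bmul_closed[OF assms(5,3,8)] closed_bmul_exact[OF assms(2,6,7)])
  finally have "R (x \<bullet>\<bullet> y) - R (x' \<bullet>\<bullet> y') = R (\<delta> (w \<bullet>\<bullet> y) + \<delta> (par x' \<bullet>\<bullet> z))"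
    by (simp only: qres_diff[symmetric] bmul_Q assms(1-4))
  also have "\<dots> = R (\<delta> (w \<bullet>\<bullet> y)) + R (\<delta> (par x' \<bullet>\<bullet> z))"
    by (intro qres_add brst_diff_Q bmul_Q assms px)
  also have "\<dots> = d (R (w \<bullet>\<bullet> y)) + d (R (par x' \<bullet>\<bullet> z))"
    by (simp only: R_chain bmul_Q assms px)
  also have "\<dots> = d (R (w \<bullet>\<bullet> y) + R (par x' \<bullet>\<bullet> z))"
    by (intro d_add[symmetric] qres_cochain bmul_Q assms px)
  finally have "R (x \<bullet>\<bullet> y) - R (x' \<bullet>\<bullet> y') = d (R (w \<bullet>\<bullet> y) + R (par x' \<bullet>\<bullet> z))" .
  moreover have "R (w \<bullet>\<bullet> y) + R (par x' \<bullet>\<bullet> z) \<in> C"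
    by (intro C_add qres_cochain bmul_Q assms px)
  ultimately show ?thesis
    using cls_eq_iff[OF qres_cochain qres_cochain, OF bmul_Q bmul_Q, OF assms(1,3,2,4)] by blast
qed

lemma cprod_cong:
  assumes "a \<in> ZC" "a' \<in> ZC" "b \<in> ZC" "b' \<in> ZC" "cls D a = cls D a'" "cls D b = cls D b'"
  shows "cls D (cprod a b) = cls D (cprod a' b')"
proof -
  have C: "a \<in> C" "a' \<in> C" "b \<in> C" "b' \<in> C" using assms(1-4) by (simp_all add: ZC_iff)
  obtain w where w: "w \<in> C" "a - a' = d w" using assms(5) cls_eq_iff[OF C(1,2)] by blast
  obtain z where z: "z \<in> C" "b - b' = d z" using assms(6) cls_eq_iff[OF C(3,4)] by blast
  have "\<Phi> a - \<Phi> a' = \<delta> (\<Phi> w)" "\<Phi> b - \<Phi> b' = \<delta> (\<Phi> z)"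
    using Phi_diff[OF C(1,2)] Phi_diff[OF C(3,4)] w z Phi_chain by simp_all
  then show ?thesis
    unfolding cprod_def
    by (intro R_bmul_exact[of _ _ _ _ "\<Phi> w" "\<Phi> z"] Phi_Q Phi_closed C w(1) z(1) assms(2,3))
qed

text \<open>
  Since \<open>x - \<Phi> (R x) = \<delta> (\<h> x)\<close> for closed \<open>x\<close>, the product of classes can be computed from
  arbitrary closed representatives in the BRST algebra.
\<close>

lemma cprod_R:
  assumes x: "x \<in> Q" "\<delta> x = 0" and y: "y \<in> Q" "\<delta> y = 0"
  shows "cls D (cprod (R x) (R y)) = cls D (R (x \<bullet>\<bullet> y))"
proof -
  have h: "x - \<Phi> (R x) = \<delta> (\<h> x)" "y - \<Phi> (R y) = \<delta> (\<h> y)"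
    using homotopy[OF x(1)] homotopy[OF y(1)] x(2) y(2) Htpy_0 by simp_all
  have "cls D (R (x \<bullet>\<bullet> y)) = cls D (R (\<Phi> (R x) \<bullet>\<bullet> \<Phi> (R y)))"
    by (rule R_bmul_exact[OF _ _ _ _ _ _ _ _ h])
      (simp_all add: x y Phi_Q qres_cochain Htpy_Q Phi_closed R_closed)
  then show ?thesis by (simp only: cprod_def)
qed

text \<open>
  The BRST product is associative, and by \<open>cprod_R\<close> the inner products \<open>\<Phi> (R (\<Phi> a \<bullet>\<bullet> \<Phi> b))\<close> may be
  replaced by \<open>\<Phi> a \<bullet>\<bullet> \<Phi> b\<close>.
\<close>

lemma cprod_assoc:
  assumes "a \<in> ZC" "b \<in> ZC" "c \<in> ZC"
  shows "cls D (cprod (cprod a b) c) = cls D (cprod a (cprod b c))"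
proof -
  have C: "a \<in> C" "b \<in> C" "c \<in> C" using assms by (simp_all add: ZC_iff)
  note Q = Phi_Q[OF C(1)] Phi_Q[OF C(2)] Phi_Q[OF C(3)]
  note cl = Phi_closed[OF assms(1)] Phi_closed[OF assms(2)] Phi_closed[OF assms(3)]
  have "cls D (cprod (R (\<Phi> a \<bullet>\<bullet> \<Phi> b)) (R (\<Phi> c))) = cls D (R ((\<Phi> a \<bullet>\<bullet> \<Phi> b) \<bullet>\<bullet> \<Phi> c))"
    by (intro cprod_R bmul_Q closed_bmul Q cl)
  also have "\<dots> = cls D (R (\<Phi> a \<bullet>\<bullet> (\<Phi> b \<bullet>\<bullet> \<Phi> c)))" by (simp only: bmul_assoc Q)
  also have "\<dots> = cls D (cprod (R (\<Phi> a)) (R (\<Phi> b \<bullet>\<bullet> \<Phi> c)))"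
    by (intro cprod_R[symmetric] bmul_Q closed_bmul Q cl)
  finally show ?thesis by (simp only: R_Phi C cprod_def[of a b] cprod_def[of b c])
qed

lemma cprod_add:
  assumes "a \<in> C" "b \<in> C" "c \<in> C"
  shows "cprod a (b + c) = cprod a b + cprod a c" "cprod (a + b) c = cprod a c + cprod b c"
  by (simp_all add: cprod_def Phi_add bmul_add_left bmul_add_right qres_add bmul_Q Phi_Q assms)

lemma cprod_kser:
  assumes a: "a \<in> C" and b: "b \<in> C"
  shows "cprod a (gscale (kser k) b) = gscale (kser k) (cprod a b)"
    and "cprod (gscale (kser k) a) b = gscale (kser k) (cprod a b)"
proof -
  show "cprod a (gscale (kser k) b) = gscale (kser k) (cprod a b)"
  proof (rule kser_linear[where A = C and T = "cprod a", OF cprod_add(1)[OF a] _ _ C_X C_scal C_kser b])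
    fix b c assume b: "b \<in> C"
    note Q = Phi_Q[OF a] Phi_Q[OF b]
    show "cprod a (gscale fps_X b) = gscale fps_X (cprod a b)"
      unfolding cprod_def Phi_X[OF b] bmul_X_right[OF Q] by (rule qres_X[OF bmul_Q[OF Q]])
    show "cprod a (gscale (scal c) b) = gscale (scal c) (cprod a b)"
      unfolding cprod_def Phi_scal[OF b] bmul_scal_right[OF Q] by (rule qres_scal[OF bmul_Q[OF Q]])
  qed
  show "cprod (gscale (kser k) a) b = gscale (kser k) (cprod a b)"
  proof (rule kser_linear[where A = C and T = "\<lambda>a. cprod a b", OF cprod_add(2)[OF _ _ b] _ _ C_X C_scal C_kser a])
    fix a c assume a: "a \<in> C"
    note Q = Phi_Q[OF a] Phi_Q[OF b]
    show "cprod (gscale fps_X a) b = gscale fps_X (cprod a b)"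
      unfolding cprod_def Phi_X[OF a] bmul_X_left[OF Q] by (rule qres_X[OF bmul_Q[OF Q]])
    show "cprod (gscale (scal c) a) b = gscale (scal c) (cprod a b)"
      unfolding cprod_def Phi_scal[OF a] bmul_scal_left[OF Q] by (rule qres_scal[OF bmul_Q[OF Q]])
  qed
qed

lemma cprod_homog:
  assumes a: "a \<in> C" "homog i a" and b: "b \<in> C" "homog j b"
  shows "homog (i + j) (cprod a b)"
  unfolding homog_def
proof (intro allI impI)
  fix S assume "cprod a b S \<noteq> 0"
  then have "(\<Phi> a \<bullet>\<bullet> \<Phi> b) S \<noteq> 0"
    using qres_fun_0 by (auto simp: cprod_def qres_def split: if_splits)
  then show "gdeg S = i + j"
    using bmul_nonzero[OF Phi_Q[OF a(1)] Phi_Q[OF b(1)], of "\<lambda>n. n = i + j" S]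
      Phi_homog_ser[OF a] Phi_homog_ser[OF b] by (simp add: homog_def)
qed

definition pr :: "('m \<Rightarrow> 'k) grass set fps \<Rightarrow> ('m \<Rightarrow> 'k) grass set fps \<Rightarrow> ('m \<Rightarrow> 'k) grass set fps" where
  "pr F G = cls D (cprod (SOME u. u \<in> ZC \<and> cls D u = F) (SOME u. u \<in> ZC \<and> cls D u = G))"

lemma pr_cls:
  assumes "a \<in> ZC" "b \<in> ZC"
  shows "pr (cls D a) (cls D b) = cls D (cprod a b)"
proof -
  have "(SOME u. u \<in> ZC \<and> cls D u = cls D c) \<in> ZC \<and> cls D (SOME u. u \<in> ZC \<and> cls D u = cls D c) = cls D c"
    if "c \<in> ZC" for c
    by (rule someI[of "\<lambda>u. u \<in> ZC \<and> cls D u = cls D c" c]) (simp add: that)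
  then show ?thesis unfolding pr_def using assms by (intro cprod_cong) blast+
qed

lemma series_algebra_pr: "series_algebra (cohom_scale D) (cohom D) pr"
proof -
  have cl: "pr x y \<in> ser (cohom D)" if "x \<in> ser (cohom D)" "y \<in> ser (cohom D)" for x y
    using that by (elim cohom_obtain) (simp add: pr_cls cls_cohom cprod_ZC)
  have r: "pr x (y + z) = pr x y + pr x z" "pr (y + z) x = pr y x + pr z x"
    if xyz: "x \<in> ser (cohom D)" "y \<in> ser (cohom D)" "z \<in> ser (cohom D)" for x y z
  proof -
    obtain a where a: "a \<in> ZC" "x = cls D a" by (rule cohom_obtain[OF xyz(1)])
    obtain b where b: "b \<in> ZC" "y = cls D b" by (rule cohom_obtain[OF xyz(2)])
    obtain c where c: "c \<in> ZC" "z = cls D c" by (rule cohom_obtain[OF xyz(3)])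
    have abc: "a \<in> C" "b \<in> C" "c \<in> C" using a b c ZC_iff by blast+
    show "pr x (y + z) = pr x y + pr x z" "pr (y + z) x = pr y x + pr z x"
      by (simp_all only: a b c cls_add[symmetric] pr_cls ZC_add cprod_add abc)
  qed
  have s: "pr x (ser_scale (cohom_scale D) c y) = ser_scale (cohom_scale D) c (pr x y)"
    "pr (ser_scale (cohom_scale D) c x) y = ser_scale (cohom_scale D) c (pr x y)"
    if xyz: "x \<in> ser (cohom D)" "y \<in> ser (cohom D)" for x y c
  proof -
    obtain a where a: "a \<in> ZC" "x = cls D a" by (rule cohom_obtain[OF xyz(1)])
    obtain b where b: "b \<in> ZC" "y = cls D b" by (rule cohom_obtain[OF xyz(2)])
    have ab: "a \<in> C" "b \<in> C" using a b ZC_iff by blast+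
    show "pr x (ser_scale (cohom_scale D) c y) = ser_scale (cohom_scale D) c (pr x y)"
      "pr (ser_scale (cohom_scale D) c x) y = ser_scale (cohom_scale D) c (pr x y)"
      by (simp_all only: a b cls_kser[symmetric] pr_cls ZC_kser cprod_kser ab)
  qed
  have as: "pr (pr x y) z = pr x (pr y z)"
    if xyz: "x \<in> ser (cohom D)" "y \<in> ser (cohom D)" "z \<in> ser (cohom D)" for x y z
  proof -
    obtain a where a: "a \<in> ZC" "x = cls D a" by (rule cohom_obtain[OF xyz(1)])
    obtain b where b: "b \<in> ZC" "y = cls D b" by (rule cohom_obtain[OF xyz(2)])
    obtain c where c: "c \<in> ZC" "z = cls D c" by (rule cohom_obtain[OF xyz(3)])
    show ?thesis by (simp only: a b c pr_cls cprod_ZC cprod_assoc)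
  qed
  show ?thesis
    unfolding series_algebra_def bilinear_op_iff by (intro conjI ballI allI cl r s as)
qed

section \<open>The grading\<close>

lemma component_ZC: "u \<in> ZC \<Longrightarrow> component n u \<in> ZC"
proof -
  assume u: "u \<in> ZC"
  have "d (component n u) = component (n + 1) (d u)"
  proof (rule gcoeff_eqI)
    fix m
    have "gcoeff u m \<in> cochains D" using ZC_gcoeff[OF u] by blast
    then show "gcoeff (d (component n u)) m = gcoeff (component (n + 1) (d u)) m"
      by (simp only: gcoeff_gser_map gcoeff_component ce_diff_component)
  qed
  moreover have "component (n + 1) (0 :: ('m \<Rightarrow> 'k) fps grass) = 0" by (rule ext) (simp add: component_def)
  moreover have "component n u \<in> C"
    using ZC_gcoeff[OF u] by (simp add: C_iff gcoeff_component ce_diff_component(1))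
  ultimately show ?thesis using u by (simp add: ZC_iff)
qed

text \<open>
  The zero of the type of sets is \<open>{0}\<close>, whereas the zero class is the coset of coboundaries; the explicit
  summand \<open>cls D 0\<close> makes empty sums agree.
\<close>

lemma cls_sum:
  assumes "finite N"
  shows "cls D 0 + (\<Sum>n\<in>N. cls D (v n)) = cls D (\<Sum>n\<in>N. v n)"
  using assms
proof (induction N rule: finite_induct)
  case (insert n N)
  have "cls D 0 + (cls D (v n) + (\<Sum>n\<in>N. cls D (v n))) = cls D (v n) + (cls D 0 + (\<Sum>n\<in>N. cls D (v n)))"
    by (rule add.left_commute)
  then show ?case unfolding sum.insert[OF insert.hyps] by (simp only: insert.IH cls_add)
qed simp

lemma cls_sum_support:
  assumes M: "finite M" "{n. y n \<noteq> cls D 0} \<subseteq> M" and y: "\<And>n. y n = cls D (v n)"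
  shows "cls D 0 + (\<Sum>n | y n \<noteq> cls D 0. y n) = cls D (\<Sum>n\<in>M. v n)"
proof -
  let ?N = "{n. y n \<noteq> cls D 0}"
  have N: "finite ?N" using M finite_subset by blast
  have "cls D 0 + (\<Sum>n\<in>M. y n) = cls D 0 + (\<Sum>n\<in>M - ?N. y n) + (\<Sum>n\<in>?N. y n)"
    by (simp only: sum.subset_diff[OF M(2,1)] add.assoc)
  also have "cls D 0 + (\<Sum>n\<in>M - ?N. y n) = cls D 0 + (\<Sum>n\<in>M - ?N. cls D 0)"
    by (intro arg_cong2[where f = "(+)"] sum.cong refl) simp
  also have "\<dots> = cls D (\<Sum>n\<in>M - ?N. 0)"
    using M(1) by (intro cls_sum) simp
  also have "(\<Sum>n\<in>M - ?N. 0 :: ('m \<Rightarrow> 'k) fps grass) = 0" by (rule sum.neutral_const)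
  finally have "cls D 0 + (\<Sum>n\<in>?N. y n) = cls D 0 + (\<Sum>n\<in>M. y n)" ..
  also have "\<dots> = cls D 0 + (\<Sum>n\<in>M. cls D (v n))" by (simp only: y)
  also have "\<dots> = cls D (\<Sum>n\<in>M. v n)" by (rule cls_sum[OF M(1)])
  finally show ?thesis .
qed

text \<open>
  A cocycle is the sum of its components, which are cocycles since the differential has degree one. For
  uniqueness, a sum of homogeneous cocycles that is a coboundary \<open>d w\<close> has as its component of degree \<open>k\<close> the
  coboundary of the component of \<open>w\<close> of degree \<open>k - 1\<close>.
\<close>

lemma graded_pr: "graded_by (cls D 0) (ser (cohom D)) (\<lambda>n. ser (cohom_deg D n)) pr"
  unfolding graded_by_def
proof (intro conjI allI ballI)
  show "ser (cohom_deg D n) \<subseteq> ser (cohom D)" for n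
    by (auto simp: ser_def cohom_deg_def cohom_def)
  show "pr x y \<in> ser (cohom_deg D (i + j))"
    if xy: "x \<in> ser (cohom_deg D i)" "y \<in> ser (cohom_deg D j)" for i j x y
  proof -
    obtain a where a: "a \<in> ZC" "homog i a" "x = cls D a" by (rule cohom_deg_obtain[OF xy(1)])
    obtain b where b: "b \<in> ZC" "homog j b" "y = cls D b" by (rule cohom_deg_obtain[OF xy(2)])
    have "homog (i + j) (cprod a b)" using a b by (intro cprod_homog) (simp_all add: ZC_iff)
    then show ?thesis using a b by (simp add: pr_cls cls_cohom_deg cprod_ZC)
  qed
  fix x assume "x \<in> ser (cohom D)"
  then obtain u where u: "u \<in> ZC" "x = cls D u" by (rule cohom_obtain)
  let ?P = "\<lambda>y. (\<forall>n. y n \<in> ser (cohom_deg D n)) \<and> finite {n. y n \<noteq> cls D 0} \<and> x = cls D 0 + (\<Sum>n | y n \<noteq> cls D 0. y n)"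
  let ?M = "gdeg ` Pow E"
  let ?y = "\<lambda>n. cls D (component n u)"
  have finM: "finite ?M" using finite_E by simp
  have u0: "u S = 0" if "gdeg S \<notin> ?M" for S
  proof -
    have "\<not> S \<subseteq> E" using that by blast
    then have "\<not> S \<subseteq> ghosts D" using ghosts_iff by blast
    then show ?thesis using u(1) unfolding ZC_iff cochain_ser_def grass_over_iff by blast
  qed
  have c0: "component n u = 0" if "n \<notin> ?M" for n
    by (rule ext) (use u0 that in \<open>auto simp: component_def\<close>)
  have supp: "{n. ?y n \<noteq> cls D 0} \<subseteq> ?M" using c0 by force
  have sumc: "(\<Sum>n\<in>?M. component n u) = u"
  proof
    fix S
    have "(\<Sum>n\<in>?M. component n u) S = (\<Sum>n\<in>?M. if gdeg S = n then u S else 0)"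
      unfolding sum_apply component_def ..
    also have "\<dots> = u S" using finM u0[of S] by (simp add: sum.delta)
    finally show "(\<Sum>n\<in>?M. component n u) S = u S" .
  qed
  have ex: "?P ?y"
  proof (intro conjI allI)
    show "?y n \<in> ser (cohom_deg D n)" for n by (intro cls_cohom_deg component_ZC u homog_component)
    show "finite {n. ?y n \<noteq> cls D 0}" using supp finM finite_subset by blast
    show "x = cls D 0 + (\<Sum>n | ?y n \<noteq> cls D 0. ?y n)"
      using cls_sum_support[OF finM supp, of "\<lambda>n. component n u"] by (simp only: sumc u(2))
  qed
  have "y = y'" if y: "?P y" and y': "?P y'" for y y'
  proof
    have "\<forall>n. \<exists>v. v \<in> ZC \<and> homog n v \<and> y n = cls D v" using y by (metis cohom_deg_obtain)
    then obtain v where v: "\<And>n. v n \<in> ZC" "\<And>n. homog n (v n)" "\<And>n. y n = cls D (v n)" by metis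
    have "\<forall>n. \<exists>v. v \<in> ZC \<and> homog n v \<and> y' n = cls D v" using y' by (metis cohom_deg_obtain)
    then obtain v' where v': "\<And>n. v' n \<in> ZC" "\<And>n. homog n (v' n)" "\<And>n. y' n = cls D (v' n)" by metis
    fix k
    let ?L = "{n. y n \<noteq> cls D 0} \<union> {n. y' n \<noteq> cls D 0} \<union> {k}"
    have finL: "finite ?L" using y y' by simp
    have "cls D (\<Sum>n\<in>?L. v n) = cls D (\<Sum>n\<in>?L. v' n)"
    proof -
      have "cls D 0 + (\<Sum>n | y n \<noteq> cls D 0. y n) = cls D (\<Sum>n\<in>?L. v n)"
        by (rule cls_sum_support[OF finL _ v(3)]) blast
      moreover have "cls D 0 + (\<Sum>n | y' n \<noteq> cls D 0. y' n) = cls D (\<Sum>n\<in>?L. v' n)"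
        by (rule cls_sum_support[OF finL _ v'(3)]) blast
      ultimately show ?thesis using y y' by simp
    qed
    moreover have sC: "(\<Sum>n\<in>?L. v n) \<in> C" "(\<Sum>n\<in>?L. v' n) \<in> C"
      using v(1) v'(1) by (auto intro!: add_closed_sum[OF C_closed] simp: ZC_iff)
    ultimately obtain w where w: "w \<in> C" "(\<Sum>n\<in>?L. v n) - (\<Sum>n\<in>?L. v' n) = d w"
      using cls_eq_iff by blast
    have comp: "component k (\<Sum>n\<in>?L. f n) = f k" if "\<And>n. homog n (f n)" for f :: "int \<Rightarrow> ('m \<Rightarrow> 'k) fps grass"
    proof -
      have "component k (\<Sum>n\<in>?L. f n) = (\<Sum>n\<in>?L. if k = n then f k else 0)"
        unfolding component_sum by (intro sum.cong refl) (simp add: component_homog[OF that])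
      then show ?thesis using finL by (simp add: sum.delta)
    qed
    have "v k - v' k = component k (d w)"
      unfolding w(2)[symmetric] component_diff comp[OF v(2)] comp[OF v'(2)] ..
    also have "\<dots> = d (component (k - 1) w)"
    proof (rule gcoeff_eqI)
      fix m
      have "gcoeff w m \<in> cochains D" using w(1) C_iff by blast
      then show "gcoeff (component k (d w)) m = gcoeff (d (component (k - 1) w)) m"
        by (simp only: gcoeff_gser_map gcoeff_component ce_diff_component diff_add_cancel)
    qed
    finally have "v k - v' k = d (component (k - 1) w)" .
    moreover have "component (k - 1) w \<in> C"
      using w(1) by (simp add: C_iff gcoeff_component ce_diff_component(1))
    ultimately have "cls D (v k) = cls D (v' k)"
      using cls_eq_iff v(1)[of k] v'(1)[of k] by (auto simp: ZC_iff)
    then show "y k = y' k" by (simp only: v(3) v'(3))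
  qed
  from this[OF _ ex] show "\<exists>!y. ?P y" by (rule ex1I[of ?P, OF ex])
qed

section \<open>Invariant functions\<close>

lemma CZ_inv_CZ: "u \<in> CZ_inv D \<Longrightarrow> u \<in> CZ D"
  by (simp add: CZ_inv_def)

lemma emb_ZC_iff:
  assumes "f \<in> ser (CZ D)"
  shows "emb f \<in> ZC \<longleftrightarrow> f \<in> ser (CZ_inv D)"
proof -
  have u: "fps_nth f n \<in> CZ D" for n using assms by (simp add: ser_def)
  have "emb f \<in> C" by (simp add: C_iff gcoeff_emb ce_diff_emb(1)[OF u])
  moreover have "d (emb f) = 0 \<longleftrightarrow> (\<forall>n. ce_diff D (emb (fps_nth f n)) = 0)"
  proof
    assume *: "d (emb f) = 0"
    have "gcoeff (d (emb f)) n = 0" for n unfolding * by (rule gcoeff_0)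
    then show "\<forall>n. ce_diff D (emb (fps_nth f n)) = 0" unfolding gcoeff_gser_map gcoeff_emb by blast
  next
    assume "\<forall>n. ce_diff D (emb (fps_nth f n)) = 0"
    then show "d (emb f) = 0" by (intro gcoeff_eqI) (simp only: gcoeff_gser_map gcoeff_emb gcoeff_0)
  qed
  ultimately show ?thesis by (simp add: ZC_iff ce_diff_emb_eq_0_iff[OF u] ser_def)
qed

lemma SZ_inv: "f \<in> ser (CZ_inv D) \<Longrightarrow> f \<in> ser (CZ D)"
  by (simp add: ser_def CZ_inv_CZ)

lemma emb_ZC: "f \<in> ser (CZ_inv D) \<Longrightarrow> emb f \<in> ZC"
  using emb_ZC_iff SZ_inv by blast

text \<open>
  There are no coboundaries in degree zero, and a cochain of degree zero is a function because all ghosts have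
  degree one.
\<close>

lemma bij_cls_emb: "bij_betw (\<lambda>f. cls D (emb f)) (ser (CZ_inv D)) (ser (cohom_deg D 0))"
proof (rule bij_betw_imageI)
  show "inj_on (\<lambda>f. cls D (emb f)) (ser (CZ_inv D))"
  proof (rule inj_onI)
    fix f g assume f: "f \<in> ser (CZ_inv D)" and g: "g \<in> ser (CZ_inv D)" and eq: "cls D (emb f) = cls D (emb g)"
    have C: "emb f \<in> C" "emb g \<in> C" using emb_ZC f g ZC_iff by blast+
    obtain w where w: "w \<in> C" "emb f - emb g = d w" using eq cls_eq_iff[OF C] by blast
    show "f = g"
    proof (rule fps_ext)
      fix n
      have "gcoeff (emb f - emb g) n {} = ce_diff D (gcoeff w n) {}"
        unfolding w(2) gcoeff_gser_map ..
      also have "\<dots> = 0" using w(1) by (intro ce_diff_empty) (simp add: C_iff)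
      finally have "(gcoeff (emb f) n - gcoeff (emb g) n) {} = 0" by (simp only: gcoeff_diff)
      then show "fps_nth f n = fps_nth g n" by (simp add: gcoeff_def emb_def)
    qed
  qed
  show "(\<lambda>f. cls D (emb f)) ` ser (CZ_inv D) = ser (cohom_deg D 0)"
  proof (rule Set.set_eqI, rule iffI)
    fix F assume "F \<in> (\<lambda>f. cls D (emb f)) ` ser (CZ_inv D)"
    then obtain f where f: "f \<in> ser (CZ_inv D)" "F = cls D (emb f)" by blast
    have "homog 0 (emb f)" by (simp add: homog_def emb_def gdeg_def)
    then show "F \<in> ser (cohom_deg D 0)" using f emb_ZC cls_cohom_deg by blast
  next
    fix F assume "F \<in> ser (cohom_deg D 0)"
    then obtain u where u: "u \<in> ZC" "homog 0 u" "F = cls D u" by (rule cohom_deg_obtain)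
    have "u S = emb (u {}) S" for S
    proof (cases "S = {}")
      case False
      have "u S = 0"
      proof (rule ccontr)
        assume nz: "u S \<noteq> 0"
        then have S: "S \<subseteq> ghosts D" using u(1) unfolding ZC_iff cochain_ser_def grass_over_iff by blast
        then have "gdeg S = int (card S)" unfolding ghosts_iff gdeg_def by simp
        moreover have "card S \<noteq> 0" using False ghosts_finite[OF S] by simp
        ultimately show False using u(2) nz by (simp add: homog_def)
      qed
      then show ?thesis using False by (simp add: emb_def)
    qed (simp add: emb_def)
    then have e: "u = emb (u {})" by (rule ext)
    have "u {} \<in> ser (CZ D)"
      using u(1) unfolding ZC_iff cochain_ser_def grass_over_iff by blast
    then have "u {} \<in> ser (CZ_inv D)" using emb_ZC_iff u(1) e by metis
    moreover have "F = cls D (emb (u {}))" by (simp only: u(3) e[symmetric])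
    ultimately show "F \<in> (\<lambda>f. cls D (emb f)) ` ser (CZ_inv D)" by (rule rev_image_eqI)
  qed
qed

lemma prol_inv: "u \<in> CZ_inv D \<Longrightarrow> prol D u \<in> CM_inv D"
  unfolding CM_inv_iff using prol_CM[OF CZ_inv_CZ] prol_equivariant[OF _ CZ_inv_CZ] prol_0
  by (simp add: CZ_inv_def)

lemma ser_prol_SM: "f \<in> ser (CZ D) \<Longrightarrow> ser_map (prol D) f \<in> SM"
  by (simp add: ser_def ser_map_def prol_CM)

text \<open>
  Strong invariance makes \<open>prol f\<close> closed, and \<open>h\<^sub>0 prol = 0\<close> makes the Neumann series of the quantum
  restriction trivial on it.
\<close>

lemma emb_prol:
  assumes f: "f \<in> ser (CZ_inv D)"
  shows "emb (ser_map (prol D) f) \<in> Q" "\<delta> (emb (ser_map (prol D) f)) = 0" "R (emb (ser_map (prol D) f)) = emb f"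
proof -
  have P: "ser_map (prol D) f \<in> SM" by (rule ser_prol_SM[OF SZ_inv[OF f]])
  show "emb (ser_map (prol D) f) \<in> Q" by (rule Q_emb[OF P])
  show "\<delta> (emb (ser_map (prol D) f)) = 0"
  proof (rule brst_diff_emb_invariant[OF P])
    fix a n assume a: "a < gdim D"
    have "fps_nth f n \<in> CZ_inv D" using f by (simp add: ser_def)
    then show "poisson D (Jc D a) (fps_nth (ser_map (prol D) f) n) = 0"
      using prol_inv a by (simp add: CM_inv_iff ser_map_def)
  qed
  show "R (emb (ser_map (prol D) f)) = emb f"
    by (simp add: qres_emb qres_fun_prol SZ_inv f)
qed

definition inv_prod :: "('m \<Rightarrow> 'k) fps \<Rightarrow> ('m \<Rightarrow> 'k) fps \<Rightarrow> ('m \<Rightarrow> 'k) fps" where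
  "inv_prod f g = qres_fun D (star D (ser_map (prol D) f) (ser_map (prol D) g))"

lemma bmul_emb_emb: "F \<in> SM \<Longrightarrow> G \<in> SM \<Longrightarrow> emb F \<bullet>\<bullet> emb G = emb (star D F G)"
  unfolding bmul_emb_left[OF _ Q_emb] by (rule ext) (simp add: emb_def star_0_right)

lemma R_emb_prol:
  assumes "f \<in> ser (CZ_inv D)" "g \<in> ser (CZ_inv D)"
  shows "R (emb (ser_map (prol D) f) \<bullet>\<bullet> emb (ser_map (prol D) g)) = emb (inv_prod f g)"
  by (simp add: bmul_emb_emb ser_prol_SM SZ_inv assms qres_emb inv_prod_def)

text \<open>
  By \<open>cprod_R\<close> the class of a product can be computed from the closed representatives \<open>prol f\<close> and
  \<open>prol g\<close> instead of \<open>\<Phi> f\<close> and \<open>\<Phi> g\<close>.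
\<close>

lemma pr_emb:
  assumes f: "f \<in> ser (CZ_inv D)" and g: "g \<in> ser (CZ_inv D)"
  shows "pr (cls D (emb f)) (cls D (emb g))
    = cls D (R (emb (ser_map (prol D) f) \<bullet>\<bullet> emb (ser_map (prol D) g)))"
  using cprod_R[OF emb_prol(1,2)[OF f] emb_prol(1,2)[OF g]]
  unfolding emb_prol(3)[OF f] emb_prol(3)[OF g] pr_cls[OF emb_ZC[OF f] emb_ZC[OF g]] .

lemma inv_prod_inv:
  assumes f: "f \<in> ser (CZ_inv D)" and g: "g \<in> ser (CZ_inv D)"
  shows "inv_prod f g \<in> ser (CZ_inv D)"
proof -
  have "R (emb (ser_map (prol D) f) \<bullet>\<bullet> emb (ser_map (prol D) g)) \<in> ZC"
    by (intro R_closed bmul_Q closed_bmul emb_prol f g)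
  then have "emb (inv_prod f g) \<in> ZC" by (simp only: R_emb_prol[OF f g])
  moreover have "inv_prod f g \<in> ser (CZ D)"
    unfolding inv_prod_def by (intro qres_fun_SZ star_SM ser_prol_SM SZ_inv f g)
  ultimately show ?thesis using emb_ZC_iff by blast
qed

section \<open>The reduced space\<close>

lemma CM_inv_CM: "f \<in> CM_inv D \<Longrightarrow> f \<in> CM D"
  by (simp add: CM_inv_def)

lemma CM_inv_closed: "add_closed (CM_inv D)"
  using CM_0 CM_add CM_minus by (auto simp: add_closed_def CM_inv_def)

lemma CM_inv_scale: "f \<in> CM_inv D \<Longrightarrow> fscale c f \<in> CM_inv D"
  using CM_scale[of f c] by (simp add: CM_inv_def) (simp add: fscale_def)

lemma CM_inv_mult: "f \<in> CM_inv D \<Longrightarrow> g \<in> CM_inv D \<Longrightarrow> f * g \<in> CM_inv D"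
  using CM_mult[of f g] by (simp add: CM_inv_def)

abbreviation "I \<equiv> IZ_inv D"

lemma I_closed: "add_closed I"
  using CM_0 CM_add CM_minus by (auto simp: add_closed_def CM_inv_def IZ_inv_def IZ_def)

lemma I_CM_inv: "w \<in> I \<Longrightarrow> w \<in> CM_inv D"
  by (simp add: IZ_inv_def)

lemma I_scale: "w \<in> I \<Longrightarrow> fscale c w \<in> I"
  using CM_scale[of w c] by (simp add: CM_inv_def IZ_inv_def IZ_def) (simp add: fscale_def)

lemma I_mult: "f \<in> CM_inv D \<Longrightarrow> w \<in> I \<Longrightarrow> f * w \<in> I" "f \<in> CM_inv D \<Longrightarrow> w \<in> I \<Longrightarrow> w * f \<in> I"
  using CM_mult[of f w] CM_mult[of w f] by (auto simp: CM_inv_def IZ_inv_def IZ_def)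

lemma diff_I_iff: "f \<in> CM_inv D \<Longrightarrow> g \<in> CM_inv D \<Longrightarrow> f - g \<in> I \<longleftrightarrow> res D f = res D g"
proof -
  assume f: "f \<in> CM_inv D" and g: "g \<in> CM_inv D"
  have d: "f - g \<in> CM_inv D" by (rule add_closedD(4)[OF CM_inv_closed f g])
  have "f - g \<in> I \<longleftrightarrow> f - g \<in> IZ D" using d by (simp add: IZ_inv_def)
  also have "\<dots> \<longleftrightarrow> res D (f - g) = 0" by (rule res_eq_0_iff[OF CM_inv_CM[OF d], symmetric])
  finally show ?thesis by (simp only: res_diff right_minus_eq)
qed

text \<open>
  The vanishing ideal is stable under the action because it is generated by the components of the moment
  map, the action is a derivation, and brackets of components vanish on \<open>Z\<close>.
\<close>

lemma poisson_IZ: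
  assumes a: "a < gdim D" and f: "f \<in> IZ D"
  shows "res D (poisson D (Jc D a) f) = 0"
proof -
  have "IZ D = {\<Sum>b<gdim D. g b * Jc D b | g. \<forall>b<gdim D. g b \<in> CM D}"
    using generating by (simp add: generating_acyclic_def)
  then obtain g where g: "f = (\<Sum>b<gdim D. g b * Jc D b)" "\<And>b. b < gdim D \<Longrightarrow> g b \<in> CM D"
    using f by blast
  have "poisson D (Jc D a) (\<Sum>b\<in>N. g b * Jc D b) \<in> CM D \<and> res D (poisson D (Jc D a) (\<Sum>b\<in>N. g b * Jc D b)) = 0"
    if "finite N" "N \<subseteq> {..<gdim D}" for N
    using that
  proof (induction N rule: finite_induct)
    case empty
    have "poisson D (Jc D a) 0 = 0" using poisson_Jc_add[OF a CM_0 CM_0] by simp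
    then show ?case using CM_0 res_0 by (simp only: sum.empty)
  next
    case (insert b N)
    then have b: "b < gdim D" and N: "N \<subseteq> {..<gdim D}" by simp_all
    have IH: "res D (poisson D (Jc D a) (\<Sum>b\<in>N. g b * Jc D b)) = 0" using insert.IH[OF N] ..
    let ?s = "\<Sum>b\<in>N. g b * Jc D b"
    have s: "?s \<in> CM D" using insert.prems g(2) by (intro CM_sum CM_mult Jc_CM) auto
    have gb: "g b * Jc D b \<in> CM D" by (intro CM_mult Jc_CM g(2) b)
    have eq: "poisson D (Jc D a) (g b * Jc D b + ?s)
        = poisson D (Jc D a) (g b) * Jc D b + g b * poisson D (Jc D a) (Jc D b) + poisson D (Jc D a) ?s"
      by (simp only: poisson_Jc_add[OF a gb s] poisson_Jc_mult[OF a g(2)[OF b] Jc_CM[OF b]])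
    have "res D (Jc D b) = 0"
      by (rule ext) (use gbasis_lie_alg[OF b] in \<open>simp add: res_def Jc_def J_of_def Zset_def\<close>)
    moreover have "res D (poisson D (Jc D a) (Jc D b)) = 0"
      by (rule ext) (simp add: res_def poisson_Jc_Jc_Zset[OF a b])
    ultimately have "res D (poisson D (Jc D a) (g b * Jc D b + ?s)) = 0"
      unfolding eq res_add res_mult using IH by (simp only: mult_zero_right add_0)
    then show ?case
      unfolding sum.insert[OF insert.hyps] using poisson_Jc_CM[OF a CM_add[OF gb s]] by blast
  qed
  from this[OF finite_lessThan subset_refl] show ?thesis unfolding g(1) by blast
qed

lemma res_inv: "f \<in> CM_inv D \<Longrightarrow> res D f \<in> CZ_inv D"
proof -
  assume f: "f \<in> CM_inv D"
  note fM = CM_inv_CM[OF f]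
  note u = res_CZ[OF fM]
  note p = prol_CM[OF u]
  have "act_Z D a (res D f) = 0" if a: "a < gdim D" for a
  proof -
    have w: "prol D (res D f) - f \<in> CM D" by (rule CM_diff[OF p fM])
    have "res D (prol D (res D f) - f) = 0" by (simp only: res_diff res_prol[OF u] right_minus_eq)
    then have "prol D (res D f) - f \<in> IZ D" using res_eq_0_iff[OF w] by blast
    then have "res D (poisson D (Jc D a) (prol D (res D f) - f)) = 0" by (rule poisson_IZ[OF a])
    moreover have "poisson D (Jc D a) ((prol D (res D f) - f) + f)
        = poisson D (Jc D a) (prol D (res D f) - f) + poisson D (Jc D a) f"
      by (rule poisson_Jc_add[OF a w fM])
    moreover have "poisson D (Jc D a) f = 0" using f a by (simp add: CM_inv_iff)
    ultimately show ?thesis unfolding act_Z_eq[OF a u] by simp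
  qed
  then show ?thesis using u by (simp add: CZ_inv_def)
qed

text \<open>
  The isomorphism \<open>C\<^sup>\<infinity>(M)\<^sup>G / I\<^sup>G \<rightarrow> C\<^sup>\<infinity>(Z)\<^sup>g\<close>, restriction of a representative.
\<close>

definition \<psi> :: "('m \<Rightarrow> 'k) set \<Rightarrow> 'm \<Rightarrow> 'k" where
  "\<psi> X = res D (SOME f. f \<in> CM_inv D \<and> coset I f = X)"

lemma \<psi>_coset: "f \<in> CM_inv D \<Longrightarrow> \<psi> (coset I f) = res D f"
proof -
  assume f: "f \<in> CM_inv D"
  let ?g = "SOME g. g \<in> CM_inv D \<and> coset I g = coset I f"
  have g: "?g \<in> CM_inv D \<and> coset I ?g = coset I f"
    by (rule someI[of "\<lambda>g. g \<in> CM_inv D \<and> coset I g = coset I f" f]) (simp add: f)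
  then have "?g - f \<in> I" by (simp only: coset_eq_iff[OF I_closed])
  then have "res D ?g = res D f" using g f diff_I_iff by blast
  then show ?thesis unfolding \<psi>_def .
qed

lemma coset_eq_res_iff: "f \<in> CM_inv D \<Longrightarrow> g \<in> CM_inv D \<Longrightarrow> coset I f = coset I g \<longleftrightarrow> res D f = res D g"
  by (simp only: coset_eq_iff[OF I_closed] diff_I_iff)

lemma CM_red_obtain:
  assumes "X \<in> CM_red D"
  obtains f where "f \<in> CM_inv D" "X = coset I f"
  using assms unfolding CM_red_def by blast

lemma \<psi>_inv: "X \<in> CM_red D \<Longrightarrow> \<psi> X \<in> CZ_inv D"
  by (elim CM_red_obtain) (simp add: \<psi>_coset res_inv)

lemma coset_prol_\<psi>: "X \<in> CM_red D \<Longrightarrow> coset I (prol D (\<psi> X)) = X"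
proof -
  assume "X \<in> CM_red D"
  then obtain f where f: "f \<in> CM_inv D" "X = coset I f" by (rule CM_red_obtain)
  have u: "res D f \<in> CZ_inv D" by (rule res_inv[OF f(1)])
  then show ?thesis
    unfolding f(2) \<psi>_coset[OF f(1)]
    using coset_eq_res_iff[OF prol_inv[OF u] f(1)] res_prol[OF CZ_inv_CZ[OF u]] by blast
qed

lemma \<psi>_coset_prol: "u \<in> CZ_inv D \<Longrightarrow> \<psi> (coset I (prol D u)) = u"
  by (simp add: \<psi>_coset prol_inv res_prol CZ_inv_CZ)

lemma coset_red: "f \<in> CM_inv D \<Longrightarrow> coset I f \<in> CM_red D"
  unfolding CM_red_def by (rule imageI)

text \<open>
  The inverse is prolongation, which maps invariants to invariants by equivariance and connectedness.
\<close>

lemma bij_\<psi>: "bij_betw \<psi> (CM_red D) (CZ_inv D)"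
  by (rule bij_betw_byWitness[where f' = "\<lambda>u. coset I (prol D u)"])
    (auto simp: coset_prol_\<psi> \<psi>_coset_prol \<psi>_inv coset_red prol_inv)

lemma red_add:
  assumes "X \<in> CM_red D" "Y \<in> CM_red D"
  shows "X + Y \<in> CM_red D" "\<psi> (X + Y) = \<psi> X + \<psi> Y"
proof -
  obtain f where f: "f \<in> CM_inv D" "X = coset I f" using assms(1) by (rule CM_red_obtain)
  obtain g where g: "g \<in> CM_inv D" "Y = coset I g" using assms(2) by (rule CM_red_obtain)
  have fg: "f + g \<in> CM_inv D" by (rule add_closedD(2)[OF CM_inv_closed f(1) g(1)])
  have "X + Y = coset I (f + g)" unfolding f(2) g(2) by (rule coset_plus[OF I_closed])
  then show "X + Y \<in> CM_red D" "\<psi> (X + Y) = \<psi> X + \<psi> Y"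
    using fg f g by (simp_all only: coset_red \<psi>_coset res_add)
qed

lemma red_scale_coset: "coset_scale fscale I c (coset I f) = coset I (fscale c f)"
  by (rule coset_scale_coset[OF I_closed]) (simp_all only: fscale_simps(1) I_scale)

lemma red_scale:
  assumes "X \<in> CM_red D"
  shows "coset_scale fscale I c X \<in> CM_red D" "\<psi> (coset_scale fscale I c X) = fscale c (\<psi> X)"
proof -
  obtain f where f: "f \<in> CM_inv D" "X = coset I f" using assms by (rule CM_red_obtain)
  show "coset_scale fscale I c X \<in> CM_red D" "\<psi> (coset_scale fscale I c X) = fscale c (\<psi> X)"
    unfolding f(2) red_scale_coset by (simp_all only: coset_red \<psi>_coset CM_inv_scale f(1) res_scale)
qed

lemma red_mult:
  assumes "X \<in> CM_red D" "Y \<in> CM_red D"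
  shows "\<psi> (coset_mult I X Y) = \<psi> X * \<psi> Y"
proof -
  obtain f where f: "f \<in> CM_inv D" "X = coset I f" using assms(1) by (rule CM_red_obtain)
  obtain g where g: "g \<in> CM_inv D" "Y = coset I g" using assms(2) by (rule CM_red_obtain)
  note I2 = add_closedD(2)[OF I_closed]
  have self: "h \<in> coset I h" for h
    unfolding coset_def by (rule image_eqI[of _ _ 0]) (simp_all add: add_closedD(1)[OF I_closed])
  have "coset_mult I X Y = coset I (f * g)"
  proof (rule Set.set_eqI, rule iffI)
    fix z assume "z \<in> coset_mult I X Y"
    then obtain a b w where z: "z = (f + a) * (g + b) + w" "a \<in> I" "b \<in> I" "w \<in> I"
      unfolding coset_mult_def f(2) g(2) coset_def by blast
    have "z = f * g + (f * b + (a * g + (a * b + w)))" unfolding z(1) by (simp add: algebra_simps)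
    moreover have "f * b + (a * g + (a * b + w)) \<in> I"
      by (intro I2 I_mult f(1) g(1) z(2-4) I_CM_inv)
    ultimately show "z \<in> coset I (f * g)" unfolding coset_def by blast
  next
    fix z assume "z \<in> coset I (f * g)"
    then obtain w where "z = f * g + w" "w \<in> I" unfolding coset_def by blast
    then show "z \<in> coset_mult I X Y" unfolding coset_mult_def f(2) g(2) using self by blast
  qed
  then show ?thesis using f g by (simp only: \<psi>_coset CM_inv_mult res_mult)
qed

lemma red_sum:
  fixes n :: nat
  assumes "\<And>i. i \<le> n \<Longrightarrow> X i \<in> CM_red D"
  shows "(\<Sum>i\<le>n. X i) \<in> CM_red D \<and> \<psi> (\<Sum>i\<le>n. X i) = (\<Sum>i\<le>n. \<psi> (X i))"
  using assms
proof (induction n)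
  case (Suc n)
  have "(\<Sum>i\<le>n. X i) \<in> CM_red D \<and> \<psi> (\<Sum>i\<le>n. X i) = (\<Sum>i\<le>n. \<psi> (X i))"
    by (rule Suc.IH) (simp add: Suc.prems)
  then show ?case
    unfolding sum.atMost_Suc using red_add[of "\<Sum>i\<le>n. X i" "X (Suc n)"] Suc.prems[of "Suc n"] by simp
qed simp

text \<open>
  The coefficient of \<open>\<nu>\<^sup>i\<close> of the product of invariant functions.
\<close>

definition restricted_op :: "nat \<Rightarrow> ('m \<Rightarrow> 'k) \<Rightarrow> ('m \<Rightarrow> 'k) \<Rightarrow> 'm \<Rightarrow> 'k" where
  "restricted_op i u v = (\<Sum>k\<le>i. res D (neumann_op k (mu D (i - k) (prol D u) (prol D v))))"

lemma neumann_op_sum: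
  assumes "\<And>j. j \<in> N \<Longrightarrow> f j \<in> CM D"
  shows "neumann_op k (\<Sum>j\<in>N. f j) = (\<Sum>j\<in>N. neumann_op k (f j))"
  using assms
proof (induction N rule: infinite_finite_induct)
  case (insert j N)
  have IH: "neumann_op k (\<Sum>j\<in>N. f j) = (\<Sum>j\<in>N. neumann_op k (f j))"
    by (rule insert.IH) (simp add: insert.prems)
  have "f j \<in> CM D" "(\<Sum>j\<in>N. f j) \<in> CM D"
    using insert.prems by (auto intro: CM_sum)
  then show ?case unfolding sum.insert[OF insert.hyps] IH[symmetric] by (rule neumann_op_add)
qed (simp_all only: sum.infinite sum.empty neumann_op_0 not_False_eq_True)

lemma ser_bilin_restricted_op:
  assumes f: "f \<in> ser (CZ D)" and g: "g \<in> ser (CZ D)"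
  shows "ser_bilin restricted_op f g = inv_prod f g"
proof (rule fps_ext)
  fix n
  have fM: "prol D (fps_nth f j) \<in> CM D" for j using f by (simp add: ser_def prol_CM)
  have gM: "prol D (fps_nth g j) \<in> CM D" for j using g by (simp add: ser_def prol_CM)
  have muM: "mu D i (prol D (fps_nth f j)) (prol D (fps_nth g l)) \<in> CM D" for i j l
    by (rule mu_CM[OF fM gM])
  let ?h = "\<lambda>k i. \<Sum>j\<le>n - (k + i). res D (neumann_op k (mu D i (prol D (fps_nth f j)) (prol D (fps_nth g (n - (k + i) - j)))))"
  have "fps_nth (ser_bilin restricted_op f g) n = (\<Sum>m\<le>n. \<Sum>k\<le>m. ?h k (m - k))"
  proof -
    have "(\<Sum>j\<le>n - m. restricted_op m (fps_nth f j) (fps_nth g (n - m - j))) = (\<Sum>k\<le>m. ?h k (m - k))" for m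
      unfolding restricted_op_def by (subst sum.swap) (intro sum.cong refl, auto)
    then show ?thesis by (simp add: ser_bilin_def)
  qed
  also have "\<dots> = (\<Sum>k\<le>n. \<Sum>i\<le>n - k. ?h k i)"
    by (rule sum_triangle[symmetric])
  also have "\<dots> = (\<Sum>k\<le>n. res D (neumann_op k (fps_nth (star D (ser_map (prol D) f) (ser_map (prol D) g)) (n - k))))"
  proof (rule sum.cong[OF refl])
    fix k
    have "neumann_op k (fps_nth (star D (ser_map (prol D) f) (ser_map (prol D) g)) (n - k))
      = (\<Sum>i\<le>n - k. \<Sum>j\<le>n - k - i. neumann_op k (mu D i (prol D (fps_nth f j)) (prol D (fps_nth g (n - k - i - j)))))"
      unfolding star_nth ser_map_def fps_nth_Abs_fps by (simp only: neumann_op_sum CM_sum muM)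
    then show "(\<Sum>i\<le>n - k. ?h k i) = res D (neumann_op k (fps_nth (star D (ser_map (prol D) f) (ser_map (prol D) g)) (n - k)))"
      by (simp only: res_sum diff_diff_left)
  qed
  also have "\<dots> = fps_nth (inv_prod f g) n"
    by (simp add: inv_prod_def qres_fun_eq star_SM ser_prol_SM f g)
  finally show "fps_nth (ser_bilin restricted_op f g) n = fps_nth (inv_prod f g) n" .
qed

lemma restricted_op_add:
  assumes "u \<in> CZ D" "u' \<in> CZ D" "v \<in> CZ D"
  shows "restricted_op i (u + u') v = restricted_op i u v + restricted_op i u' v" "restricted_op i v (u + u') = restricted_op i v u + restricted_op i v u'"
  by (simp_all only: restricted_op_def prol_add prol_CM mu_add_left mu_add_right mu_CM neumann_op_add res_add sum.distrib assms)

lemma restricted_op_scale: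
  assumes "u \<in> CZ D" "v \<in> CZ D"
  shows "restricted_op i (fscale c u) v = fscale c (restricted_op i u v)" "restricted_op i u (fscale c v) = fscale c (restricted_op i u v)"
  by (simp_all only: restricted_op_def prol_scale prol_CM mu_scale_left mu_scale_right mu_CM neumann_op_scale res_scale fscale_sum assms)

lemma restricted_op_0:
  assumes "u \<in> CZ D"
  shows "restricted_op i 0 u = 0" "restricted_op i u 0 = 0"
  using restricted_op_add[OF CZ_0 CZ_0 assms, of i] by simp_all

text \<open>
  The coefficients of the product of the constant series \<open>u\<close> and \<open>v\<close> are \<open>restricted_op i u v\<close>, and invariant
  series are closed under the product since the restriction of a closed element is a cocycle.
\<close>

lemma restricted_op_inv:
  assumes u: "u \<in> CZ_inv D" and v: "v \<in> CZ_inv D"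
  shows "restricted_op i u v \<in> CZ_inv D"
proof -
  have z: "0 \<in> CZ_inv D" by (simp add: CZ_inv_def CZ_0 act_Z_0)
  have s: "fps_const u \<in> ser (CZ_inv D)" "fps_const v \<in> ser (CZ_inv D)" using u v z by (simp_all add: ser_def)
  have "fps_nth (ser_bilin restricted_op (fps_const u) (fps_const v)) i = restricted_op i u v"
  proof -
    have "(\<Sum>j\<le>i - m. restricted_op m (fps_nth (fps_const u) j) (fps_nth (fps_const v) (i - m - j)))
        = (if m = i then restricted_op i u v else 0)" if "m \<le> i" for m
    proof -
      have "(\<Sum>j\<le>i - m. restricted_op m (fps_nth (fps_const u) j) (fps_nth (fps_const v) (i - m - j)))
          = (\<Sum>j\<le>i - m. if j = 0 then (if m = i then restricted_op i u v else 0) else 0)"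
        using that CZ_inv_CZ[OF u] CZ_inv_CZ[OF v] by (intro sum.cong refl) (auto simp: restricted_op_0 CZ_0)
      then show ?thesis by simp
    qed
    then have "fps_nth (ser_bilin restricted_op (fps_const u) (fps_const v)) i = (\<Sum>m\<le>i. if m = i then restricted_op i u v else 0)"
      by (simp add: ser_bilin_def)
    then show ?thesis by simp
  qed
  moreover have "ser_bilin restricted_op (fps_const u) (fps_const v) \<in> ser (CZ_inv D)"
    unfolding ser_bilin_restricted_op[OF SZ_inv[OF s(1)] SZ_inv[OF s(2)]] by (rule inv_prod_inv[OF s])
  ultimately show ?thesis by (simp add: ser_def) metis
qed

definition red_op :: "nat \<Rightarrow> ('m \<Rightarrow> 'k) set \<Rightarrow> ('m \<Rightarrow> 'k) set \<Rightarrow> ('m \<Rightarrow> 'k) set" where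
  "red_op i X Y = coset I (prol D (restricted_op i (\<psi> X) (\<psi> Y)))"

lemma red_op:
  assumes "X \<in> CM_red D" "Y \<in> CM_red D"
  shows "red_op i X Y \<in> CM_red D" "\<psi> (red_op i X Y) = restricted_op i (\<psi> X) (\<psi> Y)"
  unfolding red_op_def using restricted_op_inv[OF \<psi>_inv[OF assms(1)] \<psi>_inv[OF assms(2)]]
  by (simp_all only: coset_red prol_inv \<psi>_coset_prol)

lemma \<psi>_inj: "X \<in> CM_red D \<Longrightarrow> Y \<in> CM_red D \<Longrightarrow> \<psi> X = \<psi> Y \<Longrightarrow> X = Y"
  using coset_prol_\<psi> by metis

lemma bilinear_red_op: "bilinear_op (coset_scale fscale I) (CM_red D) (red_op i)"
proof -
  note p = \<psi>_inv[THEN CZ_inv_CZ]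
  have r: "red_op i X (Y + Z) = red_op i X Y + red_op i X Z" "red_op i (Y + Z) X = red_op i Y X + red_op i Z X"
    if "X \<in> CM_red D" "Y \<in> CM_red D" "Z \<in> CM_red D" for X Y Z
    by (rule \<psi>_inj; simp only: red_op red_add that restricted_op_add p)+
  have s: "red_op i X (coset_scale fscale I c Y) = coset_scale fscale I c (red_op i X Y)"
    "red_op i (coset_scale fscale I c X) Y = coset_scale fscale I c (red_op i X Y)"
    if "X \<in> CM_red D" "Y \<in> CM_red D" for X Y c
    by (rule \<psi>_inj; simp only: red_op red_scale that restricted_op_scale p)+
  show ?thesis
    unfolding bilinear_op_iff by (intro conjI ballI allI red_op(1) r s)
qed

lemma topspace_CM_red: "topspace (CM_red_topology D) = CM_red D"
proof -
  have "topspace (subtopology (CM_topology D) (CM_inv D)) = CM_inv D"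
    using CM_inv_CM by (auto simp: topspace_CM)
  then show ?thesis by (simp add: CM_red_topology_def topspace_quotient_topology CM_red_def)
qed

text \<open>
  The reduced algebra carries a quotient topology, so that continuity is tested on invariant functions, where
  the map is restriction.
\<close>

lemma continuous_\<psi>: "continuous_map (CM_red_topology D) (CZ_topology D) \<psi>"
  unfolding CM_red_topology_def
proof (rule continuous_map_from_quotient)
  have "continuous_map (subtopology (CM_topology D) (CM_inv D)) (CZ_topology D) (res D)"
    by (rule continuous_map_from_subtopology[OF continuous_res])
  then show "continuous_map (subtopology (CM_topology D) (CM_inv D)) (CZ_topology D) (\<lambda>f. \<psi> (coset I f))"
    by (rule continuous_map_eq) (simp add: \<psi>_coset)
qed

text \<open>
  The operation factors as \<open>\<psi>\<close> and prolongation on both arguments, a finite sum of bidifferential operators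
  followed by \<open>neumann_op\<close>, restriction, prolongation and the quotient map, all of them continuous.
\<close>

lemma continuous_red_op:
  "continuous_map (prod_topology (CM_red_topology D) (CM_red_topology D)) (CM_red_topology D) (\<lambda>(X, Y). red_op i X Y)"
proof -
  let ?P = "prod_topology (CM_red_topology D) (CM_red_topology D)"
  have 1: "continuous_map ?P (CM_topology D) (\<lambda>z. prol D (\<psi> (fst z)))"
    using continuous_map_compose[OF continuous_map_compose[OF continuous_map_fst continuous_\<psi>] prol_continuous]
    by (simp only: comp_def)
  have 2: "continuous_map ?P (CM_topology D) (\<lambda>z. prol D (\<psi> (snd z)))"
    using continuous_map_compose[OF continuous_map_compose[OF continuous_map_snd continuous_\<psi>] prol_continuous]
    by (simp only: comp_def)
  have "continuous_map ?P (CM_topology D) (\<lambda>z. \<Sum>k\<le>i. neumann_op k (mu D (i - k) (prol D (\<psi> (fst z))) (prol D (\<psi> (snd z)))))"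
    by (intro continuous_map_CM_sum continuous_neumann_op continuous_map_bidifferential[OF mu_bidifferential] 1 2)
  from continuous_map_compose[OF continuous_map_compose[OF this continuous_res] prol_continuous]
  have 3: "continuous_map ?P (CM_topology D) (\<lambda>z. prol D (restricted_op i (\<psi> (fst z)) (\<psi> (snd z))))"
    by (simp only: comp_def restricted_op_def res_sum)
  have "continuous_map ?P (subtopology (CM_topology D) (CM_inv D)) (\<lambda>z. prol D (restricted_op i (\<psi> (fst z)) (\<psi> (snd z))))"
  proof (rule continuous_map_into_subtopology[OF 3])
    show "(\<lambda>z. prol D (restricted_op i (\<psi> (fst z)) (\<psi> (snd z)))) \<in> topspace ?P \<rightarrow> CM_inv D"
      by (auto simp: topspace_CM_red intro!: prol_inv restricted_op_inv \<psi>_inv)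
  qed
  from continuous_map_compose[OF this continuous_map_to_quotient[where q = "coset I"]]
  show ?thesis
    unfolding CM_red_topology_def[symmetric] by (simp only: comp_def red_op_def case_prod_beta')
qed

lemma ser_bilin_red_op:
  assumes F: "F \<in> ser (CM_red D)" and G: "G \<in> ser (CM_red D)"
  shows "ser_bilin red_op F G \<in> ser (CM_red D)"
    "ser_map \<psi> (ser_bilin red_op F G) = inv_prod (ser_map \<psi> F) (ser_map \<psi> G)"
proof -
  have FG: "fps_nth F j \<in> CM_red D" "fps_nth G j \<in> CM_red D" for j using F G by (simp_all add: ser_def)
  note op = red_op[OF FG]
  have in1: "(\<Sum>j\<le>k. red_op i (fps_nth F j) (fps_nth G (k - j))) \<in> CM_red D
      \<and> \<psi> (\<Sum>j\<le>k. red_op i (fps_nth F j) (fps_nth G (k - j))) = (\<Sum>j\<le>k. restricted_op i (\<psi> (fps_nth F j)) (\<psi> (fps_nth G (k - j))))"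
    for i k using red_sum[of k "\<lambda>j. red_op i (fps_nth F j) (fps_nth G (k - j))"] by (simp only: op)
  have in2: "(\<Sum>i\<le>n. \<Sum>j\<le>n - i. red_op i (fps_nth F j) (fps_nth G (n - i - j))) \<in> CM_red D
      \<and> \<psi> (\<Sum>i\<le>n. \<Sum>j\<le>n - i. red_op i (fps_nth F j) (fps_nth G (n - i - j)))
        = (\<Sum>i\<le>n. \<Sum>j\<le>n - i. restricted_op i (\<psi> (fps_nth F j)) (\<psi> (fps_nth G (n - i - j))))" for n
    using red_sum[of n "\<lambda>i. \<Sum>j\<le>n - i. red_op i (fps_nth F j) (fps_nth G (n - i - j))"] in1
    by (simp only:)
  show "ser_bilin red_op F G \<in> ser (CM_red D)"
    using in2 by (simp add: ser_def ser_bilin_def)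
  have s: "ser_map \<psi> H \<in> ser (CZ D)" if "H \<in> ser (CM_red D)" for H
    using that by (simp add: ser_def ser_map_def \<psi>_inv[THEN CZ_inv_CZ])
  have "ser_map \<psi> (ser_bilin red_op F G) = ser_bilin restricted_op (ser_map \<psi> F) (ser_map \<psi> G)"
    by (rule fps_ext) (simp only: ser_map_def ser_bilin_def fps_nth_Abs_fps in2)
  then show "ser_map \<psi> (ser_bilin red_op F G) = inv_prod (ser_map \<psi> F) (ser_map \<psi> G)"
    by (simp only: ser_bilin_restricted_op[OF s[OF F] s[OF G]])
qed

lemma ser_\<psi>_inv: "F \<in> ser (CM_red D) \<Longrightarrow> ser_map \<psi> F \<in> ser (CZ_inv D)"
  by (simp add: ser_def ser_map_def \<psi>_inv)

text \<open>
  The embedding of \<open>C\<^sup>\<infinity>(M\<^sub>r\<^sub>e\<^sub>d)[[\<nu>]]\<close> into the cohomology transports the algebra axioms back.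
\<close>

lemma series_algebra_red: "series_algebra (coset_scale fscale I) (CM_red D) (ser_bilin red_op)"
proof -
  let ?V = "ser (CM_red D)" and ?s = "ser_scale (coset_scale fscale I)" and ?m = "ser_bilin red_op"
  let ?W = "ser (cohom D)" and ?s' = "ser_scale (cohom_scale D)"
  define \<iota> where "\<iota> F = cls D (emb (ser_map \<psi> F))" for F
  have inj: "F = G" if "F \<in> ?V" "G \<in> ?V" "\<iota> F = \<iota> G" for F G
  proof -
    have "ser_map \<psi> F = ser_map \<psi> G"
      using that ser_\<psi>_inv bij_betw_imp_inj_on[OF bij_cls_emb] unfolding \<iota>_def inj_on_def by blast
    then have "\<psi> (fps_nth F n) = \<psi> (fps_nth G n)" for n by (metis ser_map_def fps_nth_Abs_fps)
    then show ?thesis using that(1,2) \<psi>_inj by (intro fps_ext) (simp add: ser_def)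
  qed
  have W: "\<iota> F \<in> ?W" if "F \<in> ?V" for F
    unfolding \<iota>_def by (intro cls_cohom emb_ZC ser_\<psi>_inv that)
  have addV: "F + G \<in> ?V" if "F \<in> ?V" "G \<in> ?V" for F G
    using that by (simp add: ser_def red_add)
  have addi: "\<iota> (F + G) = \<iota> F + \<iota> G" if "F \<in> ?V" "G \<in> ?V" for F G
  proof -
    have "ser_map \<psi> (F + G) = ser_map \<psi> F + ser_map \<psi> G"
      by (rule fps_ext) (use that in \<open>simp add: ser_map_def ser_def red_add\<close>)
    moreover have "emb (a + b) = emb a + emb b" for a b :: "('m \<Rightarrow> 'k) fps" by (rule ext) (simp add: emb_def)
    ultimately show ?thesis by (simp only: \<iota>_def cls_add)
  qed
  have sc: "fps_nth (?s c F) n \<in> CM_red D \<and> \<psi> (fps_nth (?s c F) n) = (\<Sum>i\<le>n. fscale (fps_nth c i) (\<psi> (fps_nth F (n - i))))"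
    if "F \<in> ?V" for F c n
    using that red_sum[of n "\<lambda>i. coset_scale fscale I (fps_nth c i) (fps_nth F (n - i))"]
    by (simp add: ser_scale_def ser_def red_scale)
  have scV: "?s c F \<in> ?V" if "F \<in> ?V" for F c
    using sc[OF that] by (simp add: ser_def)
  have sci: "\<iota> (?s c F) = ?s' c (\<iota> F)" if "F \<in> ?V" for F c
  proof -
    have "ser_map \<psi> (?s c F) = kser c * ser_map \<psi> F"
      by (rule fps_ext) (use sc[OF that] in \<open>simp add: ser_map_def kser_mult_nth\<close>)
    then show ?thesis by (simp only: \<iota>_def gscale_emb[symmetric] cls_kser)
  qed
  have mV: "?m F G \<in> ?V" if "F \<in> ?V" "G \<in> ?V" for F G
    by (rule ser_bilin_red_op(1)[OF that])
  have mi: "\<iota> (?m F G) = pr (\<iota> F) (\<iota> G)" if "F \<in> ?V" "G \<in> ?V" for F G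
    unfolding \<iota>_def ser_bilin_red_op(2)[OF that] pr_emb[OF ser_\<psi>_inv[OF that(1)] ser_\<psi>_inv[OF that(2)]]
      R_emb_prol[OF ser_\<psi>_inv[OF that(1)] ser_\<psi>_inv[OF that(2)]] ..
  have alg: "pr x (y + z) = pr x y + pr x z" "pr (y + z) x = pr y x + pr z x" "pr x (?s' c y) = ?s' c (pr x y)"
    "pr (?s' c y) x = ?s' c (pr y x)" "pr (pr x y) z = pr x (pr y z)"
    if xyz: "x \<in> ?W" "y \<in> ?W" "z \<in> ?W" for x y z c
  proof -
    note s = series_algebra_pr[unfolded series_algebra_def bilinear_op_iff]
    show "pr x (y + z) = pr x y + pr x z" "pr (y + z) x = pr y x + pr z x" using s xyz by blast+
    show "pr x (?s' c y) = ?s' c (pr x y)" "pr (?s' c y) x = ?s' c (pr y x)" using s xyz(1,2) by blast+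
    show "pr (pr x y) z = pr x (pr y z)" using s xyz by blast
  qed
  have r: "?m F (G + H) = ?m F G + ?m F H" "?m (G + H) F = ?m G F + ?m H F" "?m (?m F G) H = ?m F (?m G H)"
    if "F \<in> ?V" "G \<in> ?V" "H \<in> ?V" for F G H
    by (rule inj; simp only: mV addV mi addi alg W that)+
  have s: "?m F (?s c G) = ?s c (?m F G)" "?m (?s c G) F = ?s c (?m G F)"
    if "F \<in> ?V" "G \<in> ?V" for F G c
    using alg(3,4)[OF W[OF that(1)] W[OF that(2)] W[OF that(2)]]
    by - (rule inj; simp only: mV scV mi sci that)+
  show ?thesis
    unfolding series_algebra_def bilinear_op_iff by (intro conjI ballI allI mV r s)
qed

end

theorem corollary4p3p5:
  fixes D :: "('m::{t2_space, second_countable_topology}, 'e::real_normed_vector,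
      'g::{t2_space, second_countable_topology}, 'd::real_normed_vector,
      'k::{real_normed_field, euclidean_space}) brst_data"
  assumes "hamiltonian_system D"
    and "lie_basis D"
    and "generating_acyclic D"
    and "equivariant_contraction D"
    and "star_product D"
    and "strongly_invariant D"
    and "quantum_contraction D"
  shows
    "(\<exists>pr.
        (\<forall>a\<in>cocycle_ser D. \<forall>b\<in>cocycle_ser D.
           pr (cls D a) (cls D b)
             = cls D (qres D (brst_mult D (gser_app (Phi D) a) (gser_app (Phi D) b)))) \<and>
        series_algebra (cohom_scale D) (cohom D) pr \<and>
        graded_by (cls D 0) (ser (cohom D)) (\<lambda>n. ser (cohom_deg D n)) pr \<and>
        bij_betw (\<lambda>f. cls D (emb f)) (ser (CZ_inv D)) (ser (cohom_deg D 0)) \<and>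
        (\<forall>f\<in>ser (CZ_inv D). \<forall>g\<in>ser (CZ_inv D).
           pr (cls D (emb f)) (cls D (emb g))
             = cls D (qres D (brst_mult D (emb (ser_map (prol D) f)) (emb (ser_map (prol D) g)))))) \<and>
     (\<exists>\<psi> m.
        bij_betw \<psi> (CM_red D) (CZ_inv D) \<and>
        (\<forall>f\<in>CM_inv D. \<psi> (coset (IZ_inv D) f) = res D f) \<and>
        linear_map (coset_scale fscale (IZ_inv D)) fscale (CM_red D) (CZ_inv D) \<psi> \<and>
        (\<forall>X\<in>CM_red D. \<forall>Y\<in>CM_red D. \<psi> (coset_mult (IZ_inv D) X Y) = \<psi> X * \<psi> Y) \<and>
        (\<forall>i. bilinear_op (coset_scale fscale (IZ_inv D)) (CM_red D) (m i) \<and>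
           continuous_map (prod_topology (CM_red_topology D) (CM_red_topology D))
             (CM_red_topology D) (\<lambda>(X, Y). m i X Y)) \<and>
        series_algebra (coset_scale fscale (IZ_inv D)) (CM_red D) (ser_bilin m) \<and>
        (\<forall>F\<in>ser (CM_red D). \<forall>G\<in>ser (CM_red D).
           ser_map \<psi> (ser_bilin m F G)
             = qres D (brst_mult D (emb (ser_map (prol D) (ser_map \<psi> F)))
                                   (emb (ser_map (prol D) (ser_map \<psi> G)))) {}))"
proof -
  interpret brst_setting D
    using assms by unfold_locales
  have 1: "\<forall>a\<in>cocycle_ser D. \<forall>b\<in>cocycle_ser D. pr (cls D a) (cls D b)
      = cls D (qres D (brst_mult D (gser_app (Phi D) a) (gser_app (Phi D) b)))"
    using pr_cls unfolding cprod_def by blast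
  have 2: "linear_map (coset_scale fscale (IZ_inv D)) fscale (CM_red D) (CZ_inv D) \<psi>"
    unfolding linear_map_def using \<psi>_inv red_add(2) red_scale(2) by blast
  have 3: "ser_map \<psi> (ser_bilin red_op F G)
      = qres D (brst_mult D (emb (ser_map (prol D) (ser_map \<psi> F))) (emb (ser_map (prol D) (ser_map \<psi> G)))) {}"
    if "F \<in> ser (CM_red D)" "G \<in> ser (CM_red D)" for F G
    unfolding R_emb_prol[OF ser_\<psi>_inv[OF that(1)] ser_\<psi>_inv[OF that(2)]] ser_bilin_red_op(2)[OF that]
    by (simp add: emb_def)
  show ?thesis
    by (intro conjI exI[of _ pr] exI[of _ \<psi>] exI[of _ red_op] ballI allI)
      (use 1 2 3 series_algebra_pr graded_pr bij_cls_emb pr_emb bij_\<psi> \<psi>_coset red_mult bilinear_red_op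
        continuous_red_op series_algebra_red in blast)+
qed

end
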